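(* Let $X=\mathbb{R}$ (real line case) or $X=\mathbb{T}=\mathbb{R}/2\pi\mathbb{Z}$ (periodic case), let $I\subset\mathbb{R}$ be a time interval, and let $\vec{S}:I\times X\to\mathbb{S}^2\subset\mathbb{R}^3$ be a sufficiently regular solution of the half-wave maps equation $$\partial_t\vec{S}=\vec{S}\wedge|\nabla|\vec{S}.$$ Set $\bm{S}=\vec{S}\cdot\bm{\sigma}=\sum_{j=1}^3 S_j\sigma_j$ and define the operators, acting on $\mathbb{C}^2$-valued functions on $X$, $$L_{\bm{S}}=[H,\mu_{\bm{S}}],\qquad B_{\bm{S}}=-\frac{\mathrm{i}}{2}\left(\mu_{\bm{S}}|\nabla|+|\nabla|\mu_{\bm{S}}\right)+\frac{\mathrm{i}}{2}\mu_{|\nabla|\bm{S}}.$$ Then the following Lax equation holds for all $t\in I$: $$\frac{d}{dt}L_{\bm{S}}=[B_{\bm{S}},L_{\bm{S}}].$$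
   Context: $\wedge$ is the vector product in $\mathbb{R}^3$. The operator $|\nabla|$ acts in the variable $x$ and is the Fourier multiplier with symbol $|\xi|$ if $X=\mathbb{R}$, and with symbol $|n|$ ($n\in\mathbb{Z}$) if $X=\mathbb{T}$; it acts componentwise on vector- or matrix-valued functions. $\sigma_1,\sigma_2,\sigma_3$ are the standard Pauli matrices, so that for $\vec{X}\in\mathbb{R}^3$ $$\vec{X}\cdot\bm{\sigma}=\begin{pmatrix} X_3 & X_1-\mathrm{i}X_2 \\ X_1+\mathrm{i}X_2 & -X_3 \end{pmatrix}.$$ For a $2\times2$-matrix-valued function $\bm{A}=\bm{A}(t,x)$, $\mu_{\bm{A}}$ is the multiplication operator $(\mu_{\bm{A}}\varphi)(t,x)=\bm{A}(t,x)\varphi(x)$ on functions $\varphi:X\to\mathbb{C}^2$. $[A,B]=AB-BA$ is the commutator of operators. $H$ is the Hilbert transform, acting on each component of a $\mathbb{C}^2$-valued function: $$(Hf)(x)=\mathrm{p.v.}\,\frac1\pi\int_{\mathbb{R}}\frac{f(y)}{x-y}\,dy\ \ (X=\mathbb{R}),\qquad (Hf)(x)=\mathrm{p.v.}\int_{\mathbb{T}}f(y)\cot\left(\frac{x-y}{2}\right)dy\ \ (X=\mathbb{T}).$$ The operators $L_{\bm{S}}$ (which depends on $t$ through $\vec{S}(t,\cdot)$) and $B_{\bm{S}}$ are considered on $L^2(X;\mathbb{C}^2)$; $B_{\bm{S}}$ is unbounded and defined on a suitable dense subspace (e.g. $H^1(X;\mathbb{C}^2)$), and the Lax equation is understood as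 an identity of operators on such a dense subspace. "Sufficiently regular" is not quantified in the source; it means regular enough for all the expressions involved to be well-defined, and one may take, for instance, $\vec{S}$ bounded and smooth in $(t,x)$, with in addition, for $X=\mathbb{R}$, $\partial_x\vec{S}$ continuous in $t$ with values in every Sobolev space $H^s(\mathbb{R};\mathbb{R}^3)$ (in which case $|\nabla|\vec{S}$ is understood as $H\partial_x\vec{S}$). *)

theory Defs
  imports "HOL-Analysis.Analysis"
begin

section \<open>The real line and the circle\<close>

text \<open>
  A function on the circle (the reals modulo \<open>2\<pi>\<close>) is represented by a \<open>2\<pi>\<close>-periodic function
  on the reals. Elements of \<open>L\<^sup>2\<close> are represented by functions; all \<open>L\<^sup>2\<close> statements below are
  insensitive to changes on null sets.
\<close>

datatype base_space = Line | Circle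

definition on_base :: "base_space \<Rightarrow> (real \<Rightarrow> 'a) \<Rightarrow> bool" where
  "on_base X f \<longleftrightarrow> (X = Circle \<longrightarrow> (\<forall>x. f (x + 2 * pi) = f x))"

fun cell :: "base_space \<Rightarrow> real set" where
  "cell Line = UNIV"
| "cell Circle = {-pi..pi}"

definition l2_sq :: "base_space \<Rightarrow> (real \<Rightarrow> 'a::euclidean_space) \<Rightarrow> ennreal" where
  "l2_sq X f = (\<integral>\<^sup>+ x. ennreal ((norm (f x))\<^sup>2) * indicator (cell X) x \<partial>lebesgue)"

definition L2 :: "base_space \<Rightarrow> (real \<Rightarrow> 'a::euclidean_space) \<Rightarrow> bool" where
  "L2 X f \<longleftrightarrow> on_base X f \<and> f \<in> borel_measurable lebesgue \<and> l2_sq X f < \<infinity>"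

definition has_L2_derivative ::
    "base_space \<Rightarrow> (real \<Rightarrow> real \<Rightarrow> 'a::euclidean_space) \<Rightarrow> (real \<Rightarrow> 'a) \<Rightarrow> real \<Rightarrow> real set \<Rightarrow> bool" where
  "has_L2_derivative X u v t I \<longleftrightarrow>
     (\<forall>\<tau>\<in>I. L2 X (u \<tau>)) \<and> L2 X v \<and>
     ((\<lambda>\<tau>. l2_sq X (\<lambda>x. (1 / (\<tau> - t)) *\<^sub>R (u \<tau> x - u t x) - v x)) \<longlongrightarrow> 0) (at t within I)"


section \<open>Fourier transform, Sobolev spaces and \<open>|\<nabla>|\<close>\<close>

text \<open>
  The Fourier transform on \<open>L\<^sup>2\<close> of the line, as the \<open>L\<^sup>2\<close>-limit of truncated Fourier integrals;
  the convention is \<open>F(\<xi>) = \<integral> exp(-i x \<xi>) f(x) dx\<close>.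
\<close>

definition is_fourier_transform :: "(real \<Rightarrow> complex) \<Rightarrow> (real \<Rightarrow> complex) \<Rightarrow> bool" where
  "is_fourier_transform f F \<longleftrightarrow> L2 Line f \<and> L2 Line F \<and>
     ((\<lambda>R. l2_sq Line (\<lambda>\<xi>. F \<xi> - (LINT x:{-R..R}|lebesgue. cis (- (x * \<xi>)) * f x))) \<longlongrightarrow> 0) at_top"

definition fourier_transform :: "(real \<Rightarrow> complex) \<Rightarrow> real \<Rightarrow> complex" where
  "fourier_transform f = (SOME F. is_fourier_transform f F)"

definition fourier_coeff :: "(real \<Rightarrow> complex) \<Rightarrow> int \<Rightarrow> complex" where
  "fourier_coeff f n = (1 / (2 * pi)) *\<^sub>R (LINT x:{-pi..pi}|lebesgue. cis (- (of_int n * x)) * f x)"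

text \<open>
  Squared norm of \<open>H\<^sup>s\<close>. Since \<open>sobolev\<close> includes membership in \<open>L\<^sup>2\<close>, these notions are meant
  for \<open>s \<ge> 0\<close>.
\<close>

fun sobolev_sq :: "base_space \<Rightarrow> real \<Rightarrow> (real \<Rightarrow> complex) \<Rightarrow> ennreal" where
  "sobolev_sq Line s f =
     (\<integral>\<^sup>+ \<xi>. ennreal ((1 + \<xi>\<^sup>2) powr s * (norm (fourier_transform f \<xi>))\<^sup>2) \<partial>lebesgue)"
| "sobolev_sq Circle s f =
     (\<integral>\<^sup>+ n. ennreal ((1 + (real_of_int n)\<^sup>2) powr s * (norm (fourier_coeff f n))\<^sup>2) \<partial>count_space UNIV)"

definition sobolev :: "base_space \<Rightarrow> real \<Rightarrow> (real \<Rightarrow> complex) \<Rightarrow> bool" where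
  "sobolev X s f \<longleftrightarrow> L2 X f \<and> sobolev_sq X s f < \<infinity>"

definition H1 :: "base_space \<Rightarrow> (real \<Rightarrow> complex^2) \<Rightarrow> bool" where
  "H1 X \<phi> \<longleftrightarrow> (\<forall>i. sobolev X 1 (\<lambda>x. \<phi> x $ i))"

fun is_abs_nabla :: "base_space \<Rightarrow> (real \<Rightarrow> complex) \<Rightarrow> (real \<Rightarrow> complex) \<Rightarrow> bool" where
  "is_abs_nabla Line f g \<longleftrightarrow>
     (\<exists>F. is_fourier_transform f F \<and> is_fourier_transform g (\<lambda>\<xi>. complex_of_real \<bar>\<xi>\<bar> * F \<xi>))"
| "is_abs_nabla Circle f g \<longleftrightarrow> L2 Circle f \<and> L2 Circle g \<and>
     (\<forall>n. fourier_coeff g n = of_int \<bar>n\<bar> * fourier_coeff f n)"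

text \<open>
  The multiplier determines \<open>|\<nabla>|f\<close> only almost everywhere. The continuous representative is
  selected whenever there is one, so that \<open>|\<nabla>|\<close> of a smooth function makes sense pointwise.
\<close>

definition abs_nabla :: "base_space \<Rightarrow> (real \<Rightarrow> complex) \<Rightarrow> real \<Rightarrow> complex" where
  "abs_nabla X f = (SOME g. is_abs_nabla X f g \<and>
     ((\<exists>h. is_abs_nabla X f h \<and> continuous_on UNIV h) \<longrightarrow> continuous_on UNIV g))"

definition abs_nabla_vec :: "base_space \<Rightarrow> (real \<Rightarrow> complex^2) \<Rightarrow> real \<Rightarrow> complex^2" where
  "abs_nabla_vec X \<phi> x = (\<chi> i. abs_nabla X (\<lambda>y. \<phi> y $ i) x)"


section \<open>Hilbert transform\<close>

text \<open>
  The principal value on the circle is taken over the period \<open>[x - \<pi>, x + \<pi>]\<close> around the singularity,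
  and its kernel carries no factor \<open>1/(2\<pi>)\<close>.
\<close>

fun hilbert :: "base_space \<Rightarrow> (real \<Rightarrow> 'a::euclidean_space) \<Rightarrow> real \<Rightarrow> 'a" where
  "hilbert Line f x =
     (1 / pi) *\<^sub>R Lim (at_right 0)
       (\<lambda>\<epsilon>. LINT y:{y. \<epsilon> < \<bar>x - y\<bar>}|lebesgue. (1 / (x - y)) *\<^sub>R f y)"
| "hilbert Circle f x =
     Lim (at_right 0)
       (\<lambda>\<epsilon>. LINT y:{y. \<epsilon> < \<bar>x - y\<bar> \<and> \<bar>x - y\<bar> \<le> pi}|lebesgue. cot ((x - y) / 2) *\<^sub>R f y)"


section \<open>\<open>|\<nabla>|\<close> of the spin field\<close>

text \<open>
  On the line the spin field has values in the unit sphere and so is not in \<open>L\<^sup>2\<close>; there \<open>|\<nabla>|\<close> is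
  understood as \<open>H \<partial>\<^sub>x\<close>. On the circle it is the Fourier multiplier, which maps real-valued
  functions to real-valued functions.
\<close>

fun abs_nabla_field :: "base_space \<Rightarrow> (real \<Rightarrow> real^3) \<Rightarrow> real \<Rightarrow> real^3" where
  "abs_nabla_field Line u x = hilbert Line (\<lambda>y. vector_derivative u (at y)) x"
| "abs_nabla_field Circle u x = (\<chi> j. Re (abs_nabla Circle (\<lambda>y. complex_of_real (u y $ j)) x))"

fun abs_nabla_matrix :: "base_space \<Rightarrow> (real \<Rightarrow> complex^2^2) \<Rightarrow> real \<Rightarrow> complex^2^2" where
  "abs_nabla_matrix Line A x = hilbert Line (\<lambda>y. vector_derivative A (at y)) x"
| "abs_nabla_matrix Circle A x = (\<chi> i j. abs_nabla Circle (\<lambda>y. A y $ i $ j) x)"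


section \<open>Pauli matrices and the Lax pair\<close>

definition sigma1 :: "complex^2^2" where
  "sigma1 = vector [vector [0, 1], vector [1, 0]]"

definition sigma2 :: "complex^2^2" where
  "sigma2 = vector [vector [0, - \<i>], vector [\<i>, 0]]"

definition sigma3 :: "complex^2^2" where
  "sigma3 = vector [vector [1, 0], vector [0, - 1]]"

definition pauli :: "real^3 \<Rightarrow> complex^2^2" where
  "pauli v = (v $ 1) *\<^sub>R sigma1 + (v $ 2) *\<^sub>R sigma2 + (v $ 3) *\<^sub>R sigma3"

lemma pauli_matrix:
  "pauli v = vector [vector [complex_of_real (v $ 3), complex_of_real (v $ 1) - \<i> * complex_of_real (v $ 2)],
                     vector [complex_of_real (v $ 1) + \<i> * complex_of_real (v $ 2), - complex_of_real (v $ 3)]]"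
  by (simp add: pauli_def sigma1_def sigma2_def sigma3_def vec_eq_iff forall_2
      scaleR_conv_of_real[where 'a = complex] mult.commute)

definition spin_matrix :: "(real \<Rightarrow> real \<Rightarrow> real^3) \<Rightarrow> real \<Rightarrow> real \<Rightarrow> complex^2^2" where
  "spin_matrix S t x = pauli (S t x)"

type_synonym spinor_op = "(real \<Rightarrow> complex^2) \<Rightarrow> real \<Rightarrow> complex^2"

definition mult_op :: "(real \<Rightarrow> complex^2^2) \<Rightarrow> spinor_op" where
  "mult_op A \<phi> x = A x *v \<phi> x"

definition commutator :: "spinor_op \<Rightarrow> spinor_op \<Rightarrow> spinor_op" where
  "commutator P Q \<phi> x = P (Q \<phi>) x - Q (P \<phi>) x"

definition lax_L :: "base_space \<Rightarrow> (real \<Rightarrow> complex^2^2) \<Rightarrow> spinor_op" where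
  "lax_L X A = commutator (hilbert X) (mult_op A)"

definition lax_B :: "base_space \<Rightarrow> (real \<Rightarrow> complex^2^2) \<Rightarrow> spinor_op" where
  "lax_B X A \<phi> x =
     (- (\<i> / 2)) *s (mult_op A (abs_nabla_vec X \<phi>) x + abs_nabla_vec X (mult_op A \<phi>) x)
     + (\<i> / 2) *s mult_op (abs_nabla_matrix X A) \<phi> x"


section \<open>Regular solutions of the half-wave maps equation\<close>

text \<open>
  \<open>D j k\<close> is the partial derivative of order \<open>j\<close> in time and \<open>k\<close> in space; time derivatives are
  one-sided at those endpoints of the interval that belong to it.
\<close>

definition smooth_on_strip :: "real set \<Rightarrow> (real \<Rightarrow> real \<Rightarrow> real^3) \<Rightarrow> bool" where
  "smooth_on_strip I S \<longleftrightarrow>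
     (\<exists>D :: nat \<Rightarrow> nat \<Rightarrow> real \<Rightarrow> real \<Rightarrow> real^3.
        (\<forall>t\<in>I. \<forall>x. D 0 0 t x = S t x) \<and>
        (\<forall>j k. continuous_on (I \<times> UNIV) (\<lambda>(t, x). D j k t x)) \<and>
        (\<forall>j k. \<forall>t\<in>I. \<forall>x.
           ((\<lambda>\<tau>. D j k \<tau> x) has_vector_derivative D (Suc j) k t x) (at t within I) \<and>
           ((\<lambda>y. D j k t y) has_vector_derivative D j (Suc k) t x) (at x)))"

definition sobolev_continuous_on :: "real set \<Rightarrow> real \<Rightarrow> (real \<Rightarrow> real \<Rightarrow> real^3) \<Rightarrow> bool" where
  "sobolev_continuous_on I s u \<longleftrightarrow>
     (\<forall>j. \<forall>t\<in>I. sobolev Line s (\<lambda>x. complex_of_real (u t x $ j)) \<and>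
        ((\<lambda>\<tau>. sobolev_sq Line s (\<lambda>x. complex_of_real (u \<tau> x $ j - u t x $ j))) \<longlongrightarrow> 0) (at t within I))"

definition regular_spin_field :: "base_space \<Rightarrow> real set \<Rightarrow> (real \<Rightarrow> real \<Rightarrow> real^3) \<Rightarrow> bool" where
  "regular_spin_field X I S \<longleftrightarrow>
     (\<forall>t\<in>I. on_base X (S t) \<and> (\<forall>x. norm (S t x) = 1)) \<and>
     smooth_on_strip I S \<and>
     (X = Line \<longrightarrow> (\<forall>s\<ge>0. sobolev_continuous_on I s (\<lambda>t x. vector_derivative (S t) (at x))))"

definition half_wave_maps :: "base_space \<Rightarrow> real set \<Rightarrow> (real \<Rightarrow> real \<Rightarrow> real^3) \<Rightarrow> bool" where
  "half_wave_maps X I S \<longleftrightarrow>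
     (\<forall>t\<in>I. \<forall>x. ((\<lambda>\<tau>. S \<tau> x) has_vector_derivative cross3 (S t x) (abs_nabla_field X (S t) x))
        (at t within I))"

end

theory Submission
 imports Defs "HOL-Analysis.Analysis"
begin

text \<open>
 Both cases are treated at once: \<open>mX\<close> is the measure on the space, \<open>nX\<close> the one on the frequencies
 (Lebesgue or counting), and the Fourier transform \<open>ftp\<close> is a relation on \<open>L\<^sup>2\<close>. Comparing the
 truncated principal value with the conjugate Poisson kernel at Lebesgue points identifies \<open>hilbert\<close>,
 up to the constant \<open>hc\<close>, with the multiplier \<open>h = -i sgn\<close>, so that \<open>|\<nabla>| = h \<partial>\<close> and \<open>h\<^sup>2 = -1\<close> on derivatives.
 With \<open>T = \<partial>S\<close> and \<open>W = h T\<close>, expanding \<open>[B, L]\<close> and using \<open>S\<^sup>2 = 1\<close>, \<open>S T + T S = 0\<close> and Cotlar's identity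
 \<open>h (W \<psi> + T (h \<psi>)) = W (h \<psi>) - T \<psi>\<close> for \<open>\<psi> = \<phi>\<close> and \<open>\<psi> = S \<phi>\<close> leaves \<open>[h, A]\<close> with \<open>A = -i/2 [S, W]\<close>,
 which is \<open>\<partial>\<^sub>t S\<close> by the equation. The time derivative of \<open>L\<close> exists in \<open>L\<^sup>2\<close> by dominated convergence,
 since \<open>\<partial>\<^sub>t S\<close> is bounded locally uniformly in time: by compactness on the circle, and on the line by
 the Sobolev bound on \<open>W\<close>.
\<close>

text \<open>The principal value in \<open>hilbert\<close> is a pointwise limit that exists only
  almost everywhere, \<open>abs_nabla\<close> is a choice among functions equal almost everywhere,
  and \<phi> is merely in the first Sobolev space. So the algebra is not done with the given
  operators but with relations modulo null sets (\<open>hrel\<close>, \<open>drel\<close>, their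
  vector forms \<open>hv\<close>, \<open>dv\<close>), to which the operators are tied afterwards.
  Periodicity is the exception: it is tracked at every point, since \<open>L2\<close> demands it
  there. On the line \<open>S\<close> has constant length and no transform; only its derivative
  \<open>T\<close> has one. On the circle the multiplier kills constants, so Cotlar's identity needs
  a factor of mean zero. Both facts put \<open>T\<close>, not \<open>S\<close>, into the role of the
  transformed factor. The constant \<open>hc\<close> is harmless: both sides of the Lax equation are
  linear in the Hilbert transform that enters \<open>L\<close>, while \<open>B\<close> is built from
  |\<nabla>|. Abel-Poisson regularisation serves for inversion, for the Plancherel bounds and for
  mollification. Constants such as \<open>4 * pi\<close> are not sharp; nothing depends on their
  size.\<close>

abbreviation bm :: "('a::topological_space => 'b::topological_space) set" where
 "bm \<equiv> borel_measurable borel"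

abbreviation esq :: "complex => ennreal" where "esq z \<equiv> ennreal ((cmod z)^2)"

lemmas integrable_le = Bochner_Integration.integrable_bound
  and LINT_cong = Bochner_Integration.integral_cong

section \<open>Square-integrable functions\<close>

text \<open>No square root and values in the extended reals: estimates can be stated before
  finiteness is known, and limits are limits in \<open>ennreal\<close>. The price is a factor 2 in
  every triangle inequality.\<close>

definition sqn :: "'a measure => ('a => complex) => ennreal" where
 "sqn M f = (\<integral>\<^sup>+x. esq (f x) \<partial>M)"

definition sqi :: "'a measure => ('a => complex) => bool" where
 "sqi M f \<longleftrightarrow> f \<in> borel_measurable M \<and> sqn M f < \<infinity>"

lemma sqi_measurable [measurable_dest]: "sqi M f ==> f \<in> borel_measurable M"
 by (simp add: sqi_def)

lemma sqn_cong_AE: "AE x in M. f x = g x ==> sqn M f = sqn M g"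
 unfolding sqn_def by (intro nn_integral_cong_AE) auto

lemma sqn_mono_AE: "AE x in M. cmod (f x) <= cmod (g x) ==> sqn M f <= sqn M g"
 unfolding sqn_def
 by (rule nn_integral_mono_AE, erule eventually_mono) (intro ennreal_leI power_mono norm_ge_zero, assumption)

lemma cmod_add_sq: "(cmod (a + b))^2 <= 2 * (cmod a)^2 + 2 * (cmod b)^2"
proof -
 have "(cmod (a + b))^2 <= (cmod a + cmod b)^2"
  by (intro power_mono norm_triangle_ineq norm_ge_zero)
 also have "... <= 2 * (cmod a)^2 + 2 * (cmod b)^2"
  using sum_squares_bound[of "cmod a" "cmod b"] by (simp add: power2_sum)
 finally show ?thesis .
qed

lemma sqn_add:
 assumes [measurable]: "f \<in> borel_measurable M" "g \<in> borel_measurable M"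
 shows "sqn M (\<lambda>x. f x + g x) <= 2 * sqn M f + 2 * sqn M g"
proof -
 have "sqn M (\<lambda>x. f x + g x) <= (\<integral>\<^sup>+x. 2 * (esq (f x)) + 2 * (esq (g x)) \<partial>M)"
  unfolding sqn_def
 proof (rule nn_integral_mono)
  fix x
  have "(esq (f x + g x)) <= ennreal (2 * (cmod (f x))^2 + 2 * (cmod (g x))^2)"
   by (intro ennreal_leI cmod_add_sq)
  then show "(esq (f x + g x)) <= 2 * (esq (f x)) + 2 * (esq (g x))"
   by (simp add: ennreal_mult)
 qed
 also have "... = 2 * sqn M f + 2 * sqn M g"
  unfolding sqn_def by (simp add: nn_integral_add nn_integral_cmult)
 finally show ?thesis .
qed

lemma sqn_uminus: "sqn M (\<lambda>x. - f x) = sqn M f"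
 by (simp add: sqn_def)

lemma sqn_minus_commute: "sqn M (\<lambda>x. f x - g x) = sqn M (\<lambda>x. g x - f x)"
 unfolding sqn_def by (subst norm_minus_commute) (rule refl)

lemma sqn_diff:
 assumes [measurable]: "f \<in> borel_measurable M" "g \<in> borel_measurable M"
 shows "sqn M (\<lambda>x. f x - g x) <= 2 * sqn M f + 2 * sqn M g"
 using sqn_add[of f M "\<lambda>x. - g x"] by (simp add: sqn_uminus)

lemma sqn_triangle:
 assumes [measurable]: "f \<in> borel_measurable M" "g \<in> borel_measurable M" "h \<in> borel_measurable M"
 shows "sqn M (\<lambda>x. f x - h x) <= 2 * sqn M (\<lambda>x. f x - g x) + 2 * sqn M (\<lambda>x. g x - h x)"
 using sqn_add[of "\<lambda>x. f x - g x" M "\<lambda>x. g x - h x"] by simp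

lemma sqn_cmult:
 assumes [measurable]: "f \<in> borel_measurable M"
 shows "sqn M (\<lambda>x. c * f x) = (esq c) * sqn M f"
 unfolding sqn_def by (simp add: norm_mult power_mult_distrib ennreal_mult nn_integral_cmult)

lemma sqn_bounded_mult:
 assumes [measurable]: "f \<in> borel_measurable M" and "AE x in M. cmod (b x) <= C"
 shows "sqn M (\<lambda>x. b x * f x) <= ennreal (C^2) * sqn M f"
proof -
 have "sqn M (\<lambda>x. b x * f x) <= sqn M (\<lambda>x. of_real C * f x)"
  using assms(2) by (intro sqn_mono_AE) (auto elim!: eventually_mono simp: norm_mult intro!: mult_right_mono)
 then show ?thesis by (simp add: sqn_cmult)
qed

lemma sqi_add: "sqi M f ==> sqi M g ==> sqi M (\<lambda>x. f x + g x)"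
 unfolding sqi_def by (auto intro!: le_less_trans[OF sqn_add] simp: ennreal_mult_less_top)

lemma sqi_uminus: "sqi M f ==> sqi M (\<lambda>x. - f x)"
 unfolding sqi_def by (auto simp: sqn_uminus)

lemma sqi_diff: "sqi M f ==> sqi M g ==> sqi M (\<lambda>x. f x - g x)"
 using sqi_add[of M f "\<lambda>x. - g x"] sqi_uminus[of M g] by simp

lemma sqi_bounded_mult:
 assumes "sqi M f" and [measurable]: "b \<in> borel_measurable M" and "AE x in M. cmod (b x) <= C"
 shows "sqi M (\<lambda>x. b x * f x)"
proof -
 have [measurable]: "f \<in> borel_measurable M" using assms(1) by (simp add: sqi_def)
 have "ennreal (C^2) * sqn M f < \<infinity>" using assms(1) by (auto simp: sqi_def ennreal_mult_less_top)
 then show ?thesis unfolding sqi_def using le_less_trans[OF sqn_bounded_mult[OF _ assms(3), of f]] by auto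
qed

lemma sqi_cmult: "sqi M f ==> sqi M (\<lambda>x. c * f x)"
 by (rule sqi_bounded_mult[where C = "cmod c"]) auto

lemma borel_measurable_cnj [measurable (raw)]: "f \<in> borel_measurable M ==> (\<lambda>x. cnj (f x)) \<in> borel_measurable M"
 by (rule borel_measurable_continuous_on[where f = cnj]) (auto intro: continuous_intros)

lemma sqi_cnj: "sqi M f ==> sqi M (\<lambda>x. cnj (f x))"
 unfolding sqi_def sqn_def by (simp add: borel_measurable_cnj)

lemma sqn_zero [simp]: "sqn M (\<lambda>x. 0) = 0"
 by (simp add: sqn_def)

lemma sqn_eq_0_iff:
 assumes [measurable]: "f \<in> borel_measurable M"
 shows "sqn M f = 0 \<longleftrightarrow> (AE x in M. f x = 0)"
 unfolding sqn_def by (subst nn_integral_0_iff_AE) auto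

lemma sqn_Fatou:
 assumes [measurable]: "\<And>n. f n \<in> borel_measurable M"
  and "AE x in M. (\<lambda>n. f n x) \<longlonglongrightarrow> g x"
 shows "sqn M g <= liminf (\<lambda>n. sqn M (f n))"
proof -
 have "sqn M g = (\<integral>\<^sup>+x. liminf (\<lambda>n. (esq (f n x))) \<partial>M)"
  unfolding sqn_def
 proof (rule nn_integral_cong_AE)
  show "AE x in M. (esq (g x)) = liminf (\<lambda>n. (esq (f n x)))"
   using assms(2)
  proof eventually_elim
   case (elim x)
   then have "(\<lambda>n. (esq (f n x))) \<longlonglongrightarrow> (esq (g x))"
    by (intro tendsto_intros tendsto_ennrealI)
   then show ?case using lim_imp_Liminf by (metis sequentially_bot)
  qed
 qed
 also have "... <= liminf (\<lambda>n. sqn M (f n))"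
  unfolding sqn_def by (rule nn_integral_liminf) auto
 finally show ?thesis .
qed

text \<open>The device by which uniform bounds survive almost everywhere limits; an eventual bound
  is enough because only the lower limit counts.\<close>

lemma sqn_Fatou_bound:
 assumes "\<And>n. f n \<in> borel_measurable M"
  and "AE x in M. (\<lambda>n. f n x) \<longlonglongrightarrow> g x"
  and "eventually (\<lambda>n. sqn M (f n) <= B) sequentially"
 shows "sqn M g <= B"
proof -
 have "liminf (\<lambda>n. sqn M (f n)) <= liminf (\<lambda>n. B)"
  by (rule Liminf_mono) (use assms(3) in auto)
 then show ?thesis using sqn_Fatou[OF assms(1,2)] by (auto intro: order_trans simp: Liminf_const)
qed

section \<open>Cauchy-Schwarz, continuity of the pairing, completeness\<close>

lemma sqi_Cauchy_Schwarz_nn: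
 assumes "sqi M f" "sqi M g"
 shows "(\<integral>\<^sup>+x. cmod (f x * g x) \<partial>M)^2 <= sqn M f * sqn M g"
proof -
 have [measurable]: "f \<in> borel_measurable M" "g \<in> borel_measurable M"
  using assms by (auto simp: sqi_def)
 show ?thesis
  using Cauchy_Schwarz_nn_integral[of "\<lambda>x. ennreal (cmod (f x))" M "\<lambda>x. ennreal (cmod (g x))"]
  by (simp add: sqn_def norm_mult ennreal_mult ennreal_power)
qed

lemma sqi_integrable_mult:
 assumes "sqi M f" "sqi M g"
 shows "integrable M (\<lambda>x. f x * g x)"
proof -
 have [measurable]: "f \<in> borel_measurable M" "g \<in> borel_measurable M"
  using assms by (auto simp: sqi_def)
 have "sqn M f * sqn M g < \<infinity>" using assms by (auto simp: sqi_def ennreal_mult_less_top)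
 then have "(\<integral>\<^sup>+x. cmod (f x * g x) \<partial>M)^2 < \<infinity>"
  using sqi_Cauchy_Schwarz_nn[OF assms] by (rule order.strict_trans1[rotated])
 then show ?thesis by (intro integrableI_bounded) (auto simp: power_less_top_ennreal)
qed

lemma sqi_Cauchy_Schwarz:
 assumes "sqi M f" "sqi M g"
 shows "(esq (LINT x|M. f x * g x)) <= sqn M f * sqn M g"
proof -
 have "ennreal (cmod (LINT x|M. f x * g x)) <= (\<integral>\<^sup>+x. cmod (f x * g x) \<partial>M)"
  by (rule integral_norm_bound_ennreal) (rule sqi_integrable_mult[OF assms])
 then have "ennreal (cmod (LINT x|M. f x * g x)) ^ 2 <= (\<integral>\<^sup>+x. cmod (f x * g x) \<partial>M)^2"
  by (intro power_mono) auto
 also have "... <= sqn M f * sqn M g" by (rule sqi_Cauchy_Schwarz_nn[OF assms])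
 finally show ?thesis by (simp add: ennreal_power)
qed

lemma tendsto_ennreal_sq_imp:
 fixes f :: "'a => complex"
 assumes "((\<lambda>n. (esq (f n))) \<longlongrightarrow> 0) F"
 shows "(f \<longlongrightarrow> 0) F"
proof -
 have "((\<lambda>n. (cmod (f n))^2) \<longlongrightarrow> 0) F"
  using assms by (simp add: tendsto_ennreal_iff[where x = 0, simplified])
 then have "((\<lambda>n. sqrt ((cmod (f n))^2)) \<longlongrightarrow> sqrt 0) F" by (intro tendsto_intros)
 then show ?thesis by (simp add: tendsto_norm_zero_iff)
qed

lemma ennreal_cmult_tendsto_0:
 fixes f :: "'a => ennreal"
 assumes "(f \<longlongrightarrow> 0) F" "c < \<infinity>"
 shows "((\<lambda>n. c * f n) \<longlongrightarrow> 0) F"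
 using ennreal_tendsto_cmult[OF _ assms(1), of c] assms(2) by simp

lemma tendsto_0_le_ennreal:
 fixes f g :: "'a => ennreal"
 assumes "(g \<longlongrightarrow> 0) F" "eventually (\<lambda>n. f n <= g n) F"
 shows "(f \<longlongrightarrow> 0) F"
 by (rule tendsto_sandwich[OF _ assms(2) tendsto_const assms(1)]) auto

text \<open>Cauchy-Schwarz for the product of \<open>f n - f0\<close> with \<open>g\<close>. The
  pairing is bilinear, without conjugation, as are Parseval's formula and the convolutions
  below.\<close>

lemma sqi_tendsto_integral:
 assumes "\<And>n. sqi M (f n)" "sqi M f0" "sqi M g"
  and "((\<lambda>n. sqn M (\<lambda>x. f n x - f0 x)) \<longlongrightarrow> 0) F"
 shows "((\<lambda>n. LINT x|M. f n x * g x) \<longlongrightarrow> (LINT x|M. f0 x * g x)) F"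
proof -
 have eq: "(LINT x|M. (f n x - f0 x) * g x) = (LINT x|M. f n x * g x) - (LINT x|M. f0 x * g x)" for n
  by (simp add: left_diff_distrib Bochner_Integration.integral_diff sqi_integrable_mult assms)
 have "((\<lambda>n. (esq (LINT x|M. (f n x - f0 x) * g x))) \<longlongrightarrow> 0) F"
 proof (rule tendsto_0_le_ennreal)
  show "((\<lambda>n. sqn M g * sqn M (\<lambda>x. f n x - f0 x)) \<longlongrightarrow> 0) F"
   using assms by (intro ennreal_cmult_tendsto_0) (auto simp: sqi_def)
  show "\<forall>\<^sub>F n in F. (esq (LINT x|M. (f n x - f0 x) * g x)) <= sqn M g * sqn M (\<lambda>x. f n x - f0 x)"
   using sqi_Cauchy_Schwarz[OF sqi_diff[OF assms(1,2)] assms(3)] by (auto simp: mult.commute)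
 qed
 from tendsto_ennreal_sq_imp[OF this] show ?thesis
  unfolding eq by (rule LIM_zero_cancel)
qed

text \<open>Riesz-Fischer: a rapidly converging subsequence converges almost everywhere, and Fatou
  upgrades its pointwise limit to a limit in norm of the full sequence.\<close>

proposition sqi_complete:
 fixes f :: "nat => 'a => complex"
 assumes f: "\<And>n. sqi M (f n)"
  and cauchy: "\<And>e::real. 0 < e ==> \<exists>N. \<forall>m\<ge>N. \<forall>n\<ge>N. sqn M (\<lambda>x. f m x - f n x) <= ennreal e"
 obtains g where "sqi M g" "(\<lambda>n. sqn M (\<lambda>x. f n x - g x)) \<longlonglongrightarrow> 0"
proof -
 have [measurable]: "\<And>n. f n \<in> borel_measurable M" using f by (auto simp: sqi_def)
 have "\<forall>k. \<exists>N. \<forall>m\<ge>N. \<forall>n\<ge>N. sqn M (\<lambda>x. f m x - f n x) <= ennreal ((1/8)^k)"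
  using cauchy by simp
 then obtain N where N: "\<And>k m n. m \<ge> N k ==> n \<ge> N k ==> sqn M (\<lambda>x. f m x - f n x) <= ennreal ((1/8)^k)"
  by metis
 \<comment> \<open>The sum makes \<open>r\<close> nondecreasing and at least \<open>N k\<close>; the
   summand \<open>k\<close> sends it to infinity.\<close>
 define r where "r k = (\<Sum>j\<le>k. N j) + k" for k
 have r: "N k <= r k" for k
 proof -
  have "N k <= (\<Sum>j\<le>k. N j)" by (rule member_le_sum) auto
  then show ?thesis by (simp add: r_def)
 qed
 have rs: "r k <= r (Suc k)" "k <= r k" for k by (auto simp: r_def)
 \<comment> \<open>The rate 1/8 leaves room for the weights \<open>4^k\<close>: the weighted squares
   still have a finite integral, so at almost every point the increments are at most a multiple of
   \<open>(1/2)^k\<close>.\<close>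
 have step: "sqn M (\<lambda>x. f (r (Suc k)) x - f (r k) x) <= ennreal ((1/8)^k)" for k
  using N[OF order_trans[OF r rs(1)] r] .
 have "(\<integral>\<^sup>+x. (\<Sum>k. ennreal (4^k * (cmod (f (r (Suc k)) x - f (r k) x))^2)) \<partial>M)
   = (\<Sum>k. \<integral>\<^sup>+x. ennreal (4^k * (cmod (f (r (Suc k)) x - f (r k) x))^2) \<partial>M)"
  by (intro nn_integral_suminf) measurable
 also have "... = (\<Sum>k. ennreal (4^k) * sqn M (\<lambda>x. f (r (Suc k)) x - f (r k) x))"
  unfolding sqn_def by (subst nn_integral_cmult[symmetric]) (auto simp: ennreal_mult)
 also have "... <= (\<Sum>k. ennreal ((1/2)^k))"
 proof (intro suminf_le)
  fix k
  have "ennreal (4^k) * sqn M (\<lambda>x. f (r (Suc k)) x - f (r k) x) <= ennreal (4^k) * ennreal ((1/8)^k)"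
   by (intro mult_left_mono step) auto
  also have "... = ennreal ((1/2)^k)"
   by (simp add: ennreal_mult[symmetric] power_mult_distrib[symmetric])
  finally show "ennreal (4^k) * sqn M (\<lambda>x. f (r (Suc k)) x - f (r k) x) <= ennreal ((1/2)^k)" .
 qed auto
 also have "... < \<infinity>"
  by (subst suminf_ennreal2) (auto intro!: summable_geometric)
 finally have fin: "(\<integral>\<^sup>+x. (\<Sum>k. ennreal (4^k * (cmod (f (r (Suc k)) x - f (r k) x))^2)) \<partial>M) < \<infinity>" .
 have "AE x in M. (\<Sum>k. ennreal (4^k * (cmod (f (r (Suc k)) x - f (r k) x))^2)) \<noteq> \<infinity>"
  using fin by (intro nn_integral_PInf_AE) (auto simp: infinity_ennreal_def)
 then have conv: "AE x in M. convergent (\<lambda>k. f (r k) x)"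
 proof eventually_elim
  case (elim x)
  define C where "C = enn2real (\<Sum>k. ennreal (4^k * (cmod (f (r (Suc k)) x - f (r k) x))^2))"
  have C: "ennreal C = (\<Sum>k. ennreal (4^k * (cmod (f (r (Suc k)) x - f (r k) x))^2))"
   using elim by (simp add: C_def less_top)
  have b: "cmod (f (r (Suc k)) x - f (r k) x) <= sqrt C * (1/2)^k" for k
  proof -
   have "ennreal (4^k * (cmod (f (r (Suc k)) x - f (r k) x))^2) <= ennreal C"
   proof -
    define a where "a k = ennreal (4^k * (cmod (f (r (Suc k)) x - f (r k) x))^2)" for k
    have "(\<Sum>j\<in>{k}. a j) <= suminf a" by (rule sum_le_suminf) auto
    then show ?thesis by (simp add: C a_def[abs_def])
   qed
   moreover have C0: "C \<ge> 0" by (simp add: C_def)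
   ultimately have "4^k * (cmod (f (r (Suc k)) x - f (r k) x))^2 <= C" by simp
   then have "(2^k * cmod (f (r (Suc k)) x - f (r k) x))^2 <= C"
    by (simp add: power_mult_distrib power_mult[symmetric] mult.commute[of k 2])
      (simp add: power_mult)
   then have "2^k * cmod (f (r (Suc k)) x - f (r k) x) <= sqrt C"
    by (rule real_le_rsqrt)
   then show ?thesis by (simp add: field_simps power_one_over)
  qed
  have "summable (\<lambda>k. f (r (Suc k)) x - f (r k) x)"
   by (rule summable_comparison_test'[where g = "\<lambda>k. sqrt C * (1/2)^k" and N = 0])
     (use b in \<open>auto intro!: summable_mult summable_geometric\<close>)
  then have "convergent (\<lambda>n. \<Sum>k<n. f (r (Suc k)) x - f (r k) x)"
   by (simp add: summable_iff_convergent)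
  moreover have "(\<Sum>k<n. f (r (Suc k)) x - f (r k) x) = f (r n) x - f (r 0) x" for n
   by (induction n) auto
  ultimately have "convergent (\<lambda>n. f (r n) x - f (r 0) x)" by simp
  then have "convergent (\<lambda>n. (f (r n) x - f (r 0) x) + f (r 0) x)"
   by (intro convergent_add convergent_const)
  then show ?case by simp
 qed
 define g where "g x = lim (\<lambda>k. f (r k) x)" for x
 have [measurable]: "g \<in> borel_measurable M" unfolding g_def by measurable
 have lim: "AE x in M. (\<lambda>k. f (r k) x) \<longlonglongrightarrow> g x"
  using conv by eventually_elim (simp add: g_def convergent_LIMSEQ_iff)
 have bd: "sqn M (\<lambda>x. f n x - g x) <= ennreal e"
  if "\<And>i j. i \<ge> K ==> j \<ge> K ==> sqn M (\<lambda>x. f i x - f j x) <= ennreal e" "n \<ge> K" for K n e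
 proof (rule sqn_Fatou_bound[where f = "\<lambda>k x. f n x - f (r k) x"])
  show "AE x in M. (\<lambda>k. f n x - f (r k) x) \<longlonglongrightarrow> f n x - g x"
   using lim by eventually_elim (intro tendsto_intros)
  show "\<forall>\<^sub>F k in sequentially. sqn M (\<lambda>x. f n x - f (r k) x) <= ennreal e"
   using eventually_ge_at_top[of K]
  proof eventually_elim
   case (elim k)
   then have "K <= r k" using rs(2)[of k] by simp
   then show ?case using that by auto
  qed
 qed auto
 have lim0: "(\<lambda>n. sqn M (\<lambda>x. f n x - g x)) \<longlonglongrightarrow> 0"
 proof (rule order_tendstoI)
  fix e :: ennreal assume "0 < e"
  obtain e' where e': "0 < e'" "ennreal e' < e"
  proof -
   obtain d where d: "0 < d" "d < e" using dense[OF \<open>0 < e\<close>] by blast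
   then have "ennreal (enn2real d) = d" by (simp add: less_top order.strict_trans2[OF d(2)])
   then show ?thesis using d that[of "enn2real d"] by (metis ennreal_less_zero_iff)
  qed
  obtain K where K: "\<forall>m\<ge>K. \<forall>n\<ge>K. sqn M (\<lambda>x. f m x - f n x) <= ennreal e'" using cauchy[OF e'(1)] by auto
  show "\<forall>\<^sub>F n in sequentially. sqn M (\<lambda>x. f n x - g x) < e"
   using eventually_ge_at_top[of K]
  proof eventually_elim
   case (elim n)
   have "sqn M (\<lambda>x. f n x - g x) <= ennreal e'" using K elim by (intro bd) auto
   then show ?case using e'(2) by (rule le_less_trans)
  qed
 qed simp
 have "sqi M g"
 proof -
  obtain K where K: "\<forall>m\<ge>K. \<forall>n\<ge>K. sqn M (\<lambda>x. f m x - f n x) <= ennreal 1" using cauchy[of 1] by auto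
  have "sqn M g <= 2 * sqn M (f K) + 2 * sqn M (\<lambda>x. f K x - g x)"
   using sqn_diff[of "f K" M "\<lambda>x. f K x - g x"] by simp
  also have "... < \<infinity>"
  proof -
   have "sqn M (\<lambda>x. f K x - g x) <= ennreal 1" using K by (intro bd) auto
   then have "sqn M (\<lambda>x. f K x - g x) < \<infinity>" by (rule order.strict_trans1) simp
   then show ?thesis using f[of K] by (simp add: sqi_def ennreal_mult_less_top)
  qed
  finally show ?thesis by (simp add: sqi_def)
 qed
 with lim0 show ?thesis using that by blast
qed

section \<open>Lebesgue points\<close>

text \<open>Lebesgue points, with the average cleared of its denominator: \<open>h\<close> is the
  radius, the length of the ball is \<open>2 * h\<close>. The nonnegative integral makes the notion
  meaningful for every function.\<close>

definition lebesgue_pt :: "(real => complex) => real => bool" where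
 "lebesgue_pt f x \<longleftrightarrow> (\<forall>e>0. \<exists>r>0. \<forall>h. 0 < h \<and> h < r \<longrightarrow>
   (\<integral>\<^sup>+y. ennreal (cmod (f y - f x)) * indicator (ball x h) y \<partial>lborel) <= ennreal (e * h))"

lemma lebesgue_ptE:
 assumes "lebesgue_pt f x" "e > 0"
 obtains r where "r > 0" "\<And>h. 0 < h ==> h < r ==>
   (\<integral>\<^sup>+y. ennreal (cmod (f y - f x)) * indicator (ball x h) y \<partial>lborel) <= ennreal (e * h)"
 using assms(1)[unfolded lebesgue_pt_def, rule_format, OF assms(2)] by blast

text \<open>Superlevel set of the centred Hardy-Littlewood maximal function, at level
  \<open>l / 2\<close> in the usual normalisation by the length of the ball.\<close>

definition max_set :: "(real => complex) => real => real set" where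
 "max_set g l = {x. \<exists>r>0. (\<integral>\<^sup>+y. ennreal (cmod (g y)) * indicator (ball x r) y \<partial>lborel) > ennreal (l * r)}"

lemma ball_borel_measurable [measurable]: "ball (x::real) r \<in> sets borel"
 by simp

lemma emeasure_lborel_ball: "r \<ge> 0 ==> emeasure lborel (ball (x::real) r) = ennreal (2 * r)"
 unfolding ball_eq_greaterThanLessThan
 by (subst emeasure_lborel_Ioo) (linarith, rule arg_cong[where f = ennreal], linarith)

text \<open>The Hardy-Littlewood weak type bound. Vitali's lemma selects disjoint balls whose
  fivefold enlargements cover the set; an enlarged ball has length \<open>10 * r\<close>, while its
  core carries mass above \<open>l * r\<close>, whence the factor \<open>10 / l\<close>. The union
  of the enlarged balls is a measurable set around \<open>max_set\<close>.\<close>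

lemma max_set_weak_type:
 assumes [measurable]: "g \<in> bm"
  and G: "(\<integral>\<^sup>+y. ennreal (cmod (g y)) \<partial>lborel) <= ennreal G" and l: "l > 0"
 obtains E where "E \<in> sets lborel" "max_set g l \<subseteq> E" "emeasure lborel E <= ennreal (10 * G / l)"
proof -
 define J where "J x r = (\<integral>\<^sup>+y. ennreal (cmod (g y)) * indicator (ball x r) y \<partial>lborel)" for x r
 define K where "K = {(x, r). r > 0 \<and> J x r > ennreal (l * r)}"
 have JG: "J x r <= ennreal G" for x r
 proof -
  have "J x r <= (\<integral>\<^sup>+y. ennreal (cmod (g y)) \<partial>lborel)"
   unfolding J_def by (intro nn_integral_mono) (auto split: split_indicator)
  then show ?thesis using G by (rule order_trans)
 qed
 have cov: "max_set g l \<subseteq> (\<Union>i\<in>K. ball (fst i) (snd i))"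
  by (force simp: max_set_def K_def J_def)
 \<comment> \<open>Vitali's lemma needs bounded radii; the total mass \<open>G\<close> bounds
   them.\<close>
 have bd: "0 < snd i \<and> snd i <= G / l" if "i \<in> K" for i
 proof -
  from that have 1: "snd i > 0" "ennreal (l * snd i) < J (fst i) (snd i)" by (auto simp: K_def)
  from 1(2) JG have "ennreal (l * snd i) < ennreal G" by (rule order.strict_trans2)
  then have "l * snd i < G" using l 1 by (simp add: ennreal_less_iff)
  then show ?thesis using 1 l by (simp add: field_simps)
 qed
 obtain C where C: "countable C" "C \<subseteq> K"
  "pairwise (\<lambda>i j. disjnt (ball (fst i) (snd i)) (ball (fst j) (snd j))) C"
  "max_set g l \<subseteq> (\<Union>i\<in>C. ball (fst i) (5 * snd i))"
  by (rule Vitali_covering_lemma_balls[OF cov bd])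
 define E where "E = (\<Union>i\<in>C. ball (fst i) (5 * snd i))"
 have dis: "disjoint_family_on (\<lambda>i. ball (fst i) (snd i)) C"
  using C(3) by (auto simp: disjoint_family_on_def pairwise_def disjnt_def)
 have "emeasure lborel E <= (\<integral>\<^sup>+i. emeasure lborel (ball (fst i) (5 * snd i)) \<partial>count_space C)"
 proof -
  have Em: "E \<in> sets lborel" unfolding E_def sets_lborel by (intro borel_open open_UN) auto
  have "emeasure lborel E = (\<integral>\<^sup>+x. indicator E x \<partial>lborel)" using Em by simp
  also have "... <= (\<integral>\<^sup>+x. \<integral>\<^sup>+i. indicator (ball (fst i) (5 * snd i)) x \<partial>count_space C \<partial>lborel)"
  proof (rule nn_integral_mono)
   fix x :: real
   show "indicator E x <= (\<integral>\<^sup>+i. indicator (ball (fst i) (5 * snd i)) x \<partial>count_space C)"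
   proof (cases "x \<in> E")
    case True
    then obtain i where i: "i \<in> C" "x \<in> ball (fst i) (5 * snd i)" by (auto simp: E_def)
    have "1 = (\<integral>\<^sup>+j. indicator {i} j \<partial>count_space C)" using i by (subst nn_integral_indicator) auto
    also have "... <= (\<integral>\<^sup>+i. indicator (ball (fst i) (5 * snd i)) x \<partial>count_space C)"
     using i by (intro nn_integral_mono) (auto split: split_indicator)
    finally show ?thesis using True by simp
   qed simp
  qed
  also have "... = (\<integral>\<^sup>+i. \<integral>\<^sup>+x. indicator (ball (fst i) (5 * snd i)) x \<partial>lborel \<partial>count_space C)"
   by (intro nn_integral_count_space_nn_integral C) auto
  finally show ?thesis by simp
 qed
 also have "... <= (\<integral>\<^sup>+i. ennreal (10 / l) * J (fst i) (snd i) \<partial>count_space C)"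
 proof (rule nn_integral_mono)
  fix i assume "i \<in> space (count_space C)"
  then have i: "i \<in> K" using C by auto
  then have 1: "snd i > 0" "ennreal (l * snd i) < J (fst i) (snd i)" by (auto simp: K_def)
  have "emeasure lborel (ball (fst i) (5 * snd i)) = ennreal (10 * snd i)"
   using 1 by (subst emeasure_lborel_ball) auto
  also have "... = ennreal (10 / l) * ennreal (l * snd i)"
   using l 1 by (subst ennreal_mult[symmetric]) auto
  also have "... <= ennreal (10 / l) * J (fst i) (snd i)"
   using 1 by (intro mult_left_mono) auto
  finally show "emeasure lborel (ball (fst i) (5 * snd i)) <= ennreal (10 / l) * J (fst i) (snd i)" .
 qed
 also have "... = ennreal (10 / l) * (\<integral>\<^sup>+i. J (fst i) (snd i) \<partial>count_space C)"
  by (simp add: nn_integral_cmult)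
 also have "(\<integral>\<^sup>+i. J (fst i) (snd i) \<partial>count_space C)
   = (\<integral>\<^sup>+i. emeasure (density lborel (\<lambda>y. ennreal (cmod (g y)))) (ball (fst i) (snd i)) \<partial>count_space C)"
  unfolding J_def by (intro nn_integral_cong) (auto simp: emeasure_density)
 also have "... = emeasure (density lborel (\<lambda>y. ennreal (cmod (g y)))) (\<Union>i\<in>C. ball (fst i) (snd i))"
  using C dis by (intro emeasure_UN_countable[symmetric]) auto
 also have "... <= ennreal G"
 proof -
  have o: "open (\<Union>i\<in>C. ball (fst i) (snd i))" by (intro open_UN) auto
  then have [measurable]: "(\<Union>i\<in>C. ball (fst i) (snd i)) \<in> sets borel" by (rule borel_open)
  have "emeasure (density lborel (\<lambda>y. ennreal (cmod (g y)))) (\<Union>i\<in>C. ball (fst i) (snd i))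
    = (\<integral>\<^sup>+y. ennreal (cmod (g y)) * indicator (\<Union>i\<in>C. ball (fst i) (snd i)) y \<partial>lborel)"
   by (subst emeasure_density) auto
  also have "... <= (\<integral>\<^sup>+y. ennreal (cmod (g y)) \<partial>lborel)"
   by (intro nn_integral_mono) (auto split: split_indicator)
  finally show ?thesis using G by (rule order_trans)
 qed
 also have "ennreal (10 / l) * ennreal G <= ennreal (10 * G / l)"
  using l by (subst ennreal_mult'[symmetric]) auto
 finally have "emeasure lborel E <= ennreal (10 * G / l)"
  by (simp add: mult_left_mono order_trans)
 moreover have "E \<in> sets lborel"
  unfolding E_def sets_lborel by (intro borel_open open_UN) auto
 ultimately show ?thesis using that C(4) by (auto simp: E_def)
qed

text \<open>Along a subsequence whose integrals are at most \<open>1 / Suc n\<close>, the weak type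
  bound puts the intersection of the sets into covers of arbitrarily small measure.\<close>

lemma AE_not_in_max_sets:
 assumes [measurable]: "\<And>i. g i \<in> bm"
  and lim: "(\<lambda>i. \<integral>\<^sup>+y. ennreal (cmod (g i y)) \<partial>lborel) \<longlonglongrightarrow> 0" and l: "l > (0::real)"
 shows "AE x in lborel. \<exists>i::nat. x \<notin> max_set (g i) l"
proof -
 have "\<exists>i. (\<integral>\<^sup>+y. ennreal (cmod (g i y)) \<partial>lborel) <= ennreal (1 / Suc n)" for n
 proof -
  have "\<forall>\<^sub>F i in sequentially. (\<integral>\<^sup>+y. ennreal (cmod (g i y)) \<partial>lborel) < ennreal (1 / Suc n)"
   by (rule order_tendstoD(2)[OF lim]) simp
  then show ?thesis by (auto dest!: eventually_happens intro: less_imp_le)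
 qed
 then obtain i where i: "\<And>n. (\<integral>\<^sup>+y. ennreal (cmod (g (i n) y)) \<partial>lborel) <= ennreal (1 / Suc n)" by metis
 have "\<forall>n. \<exists>E. E \<in> sets lborel \<and> max_set (g (i n)) l \<subseteq> E \<and> emeasure lborel E <= ennreal (10 * (1 / Suc n) / l)"
  using max_set_weak_type[OF _ i l] by (metis assms(1))
 then obtain E where E: "\<And>n. E n \<in> sets lborel" "\<And>n. max_set (g (i n)) l \<subseteq> E n"
  "\<And>n. emeasure lborel (E n) <= ennreal (10 * (1 / Suc n) / l)" by metis
 have small: "emeasure lborel (\<Inter>n. E n) <= ennreal e" if "e > 0" for e :: real
 proof -
  obtain n where n: "10 / (l * e) < real n" using reals_Archimedean2 by blast
  have "emeasure lborel (\<Inter>n. E n) <= emeasure lborel (E n)"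
   by (intro emeasure_mono E) auto
  also have "... <= ennreal (10 * (1 / Suc n) / l)" by (rule E)
  also have "... <= ennreal e"
  proof (rule ennreal_leI)
   have "10 < real n * (l * e)" using n l that by (simp add: divide_less_eq)
   also have "... <= real (Suc n) * (l * e)" using l that by (intro mult_right_mono) auto
   finally show "10 * (1 / Suc n) / l <= e" using l that by (simp add: divide_simps mult_ac del: of_nat_Suc)
  qed
  finally show ?thesis .
 qed
 have "emeasure lborel (\<Inter>n. E n) <= 0"
  by (rule ennreal_le_epsilon) (simp add: small)
 then have "(\<Inter>n. E n) \<in> null_sets lborel"
  using E(1) by (intro null_setsI sets.countable_INT) auto
 then have "AE x in lborel. x \<notin> (\<Inter>n. E n)" by (rule AE_not_in)
 then show ?thesis
 proof (rule AE_mp, intro AE_I2 impI)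
  fix x assume "x \<notin> (\<Inter>n. E n)"
  then obtain n where "x \<notin> E n" by auto
  then have "x \<notin> max_set (g (i n)) l" using E(2)[of n] by auto
  then show "\<exists>i. x \<notin> max_set (g i) l" ..
 qed
qed

text \<open>Three errors: the mean of \<open>f - s i\<close> is controlled by the maximal function,
  \<open>s i\<close> has a Lebesgue point at \<open>x\<close>, and \<open>s i x\<close> is near
  \<open>f x\<close>. The set \<open>A\<close> admits approximations that are good only at the
  points of \<open>A\<close>, as is the case for indicators.\<close>

lemma lebesgue_pt_approx:
 assumes meas [measurable]: "f \<in> bm" "\<And>i. s i \<in> bm"
  and lim: "(\<lambda>i. \<integral>\<^sup>+y. ennreal (cmod (f y - s i y)) \<partial>lborel) \<longlonglongrightarrow> 0"
  and s: "AE x in lborel. x \<in> A \<longrightarrow> (\<forall>i. lebesgue_pt (s i) x) \<and> (\<lambda>i. s i x) \<longlonglongrightarrow> f x"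
 shows "AE x in lborel. x \<in> A \<longrightarrow> lebesgue_pt f x"
proof -
 \<comment> \<open>The shift by \<open>k\<close> lets the index be chosen beyond the point where
   \<open>s i x\<close> is close to \<open>f x\<close>.\<close>
 have *: "AE x in lborel. \<forall>n k. \<exists>i. x \<notin> max_set (\<lambda>y. f y - s (i + k) y) (1 / Suc n)"
  unfolding AE_all_countable by (intro allI AE_not_in_max_sets LIMSEQ_ignore_initial_segment[OF lim]) auto
 show ?thesis using * s
 proof eventually_elim
  case (elim x)
  show ?case
  proof (intro impI)
   assume A: "x \<in> A"
   show "lebesgue_pt f x" unfolding lebesgue_pt_def
   proof (intro allI impI)
    fix e :: real assume e: "e > 0"
    \<comment> \<open>The shares are \<open>e / 4\<close>, \<open>e / 2\<close> and
      \<open>e / 16\<close>; the last counts twice, as the ball of radius \<open>h\<close> has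
      length \<open>2 * h\<close>.\<close>
    obtain n where n: "1 / real (Suc n) < e / 4" using nat_approx_posE[of "e/4"] e by auto
    have "\<forall>\<^sub>F i in sequentially. dist (s i x) (f x) < e / 16"
     using elim A e by (intro tendstoD) auto
    then obtain k where k: "\<And>i. i \<ge> k ==> dist (s i x) (f x) < e / 16" by (auto simp: eventually_sequentially)
    obtain j where "x \<notin> max_set (\<lambda>y. f y - s (j + k) y) (1 / Suc n)" using elim(1) by blast
    then obtain i where i: "x \<notin> max_set (\<lambda>y. f y - s i y) (1 / Suc n)" "i \<ge> k" by (metis le_add2)
    have six: "cmod (s i x - f x) < e / 16" using k[OF i(2)] by (simp add: dist_norm)
    have "lebesgue_pt (s i) x" using elim A by auto
    then obtain d where d: "d > 0" "\<And>h. 0 < h ==> h < d ==>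
     (\<integral>\<^sup>+y. ennreal (cmod (s i y - s i x)) * indicator (ball x h) y \<partial>lborel) <= ennreal (e / 2 * h)"
     using e unfolding lebesgue_pt_def by (metis half_gt_zero)
    show "\<exists>r>0. \<forall>h. 0 < h \<and> h < r \<longrightarrow>
      (\<integral>\<^sup>+y. ennreal (cmod (f y - f x)) * indicator (ball x h) y \<partial>lborel) <= ennreal (e * h)"
    proof (intro exI[of _ d] conjI d allI impI)
     fix h assume h: "0 < h \<and> h < d"
     have "(\<integral>\<^sup>+y. ennreal (cmod (f y - f x)) * indicator (ball x h) y \<partial>lborel)
       <= (\<integral>\<^sup>+y. ennreal (cmod (f y - s i y)) * indicator (ball x h) y +
          ennreal (cmod (s i y - s i x)) * indicator (ball x h) y + ennreal (e / 16) * indicator (ball x h) y \<partial>lborel)"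
     proof (intro nn_integral_mono)
      fix y
      have "cmod (f y - f x) <= cmod (f y - s i y) + cmod (s i y - s i x) + e / 16"
       using norm_triangle_ineq[of "f y - s i y" "s i y - s i x"]
        norm_triangle_ineq[of "f y - s i x" "s i x - f x"] six by simp
      then show "ennreal (cmod (f y - f x)) * indicator (ball x h) y \<le>
        ennreal (cmod (f y - s i y)) * indicator (ball x h) y +
          ennreal (cmod (s i y - s i x)) * indicator (ball x h) y + ennreal (e / 16) * indicator (ball x h) y"
       using e by (auto split: split_indicator simp: ennreal_plus[symmetric] simp del: ennreal_plus intro!: ennreal_leI)
     qed
     also have "... = (\<integral>\<^sup>+y. ennreal (cmod (f y - s i y)) * indicator (ball x h) y \<partial>lborel) +
       (\<integral>\<^sup>+y. ennreal (cmod (s i y - s i x)) * indicator (ball x h) y \<partial>lborel) + ennreal (e / 16) * ennreal (2 * h)"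
      using h by (subst nn_integral_add nn_integral_cmult_indicator | simp add: emeasure_lborel_ball)+
     also have "... <= ennreal (1 / Suc n * h) + ennreal (e / 2 * h) + ennreal (e / 16) * ennreal (2 * h)"
      proof (intro add_mono order_refl)
      show "(\<integral>\<^sup>+y. ennreal (cmod (f y - s i y)) * indicator (ball x h) y \<partial>lborel) <= ennreal (1 / Suc n * h)"
       using i(1) h unfolding max_set_def by (simp only: mem_Collect_eq not_ex not_less de_Morgan_conj) (meson not_less)
          
      show "(\<integral>\<^sup>+y. ennreal (cmod (s i y - s i x)) * indicator (ball x h) y \<partial>lborel) <= ennreal (e / 2 * h)"
       using h by (intro d(2)) auto
     qed
     also have "... = ennreal (1 / Suc n * h + e / 2 * h + e / 16 * (2 * h))"
      using h e by (subst ennreal_mult[symmetric] ennreal_plus | simp)+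
     also have "... <= ennreal (e * h)"
     proof -
      have "1 / Suc n * h <= e / 4 * h" using n h by (intro mult_right_mono) auto
      then have "1 / Suc n * h + e / 2 * h + e / 16 * (2 * h) <= e / 4 * h + e / 2 * h + e / 16 * (2 * h)" by (intro add_right_mono)
      also have "... <= e * h" using e h by (simp add: field_simps)
      finally show ?thesis by (rule ennreal_leI)
     qed
     finally show "(\<integral>\<^sup>+y. ennreal (cmod (f y - f x)) * indicator (ball x h) y \<partial>lborel) <= ennreal (e * h)" .
    qed
   qed
  qed
 qed
qed

lemma lebesgue_pt_locally_const:
 assumes "0 < d" "\<And>y. dist x y < d ==> f y = f x"
 shows "lebesgue_pt f x"
 unfolding lebesgue_pt_def
proof (intro allI impI exI[of _ d] conjI assms)
 fix e h :: real assume "0 < h \<and> h < d" "0 < e"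
 then have "(\<integral>\<^sup>+y. ennreal (cmod (f y - f x)) * indicator (ball x h) y \<partial>lborel) = nn_integral lborel (\<lambda>y::real. 0)"
 proof (intro nn_integral_cong)
  fix y
  have "f y = f x" if "y \<in> ball x h" using that \<open>0 < h \<and> h < d\<close> by (intro assms(2)) auto
  then show "ennreal (cmod (f y - f x)) * indicator (ball x h) y = 0" by (cases "y \<in> ball x h") simp_all
 qed
 then show "(\<integral>\<^sup>+y. ennreal (cmod (f y - f x)) * indicator (ball x h) y \<partial>lborel) <= ennreal (e * h)" by simp
qed

lemma lebesgue_pt_cmult: 
 assumes "lebesgue_pt f x" and [measurable]: "f \<in> bm"
 shows "lebesgue_pt (\<lambda>y. f y * c) x"
proof -
 have eq: "cmod (f y * c - f x * c) = cmod (f y - f x) * cmod c" for y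
  by (simp add: left_diff_distrib[symmetric] norm_mult)
 show ?thesis unfolding lebesgue_pt_def eq
 proof (intro allI impI)
  fix e :: real assume e: "e > 0"
  define e' where "e' = e / (cmod c + 1)"
  have c: "cmod c + 1 > 0" by (simp add: add_nonneg_pos)
  have "e' > 0" using e c by (simp add: e'_def)
  then obtain d where d: "d > 0" "\<And>h. 0 < h ==> h < d ==>
     (\<integral>\<^sup>+y. ennreal (cmod (f y - f x)) * indicator (ball x h) y \<partial>lborel) <= ennreal (e' * h)"
   using assms(1) unfolding lebesgue_pt_def by metis
  show "\<exists>r>0. \<forall>h. 0 < h \<and> h < r \<longrightarrow>
     (\<integral>\<^sup>+y. ennreal (cmod (f y - f x) * cmod c) * indicator (ball x h) y \<partial>lborel) <= ennreal (e * h)"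
  proof (intro exI[of _ d] conjI d allI impI)
   fix h assume h: "0 < h \<and> h < d"
   show "(\<integral>\<^sup>+y. ennreal (cmod (f y - f x) * cmod c) * indicator (ball x h) y \<partial>lborel) <= ennreal (e * h)"
   proof -
    have "(\<integral>\<^sup>+y. ennreal (cmod (f y - f x) * cmod c) * indicator (ball x h) y \<partial>lborel)
     = (\<integral>\<^sup>+y. ennreal (cmod c) * (ennreal (cmod (f y - f x)) * indicator (ball x h) y) \<partial>lborel)"
     by (simp add: ennreal_mult mult_ac)
    also have "... = ennreal (cmod c) * (\<integral>\<^sup>+y. ennreal (cmod (f y - f x)) * indicator (ball x h) y \<partial>lborel)"
     by (rule nn_integral_cmult) measurable
    also have "... <= ennreal (cmod c) * ennreal (e' * h)"
     using d h by (intro mult_left_mono) auto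
    also have "... <= ennreal (e * h)"
    proof -
     have "cmod c * e' <= e" using c e by (simp add: e'_def field_simps)
     then have "cmod c * e' * h <= e * h" using h by (intro mult_right_mono) auto
     then show ?thesis by (simp add: ennreal_mult'[symmetric] mult.assoc ennreal_leI)
    qed
    finally show ?thesis .
   qed
  qed
 qed
qed

text \<open>Open supersets with small excess approximate \<open>A\<close>, and their indicators are
  constant near each point of \<open>A\<close>. The points outside \<open>A\<close> are the same
  case for the complement, because the two indicators oscillate equally.\<close>

lemma AE_lebesgue_pt_indicator:
 assumes A: "A \<in> sets lborel"
 shows "AE x in lborel. lebesgue_pt (\<lambda>x. indicator A x) x"
proof -
 have main: "AE x in lborel. x \<in> A \<longrightarrow> lebesgue_pt (\<lambda>x. indicator A x) x" if A: "A \<in> sets lborel" for A :: "real set"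
 proof -
  have "\<forall>n. \<exists>T. open T \<and> A \<subseteq> T \<and> emeasure lebesgue (T - A) < ennreal (1 / Suc n)"
   using A sets_lebesgue_outer_open[of A] by (metis sets_completionI_sets zero_less_divide_1_iff of_nat_0_less_iff zero_less_Suc)
  then obtain T where T: "\<And>n. open (T n)" "\<And>n. A \<subseteq> T n" "\<And>n. emeasure lebesgue (T n - A) < ennreal (1 / Suc n)"
   by metis
  have [measurable]: "T n \<in> sets borel" "A \<in> sets borel" for n using T A by auto
  show ?thesis
  proof (rule lebesgue_pt_approx[where s = "\<lambda>n x. indicator (T n) x"])
   have b: "(\<integral>\<^sup>+y. ennreal (cmod (indicator A y - indicator (T n) y)) \<partial>lborel) <= ennreal (1 / Suc n)" for n
   proof -
    have "(\<integral>\<^sup>+y. ennreal (cmod (indicator A y - indicator (T n) y)) \<partial>lborel) = (\<integral>\<^sup>+y. indicator (T n - A) y \<partial>lborel)"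
     using T(2)[of n] by (intro nn_integral_cong) (auto split: split_indicator)
    also have "... = emeasure lebesgue (T n - A)" by (simp add: emeasure_completion)
    finally show ?thesis using T(3)[of n] by simp
   qed
   have c: "(\<lambda>n. ennreal (1 / Suc n)) \<longlonglongrightarrow> ennreal 0"
    by (intro tendsto_ennrealI LIMSEQ_Suc[OF lim_1_over_n])
   show "(\<lambda>n. \<integral>\<^sup>+y. ennreal (cmod (indicator A y - indicator (T n) y)) \<partial>lborel) \<longlonglongrightarrow> 0"
    by (intro tendsto_0_le_ennreal[OF c[unfolded ennreal_0]] always_eventually allI b)
   show "AE x in lborel. x \<in> A \<longrightarrow> (\<forall>n. lebesgue_pt (\<lambda>x. indicator (T n) x) x) \<and> (\<lambda>n. indicator (T n) x) \<longlonglongrightarrow> (indicator A x::complex)"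
   proof (intro AE_I2 impI allI conjI)
    fix x assume x: "x \<in> A"
    have "x \<in> T n" for n using x T by auto
    then show "(\<lambda>n. indicator (T n) x) \<longlonglongrightarrow> (indicator A x::complex)" using x by simp
   next
    fix x n assume x: "x \<in> A"
    then have "x \<in> T n" using T by auto
    then obtain d where d: "d > 0" "ball x d \<subseteq> T n" using T(1) openE by blast
    show "lebesgue_pt (\<lambda>x. indicator (T n) x) x"
     by (rule lebesgue_pt_locally_const[OF d(1)]) (use d \<open>x \<in> T n\<close> in \<open>auto simp: indicator_def mem_ball\<close>)
   qed
  qed auto
 qed
 have "AE x in lborel. x \<in> - A \<longrightarrow> lebesgue_pt (\<lambda>x. indicator (- A) x) x"
  using A by (intro main) auto
 then show ?thesis using main[OF A]
 proof eventually_elim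
  case (elim x)
  have "cmod (indicator A y - indicator A x) = cmod (indicator (-A) y - indicator (-A) x)" for y
   by (auto split: split_indicator)
  with elim show ?case by (cases "x \<in> A") (auto simp: lebesgue_pt_def)
 qed
qed

lemma lebesgue_pt_add:
 assumes "lebesgue_pt f x" "lebesgue_pt g x" and [measurable]: "f \<in> bm" "g \<in> bm"
 shows "lebesgue_pt (\<lambda>y. f y + g y) x"
 unfolding lebesgue_pt_def
proof (intro allI impI)
 fix e :: real assume e: "e > 0"
 obtain d1 where d1: "d1 > 0" "\<And>h. 0 < h ==> h < d1 ==>
   (\<integral>\<^sup>+y. ennreal (cmod (f y - f x)) * indicator (ball x h) y \<partial>lborel) <= ennreal (e/2 * h)"
  using lebesgue_ptE[OF assms(1) half_gt_zero[OF e]] by blast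
 obtain d2 where d2: "d2 > 0" "\<And>h. 0 < h ==> h < d2 ==>
   (\<integral>\<^sup>+y. ennreal (cmod (g y - g x)) * indicator (ball x h) y \<partial>lborel) <= ennreal (e/2 * h)"
  using lebesgue_ptE[OF assms(2) half_gt_zero[OF e]] by blast
 show "\<exists>r>0. \<forall>h. 0 < h \<and> h < r \<longrightarrow>
   (\<integral>\<^sup>+y. ennreal (cmod (f y + g y - (f x + g x))) * indicator (ball x h) y \<partial>lborel) <= ennreal (e * h)"
 proof (intro exI[of _ "min d1 d2"] conjI allI impI)
  fix h assume h: "0 < h \<and> h < min d1 d2"
  have "(\<integral>\<^sup>+y. ennreal (cmod (f y + g y - (f x + g x))) * indicator (ball x h) y \<partial>lborel)
   <= (\<integral>\<^sup>+y. ennreal (cmod (f y - f x)) * indicator (ball x h) y + ennreal (cmod (g y - g x)) * indicator (ball x h) y \<partial>lborel)"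
  proof (intro nn_integral_mono)
   fix y
   have "cmod (f y + g y - (f x + g x)) <= cmod (f y - f x) + cmod (g y - g x)"
    using norm_triangle_ineq[of "f y - f x" "g y - g x"] by (simp add: algebra_simps)
   then show "ennreal (cmod (f y + g y - (f x + g x))) * indicator (ball x h) y
    <= ennreal (cmod (f y - f x)) * indicator (ball x h) y + ennreal (cmod (g y - g x)) * indicator (ball x h) y"
    by (auto split: split_indicator simp: ennreal_plus[symmetric] simp del: ennreal_plus intro!: ennreal_leI)
  qed
  also have "... = (\<integral>\<^sup>+y. ennreal (cmod (f y - f x)) * indicator (ball x h) y \<partial>lborel)
    + (\<integral>\<^sup>+y. ennreal (cmod (g y - g x)) * indicator (ball x h) y \<partial>lborel)"
   by (intro nn_integral_add) auto
  also have "... <= ennreal (e/2 * h) + ennreal (e/2 * h)" using h d1 d2 by (intro add_mono) auto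
  also have "... = ennreal (e * h)" using e h by (simp add: ennreal_plus[symmetric] del: ennreal_plus)
  finally show "(\<integral>\<^sup>+y. ennreal (cmod (f y + g y - (f x + g x))) * indicator (ball x h) y \<partial>lborel) <= ennreal (e * h)" .
 qed (use d1 d2 in auto)
qed

text \<open>Lebesgue's differentiation theorem: true for indicators, stable under sums, and stable
  under dominated limits thanks to the maximal inequality behind
  \<open>lebesgue_pt_approx\<close>.\<close>

proposition AE_lebesgue_pt:
 assumes "integrable lborel f"
 shows "AE x in lborel. lebesgue_pt f x"
 using assms
proof (induction rule: integrable_induct)
 case (base A c)
 show ?case using AE_lebesgue_pt_indicator[OF base(1)]
 proof eventually_elim
  case (elim x)
  from base have [measurable]: "A \<in> sets borel" by simp
  from lebesgue_pt_cmult[OF elim, of c] show ?case 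
   by (rule back_subst[where P = "\<lambda>f. lebesgue_pt f x"]) (auto split: split_indicator)
 qed
next
 case (add f g)
 then show ?case by (auto elim!: eventually_elim2 intro!: lebesgue_pt_add dest: borel_measurable_integrable)
next
 case (lim f s)
 have meas [measurable]: "f \<in> bm" "\<And>i. s i \<in> bm"
  using borel_measurable_integrable[OF lim(4)] borel_measurable_integrable[OF lim(1)] by auto
 have l1: "(\<lambda>i. \<integral>\<^sup>+y. ennreal (cmod (f y - s i y)) \<partial>lborel) \<longlonglongrightarrow> 0"
 proof (rule nn_integral_dominated_convergence_norm[where w = "\<lambda>x. 2 * norm (f x)"])
  have "(\<integral>\<^sup>+ x. ennreal (2 * cmod (f x)) \<partial>lborel) = 2 * (\<integral>\<^sup>+ x. ennreal (cmod (f x)) \<partial>lborel)"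
   by (simp add: ennreal_mult nn_integral_cmult)
  also have "... < \<infinity>" using lim(4) by (simp add: integrable_iff_bounded ennreal_mult_less_top)
  finally show "(\<integral>\<^sup>+ x. ennreal (2 * cmod (f x)) \<partial>lborel) < \<infinity>" .
  
  show "AE x in lborel. cmod (s i x) <= 2 * cmod (f x)" for i using lim(3)[of _ i] by (intro AE_I2) simp
  show "AE x in lborel. (\<lambda>i. s i x) \<longlonglongrightarrow> f x" using lim(2) by (intro AE_I2) simp
 qed measurable
 have "AE x in lborel. x \<in> UNIV \<longrightarrow> lebesgue_pt f x"
 proof (rule lebesgue_pt_approx[OF meas l1])
  have "AE x in lborel. \<forall>i. lebesgue_pt (s i) x" using lim(5) by (simp add: AE_all_countable)
  then show "AE x in lborel. x \<in> UNIV \<longrightarrow> (\<forall>i. lebesgue_pt (s i) x) \<and> (\<lambda>i. s i x) \<longlonglongrightarrow> f x"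
   by eventually_elim (use lim(2) in auto)
 qed
 then show ?case by simp
qed

section \<open>Haar measure on the space and on its dual\<close>

text \<open>Functions on the circle stay periodic functions on the line; only the measure is
  restricted to a period. Its total mass there is \<open>2 * pi\<close>, not normalised to
  1.\<close>

definition mX :: "base_space => real measure" where
 "mX X = density lborel (indicator (cell X))"

text \<open>Counting measure is pushed forward to the reals so that frequencies have type
  \<open>real\<close> in both cases. With this choice Plancherel's constant is \<open>2 * pi\<close>
  on the line and on the circle alike.\<close>

fun nX :: "base_space => real measure" where
 "nX Line = lborel"
| "nX Circle = distr (count_space (UNIV::int set)) borel real_of_int"

fun frequencies :: "base_space => real set" where
 "frequencies Line = UNIV"
| "frequencies Circle = \<int>"

lemma cell_borel [measurable, simp]: "cell X \<in> sets borel"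
 by (cases X) auto

lemma sets_mX [simp, measurable_cong]: "sets (mX X) = sets borel"
 by (simp add: mX_def)

lemma space_mX [simp]: "space (mX X) = UNIV"
 by (simp add: mX_def)

lemma sets_nX [simp, measurable_cong]: "sets (nX X) = sets borel"
 by (cases X) auto

lemma space_nX [simp]: "space (nX X) = UNIV"
 by (cases X) auto

lemma mX_Line [simp]: "mX Line = lborel"
proof -
 have "indicator (UNIV :: real set) = (\<lambda>x. 1 :: ennreal)" by (auto simp: fun_eq_iff)
 then show ?thesis by (simp only: mX_def cell.simps density_1)
qed

lemma nn_integral_mX:
 "f \<in> bm ==> (\<integral>\<^sup>+x. f x \<partial>mX X) = (\<integral>\<^sup>+x. f x * indicator (cell X) x \<partial>lborel)"
 unfolding mX_def by (subst nn_integral_density) (auto simp: mult.commute)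

lemma AE_mX_iff: "(AE x in mX X. P x) \<longleftrightarrow> (AE x in lborel. x \<in> cell X \<longrightarrow> P x)"
 unfolding mX_def by (subst AE_density) (auto simp: indicator_def)

lemma AE_mX_I: "AE x in lborel. P x ==> AE x in mX X. P x"
 unfolding AE_mX_iff by (erule AE_mp) auto

lemma integrable_mX_iff:
 fixes f :: "real => complex"
 assumes "f \<in> bm"
 shows "integrable (mX X) f \<longleftrightarrow> integrable lborel (\<lambda>x. indicator (cell X) x *\<^sub>R f x)"
proof -
 have "mX X = density lborel (\<lambda>x. ennreal (indicator (cell X) x))"
  unfolding mX_def by (rule arg_cong[where f = "density lborel"]) (auto simp: fun_eq_iff indicator_def)
 then show ?thesis using assms by (simp add: integrable_density)
qed

lemma integral_mX:
 fixes f :: "real => complex"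
 assumes "f \<in> bm"
 shows "(LINT x|mX X. f x) = (LINT x|lborel. indicator (cell X) x *\<^sub>R f x)"
proof -
 have "mX X = density lborel (\<lambda>x. ennreal (indicator (cell X) x))"
  unfolding mX_def by (rule arg_cong[where f = "density lborel"]) (auto simp: fun_eq_iff indicator_def)
 then show ?thesis using assms by (simp add: integral_density)
qed

lemma sigma_finite_mX: "sigma_finite_measure (mX X)"
 unfolding mX_def by (subst sigma_finite_measure.sigma_finite_iff_density_finite[OF sigma_finite_lborel]) (auto simp: indicator_def)

lemma emeasure_nX_Circle:
 "A \<in> sets borel ==> emeasure (nX Circle) A = emeasure (count_space UNIV) {n::int. real_of_int n \<in> A}"
 by (simp add: emeasure_distr vimage_def)

lemma sigma_finite_nX: "sigma_finite_measure (nX X)"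
proof (cases X)
 case Line
 then show ?thesis by (simp add: sigma_finite_lborel)
next
 case Circle
 show ?thesis unfolding Circle
 proof
  show "\<exists>A. countable A \<and> A \<subseteq> sets (nX Circle) \<and> \<Union> A = space (nX Circle) \<and> (\<forall>a\<in>A. emeasure (nX Circle) a \<noteq> \<infinity>)"
  proof (intro exI[of _ "range (\<lambda>n::int. {real_of_int n..<real_of_int n + 1})"] conjI ballI)
   show "\<Union> (range (\<lambda>n::int. {real_of_int n..<real_of_int n + 1})) = space (nX Circle)"
   proof -
    have "x \<in> {real_of_int \<lfloor>x\<rfloor>..<real_of_int \<lfloor>x\<rfloor> + 1}" for x :: real
     using floor_correct[of x] by auto
    then show ?thesis by (auto simp del: atLeastLessThan_iff)
   qed
   fix a assume "a \<in> range (\<lambda>n::int. {real_of_int n..<real_of_int n + 1})"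
   then obtain n :: int where a: "a = {real_of_int n..<real_of_int n + 1}" by auto
   have eq: "{m::int. real_of_int m \<in> a} = {n}" unfolding a by auto
   have "a \<in> sets borel" unfolding a by simp
   then have "emeasure (nX Circle) a = emeasure (count_space UNIV) {n}"
    by (simp only: emeasure_nX_Circle eq)
   then show "emeasure (nX Circle) a \<noteq> \<infinity>" by simp
  qed auto
 qed
qed

lemma pair_sigma_finite_mn: "pair_sigma_finite (mX X) (nX X)"
 by (simp add: pair_sigma_finite_def sigma_finite_mX sigma_finite_nX)

lemma pair_sigma_finite_mm: "pair_sigma_finite (mX X) (mX X)"
 by (simp add: pair_sigma_finite_def sigma_finite_mX)

lemma AE_nX_frequencies: "AE k in nX X. k \<in> frequencies X"
proof (cases X)
 case Circle
 have "{x \<in> space borel. x \<in> \<int>} \<in> sets (borel :: real measure)"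
 proof -
  have "countable (\<int> :: real set)" by (simp add: Ints_def)
  then show ?thesis by (auto intro!: sets.countable)
 qed
 then have "AE k in nX Circle. k \<in> \<int>"
  unfolding nX.simps by (subst AE_distr_iff) auto
 then show ?thesis by (simp only: Circle frequencies.simps)
qed simp

text \<open>Reflections yield inversion (\<open>a = 0\<close>) and, two at a time, translations. On
  the circle \<open>a\<close> has to be an integer, since no other reflection preserves the
  integers.\<close>

lemma distr_nX_reflect:
 assumes "a \<in> frequencies X"
 shows "distr (nX X) borel (\<lambda>z. a - z) = nX X"
proof (cases X)
 case Line
 have "distr lborel borel (\<lambda>z. a - z) = distr (distr lborel borel uminus) borel (\<lambda>z. a + z)"
  by (subst distr_distr) (auto simp: comp_def)
 also have "... = lborel" by (simp add: lborel_distr_uminus lborel_distr_plus)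
 finally show ?thesis using Line by simp
next
 case Circle
 then obtain k where k: "a = of_int k" using assms by (auto elim: Ints_cases)
 have "bij_betw (\<lambda>n::int. k - n) UNIV UNIV" by (rule bij_betwI[of _ _ _ "\<lambda>n. k - n"]) auto
 then have 1: "distr (count_space UNIV) (count_space UNIV) (\<lambda>n::int. k - n) = count_space UNIV"
  by (rule distr_bij_count_space)
 have "distr (nX Circle) borel (\<lambda>z. a - z) = distr (count_space UNIV) borel (real_of_int \<circ> (\<lambda>n. k - n))"
  by (simp add: distr_distr comp_def k)
 also have "... = distr (distr (count_space UNIV) (count_space UNIV) (\<lambda>n::int. k - n)) borel real_of_int"
  by (subst distr_distr) auto
 also have "... = nX Circle" by (simp add: 1)
 finally show ?thesis using Circle by simp
qed

lemma nn_integral_nX_reflect: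
 assumes "a \<in> frequencies X" "f \<in> bm"
 shows "(\<integral>\<^sup>+k. f (a - k) \<partial>nX X) = (\<integral>\<^sup>+k. f k \<partial>nX X)"
 by (subst (2) distr_nX_reflect[OF assms(1), symmetric], subst nn_integral_distr) (use assms in auto)

lemma integral_nX_reflect:
 fixes f :: "real => complex"
 assumes "a \<in> frequencies X" "f \<in> bm"
 shows "(LINT k|nX X. f (a - k)) = (LINT k|nX X. f k)"
 by (subst (2) distr_nX_reflect[OF assms(1), symmetric], subst integral_distr) (use assms in auto)

lemma integrable_nX_reflect:
 fixes f :: "real => complex"
 assumes "a \<in> frequencies X" "integrable (nX X) f"
 shows "integrable (nX X) (\<lambda>k. f (a - k))"
proof -
 have [measurable]: "f \<in> bm" using borel_measurable_integrable[OF assms(2)] by simp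
 have "integrable (distr (nX X) borel (\<lambda>k. a - k)) f" using assms by (simp add: distr_nX_reflect)
 then show ?thesis by (subst (asm) integrable_distr_eq) auto
qed

lemma zero_in_frequencies [simp]: "0 \<in> frequencies X"
 by (cases X) auto

lemma cis_period: "a \<in> frequencies X ==> on_base X (\<lambda>x. cis (a * x))"
proof (cases X)
 case Circle
 assume "a \<in> frequencies X"
 then obtain k where k: "a = of_int k" using Circle by (auto elim: Ints_cases)
 have "cis (a * (x + 2 * pi)) = cis (a * x)" for x
 proof -
  have "a * (x + 2 * pi) = a * x + 2 * pi * of_int k" by (simp add: k algebra_simps)
  then show ?thesis by (simp add: cis_mult[symmetric] cis_multiple_2pi)
 qed
 then show ?thesis by (simp add: on_base_def)
qed (simp add: on_base_def)

subsection \<open>Periodic functions\<close>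

lemma on_base_of_int:
 assumes "on_base Circle f"
 shows "f (x + 2 * pi * of_int k) = f x"
proof -
 have p: "f (x + 2 * pi) = f x" for x using assms by (simp add: on_base_def)
 have nat: "f (x + 2 * pi * real n) = f x" for n x
 proof (induction n)
  case (Suc n)
  have "f (x + 2 * pi * real (Suc n)) = f ((x + 2 * pi * real n) + 2 * pi)" by (simp add: algebra_simps)
  then show ?case using Suc p by simp
 qed simp
 show ?thesis
 proof (cases "k \<ge> 0")
  case True
  then show ?thesis using nat[of x "nat k"] by simp
 next
  case False
  then show ?thesis using nat[of "x + 2 * pi * of_int k" "nat (- k)"] by (simp add: algebra_simps)
 qed
qed

text \<open>Cut one window by the tiling of the line with translates of the other, move each piece
  by its multiple of \<open>2 * pi\<close>, and reassemble. Nonnegative integrands make the exchange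
  of sum and integral free.\<close>

lemma nn_integral_period_window:
 fixes f :: "real => ennreal"
 assumes [measurable]: "f \<in> bm" and per: "on_base Circle f"
 shows "(\<integral>\<^sup>+y. f y * indicator {b..<b + 2 * pi} y \<partial>lborel) = (\<integral>\<^sup>+y. f y * indicator {c..<c + 2 * pi} y \<partial>lborel)"
proof -
 define T where "T b k = (indicator {b + 2 * pi * of_int k..<b + 2 * pi * of_int k + 2 * pi} :: real => ennreal)"
  for b :: real and k :: int
 have [measurable]: "T b k \<in> bm" for b k
  unfolding T_def by measurable
 have T0: "T b 0 y = indicator {b..<b + 2 * pi} y" for b y
  by (simp add: T_def)
 \<comment> \<open>Through the floor function, membership in a tile becomes an equation between
   integers, and translation a shift of the index.\<close>
 have Tf: "T b k y = indicator {k} \<lfloor>(y - b) / (2 * pi)\<rfloor>" for b k y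
 proof -
  have "\<lfloor>(y - b) / (2 * pi)\<rfloor> = k \<longleftrightarrow> y \<in> {b + 2 * pi * of_int k..<b + 2 * pi * of_int k + 2 * pi}"
   by (auto simp: floor_eq_iff field_simps)
  then show ?thesis by (simp add: T_def indicator_def)
 qed
 have Tshift: "T b k (2 * pi * of_int m + 1 * y) = T b (k - m) y" for b k m y
 proof -
  have "(2 * pi * of_int m + 1 * y - b) / (2 * pi) = (y - b) / (2 * pi) + of_int m" by (simp add: field_simps)
  then have "\<lfloor>(2 * pi * of_int m + 1 * y - b) / (2 * pi)\<rfloor> = \<lfloor>(y - b) / (2 * pi)\<rfloor> + m" by simp
  then show ?thesis unfolding Tf by (auto simp: indicator_def)
 qed
 have T1: "(\<integral>\<^sup>+k. T b k y \<partial>count_space UNIV) = 1" for b y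
 proof -
  have "(\<integral>\<^sup>+k. T b k y \<partial>count_space UNIV) = (\<integral>\<^sup>+k. indicator {\<lfloor>(y - b) / (2 * pi)\<rfloor>} k \<partial>count_space UNIV)"
   by (intro nn_integral_cong) (auto simp: Tf indicator_def)
  then show ?thesis by simp
 qed
 have T1m: "(\<integral>\<^sup>+k. T b (0 - k) y \<partial>count_space UNIV) = 1" for b y
 proof -
  have "(\<integral>\<^sup>+k. T b (0 - k) y \<partial>count_space UNIV) = (\<integral>\<^sup>+k. indicator {- \<lfloor>(y - b) / (2 * pi)\<rfloor>} k \<partial>count_space UNIV)"
   by (intro nn_integral_cong) (auto simp: Tf indicator_def)
  then show ?thesis by simp
 qed
 have fs: "f (2 * pi * of_int k + 1 * y) = f y" for k y
  using on_base_of_int[OF per, of y k] by (simp add: add.commute)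
 have "(\<integral>\<^sup>+y. f y * T b 0 y \<partial>lborel) = (\<integral>\<^sup>+y. \<integral>\<^sup>+k. f y * T b 0 y * T c k y \<partial>count_space UNIV \<partial>lborel)"
  by (intro nn_integral_cong) (simp add: nn_integral_cmult T1)
 also have "... = (\<integral>\<^sup>+k. \<integral>\<^sup>+y. f y * T b 0 y * T c k y \<partial>lborel \<partial>count_space UNIV)"
  by (intro nn_integral_count_space_nn_integral) auto
 also have "... = (\<integral>\<^sup>+k. \<integral>\<^sup>+y. f y * T b (0 - k) y * T c 0 y \<partial>lborel \<partial>count_space UNIV)"
 proof (rule nn_integral_cong)
  fix k :: int
  have "(\<integral>\<^sup>+y. f y * T b 0 y * T c k y \<partial>lborel)
   = (\<integral>\<^sup>+y. f (2*pi* of_int k + 1*y) * T b 0 (2*pi* of_int k + 1*y) * T c k (2*pi* of_int k + 1*y) \<partial>lborel)"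
   by (subst nn_integral_real_affine[where c = 1 and t = "2*pi* of_int k"]) auto
  then show "(\<integral>\<^sup>+y. f y * T b 0 y * T c k y \<partial>lborel) = (\<integral>\<^sup>+y. f y * T b (0 - k) y * T c 0 y \<partial>lborel)"
   unfolding Tshift fs by simp
 qed
 also have "... = (\<integral>\<^sup>+y. \<integral>\<^sup>+k. f y * T b (0 - k) y * T c 0 y \<partial>count_space UNIV \<partial>lborel)"
  by (intro nn_integral_count_space_nn_integral[symmetric]) auto
 also have "... = (\<integral>\<^sup>+y. \<integral>\<^sup>+k. f y * T c 0 y * T b (0 - k) y \<partial>count_space UNIV \<partial>lborel)"
  by (simp add: mult_ac)
 also have "... = (\<integral>\<^sup>+y. f y * T c 0 y \<partial>lborel)"
  by (intro nn_integral_cong) (subst nn_integral_cmult, simp, simp only: T1m mult_1_right)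
 finally show ?thesis unfolding T0 .
qed

lemma nn_integral_mX_translate:
 fixes f :: "real => ennreal"
 assumes [measurable]: "f \<in> bm" and per: "on_base X f"
 shows "(\<integral>\<^sup>+u. f (a - u) \<partial>mX X) = (\<integral>\<^sup>+u. f u \<partial>mX X)"
proof (cases X)
 case Line
 show ?thesis using nn_integral_real_affine[of f "-1" a] by (simp add: Line)
next
 case Circle
 have ico: "(\<integral>\<^sup>+y. g y * indicator {b..d} y \<partial>lborel) = (\<integral>\<^sup>+y. g y * indicator {b..<d} y \<partial>lborel)"
  for g :: "real => ennreal" and b d
  by (intro nn_integral_cong_AE AE_I[of _ _ "{d}"]) (auto split: split_indicator)
 have "(\<integral>\<^sup>+u. f (a - u) \<partial>mX X) = (\<integral>\<^sup>+u. f (a - u) * indicator {-pi..pi} u \<partial>lborel)"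
  by (subst nn_integral_mX) (auto simp: Circle)
 also have "... = (\<integral>\<^sup>+u. (\<lambda>y. f y * indicator {a - pi..a + pi} y) (a + (-1) * u) \<partial>lborel)"
  by (intro nn_integral_cong) (auto split: split_indicator)
 also have "... = (\<integral>\<^sup>+y. f y * indicator {a - pi..a + pi} y \<partial>lborel)"
  by (subst (2) nn_integral_real_affine[where c = "-1" and t = a]) auto
 also have "... = (\<integral>\<^sup>+y. f y * indicator {a - pi..<(a - pi) + 2 * pi} y \<partial>lborel)"
  using ico[of f "a - pi" "a + pi"] by (simp add: algebra_simps)
 also have "... = (\<integral>\<^sup>+y. f y * indicator {-pi..<-pi + 2 * pi} y \<partial>lborel)"
  using per Circle by (intro nn_integral_period_window) auto
 also have "... = (\<integral>\<^sup>+u. f u \<partial>mX X)"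
  by (subst nn_integral_mX) (auto simp: Circle ico)
 finally show ?thesis .
qed

lemma on_base_compose: "on_base X f ==> on_base X (\<lambda>x. g (f x))"
 by (auto simp: on_base_def)

lemma on_base_compose2: "on_base X f ==> on_base X g ==> on_base X (\<lambda>x. h (f x) (g x))"
 by (auto simp: on_base_def)

lemma on_base_reflect: "on_base X f ==> on_base X (\<lambda>x. f (a - x))"
proof (cases X)
 case Circle
 assume "on_base X f"
 then have p: "f (x + 2 * pi) = f x" for x using Circle by (simp add: on_base_def)
 have "f (a - (x + 2 * pi)) = f (a - x)" for x
  using p[of "a - (x + 2 * pi)"] by (simp add: algebra_simps)
 then show ?thesis by (simp add: on_base_def)
qed (simp add: on_base_def)

lemma
 fixes f :: "real => complex"
 assumes int: "integrable (mX X) f" and per: "on_base X f"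
 shows integrable_mX_translate: "integrable (mX X) (\<lambda>u. f (a - u))"
  and integral_mX_translate: "(LINT u|mX X. f (a - u)) = (LINT u|mX X. f u)"
proof -
 have [measurable]: "f \<in> bm"
  using borel_measurable_integrable[OF int] by simp
 have "(\<integral>\<^sup>+u. ennreal (cmod (f (a - u))) \<partial>mX X) = (\<integral>\<^sup>+u. ennreal (cmod (f u)) \<partial>mX X)"
  by (intro nn_integral_mX_translate on_base_compose[OF per]) auto
 then show int': "integrable (mX X) (\<lambda>u. f (a - u))"
  using int by (simp add: integrable_iff_bounded)
 \<comment> \<open>Signed integrals reduce to the nonnegative case by positive and negative parts,
   complex ones by real and imaginary parts.\<close>
 have re: "(LINT u|mX X. g (f (a - u))) = (LINT u|mX X. g (f u))"
  if i: "integrable (mX X) (\<lambda>u. g (f (a - u)))" "integrable (mX X) (\<lambda>u. g (f u))"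
   and [measurable]: "g \<in> bm" for g :: "complex => real"
 proof -
  have "(\<integral>\<^sup>+u. ennreal (g (f (a - u))) \<partial>mX X) = (\<integral>\<^sup>+u. ennreal (g (f u)) \<partial>mX X)"
   by (intro nn_integral_mX_translate on_base_compose[OF per]) auto
  moreover have "(\<integral>\<^sup>+u. ennreal (- g (f (a - u))) \<partial>mX X) = (\<integral>\<^sup>+u. ennreal (- g (f u)) \<partial>mX X)"
   by (intro nn_integral_mX_translate on_base_compose[OF per]) auto
  ultimately show ?thesis
   by (simp add: real_lebesgue_integral_def[OF i(1)] real_lebesgue_integral_def[OF i(2)])
 qed
 have "(LINT u|mX X. Re (f (a - u))) = (LINT u|mX X. Re (f u))"
  using int int' by (intro re) auto
 moreover have "(LINT u|mX X. Im (f (a - u))) = (LINT u|mX X. Im (f u))"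
  using int int' by (intro re) auto
 ultimately show "(LINT u|mX X. f (a - u)) = (LINT u|mX X. f u)"
  using int int' by (simp add: complex_eq_iff)
qed

section \<open>Poisson kernels\<close>

text \<open>The Abel-Poisson weight, integrable over both frequency spaces; its inverse transform is
  the Poisson kernel.\<close>

definition wt :: "real => real => complex" where
 "wt e k = complex_of_real (exp (- e * \<bar>k\<bar>))"

lemma wt_measurable [measurable]: "wt e \<in> bm"
 unfolding wt_def by measurable

lemma norm_wt: "cmod (wt e k) = exp (- e * \<bar>k\<bar>)"
 by (simp add: wt_def)

lemma norm_wt_le: "e \<ge> 0 ==> cmod (wt e k) <= 1"
 by (simp add: norm_wt)

lemma wt_minus [simp]: "wt e (- k) = wt e k"
 by (simp add: wt_def)

lemma cis_measurable [measurable]: "cis \<in> bm"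
 by (intro borel_measurable_continuous_onI continuous_intros)

lemma integral_exp_decay:
 assumes e: "e > 0"
 shows "integrable lborel (\<lambda>k. indicator {0..} k *\<^sub>R (exp (- e * k) *\<^sub>R cis (x * k)))"
  and "(LINT k|lborel. indicator {0..} k *\<^sub>R (exp (- e * k) *\<^sub>R cis (x * k))) = 1 / Complex e (- x)"
proof -
 define c where "c = Complex (- e) x"
 have c0: "c \<noteq> 0" using e by (simp add: c_def complex_eq_iff)
 define F where "F k = exp (of_real k * c) / c" for k :: real
 have fe: "exp (- e * k) *\<^sub>R cis (x * k) = exp (of_real k * c)" for k
  by (simp add: exp_eq_polar c_def scaleR_conv_of_real mult.commute)
 have nn: "(\<integral>\<^sup>+k. ennreal (exp (- e * k)) * indicator {0..} k \<partial>lborel) = ennreal (0 - (- exp (- e * 0) / e))"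
 proof (rule nn_integral_FTC_atLeast)
  show "((\<lambda>k. - exp (- e * k) / e) \<longlongrightarrow> 0) at_top"
  proof -
   have "((\<lambda>k. exp (- e * k)) \<longlongrightarrow> 0) at_top"
    using e by (intro filterlim_compose[OF exp_at_bot] filterlim_tendsto_neg_mult_at_bot[where c = "-e"] filterlim_ident) auto
   then have "((\<lambda>k. - exp (- e * k) / e) \<longlongrightarrow> - 0 / e) at_top" using e by (intro tendsto_intros) auto
   then show ?thesis by simp
  qed
  show "((\<lambda>k. - exp (- e * k) / e) has_real_derivative exp (- e * k)) (at k)" for k
   using e by (auto intro!: derivative_eq_intros)
 qed auto
 have int: "integrable lborel (\<lambda>k. indicator {0..} k * exp (- e * k))"
 proof (rule integrableI_bounded)
  have "(\<integral>\<^sup>+k. ennreal (norm (indicator {0..} k * exp (- e * k))) \<partial>lborel)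
   = (\<integral>\<^sup>+k. ennreal (exp (- e * k)) * indicator {0..} k \<partial>lborel)"
   by (intro nn_integral_cong) (auto split: split_indicator)
  then show "(\<integral>\<^sup>+k. ennreal (norm (indicator {0..} k * exp (- e * k))) \<partial>lborel) < \<infinity>"
   using nn by simp
 qed auto
 show int2: "integrable lborel (\<lambda>k. indicator {0..} k *\<^sub>R (exp (- e * k) *\<^sub>R cis (x * k)))"
  by (rule integrable_le[OF int]) (auto split: split_indicator)
 have "(\<lambda>n. LINT k|lborel. indicator {0..real n} k *\<^sub>R (exp (- e * k) *\<^sub>R cis (x * k)))
   \<longlonglongrightarrow> (LINT k|lborel. indicator {0..} k *\<^sub>R (exp (- e * k) *\<^sub>R cis (x * k)))"
 proof (rule integral_dominated_convergence[where w = "\<lambda>k. indicator {0..} k * exp (- e * k)"])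
  show "AE k in lborel. (\<lambda>n. indicator {0..real n} k *\<^sub>R (exp (- e * k) *\<^sub>R cis (x * k)))
    \<longlonglongrightarrow> indicator {0..} k *\<^sub>R (exp (- e * k) *\<^sub>R cis (x * k))"
  proof (intro AE_I2 tendsto_eventually)
   fix k :: real
   obtain N where N: "k <= real N" using real_arch_simple by blast
   show "\<forall>\<^sub>F n in sequentially. indicator {0..real n} k *\<^sub>R (exp (- e * k) *\<^sub>R cis (x * k))
     = indicator {0..} k *\<^sub>R (exp (- e * k) *\<^sub>R cis (x * k))"
    using eventually_ge_at_top[of N]
   proof eventually_elim
    case (elim n)
    then have "k <= real n" using N by linarith
    then show ?case by (simp add: indicator_def)
   qed
  qed
 qed (use int in \<open>auto split: split_indicator\<close>)
 moreover have "(LINT k|lborel. indicator {0..real n} k *\<^sub>R (exp (- e * k) *\<^sub>R cis (x * k))) = F (real n) - F 0" for n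
  unfolding fe
 proof (rule integral_FTC_Icc)
  show "(F has_vector_derivative exp (of_real k * c)) (at k within {0..real n})" for k
  proof -
   have "((\<lambda>z. exp (z * c) / c) has_field_derivative exp (of_real k * c)) (at (of_real k) within UNIV)"
    using c0 by (auto intro!: derivative_eq_intros)
   then show ?thesis unfolding F_def
    by (intro has_vector_derivative_real_field[of "\<lambda>z. exp (z * c) / c"]) simp
  qed
 qed (auto intro!: continuous_intros)
 moreover have "(\<lambda>n. F (real n) - F 0) \<longlonglongrightarrow> 0 - F 0"
 proof (intro tendsto_intros)
  have "(\<lambda>n. norm (F (real n))) \<longlonglongrightarrow> 0"
  proof -
   have "norm (F (real n)) = exp (- e) ^ n / norm c" for n
    by (simp add: F_def norm_divide norm_exp_eq_Re c_def exp_of_nat_mult[symmetric] mult.commute)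
   moreover have "(\<lambda>n. exp (- e) ^ n / norm c) \<longlonglongrightarrow> 0 / norm c"
    using e c0 by (intro tendsto_intros LIMSEQ_power_zero) auto
   ultimately show ?thesis by simp
  qed
  then show "(\<lambda>n. F (real n)) \<longlonglongrightarrow> 0" by (simp add: tendsto_norm_zero_iff)
 qed
 ultimately have "(LINT k|lborel. indicator {0..} k *\<^sub>R (exp (- e * k) *\<^sub>R cis (x * k))) = 0 - F 0"
  using LIMSEQ_unique by simp blast
 also have "... = 1 / Complex e (- x)"
 proof -
  have "- c = Complex e (- x)" by (simp add: c_def complex_eq_iff)
  moreover have "0 - F 0 = 1 / (- c)" by (simp add: F_def)
  ultimately show ?thesis by simp
 qed
 finally show "(LINT k|lborel. indicator {0..} k *\<^sub>R (exp (- e * k) *\<^sub>R cis (x * k))) = 1 / Complex e (- x)" .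
qed

text \<open>With \<open>z = exp (Complex (- e) x)\<close>, of modulus below 1, the integral is the
  geometric series of \<open>z ^ Suc n\<close>.\<close>

lemma integral_positive_frequencies_Circle:
 assumes e: "e > 0"
 shows "integrable (nX Circle) (\<lambda>l. indicator {0<..} l *\<^sub>R (exp (- e * l) *\<^sub>R cis (x * l)))"
  and "(LINT l|nX Circle. indicator {0<..} l *\<^sub>R (exp (- e * l) *\<^sub>R cis (x * l)))
   = exp (Complex (- e) x) / (1 - exp (Complex (- e) x))"
proof -
 define z where "z = exp (Complex (- e) x)"
 have z: "norm z < 1" using e by (simp add: z_def norm_exp_eq_Re)
 define h where "h l = indicator {0<..} l *\<^sub>R (exp (- e * l) *\<^sub>R cis (x * l))" for l :: real
 have h [measurable]: "h \<in> bm" unfolding h_def by measurable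
 have hz: "h (real_of_int (int (Suc n))) = z ^ Suc n" for n
 proof -
  have "exp (- e * l) *\<^sub>R cis (x * l) = exp (of_real l * Complex (- e) x)" for l
   by (simp add: exp_eq_polar scaleR_conv_of_real mult.commute)
  then have "h (real_of_int (int (Suc n))) = exp (of_nat (Suc n) * Complex (- e) x)"
   unfolding h_def by (simp add: indicator_def del: of_nat_Suc)
  then show ?thesis by (simp only: z_def exp_of_nat_mult)
 qed
 have bij: "bij_betw (\<lambda>n. int (Suc n)) UNIV {0<..}"
  by (rule bij_betwI[where g = "\<lambda>k. nat (k - 1)"]) auto
 have s1: "Infinite_Set_Sum.abs_summable_on (\<lambda>n. z ^ Suc n) UNIV"
  unfolding abs_summable_on_nat_iff
  using z by (auto simp: norm_power norm_mult intro!: summable_mult summable_geometric)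
 have s2: "Infinite_Set_Sum.abs_summable_on (\<lambda>k. h (real_of_int k)) {0<..}"
  by (subst Infinite_Set_Sum.abs_summable_on_reindex_bij_betw[OF bij, symmetric]) (use s1 hz in simp)
 have s3: "Infinite_Set_Sum.abs_summable_on (\<lambda>k. h (real_of_int k)) UNIV"
  by (rule iffD1[OF Infinite_Set_Sum.abs_summable_on_cong_neutral s2]) (auto simp: h_def)
 then have "integrable (nX Circle) h"
  by (simp add: Infinite_Set_Sum.abs_summable_on_def integrable_distr_eq)
 then show "integrable (nX Circle) (\<lambda>l. indicator {0<..} l *\<^sub>R (exp (- e * l) *\<^sub>R cis (x * l)))"
  by (simp add: h_def[abs_def])
 have "(LINT l|nX Circle. h l) = infsetsum (\<lambda>k. h (real_of_int k)) UNIV"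
  by (simp add: infsetsum_def integral_distr)
 also have "... = infsetsum (\<lambda>k. h (real_of_int k)) {0<..}"
  by (rule infsetsum_cong_neutral) (auto simp: h_def)
 also have "... = infsetsum (\<lambda>n. h (real_of_int (int (Suc n)))) UNIV"
  by (rule infsetsum_reindex_bij_betw[OF bij, symmetric])
 also have "... = infsetsum (\<lambda>n. z ^ Suc n) UNIV" by (simp only: hz)
 also have "... = (\<Sum>n. z ^ Suc n)" by (rule infsetsum_nat') (rule s1)
 also have "... = z / (1 - z)"
  using suminf_mult[OF summable_geometric[OF z], of z] suminf_geometric[OF z] by simp
 finally show "(LINT l|nX Circle. indicator {0<..} l *\<^sub>R (exp (- e * l) *\<^sub>R cis (x * l)))
   = exp (Complex (- e) x) / (1 - exp (Complex (- e) x))"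
  by (simp add: h_def[abs_def] z_def)
qed

text \<open>Cauchy-type kernels, the inverse transform of the positive half of the weight. Sum and
  difference of the values at \<open>x\<close> and \<open>- x\<close> give the Poisson and conjugate
  Poisson kernels.\<close>

fun half_kernel :: "base_space => real => real => complex" where
 "half_kernel Line e x = 1 / Complex e (- x)"
| "half_kernel Circle e x = exp (Complex (- e) x) / (1 - exp (Complex (- e) x))"

text \<open>Frequency zero is left out: it is a null set on the line, and on the circle it must
  enter the Poisson kernel once and not twice, which \<open>nu0\<close> takes care of.\<close>

definition hw :: "real => real => real => complex" where
 "hw e x k = indicator {0<..} k *\<^sub>R (exp (- e * k) *\<^sub>R cis (x * k))"

lemma integrable_hw: "e > 0 ==> integrable (nX X) (hw e x)"
 and integral_hw: "e > 0 ==> (LINT k|nX X. hw e x k) = half_kernel X e x"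
proof -
 assume e: "e > 0"
 have ae: "AE k in lborel. hw e x k = indicator {0..} k *\<^sub>R (exp (- e * k) *\<^sub>R cis (x * k))"
  using AE_lborel_singleton[of 0] by eventually_elim (auto simp: hw_def indicator_def)
 have [measurable]: "hw e x \<in> bm" unfolding hw_def[abs_def] by measurable
 have "integrable lborel (hw e x) \<and> (LINT k|lborel. hw e x k) = half_kernel Line e x"
  using integral_exp_decay[OF e, of x] integral_cong_AE[OF _ _ ae] integrable_cong_AE[OF _ _ ae] by simp
 moreover have "integrable (nX Circle) (hw e x) \<and> (LINT k|nX Circle. hw e x k) = half_kernel Circle e x"
  using integral_positive_frequencies_Circle[OF e, of x] by (simp add: hw_def[abs_def])
 ultimately have "integrable (nX X) (hw e x) \<and> (LINT k|nX X. hw e x k) = half_kernel X e x"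
  by (cases X) auto
 then show "integrable (nX X) (hw e x)" "(LINT k|nX X. hw e x k) = half_kernel X e x" by auto
qed

text \<open>Poisson kernels of the half-plane at height \<open>e\<close> and of the disc at radius
  \<open>r = exp (- e)\<close>, with total mass \<open>2 * pi\<close>. The denominator on the circle
  is \<open>1 - 2 * r * cos x + r^2\<close>, written so that its positivity is visible.\<close>

fun pk :: "base_space => real => real => real" where
 "pk Line e x = 2 * e / (e^2 + x^2)"
| "pk Circle e x = (1 - (exp (- e))^2) / ((1 - exp (- e))^2 + 2 * exp (- e) * (1 - cos x))"

text \<open>The conjugate Poisson kernels; for \<open>e\<close> tending to zero they become
  \<open>2 / x\<close> and \<open>cot (x / 2)\<close>.\<close>

fun qk :: "base_space => real => real => real" where
 "qk Line e x = 2 * x / (e^2 + x^2)"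
| "qk Circle e x = 2 * exp (- e) * sin x / ((1 - exp (- e))^2 + 2 * exp (- e) * (1 - cos x))"

definition nu0 :: "base_space => real" where
 "nu0 X = (case X of Line => 0 | Circle => 1)"

lemma half_kernel_pk: "e > 0 ==> half_kernel X e x + half_kernel X e (- x) + of_real (nu0 X) = of_real (pk X e x)"
 and half_kernel_qk: "e > 0 ==> half_kernel X e x - half_kernel X e (- x) = \<i> * of_real (qk X e x)"
proof -
 assume e: "e > 0"
 have cnj: "half_kernel X e (- x) = cnj (half_kernel X e x)"
  by (cases X) (simp_all add: exp_cnj[symmetric] complex_eq_iff Re_exp Im_exp Re_divide Im_divide)
 have re: "2 * Re (half_kernel X e x) + nu0 X = pk X e x \<and> 2 * Im (half_kernel X e x) = qk X e x"
 proof (cases X)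
  case Line
  then show ?thesis using e by (simp add: nu0_def Re_divide Im_divide)
 next
  case Circle
  define r where "r = exp (- e)"
  have r: "0 < r" "r < 1" using e by (auto simp: r_def)
  define D where "D = (1 - r)^2 + 2 * r * (1 - cos x)"
  have "(1 - r)^2 > 0" using r by simp
  moreover have "2 * r * (1 - cos x) \<ge> 0" using r by simp
  ultimately have D: "D > 0" unfolding D_def by linarith
  \<comment> \<open>The denominator is the squared modulus of \<open>1 - r * cis x\<close>.\<close>
  have D2: "(1 - r * cos x)^2 + (r * sin x)^2 = D"
   unfolding D_def using sin_cos_squared_add[of x] by algebra
  have "Re (half_kernel X e x) = (r * cos x * (1 - r * cos x) - r * sin x * (r * sin x)) / D"
   by (simp add: Circle Re_divide Re_exp Im_exp r_def[symmetric] D2)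
  moreover have "r * cos x * (1 - r * cos x) - r * sin x * (r * sin x) = r * cos x - r^2"
   using sin_cos_squared_add[of x] by algebra
  ultimately have "Re (half_kernel X e x) = (r * cos x - r^2) / D" by simp
  then have "2 * Re (half_kernel X e x) + nu0 X = (2 * (r * cos x - r^2) + D) / D"
   using D by (simp add: nu0_def Circle add_divide_distrib)
  also have "2 * (r * cos x - r^2) + D = 1 - r^2" by (simp add: D_def power2_eq_square algebra_simps)
  finally have 1: "2 * Re (half_kernel X e x) + nu0 X = pk X e x" by (simp add: Circle r_def D_def)
  have "Im (half_kernel X e x) = (r * sin x * (1 - r * cos x) + r * cos x * (r * sin x)) / D"
   by (simp add: Circle Im_divide Re_exp Im_exp r_def[symmetric] D2)
  also have "r * sin x * (1 - r * cos x) + r * cos x * (r * sin x) = r * sin x" by (simp add: algebra_simps)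
  finally have "2 * Im (half_kernel X e x) = qk X e x" by (simp add: Circle r_def D_def)
  with 1 show ?thesis by simp
 qed
 show "half_kernel X e x + half_kernel X e (- x) + of_real (nu0 X) = of_real (pk X e x)"
  using re by (simp add: cnj complex_eq_iff)
 show "half_kernel X e x - half_kernel X e (- x) = \<i> * of_real (qk X e x)"
  using re by (simp add: cnj complex_eq_iff)
qed

lemma nX_zero: "integrable (nX X) (\<lambda>k. indicator {0} k :: complex)" "(LINT k|nX X. indicator {0} k) = complex_of_real (nu0 X)"
proof -
 have "emeasure (nX X) {0} = ennreal (nu0 X)"
 proof (cases X)
  case Circle
  have "{n::int. real_of_int n \<in> {0}} = {0}" by auto
  then show ?thesis unfolding Circle by (subst emeasure_nX_Circle) (auto simp: nu0_def)
 qed (simp add: nu0_def)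
 moreover have "nu0 X \<ge> 0" by (simp add: nu0_def split: base_space.split)
 ultimately have "has_bochner_integral (nX X) (\<lambda>k. indicator {0} k *\<^sub>R (1::complex)) (nu0 X *\<^sub>R 1)"
  using has_bochner_integral_indicator[of "{0}" "nX X" "1::complex"] by (simp add: measure_def)
 then have "has_bochner_integral (nX X) (\<lambda>k. indicator {0} k :: complex) (of_real (nu0 X))"
  by (simp add: scaleR_conv_of_real of_real_indicator)
 then show "integrable (nX X) (\<lambda>k. indicator {0} k :: complex)" "(LINT k|nX X. indicator {0} k) = complex_of_real (nu0 X)"
  by (auto simp: has_bochner_integral_iff)
qed

lemma
 assumes e: "e > 0"
 shows integrable_wt_cis: "integrable (nX X) (\<lambda>k. wt e k * cis (x * k))"
  and integral_wt_cis: "(LINT k|nX X. wt e k * cis (x * k)) = of_real (pk X e x)"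
  and integral_wt_sgn_cis: "(LINT k|nX X. (- \<i> * of_real (sgn k)) * wt e k * cis (x * k)) = of_real (qk X e x)"
proof -
 have i2: "integrable (nX X) (\<lambda>k. hw e (- x) (0 - k))"
  by (rule integrable_nX_reflect) (auto intro: integrable_hw e)
 have [measurable]: "hw e y \<in> bm" for y unfolding hw_def[abs_def] by measurable
 have e2: "(LINT k|nX X. hw e (- x) (0 - k)) = half_kernel X e (- x)"
  by (subst integral_nX_reflect) (auto simp: integral_hw e)
 have eq: "wt e k * cis (x * k) = hw e x k + hw e (- x) (0 - k) + indicator {0} k" for k
  by (cases "k = 0"; cases "k > 0") (auto simp: wt_def hw_def indicator_def scaleR_conv_of_real)
 have eq2: "(- \<i> * of_real (sgn k)) * wt e k * cis (x * k) = - \<i> * (hw e x k - hw e (- x) (0 - k))" for k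
  by (cases "k = 0"; cases "k > 0") (auto simp: wt_def hw_def indicator_def scaleR_conv_of_real)
 show "integrable (nX X) (\<lambda>k. wt e k * cis (x * k))"
  unfolding eq using i2 nX_zero by (intro Bochner_Integration.integrable_add integrable_hw e) auto
 show "(LINT k|nX X. wt e k * cis (x * k)) = of_real (pk X e x)"
  unfolding eq using i2 nX_zero half_kernel_pk[OF e, of X x]
  by (simp add: integrable_hw e integral_hw e2[simplified] Bochner_Integration.integral_add)
 have "(LINT k|nX X. hw e x k - hw e (- x) (0 - k)) = \<i> * of_real (qk X e x)"
  using i2 half_kernel_qk[OF e, of X x]
  by (simp add: integrable_hw e integral_hw e2[simplified])
 then show "(LINT k|nX X. (- \<i> * of_real (sgn k)) * wt e k * cis (x * k)) = of_real (qk X e x)"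
  unfolding eq2 integral_mult_right_zero by simp
qed

lemma borel_measurable_mX [simp]: "borel_measurable (mX X) = borel_measurable borel"
 by (intro measurable_cong_sets) auto

lemma borel_measurable_nX [simp]: "borel_measurable (nX X) = borel_measurable borel"
 by (intro measurable_cong_sets) auto

subsection \<open>Comparison with the truncated singular kernel\<close>

text \<open>Half the Poisson kernel of the line, the common majorant for the kernels of both spaces;
  over the whole line its integral is \<open>pi\<close> for every positive \<open>e\<close>.\<close>

definition pw :: "real => real => real" where
 "pw e u = e / (e^2 + u^2)"

text \<open>Normalised as the limit of \<open>qk\<close>; on the line it is twice the kernel of the
  principal value, which \<open>tk_scale\<close> corrects later.\<close>

fun sk :: "base_space => real => real" where
 "sk Line u = 2 / u"
| "sk Circle u = cot (u / 2)"

definition tk :: "base_space => real => real => real" where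
 "tk X e u = indicator {u. e < \<bar>u\<bar>} u * sk X u"

lemma pw_nonneg: "e \<ge> 0 ==> 0 <= pw e u"
 by (simp add: pw_def)

lemma pw_measurable [measurable]: "pw e \<in> bm"
 unfolding pw_def[abs_def] by measurable

lemma pk_measurable [measurable]: "pk X e \<in> bm"
 by (cases X) (simp_all add: pk.simps[abs_def])

lemma qk_measurable [measurable]: "qk X e \<in> bm"
 by (cases X) (simp_all add: qk.simps[abs_def])

lemma sk_measurable [measurable]: "sk X \<in> bm"
 by (cases X) (simp_all add: sk.simps[abs_def] cot_def)

lemma tk_measurable [measurable]: "tk X e \<in> bm"
 unfolding tk_def[abs_def] by measurable

text \<open>The constant 1/16 is small enough for crude arguments: up to |u| = 2 the fourth order
  Taylor bound gives even \<open>u^2 / 3\<close>, and beyond that the cosine is nonpositive while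
  \<open>u^2\<close> is at most 16.\<close>

lemma one_minus_cos_ge:
 assumes "\<bar>u\<bar> <= pi"
 shows "u\<^sup>2 / 16 <= 1 - cos u"
proof (cases "\<bar>u\<bar> <= 2")
 case True
 obtain t where "cos u = (\<Sum>m<4. cos_coeff m * u ^ m) + (cos (t + 1/2 * real 4 * pi) / fact 4) * u ^ 4"
  using Maclaurin_cos_expansion[of u 4] by blast
 moreover have "(\<Sum>m<4. cos_coeff m * u ^ m) = 1 - u^2 / 2"
 proof -
  have "{..<4::nat} = {0, 1, 2, 3}" by auto
  then show ?thesis by (simp add: cos_coeff_def)
 qed
 moreover have "(cos (t + 1/2 * real 4 * pi) / fact 4) * u ^ 4 <= (1 / fact 4) * u ^ 4"
  by (intro mult_right_mono divide_right_mono) auto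
 moreover have "u ^ 4 <= 4 * u^2"
 proof -
  have "u\<^sup>2 <= 2\<^sup>2" using True by (metis abs_le_square_iff abs_numeral)
  then have "u\<^sup>2 * u^2 <= 4 * u^2" by (intro mult_right_mono) auto
  then show ?thesis by (simp add: power2_eq_square power4_eq_xxxx mult_ac)
 qed
 ultimately have "cos u <= 1 - u^2 / 2 + u^2 / 6" by (simp add: fact_numeral)
 moreover have "0 <= u^2" by simp
 ultimately show ?thesis by linarith
next
 case False
 have "cos \<bar>u\<bar> <= cos (pi / 2)"
  using False assms pi_less_4 by (intro cos_monotone_0_pi_le) auto
 then have c: "cos u <= 0" by simp
 have "\<bar>u\<bar> <= \<bar>4\<bar>" using assms pi_less_4 by linarith
 then have "u\<^sup>2 <= 4\<^sup>2" by (simp only: abs_le_square_iff)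
 then show ?thesis using c by simp
qed

text \<open>These bounds compare the kernels of the disc with those of the half-plane. The 24 comes
  from \<open>2 * r\<close> being at least 2/3 and from the constant 16 of
  \<open>one_minus_cos_ge\<close>.\<close>

lemma circle_denominator:
 assumes "0 < e" "e <= 1"
 defines "r \<equiv> exp (- e)"
 shows "e / 2 <= 1 - r" "1 - r <= e" "1 - r^2 <= 2 * e" "0 < r" "r < 1"
  and "\<bar>u\<bar> <= pi ==> (e^2 + u^2) / 24 <= (1 - r)^2 + 2 * r * (1 - cos u)"
proof -
 have "1 + e <= exp e" by simp
 then have "r <= 1 / (1 + e)" using assms by (simp add: r_def exp_minus field_simps)
 moreover have "1 / (1 + e) <= 1 - e / 2"
 proof -
  have "1 <= (1 - e / 2) * (1 + e)" using assms by (simp add: field_simps)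
  then show ?thesis using assms by (simp add: divide_le_eq)
 qed
 ultimately show 1: "e / 2 <= 1 - r" by simp
 show "1 - r <= e" using exp_ge_add_one_self[of "- e"] by (simp add: r_def)
 have "r\<^sup>2 = exp (- (2 * e))" by (simp add: r_def power2_eq_square exp_add[symmetric])
 then show "1 - r^2 <= 2 * e" using exp_ge_add_one_self[of "- (2 * e)"] by simp
 show r: "0 < r" "r < 1" using assms by (auto simp: r_def)
 have r3: "1 / 3 <= r"
 proof -
  have "exp e <= exp 1" using assms by simp
  also have "... <= 3" by (rule exp_le)
  finally show ?thesis by (simp add: r_def exp_minus field_simps)
 qed
 assume u: "\<bar>u\<bar> <= pi"
 have "(e / 2)^2 <= (1 - r)^2" using 1 assms by (intro power_mono) auto
 then have a: "e\<^sup>2 / 4 <= (1 - r)^2" by (simp add: power_divide)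
 have "2 / 3 * (u^2 / 16) <= 2 * r * (1 - cos u)"
  using r3 one_minus_cos_ge[OF u] by (intro mult_mono) auto
 with a have "e\<^sup>2 / 4 + 2 / 3 * (u^2 / 16) <= (1 - r)^2 + 2 * r * (1 - cos u)" by (rule add_mono)
 moreover have "(e^2 + u^2) / 24 <= e^2 / 4 + 2 / 3 * (u^2 / 16)" by simp
 ultimately show "(e^2 + u^2) / 24 <= (1 - r)^2 + 2 * r * (1 - cos u)" by (rule order_trans[rotated])
qed

lemma cell_abs_le: "u \<in> cell Circle ==> \<bar>u\<bar> <= pi"
 by auto

lemma pk_nonneg: "e > 0 ==> 0 <= pk X e u"
 by (cases X) (auto intro!: divide_nonneg_nonneg add_nonneg_nonneg mult_nonneg_nonneg simp: power_le_one)

lemma pk_le_pw: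
 assumes "0 < e" "e <= 1" "u \<in> cell X"
 shows "pk X e u <= 48 * pw e u"
proof (cases X)
 case Line
 have "2 * pw e u <= 48 * pw e u" using pw_nonneg[of e u] assms by simp
 then show ?thesis by (simp add: Line pw_def)
next
 case Circle
 define r where "r = exp (- e)"
 note d = circle_denominator[OF assms(1,2), folded r_def]
 have "(1 - r^2) / ((1 - r)^2 + 2 * r * (1 - cos u)) <= 2 * e / ((e^2 + u^2) / 24)"
  using assms d by (intro frac_le d cell_abs_le) (auto simp: Circle power2_eq_square intro!: divide_pos_pos add_pos_nonneg)
 then show ?thesis by (simp add: Circle pw_def r_def)
qed

text \<open>Beyond the truncation the singular parts cancel to second order in \<open>e\<close>;
  inside it only \<open>qk\<close> is left, and there |u| is at most \<open>e\<close>. So the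
  difference is dominated by an approximate identity, which is why truncated principal values and
  conjugate Poisson integrals have the same limit. The largest constant met is 384, which is 16
  times 24.\<close>

lemma tk_minus_qk_le:
 assumes "0 < e" "e <= 1" "u \<in> cell X"
 shows "\<bar>tk X e u - qk X e u\<bar> <= 400 * pw e u"
proof (cases X)
 case Line
 have p: "e\<^sup>2 + u^2 > 0" using assms by (simp add: add_pos_nonneg)
 have "\<bar>tk X e u - qk X e u\<bar> <= 2 * pw e u"
 proof (cases "e < \<bar>u\<bar>")
  case True
  then have u: "u \<noteq> 0" using assms by auto
  have "tk X e u - qk X e u = 2 * e^2 / (u * (e^2 + u^2))"
   using True u p by (simp add: Line tk_def field_simps power2_eq_square)
  then have "\<bar>tk X e u - qk X e u\<bar> = 2 * (e / \<bar>u\<bar>) * pw e u"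
   using p assms by (simp add: pw_def abs_mult abs_divide power2_eq_square)
  also have "... <= 2 * 1 * pw e u"
   using True assms by (intro mult_right_mono mult_left_mono pw_nonneg) auto
  finally show ?thesis by simp
 next
  case False
  then have "\<bar>tk X e u - qk X e u\<bar> = 2 * \<bar>u\<bar> / (e^2 + u^2)"
   using p by (simp add: Line tk_def abs_divide abs_mult)
  also have "... <= 2 * e / (e^2 + u^2)" using False p by (intro divide_right_mono) auto
  finally show ?thesis by (simp add: pw_def)
 qed
 also have "... <= 400 * pw e u" using pw_nonneg[of e u] assms by simp
 finally show ?thesis .
next
 case Circle
 define r where "r = exp (- e)"
 define D where "D = (1 - r)^2 + 2 * r * (1 - cos u)"
 note d = circle_denominator[OF assms(1,2), folded r_def]
 have u: "\<bar>u\<bar> <= pi" using assms(3) Circle by auto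
 have D: "(e^2 + u^2) / 24 <= D" unfolding D_def by (rule d(6)[OF u])
 have p: "(e^2 + u^2) / 24 > 0" using assms by (simp add: add_pos_nonneg)
 have D0: "D > 0" using D p by linarith
 have s: "\<bar>sin u\<bar> <= \<bar>u\<bar>" by (rule abs_sin_x_le_abs_x)
 have q: "qk X e u = 2 * r * sin u / D" by (simp add: Circle r_def D_def)
 show ?thesis
 proof (cases "e < \<bar>u\<bar>")
  case True
  then have u0: "u\<^sup>2 > 0" using assms by auto
  define c where "c = 1 - cos u"
  have c: "u\<^sup>2 / 16 <= c" unfolding c_def by (rule one_minus_cos_ge[OF u])
  have c0: "c > 0" using c u0 by linarith
  have "cot (u / 2) = sin u / c"
  proof -
   define y where "y = u / 2"
   have uy: "u = 2 * y" by (simp add: y_def)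
   have "c = 2 * (sin y)^2" unfolding c_def uy by (simp add: cos_double_sin)
   moreover have "sin u = 2 * sin y * cos y" unfolding uy by (rule sin_double)
   ultimately show ?thesis using c0 by (simp add: cot_def y_def[symmetric] power2_eq_square)
  qed
  then have "tk X e u - qk X e u = sin u / c - 2 * r * sin u / D" using True unfolding q by (simp add: tk_def Circle)
  also have "... = sin u * (1 - r)^2 / (c * D)"
  proof -
   have "sin u / c - 2 * r * sin u / D = (sin u * D - 2 * r * sin u * c) / (c * D)"
    using c0 D0 by (simp add: diff_frac_eq)
   also have "sin u * D - 2 * r * sin u * c = sin u * (1 - r)^2" by (simp add: D_def c_def algebra_simps)
   finally show ?thesis .
  qed
  finally have "\<bar>tk X e u - qk X e u\<bar> = \<bar>sin u\<bar> * (1 - r)^2 / (c * D)"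
   using c0 D0 by (simp add: abs_mult abs_divide)
  also have "... <= \<bar>u\<bar> * e^2 / (u^2 / 16 * ((e^2 + u^2) / 24))"
   using c D p s d u0 c0 D0 assms by (intro frac_le mult_mono power_mono mult_pos_pos) auto
  also have "... = 384 * (e / \<bar>u\<bar>) * pw e u"
  proof -
   have "a * e^2 / (a * a / 16 * (P / 24)) = 384 * (e / a) * (e / P)" if "a > 0" "P > 0" for a P
    using that by (simp add: divide_simps power2_eq_square)
   from this[of "\<bar>u\<bar>" "e\<^sup>2 + u^2"] show ?thesis
    using u0 p True by (simp add: pw_def power2_eq_square) (use True assms in auto)
  qed
  also have "... <= 384 * 1 * pw e u"
   using True assms by (intro mult_right_mono mult_left_mono pw_nonneg) auto
  also have "... <= 400 * pw e u" using pw_nonneg[of e u] assms by simp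
  finally show ?thesis .
 next
  case False
  then have "\<bar>tk X e u - qk X e u\<bar> = 2 * r * \<bar>sin u\<bar> / D"
   using D0 d by (simp add: q tk_def abs_mult abs_divide)
  also have "... <= 2 * 1 * e / ((e^2 + u^2) / 24)"
   using D p s d False by (intro frac_le mult_mono) auto
  also have "... = 48 * pw e u" by (simp add: pw_def)
  also have "... <= 400 * pw e u" using pw_nonneg[of e u] assms by simp
  finally show ?thesis .
 qed
qed

subsection \<open>Averages against \<open>pw\<close>\<close>

lemma nn_integral_arctan:
 assumes "e > 0"
 shows "(\<integral>\<^sup>+h. ennreal (pw e h) * indicator {0..} h \<partial>lborel) = ennreal (pi / 2)"
proof -
 have "(\<integral>\<^sup>+h. ennreal (pw e h) * indicator {0..} h \<partial>lborel) = ennreal (pi / 2 - arctan (0 / e))"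
 proof (rule nn_integral_FTC_atLeast)
  fix h :: real
  show "((\<lambda>h. arctan (h / e)) has_real_derivative pw e h) (at h)"
  proof -
   have "((\<lambda>h. arctan (h / e)) has_real_derivative inverse (1 + (h / e)^2) * (1 / e)) (at h)"
    using assms by (auto intro!: derivative_eq_intros simp: divide_inverse)
   moreover have "inverse (1 + (h / e)^2) * (1 / e) = pw e h"
   proof -
    have "1 + (h / e)^2 = (e^2 + h^2) / e^2" using assms by (simp add: field_simps)
    then show ?thesis using assms by (simp add: pw_def power2_eq_square)
   qed
   ultimately show ?thesis by simp
  qed
 next
  have "filterlim (\<lambda>h::real. h / e) at_top at_top"
   using assms filterlim_tendsto_pos_mult_at_top[OF tendsto_const[of "1 / e"] _ filterlim_ident] by simp
  then show "((\<lambda>h. arctan (h / e)) \<longlongrightarrow> pi / 2) at_top"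
   by (rule filterlim_compose[OF tendsto_arctan_at_top])
 qed (use assms in \<open>auto simp: pw_nonneg\<close>)
 then show ?thesis by simp
qed

lemma nn_integral_pw:
 assumes e: "e > 0"
 shows "(\<integral>\<^sup>+u. ennreal (pw e u) \<partial>lborel) = ennreal pi"
proof -
 have "(\<integral>\<^sup>+u. ennreal (pw e u) \<partial>lborel)
  = (\<integral>\<^sup>+u. ennreal (pw e u) * indicator {0..} u + ennreal (pw e (0 + -1 * u)) * indicator {0..} (0 + -1 * u) \<partial>lborel)"
 proof (rule nn_integral_cong_AE)
  show "AE u in lborel. ennreal (pw e u) = ennreal (pw e u) * indicator {0..} u + ennreal (pw e (0 + -1 * u)) * indicator {0..} (0 + -1 * u)"
   using AE_lborel_singleton[of 0] by eventually_elim (auto simp: pw_def indicator_def)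
 qed
 also have "... = (\<integral>\<^sup>+u. ennreal (pw e u) * indicator {0..} u \<partial>lborel) + (\<integral>\<^sup>+u. ennreal (pw e (0 + -1 * u)) * indicator {0..} (0 + -1 * u) \<partial>lborel)"
  by (intro nn_integral_add) auto
 also have "(\<integral>\<^sup>+u. ennreal (pw e (0 + -1 * u)) * indicator {0..} (0 + -1 * u) \<partial>lborel) = (\<integral>\<^sup>+u. ennreal (pw e u) * indicator {0..} u \<partial>lborel)"
  by (subst (2) nn_integral_real_affine[where c = "-1" and t = 0]) auto
 also have "ennreal (pi / 2) + ennreal (pi / 2) = ennreal pi" by (simp add: ennreal_plus[symmetric] del: ennreal_plus)
 ultimately show ?thesis by (simp only: nn_integral_arctan[OF e])
qed

text \<open>Layer-cake formula: the kernel is a superposition of indicators of centred balls, with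
  density minus its derivative in the radius. It converts bounds for means over balls into bounds
  for means against the kernel.\<close>

lemma pw_layers:
 assumes e: "e > 0"
 shows "ennreal (pw e u) = (\<integral>\<^sup>+h. ennreal (2 * h * e / (e^2 + h^2)^2) * indicator {0..} h * indicator (cball 0 h) (u::real) \<partial>lborel)"
proof -
 have "(\<integral>\<^sup>+h. ennreal (2 * h * e / (e^2 + h^2)^2) * indicator {\<bar>u\<bar>..} h \<partial>lborel) = ennreal (0 - - pw e \<bar>u\<bar>)"
 proof (rule nn_integral_FTC_atLeast)
  fix h :: real assume "\<bar>u\<bar> <= h"
  show "((\<lambda>h. - pw e h) has_real_derivative 2 * h * e / (e^2 + h^2)^2) (at h)"
  proof -
   have "e\<^sup>2 + h^2 \<noteq> 0" using e by (metis add_pos_nonneg less_irrefl zero_le_power2 zero_less_power)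
   then show ?thesis unfolding pw_def
    by (auto intro!: derivative_eq_intros simp: power2_eq_square)
  qed
  show "0 <= 2 * h * e / (e^2 + h^2)^2" using \<open>\<bar>u\<bar> <= h\<close> e by auto
 next
  have "filterlim (\<lambda>h::real. e^2 + h^2) at_top at_top"
   by (intro filterlim_tendsto_add_at_top[OF tendsto_const] filterlim_pow_at_top filterlim_ident) auto
  then have "((\<lambda>h. e / (e^2 + h^2)) \<longlongrightarrow> 0) at_top"
   by (rule tendsto_divide_0[OF tendsto_const filterlim_at_top_imp_at_infinity])
  then have "((\<lambda>h. - (e / (e^2 + h^2))) \<longlongrightarrow> - 0) at_top" by (rule tendsto_minus)
  then show "((\<lambda>h. - pw e h) \<longlongrightarrow> 0) at_top" by (simp add: pw_def)
 qed auto
 moreover have "(\<integral>\<^sup>+h. ennreal (2 * h * e / (e^2 + h^2)^2) * indicator {\<bar>u\<bar>..} h \<partial>lborel)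
  = (\<integral>\<^sup>+h. ennreal (2 * h * e / (e^2 + h^2)^2) * indicator {0..} h * indicator (cball 0 h) u \<partial>lborel)"
  by (intro nn_integral_cong) (auto simp: indicator_def)
 ultimately show ?thesis by (simp add: pw_def)
qed

text \<open>After Tonelli each layer is estimated by the hypothesis; the layer density times the
  radius is again at most a multiple of the kernel, whose half-line integral is
  \<open>pi / 2\<close>.\<close>

lemma pw_average_le:
 assumes [measurable]: "a \<in> bm" and e: "e > 0" and y: "y \<ge> 0"
  and avg: "\<And>h. h > 0 ==> (\<integral>\<^sup>+u. a u * indicator (ball 0 h) u \<partial>lborel) <= ennreal (y * h)"
 shows "(\<integral>\<^sup>+u. a u * ennreal (pw e u) \<partial>lborel) <= ennreal (2 * y * pi)"
proof -
 define w where "w h = ennreal (2 * h * e / (e^2 + h^2)^2) * indicator {0..} h" for h :: real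
 have [measurable]: "w \<in> bm" unfolding w_def by measurable
 have m: "(\<lambda>(u::real, h::real). indicator (cball 0 h) u :: ennreal) \<in> borel_measurable (lborel \<Otimes>\<^sub>M lborel)"
 proof -
  have "(\<lambda>(u::real, h::real). indicator (cball 0 h) u :: ennreal) = (\<lambda>p. if \<bar>fst p\<bar> <= snd p then 1 else 0)"
   by (auto simp: fun_eq_iff indicator_def)
  then show ?thesis by simp
 qed
 have [measurable]: "(\<lambda>p. a (fst p) * (w (snd p) * indicator (cball 0 (snd p)) (fst p))) \<in> borel_measurable (lborel \<Otimes>\<^sub>M lborel)"
  using m by (simp add: case_prod_beta')
 have "(\<integral>\<^sup>+u. a u * ennreal (pw e u) \<partial>lborel) = (\<integral>\<^sup>+u. \<integral>\<^sup>+h. a u * (w h * indicator (cball 0 h) u) \<partial>lborel \<partial>lborel)"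
 proof (rule nn_integral_cong)
  fix u
  have [measurable]: "(\<lambda>h::real. indicator (cball 0 h) (u::real) :: ennreal) \<in> bm"
  proof -
   have "(\<lambda>h::real. indicator (cball 0 h) (u::real) :: ennreal) = (\<lambda>h. if \<bar>u\<bar> <= h then 1 else 0)"
    by (auto simp: fun_eq_iff indicator_def)
   then show ?thesis by simp
  qed
  show "a u * ennreal (pw e u) = (\<integral>\<^sup>+h. a u * (w h * indicator (cball 0 h) u) \<partial>lborel)"
   unfolding pw_layers[OF e] w_def by (subst nn_integral_cmult) auto
 qed
 also have "... = (\<integral>\<^sup>+h. \<integral>\<^sup>+u. a u * (w h * indicator (cball 0 h) u) \<partial>lborel \<partial>lborel)"
  by (rule lborel_pair.Fubini'[symmetric]) (simp add: case_prod_beta')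
 also have "... <= (\<integral>\<^sup>+h. ennreal (4 * y) * (ennreal (pw e h) * indicator {0..} h) \<partial>lborel)"
 proof (rule nn_integral_mono)
  fix h :: real
  show "(\<integral>\<^sup>+u. a u * (w h * indicator (cball 0 h) u) \<partial>lborel) <= ennreal (4 * y) * (ennreal (pw e h) * indicator {0..} h)"
  proof (cases "h > 0")
   case True
   have [measurable]: "cball (0::real) h \<in> sets borel" by simp
   have "(\<integral>\<^sup>+u. a u * (w h * indicator (cball 0 h) u) \<partial>lborel) = w h * (\<integral>\<^sup>+u. a u * indicator (cball 0 h) u \<partial>lborel)"
    by (subst nn_integral_cmult[symmetric]) (auto simp: mult_ac)
   \<comment> \<open>The hypothesis concerns open balls, so the closed ball is put into the open one
     of twice the radius; this doubles the constant.\<close>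
   also have "(\<integral>\<^sup>+u. a u * indicator (cball 0 h) u \<partial>lborel) <= (\<integral>\<^sup>+u. a u * indicator (ball 0 (2 * h)) u \<partial>lborel)"
    using True by (intro nn_integral_mono) (auto simp: indicator_def)
   also have "... <= ennreal (y * (2 * h))" using True by (intro avg) auto
   also have "w h * ennreal (y * (2 * h)) = ennreal (2 * h * e / (e^2 + h^2)^2 * (y * (2 * h)))"
   proof -
    have "w h = ennreal (2 * h * e / (e^2 + h^2)^2)" using True by (simp add: w_def)
    then show ?thesis using True y e by (simp only:) (subst ennreal_mult[symmetric], auto)
   qed
   also have "... <= ennreal (4 * y * pw e h)"
   proof (rule ennreal_leI)
    have p: "e\<^sup>2 + h^2 > 0" using e by (simp add: add_pos_nonneg)
    have "2 * h * e / (e^2 + h^2)^2 * (y * (2 * h)) = 4 * y * pw e h * (h^2 / (e^2 + h^2))"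
     using p by (simp add: pw_def power2_eq_square)
    also have "... <= 4 * y * pw e h * 1"
     using p y e by (intro mult_left_mono mult_nonneg_nonneg pw_nonneg) auto
    finally show "2 * h * e / (e^2 + h^2)^2 * (y * (2 * h)) <= 4 * y * pw e h" by simp
   qed
   finally show ?thesis using True y e by (simp add: ennreal_mult pw_nonneg mult_left_mono)
  next
   case False
   then have "w h = 0" by (cases "h = 0") (auto simp: w_def)
   then show ?thesis by simp
  qed
 qed
 also have "... = ennreal (4 * y) * ennreal (pi / 2)"
  by (subst nn_integral_cmult) (auto simp: nn_integral_arctan[OF e])
 also have "... = ennreal (2 * y * pi)" using y by (simp add: ennreal_mult[symmetric])
 finally show ?thesis .
qed

lemma sk_bound:
 assumes "u \<in> cell X" "u \<noteq> 0"
 shows "\<bar>sk X u\<bar> <= 16 / \<bar>u\<bar>"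
proof (cases X)
 case Line
 then show ?thesis by (simp add: abs_divide divide_right_mono)
next
 case Circle
 define y where "y = u / 2"
 have uy: "u = 2 * y" by (simp add: y_def)
 have "u\<^sup>2 / 16 <= 1 - cos u" using assms Circle by (intro one_minus_cos_ge) auto
 then have c: "u\<^sup>2 / 16 <= 2 * (sin y)^2" unfolding uy by (simp add: cos_double_sin)
 have u2: "u\<^sup>2 > 0" using assms by simp
 then have s: "sin y \<noteq> 0" using c by auto
 have "cot y = sin u / (2 * (sin y)^2)"
  using s unfolding uy sin_double by (simp add: cot_def power2_eq_square)
 then have "\<bar>cot y\<bar> = \<bar>sin u\<bar> / (2 * (sin y)^2)" by (simp add: abs_divide)
 also have "... <= \<bar>u\<bar> / (u^2 / 16)" using c u2 by (intro frac_le abs_sin_x_le_abs_x) auto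
 also have "... = 16 / \<bar>u\<bar>"
 proof -
  have "a / (a * a / 16) = 16 / a" if "a > 0" for a :: real using that by simp
  from this[of "\<bar>u\<bar>"] show ?thesis using assms by (simp add: power2_eq_square)
 qed
 finally show ?thesis by (simp add: Circle y_def)
qed

lemma sqi_pw_bound:
 assumes "f \<in> bm" "AE u in mX X. (cmod (f u))^2 <= C * pw e u" "e > 0" "C \<ge> 0"
 shows "sqi (mX X) f"
proof -
 have "sqn (mX X) f <= (\<integral>\<^sup>+u. ennreal C * ennreal (pw e u) \<partial>mX X)"
  unfolding sqn_def
 proof (rule nn_integral_mono_AE)
  show "AE u in mX X. (esq (f u)) <= ennreal C * ennreal (pw e u)"
   using assms(2) by eventually_elim (simp add: ennreal_mult'[symmetric] assms ennreal_leI)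
 qed
 also have "... <= (\<integral>\<^sup>+u. ennreal C * ennreal (pw e u) \<partial>lborel)"
  by (subst nn_integral_mX) (auto intro!: nn_integral_mono simp: indicator_def)
 also have "... = ennreal C * ennreal pi"
  using assms by (subst nn_integral_cmult) (auto simp: nn_integral_pw)
 also have "... < \<infinity>" by (simp add: ennreal_mult_less_top)
 finally show ?thesis using assms(1) by (simp add: sqi_def)
qed

lemma AE_cell: "AE u in mX X. u \<in> cell X"
 by (simp add: AE_mX_iff)

lemma sqi_tk:
 assumes "0 < e"
 shows "sqi (mX X) (\<lambda>u. of_real (tk X e u))"
proof (rule sqi_pw_bound[where C = "256 * (1 + 1 / e^2)" and e = 1])
 show "AE u in mX X. (cmod (of_real (tk X e u)))^2 <= 256 * (1 + 1 / e^2) * pw 1 u"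
  using AE_cell
 proof eventually_elim
  case (elim u)
  show ?case
  proof (cases "e < \<bar>u\<bar>")
   case True
   then have u: "u \<noteq> 0" "e\<^sup>2 <= u^2" using assms by (auto simp: abs_le_square_iff[symmetric])
   have "(cmod (of_real (tk X e u)))^2 = \<bar>sk X u\<bar>\<^sup>2" using True by (simp add: tk_def)
   also have "... <= (16 / \<bar>u\<bar>)^2" using elim u by (intro power_mono sk_bound) auto
   also have "... = 256 / u^2" by (simp add: power_divide)
   also have "... <= 256 * (1 + 1 / e^2) * pw 1 u"
   proof -
    have "1 + u^2 <= (1 + 1 / e^2) * u^2"
     using u assms by (simp add: distrib_right divide_simps)
    moreover have "u\<^sup>2 > 0" "1 + u^2 > 0" using u by (auto intro: add_pos_nonneg)
    ultimately show ?thesis by (simp add: pw_def divide_simps mult_ac)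
   qed
   finally show ?thesis .
  qed (use assms in \<open>simp add: tk_def pw_nonneg\<close>)
 qed
qed (use assms in auto)

lemma pw_le_inverse: "e > 0 ==> pw e u <= 1 / e"
proof -
 assume e: "e > 0"
 have "e / (e^2 + u^2) <= e / e^2" using e by (intro divide_left_mono mult_pos_pos add_pos_nonneg) auto
 then show ?thesis using e by (simp add: pw_def power2_eq_square)
qed

lemma sqi_dominated_pw:
 assumes [measurable]: "f \<in> bm" and "0 < e" "C \<ge> 0" "\<And>u. u \<in> cell X ==> cmod (f u) <= C * pw e u"
 shows "sqi (mX X) f"
proof (rule sqi_pw_bound[where C = "C\<^sup>2 / e" and e = e])
 show "AE u in mX X. (cmod (f u))^2 <= C^2 / e * pw e u"
  using AE_cell
 proof eventually_elim
  case (elim u)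
  have "(cmod (f u))^2 <= (C * pw e u)^2" using assms elim by (intro power_mono) auto
  also have "... = C^2 * pw e u * pw e u" by (simp add: power2_eq_square)
  also have "... <= C^2 * pw e u * (1 / e)"
   using assms by (intro mult_left_mono pw_le_inverse mult_nonneg_nonneg pw_nonneg) auto
  finally show ?case by (simp add: mult_ac)
 qed
qed (use assms in auto)

lemma sqi_pk: "0 < e ==> e <= 1 ==> sqi (mX X) (\<lambda>u. of_real (pk X e u))"
 by (rule sqi_dominated_pw[where C = 48 and e = e]) (auto simp: pk_nonneg intro: pk_le_pw)

lemma sqi_tk_minus_qk: "0 < e ==> e <= 1 ==> sqi (mX X) (\<lambda>u. of_real (tk X e u - qk X e u))"
 by (rule sqi_dominated_pw[where C = 400 and e = e]) (auto simp: tk_minus_qk_le simp del: of_real_diff)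

lemma sqi_qk: "0 < e ==> e <= 1 ==> sqi (mX X) (\<lambda>u. of_real (qk X e u))"
 using sqi_diff[OF sqi_tk[of e X] sqi_tk_minus_qk[of e X]] by simp

subsection \<open>Lebesgue points of square-integrable functions\<close>

lemma sqi_mX_reflect:
 assumes "sqi (mX X) f" "on_base X f"
 shows "sqi (mX X) (\<lambda>u. f (x - u))" "sqn (mX X) (\<lambda>u. f (x - u)) = sqn (mX X) f"
proof -
 have [measurable]: "f \<in> bm" using assms(1) by (simp add: sqi_def)
 show 1: "sqn (mX X) (\<lambda>u. f (x - u)) = sqn (mX X) f"
  unfolding sqn_def by (rule nn_integral_mX_translate) (auto intro: on_base_compose assms)
 have "(\<lambda>u. f (x - u)) \<in> borel_measurable (mX X)" by measurable
 then show "sqi (mX X) (\<lambda>u. f (x - u))" using assms(1) 1 by (simp add: sqi_def)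
qed

text \<open>The countably many translates of an exceptional null set are still null, and some
  multiple of \<open>2 * pi\<close> brings every point back to the cell.\<close>

lemma AE_periodic:
 assumes "AE x in mX X. P x" and per: "on_base X P"
 shows "AE x in lborel. P x"
proof (cases X)
 case Line
 show ?thesis using assms(1) unfolding Line mX_Line .
next
 case Circle
 have "AE x in lborel. x \<in> cell X \<longrightarrow> P x" using assms(1) by (simp add: AE_mX_iff)
 then obtain N where N: "N \<in> null_sets lborel" "{x \<in> space lborel. \<not> (x \<in> cell X \<longrightarrow> P x)} \<subseteq> N"
  by (auto simp: eventually_ae_filter)
 have "N \<in> sets borel" using N(1) by auto
 then have m: "Measurable.pred borel (\<lambda>x. x \<notin> N)" by measurable
 have "AE x in lborel. \<forall>k::int. 2 * pi * of_int k + 1 * x \<notin> N"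
  unfolding AE_all_countable using AE_not_in[OF N(1)] m by (intro allI AE_borel_affine) auto
 then show ?thesis
 proof eventually_elim
  case (elim x)
  define k where "k = - \<lfloor>(x + pi) / (2 * pi)\<rfloor>"
  have "2 * pi * of_int k + x \<in> {-pi..pi}"
  proof -
   have "2 * pi * of_int \<lfloor>(x + pi) / (2 * pi)\<rfloor> <= 2 * pi * ((x + pi) / (2 * pi))"
    by (intro mult_left_mono of_int_floor_le) auto
   then have a: "2 * pi * of_int \<lfloor>(x + pi) / (2 * pi)\<rfloor> <= x + pi" by simp
   have "(x + pi) / (2 * pi) < of_int \<lfloor>(x + pi) / (2 * pi)\<rfloor> + 1" by linarith
   then have "x + pi < 2 * pi * of_int \<lfloor>(x + pi) / (2 * pi)\<rfloor> + 2 * pi" by (simp add: field_simps)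
   then show ?thesis using a by (simp add: k_def)
  qed
  then have "P (2 * pi * of_int k + x)" using elim[rule_format, of k] N(2) Circle by auto
  then show ?case using on_base_of_int[of P x k] per Circle by (simp add: add.commute)
 qed
qed

lemma lebesgue_pt_cong:
 assumes "lebesgue_pt g x" "d > 0" "\<And>y. y \<in> ball x d ==> f y = g y"
 shows "lebesgue_pt f x"
 unfolding lebesgue_pt_def
proof (intro allI impI)
 fix e :: real assume "e > 0"
 from lebesgue_ptE[OF assms(1) this] obtain r where d: "r > 0" "\<And>h. 0 < h ==> h < r ==>
   (\<integral>\<^sup>+y. ennreal (cmod (g y - g x)) * indicator (ball x h) y \<partial>lborel) <= ennreal (e * h)" by blast
 show "\<exists>r>0. \<forall>h. 0 < h \<and> h < r \<longrightarrow>
   (\<integral>\<^sup>+y. ennreal (cmod (f y - f x)) * indicator (ball x h) y \<partial>lborel) <= ennreal (e * h)"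
 proof (intro exI[of _ "min d r"] conjI allI impI)
  fix h assume h: "0 < h \<and> h < min d r"
  have "(\<integral>\<^sup>+y. ennreal (cmod (f y - f x)) * indicator (ball x h) y \<partial>lborel)
    = (\<integral>\<^sup>+y. ennreal (cmod (g y - g x)) * indicator (ball x h) y \<partial>lborel)"
  proof (rule nn_integral_cong)
   fix y
   have "f y = g y" if "y \<in> ball x h" using that h by (intro assms(3)) auto
   moreover have "f x = g x" using assms(2) by (intro assms(3)) auto
   ultimately show "ennreal (cmod (f y - f x)) * indicator (ball x h) y = ennreal (cmod (g y - g x)) * indicator (ball x h) y"
    by (cases "y \<in> ball x h") simp_all
  qed
  then show "(\<integral>\<^sup>+y. ennreal (cmod (f y - f x)) * indicator (ball x h) y \<partial>lborel) <= ennreal (e * h)"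
   using d(2)[of h] h by simp
 qed (use d assms in auto)
qed

lemma lebesgue_pt_periodic:
 assumes "on_base X f" and [measurable]: "f \<in> bm"
 shows "on_base X (lebesgue_pt f)"
proof (cases X)
 case Circle
 then have p: "f (x + 2 * pi) = f x" for x using assms by (simp add: on_base_def)
 have "(\<integral>\<^sup>+y. ennreal (cmod (f y - f (x + 2 * pi))) * indicator (ball (x + 2 * pi) h) y \<partial>lborel)
   = (\<integral>\<^sup>+y. ennreal (cmod (f y - f x)) * indicator (ball x h) y \<partial>lborel)" for x h
 proof -
  have "(\<integral>\<^sup>+y. ennreal (cmod (f y - f (x + 2 * pi))) * indicator (ball (x + 2 * pi) h) y \<partial>lborel)
   = (\<integral>\<^sup>+y. ennreal (cmod (f (2 * pi + 1 * y) - f (x + 2 * pi))) * indicator (ball (x + 2 * pi) h) (2 * pi + 1 * y) \<partial>lborel)"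
   by (subst nn_integral_real_affine[where c = 1 and t = "2 * pi"]) auto
  also have "... = (\<integral>\<^sup>+y. ennreal (cmod (f y - f x)) * indicator (ball x h) y \<partial>lborel)"
   using p by (intro nn_integral_cong) (auto simp: add.commute[of "2 * pi"] indicator_def dist_real_def)
  finally show ?thesis .
 qed
 then show ?thesis by (simp add: on_base_def lebesgue_pt_def)
qed (simp add: on_base_def)

lemma sqi_local_integrable:
 assumes "sqi (mX X) f"
 shows "integrable lborel (\<lambda>x. indicator (cell X \<inter> {-real n..real n}) x * f x)"
proof -
 have [measurable]: "f \<in> bm" using assms by (simp add: sqi_def)
 have "integrable (mX X) (\<lambda>x. indicator {-real n..real n} x * f x)"
 proof (rule sqi_integrable_mult[OF _ assms])
  have "sqn (mX X) (indicator {-real n..real n}) <= emeasure lborel {-real n..real n}"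
   unfolding sqn_def by (subst nn_integral_mX) (auto simp: nn_integral_indicator[symmetric] simp del: nn_integral_indicator intro!: nn_integral_mono split: split_indicator)
  also have "... < \<infinity>" by simp
  finally show "sqi (mX X) (indicator {-real n..real n})" by (simp add: sqi_def)
 qed
 then have "integrable lborel (\<lambda>x. indicator (cell X) x *\<^sub>R (indicator {-real n..real n} x * f x))"
  by (subst (asm) integrable_mX_iff) auto
 then show ?thesis
  by (rule back_subst[where P = "integrable lborel"]) (auto simp: fun_eq_iff indicator_def)
qed

text \<open>Being a Lebesgue point is local, so integrability is only needed on bounded pieces of
  the cell; the end points of the cell are discarded and periodicity covers the rest of the
  line.\<close>

proposition AE_lebesgue_pt_sqi:
 assumes f: "sqi (mX X) f" and per: "on_base X f"
 shows "AE x in lborel. lebesgue_pt f x"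
proof (rule AE_periodic[OF _ lebesgue_pt_periodic[OF per]])
 show "f \<in> bm" using f by (simp add: sqi_def)
 have "AE x in lborel. \<forall>n. lebesgue_pt (\<lambda>x. indicator (cell X \<inter> {-real n..real n}) x * f x) x"
  unfolding AE_all_countable by (intro allI AE_lebesgue_pt sqi_local_integrable f)
 then have "AE x in lborel. x \<in> cell X \<longrightarrow> lebesgue_pt f x"
  using AE_lborel_singleton[of pi] AE_lborel_singleton[of "-pi"]
 proof eventually_elim
  case (elim x)
  show ?case
  proof
   assume x: "x \<in> cell X"
   obtain n where n: "\<bar>x\<bar> < real n" using reals_Archimedean2 by blast
   have "x \<in> interior (cell X \<inter> {-real n..real n})"
    using elim x n by (cases X) (auto simp: interior_Int)
   then obtain d where d: "d > 0" "ball x d \<subseteq> cell X \<inter> {-real n..real n}"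
    unfolding mem_interior by blast
   show "lebesgue_pt f x"
    using d(2) by (intro lebesgue_pt_cong[OF elim(1)[rule_format, of n] d(1)]) (auto simp: indicator_def)
  qed
 qed
 then show "AE x in mX X. lebesgue_pt f x" by (simp add: AE_mX_iff)
qed

subsection \<open>Poisson averages converge at Lebesgue points\<close>

lemma ennreal_tendsto_0I:
 fixes f :: "'a => ennreal"
 assumes "\<And>e::real. e > 0 ==> eventually (\<lambda>x. f x <= ennreal e) F"
 shows "(f \<longlongrightarrow> 0) F"
proof (rule order_tendstoI)
 fix e :: ennreal assume "0 < e"
 obtain d where d: "0 < d" "d < e" using dense[OF \<open>0 < e\<close>] by blast
 then have eq: "ennreal (enn2real d) = d" by (simp add: less_top order.strict_trans2[OF d(2)])
 then have "enn2real d > 0" using d(1) by (metis ennreal_less_zero_iff)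
 from assms[OF this] show "eventually (\<lambda>x. f x < e) F"
  by eventually_elim (use d(2) eq in auto)
qed simp

text \<open>Mean oscillation of \<open>f\<close> at \<open>x\<close> against the majorant kernel;
  the kernel limits at Lebesgue points reduce to its vanishing.\<close>

definition osc :: "base_space => (real => complex) => real => real => ennreal" where
 "osc X f x e = (\<integral>\<^sup>+u. ennreal (cmod (f (x - u) - f x)) * ennreal (pw e u) \<partial>mX X)"

text \<open>Close to zero the Lebesgue point condition is fed into \<open>pw_average_le\<close>.
  Away from zero \<open>pw r\<close> is at most a multiple of \<open>r * pw 1\<close>, and
  square-integrability of \<open>f\<close> turns this into a term of order \<open>r\<close>.\<close>

lemma osc_tendsto_0:
 assumes f: "sqi (mX X) f" and per: "on_base X f" and pt: "lebesgue_pt f x"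
 shows "(osc X f x \<longlongrightarrow> 0) (at_right 0)"
proof (rule ennreal_tendsto_0I)
 fix e :: real assume e: "e > 0"
 have [measurable]: "f \<in> bm" using f by (simp add: sqi_def)
 \<comment> \<open>Chosen so that the near part, at most \<open>2 * n * pi\<close>, is at most
   \<open>e / 2\<close>.\<close>
 define n where "n = e / (4 * pi)"
 have n: "n > 0" using e by (simp add: n_def)
 obtain d where d: "d > 0" "\<And>h. 0 < h ==> h < d ==>
   (\<integral>\<^sup>+y. ennreal (cmod (f y - f x)) * indicator (ball x h) y \<partial>lborel) <= ennreal (n * h)"
  using lebesgue_ptE[OF pt n] by blast
 define \<delta> where "\<delta> = d / 2"
 have \<delta>: "0 < \<delta>" "\<delta> < d" using d by (auto simp: \<delta>_def)
 define a where "a u = ennreal (cmod (f (x - u) - f x)) * indicator (ball 0 \<delta>) u" for u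
 have [measurable]: "a \<in> bm" unfolding a_def by measurable
 have avg: "(\<integral>\<^sup>+u. a u * indicator (ball 0 h) u \<partial>lborel) <= ennreal (n * h)" if h: "h > 0" for h
 proof -
  have "(\<integral>\<^sup>+y. ennreal (cmod (f y - f x)) * indicator (ball x (min h \<delta>)) y \<partial>lborel)
    = (\<integral>\<^sup>+u. ennreal (cmod (f (x + -1 * u) - f x)) * indicator (ball x (min h \<delta>)) (x + -1 * u) \<partial>lborel)"
   by (subst nn_integral_real_affine[where c = "-1" and t = x]) auto
  also have "... = (\<integral>\<^sup>+u. a u * indicator (ball 0 h) u \<partial>lborel)"
   by (intro nn_integral_cong) (auto simp: a_def indicator_def dist_real_def)
  finally have "(\<integral>\<^sup>+u. a u * indicator (ball 0 h) u \<partial>lborel) <= ennreal (n * min h \<delta>)"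
   using d(2)[of "min h \<delta>"] h \<delta> by simp
  also have "... <= ennreal (n * h)" using n by (intro ennreal_leI mult_left_mono) auto
  finally show ?thesis .
 qed
 \<comment> \<open>With this \<open>C\<close>, \<open>1 + u^2\<close> is at most
   \<open>C * u^2\<close> as soon as |u| is at least \<delta>.\<close>
 define C where "C = 1 + 1 / \<delta>\<^sup>2"
 have C: "C \<ge> 0" by (simp add: C_def)
 define B where "B = ennreal C * (sqn (mX X) f + ennreal (1 + cmod (f x)) * ennreal pi)"
 have "B < \<infinity>" using f by (simp add: B_def sqi_def ennreal_mult_less_top)
 then obtain b where b: "B = ennreal b" "b \<ge> 0" by (cases B) auto
 have far: "ennreal (cmod (f (x - u) - f x)) * ennreal (pw r u)
   <= a u * ennreal (pw r u) + ennreal (r * C) * ((esq (f (x - u))) + ennreal (1 + cmod (f x)) * ennreal (pw 1 u))"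
  if eps: "r > 0" for r u
 proof (cases "u \<in> ball 0 \<delta>")
  case True
  then have "a u = ennreal (cmod (f (x - u) - f x))" by (simp add: a_def)
  then show ?thesis by simp
 next
  case False
  then have "\<delta> <= \<bar>u\<bar>" by (simp add: dist_real_def)
  then have u2: "\<delta>\<^sup>2 <= u^2" using \<delta> by (metis abs_le_square_iff abs_of_pos)
  have up: "u\<^sup>2 > 0" using u2 \<delta> by (metis less_le_trans zero_less_power)
  have p1: "pw r u <= r * C * pw 1 u"
  proof -
   have "pw r u <= r / u^2" unfolding pw_def using eps up by (intro divide_left_mono mult_pos_pos add_pos_pos) auto
   also have "... <= r * C * pw 1 u"
   proof -
    have "1 + u^2 <= C * u^2" using u2 \<delta> by (simp add: C_def distrib_right divide_simps)
    then have "r * (1 + u^2) <= r * (C * u^2)" using eps by (intro mult_left_mono) auto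
    moreover obtain q where q: "q = 1 + u^2" by blast
    ultimately have le: "r * q <= r * (C * u^2)" by simp
    have q0: "q > 0" using up unfolding q by linarith
    have "r / u^2 = (r * q) / (q * u^2)" using q0 by simp
    also have "... <= (r * (C * u^2)) / (q * u^2)" using le up q0 by (intro divide_right_mono) auto
    also have "... = r * C * (1 / q)" using up by simp
    also have "1 / q = pw 1 u" by (simp add: pw_def q)
    finally show ?thesis .
   qed
   finally show ?thesis .
  qed
  have p2: "pw r u <= r * C"
  proof -
   have "r * C * pw 1 u <= r * C * 1" using pw_le_inverse[of 1 u] eps C by (intro mult_left_mono) auto
   with p1 show ?thesis by simp
  qed
  have "cmod (f (x - u) - f x) <= (cmod (f (x - u)))^2 + (1 + cmod (f x))"
  proof -
   have "cmod (f (x - u) - f x) <= cmod (f (x - u)) + cmod (f x)" by (rule norm_triangle_ineq4)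
   moreover have "cmod (f (x - u)) <= (cmod (f (x - u)))^2 + 1"
   proof -
    have "0 <= (cmod (f (x - u)) - 1)^2" by simp
    then have "2 * cmod (f (x - u)) <= (cmod (f (x - u)))^2 + 1" by (simp add: power2_diff)
    then show ?thesis using norm_ge_zero[of "f (x - u)"] by linarith
   qed
   ultimately show ?thesis by linarith
  qed
  then have "cmod (f (x - u) - f x) * pw r u <= ((cmod (f (x - u)))^2 + (1 + cmod (f x))) * pw r u"
   using eps by (intro mult_right_mono pw_nonneg) auto
  also have "... <= (cmod (f (x - u)))^2 * (r * C) + (1 + cmod (f x)) * (r * C * pw 1 u)"
   unfolding distrib_right[of "(cmod (f (x - u)))^2" "1 + cmod (f x)" "pw r u"] using p1 p2 by (intro add_mono mult_left_mono) auto
  also have "... = r * C * ((cmod (f (x - u)))^2 + (1 + cmod (f x)) * pw 1 u)" by (simp add: algebra_simps)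
  finally have "ennreal (cmod (f (x - u) - f x) * pw r u) <= ennreal (r * C * ((cmod (f (x - u)))^2 + (1 + cmod (f x)) * pw 1 u))"
   by (rule ennreal_leI)
  also have "... = ennreal (r * C) * ((esq (f (x - u))) + ennreal (1 + cmod (f x)) * ennreal (pw 1 u))"
   using eps C pw_nonneg[of 1 u] by (simp add: ennreal_mult ennreal_plus)
  finally show ?thesis using pw_nonneg[of r u] eps by (simp add: ennreal_mult add_increasing)
 qed
 have main: "osc X f x r <= ennreal (e / 2 + r * b)" if eps: "r > 0" for r
 proof -
  have "osc X f x r <= (\<integral>\<^sup>+u. a u * ennreal (pw r u) + ennreal (r * C) * ((esq (f (x - u))) + ennreal (1 + cmod (f x)) * ennreal (pw 1 u)) \<partial>mX X)"
   unfolding osc_def by (intro nn_integral_mono far eps)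
  also have "... = (\<integral>\<^sup>+u. a u * ennreal (pw r u) \<partial>mX X) + ennreal (r * C) * ((\<integral>\<^sup>+u. (esq (f (x - u))) \<partial>mX X) + ennreal (1 + cmod (f x)) * (\<integral>\<^sup>+u. ennreal (pw 1 u) \<partial>mX X))"
   by (simp add: nn_integral_add nn_integral_cmult del: ennreal_plus)
  also have "... <= ennreal (2 * n * pi) + ennreal (r * C) * (sqn (mX X) f + ennreal (1 + cmod (f x)) * ennreal pi)"
  proof (intro add_mono mult_left_mono)
   have "(\<integral>\<^sup>+u. a u * ennreal (pw r u) \<partial>mX X) <= (\<integral>\<^sup>+u. a u * ennreal (pw r u) \<partial>lborel)"
    by (subst nn_integral_mX) (auto intro!: nn_integral_mono simp: indicator_def)
   also have "... <= ennreal (2 * n * pi)" using n eps by (intro pw_average_le avg) auto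
   finally show "(\<integral>\<^sup>+u. a u * ennreal (pw r u) \<partial>mX X) <= ennreal (2 * n * pi)" .
   show "(\<integral>\<^sup>+u. (esq (f (x - u))) \<partial>mX X) <= sqn (mX X) f"
    using sqi_mX_reflect(2)[OF f per, of x] by (simp add: sqn_def)
   have "(\<integral>\<^sup>+u. ennreal (pw 1 u) \<partial>mX X) <= (\<integral>\<^sup>+u. ennreal (pw 1 u) \<partial>lborel)"
    by (subst nn_integral_mX) (auto intro!: nn_integral_mono simp: indicator_def)
   then show "(\<integral>\<^sup>+u. ennreal (pw 1 u) \<partial>mX X) <= ennreal pi" by (simp add: nn_integral_pw)
  qed auto
  also have "... = ennreal (e / 2) + ennreal r * B"
   using eps C by (simp add: B_def n_def ennreal_mult mult.assoc)
  also have "... = ennreal (e / 2 + r * b)" using eps e b by (simp add: ennreal_mult ennreal_plus)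
  finally show ?thesis .
 qed
 have "\<forall>\<^sub>F r in at_right 0. r < e / (2 * (b + 1))"
  by (rule eventually_at_rightI[of 0 "e / (2 * (b + 1))"]) (use e b in auto)
 moreover have "\<forall>\<^sub>F r::real in at_right 0. r > 0"
  by (rule eventually_at_rightI[of 0 1]) auto
 ultimately show "\<forall>\<^sub>F r in at_right 0. osc X f x r <= ennreal e"
 proof eventually_elim
  case (elim r)
  then have "r * (2 * (b + 1)) < e" using b by (simp add: pos_less_divide_eq)
  then have "e / 2 + r * b <= e" using elim by (simp add: algebra_simps)
  then have "ennreal (e / 2 + r * b) <= ennreal e" by (rule ennreal_leI)
  then show ?case using main[OF elim(2)] by (rule order_trans[rotated])
 qed
qed

text \<open>Kernels enter only through their majorant, so \<open>pk\<close> and the difference of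
  \<open>tk\<close> and \<open>qk\<close> are treated alike.\<close>

lemma dominated_kernel_tendsto_0:
 fixes g :: "real => real => real"
 assumes f: "sqi (mX X) f" and per: "on_base X f" and pt: "lebesgue_pt f x"
  and [measurable]: "\<And>e. g e \<in> bm"
  and bd: "\<And>e u. 0 < e ==> e <= 1 ==> u \<in> cell X ==> \<bar>g e u\<bar> <= C * pw e u" and C: "C \<ge> 0"
 shows "((\<lambda>e. LINT u|mX X. of_real (g e u) * (f (x - u) - f x)) \<longlongrightarrow> 0) (at_right 0)"
proof -
 have [measurable]: "f \<in> bm" using f by (simp add: sqi_def)
 have le: "ennreal (cmod (LINT u|mX X. of_real (g e u) * (f (x - u) - f x))) <= ennreal C * osc X f x e"
  if "0 < e" "e <= 1" for e
 proof -
  have "ennreal (cmod (LINT u|mX X. of_real (g e u) * (f (x - u) - f x)))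
    <= (\<integral>\<^sup>+u. ennreal (cmod (of_real (g e u) * (f (x - u) - f x))) \<partial>mX X)"
   by (cases "integrable (mX X) (\<lambda>u. of_real (g e u) * (f (x - u) - f x))")
     (auto intro: integral_norm_bound_ennreal simp: not_integrable_integral_eq)
  also have "... <= (\<integral>\<^sup>+u. ennreal C * (ennreal (cmod (f (x - u) - f x)) * ennreal (pw e u)) \<partial>mX X)"
  proof (rule nn_integral_mono_AE)
   show "AE u in mX X. ennreal (cmod (of_real (g e u) * (f (x - u) - f x))) <= ennreal C * (ennreal (cmod (f (x - u) - f x)) * ennreal (pw e u))"
    using AE_cell
   proof eventually_elim
    case (elim u)
    have "cmod (of_real (g e u) * (f (x - u) - f x)) <= C * pw e u * cmod (f (x - u) - f x)"
     using bd[OF that elim] by (simp add: norm_mult mult_right_mono)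
    then have "ennreal (cmod (of_real (g e u) * (f (x - u) - f x))) <= ennreal (C * (cmod (f (x - u) - f x) * pw e u))"
     by (intro ennreal_leI) (simp add: mult_ac)
    then show ?case using C pw_nonneg[of e u] that by (simp add: ennreal_mult)
   qed
  qed
  also have "... = ennreal C * osc X f x e" unfolding osc_def by (subst nn_integral_cmult) auto
  finally show ?thesis .
 qed
 have "((\<lambda>e. ennreal (cmod (LINT u|mX X. of_real (g e u) * (f (x - u) - f x)))) \<longlongrightarrow> 0) (at_right 0)"
 proof (rule tendsto_0_le_ennreal)
  show "((\<lambda>e. ennreal C * osc X f x e) \<longlongrightarrow> 0) (at_right 0)"
   by (intro ennreal_cmult_tendsto_0 osc_tendsto_0 assms) auto
  show "\<forall>\<^sub>F e in at_right 0. ennreal (cmod (LINT u|mX X. of_real (g e u) * (f (x - u) - f x))) <= ennreal C * osc X f x e"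
   using le by (intro eventually_at_rightI[of 0 1]) auto
 qed
 then have "((\<lambda>e. cmod (LINT u|mX X. of_real (g e u) * (f (x - u) - f x))) \<longlongrightarrow> 0) (at_right 0)"
  by (simp add: tendsto_ennreal_iff[where x = 0, simplified])
 then show ?thesis by (rule tendsto_norm_zero_cancel)
qed

subsection \<open>Fubini for weighted kernels\<close>

text \<open>The shape of the exchanges of integrals in the Fourier part: a bounded kernel, an
  integrable function of space and an integrable function of frequency.\<close>

lemma
 fixes b :: "'a => 'b => complex"
 assumes ps: "pair_sigma_finite M N" and f: "integrable M f" and g: "integrable N g"
  and b [measurable]: "case_prod b \<in> borel_measurable (M \<Otimes>\<^sub>M N)" and bd: "\<And>x y. cmod (b x y) <= C"
 shows integrable_weighted: "integrable (M \<Otimes>\<^sub>M N) (\<lambda>(x, y). b x y * f x * g y)"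
  and Fubini_weighted: "(LINT x|M. LINT y|N. b x y * f x * g y) = (LINT y|N. LINT x|M. b x y * f x * g y)"
proof -
 interpret pair_sigma_finite M N by fact
 have [measurable]: "f \<in> borel_measurable M" "g \<in> borel_measurable N" using f g by auto
 have m: "(\<lambda>(x, y). b x y * f x * g y) \<in> borel_measurable (M \<Otimes>\<^sub>M N)" by measurable
 have "(\<integral>\<^sup>+p. ennreal (norm (case p of (x, y) => b x y * f x * g y)) \<partial>(M \<Otimes>\<^sub>M N))
   <= (\<integral>\<^sup>+p. ennreal C * (ennreal (cmod (f (fst p))) * ennreal (cmod (g (snd p)))) \<partial>(M \<Otimes>\<^sub>M N))"
 proof (rule nn_integral_mono)
  fix p :: "'a \<times> 'b"
  have C: "C \<ge> 0" using bd norm_ge_zero order_trans by blast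
  have "cmod (b (fst p) (snd p)) * (cmod (f (fst p)) * cmod (g (snd p))) <= C * (cmod (f (fst p)) * cmod (g (snd p)))"
   by (intro mult_right_mono bd mult_nonneg_nonneg) auto
  then have "ennreal (norm (case p of (x, y) => b x y * f x * g y)) <= ennreal (C * (cmod (f (fst p)) * cmod (g (snd p))))"
   by (intro ennreal_leI) (simp add: case_prod_beta norm_mult mult_ac)
  then show "ennreal (norm (case p of (x, y) => b x y * f x * g y)) <= ennreal C * (ennreal (cmod (f (fst p))) * ennreal (cmod (g (snd p))))"
   using C by (simp add: ennreal_mult)
 qed
 also have "... = ennreal C * (\<integral>\<^sup>+x. \<integral>\<^sup>+y. ennreal (cmod (f x)) * ennreal (cmod (g y)) \<partial>N \<partial>M)"
  by (subst nn_integral_cmult) (auto simp: M2.nn_integral_fst[symmetric])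
 also have "... = ennreal C * ((\<integral>\<^sup>+x. ennreal (cmod (f x)) \<partial>M) * (\<integral>\<^sup>+y. ennreal (cmod (g y)) \<partial>N))"
  by (simp add: nn_integral_cmult nn_integral_multc)
 also have "... < \<infinity>"
  using f g by (simp add: integrable_iff_bounded ennreal_mult_less_top)
 finally show int: "integrable (M \<Otimes>\<^sub>M N) (\<lambda>(x, y). b x y * f x * g y)"
  using m by (intro integrableI_bounded) auto
 show "(LINT x|M. LINT y|N. b x y * f x * g y) = (LINT y|N. LINT x|M. b x y * f x * g y)"
  using Fubini_integral[OF int] by simp
qed

lemma cis_kernel_measurable [measurable]:
 "(\<lambda>(x, k). cis (c * k * (x - d))) \<in> borel_measurable (mX X \<Otimes>\<^sub>M nX Y)"
 by measurable

section \<open>Orthogonality on the circle and the mass of the Poisson kernels\<close>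

lemma finite_mX_Circle: "emeasure (mX Circle) UNIV = ennreal (2 * pi)"
proof -
 have "emeasure (mX Circle) UNIV = (\<integral>\<^sup>+x. 1 \<partial>mX Circle)" by simp
 also have "... = ennreal (2 * pi)" by (subst nn_integral_mX) auto
 finally show ?thesis .
qed

lemma integrable_const_Circle: "integrable (mX Circle) (\<lambda>x. c :: complex)"
proof -
 have "finite_measure (mX Circle)" by (rule finite_measureI) (simp add: finite_mX_Circle)
 then show ?thesis by (rule finite_measure.integrable_const)
qed

lemma integral_cis_Circle:
 "(LINT x|mX Circle. cis (of_int n * x)) = (if n = 0 then of_real (2 * pi) else 0)"
proof (cases "n = 0")
 case True
 then show ?thesis by (simp add: measure_def finite_mX_Circle scaleR_conv_of_real)
next
 case False
 have "(LINT x|mX Circle. cis (of_int n * x)) = (LINT x|lborel. indicator {-pi..pi} x *\<^sub>R cis (of_int n * x))"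
  by (subst integral_mX) auto
 also have "... = cis (of_int n * pi) / (\<i> * of_int n) - cis (of_int n * (-pi)) / (\<i> * of_int n)"
 proof (rule integral_FTC_Icc)
  fix x
  have "((\<lambda>z. exp (\<i> * of_int n * z) / (\<i> * of_int n)) has_field_derivative exp (\<i> * of_int n * of_real x)) (at (of_real x))"
   using False by (auto intro!: derivative_eq_intros)
  then show "((\<lambda>x. cis (of_int n * x) / (\<i> * of_int n)) has_vector_derivative cis (of_int n * x)) (at x within {-pi..pi})"
   using has_vector_derivative_real_field[of "\<lambda>z. exp (\<i> * of_int n * z) / (\<i> * of_int n)" _ x "{-pi..pi}"]
   by (simp add: cis_conv_exp mult_ac)
 qed (auto intro!: continuous_intros)
 also have "cis (of_int n * (-pi)) = cis (of_int n * pi)"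
  using cis_period[of "of_int n" Circle] by (simp add: on_base_def) (metis (no_types, opaque_lifting) add.commute add_diff_cancel_right' diff_minus_eq_add mult_2 mult_minus_right uminus_add_conv_diff)
 finally show ?thesis using False by simp
qed

text \<open>On the line this is the arctangent integral; on the circle the kernel is expanded in
  frequencies and only frequency zero survives integration over a period.\<close>

lemma integral_pk:
 assumes e: "0 < e" "e <= 1"
 shows "integrable (mX X) (\<lambda>u. complex_of_real (pk X e u))" "(LINT u|mX X. complex_of_real (pk X e u)) = of_real (2 * pi)"
proof -
 have "integrable (mX X) (\<lambda>u. complex_of_real (pk X e u)) \<and> (LINT u|mX X. complex_of_real (pk X e u)) = of_real (2 * pi)"
 proof (cases X)
  case Line
  have h: "has_bochner_integral lborel (pw e) pi"
   using e nn_integral_pw[of e] by (intro has_bochner_integral_nn_integral) (auto simp: pw_nonneg)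
  have "has_bochner_integral lborel (\<lambda>u. complex_of_real (2 * pw e u)) (of_real (2 * pi))"
   by (intro has_bochner_integral_of_real has_bochner_integral_mult_right h)
  moreover have "pk Line e = (\<lambda>u. 2 * pw e u)" by (auto simp: fun_eq_iff pw_def)
  ultimately show ?thesis by (simp add: Line has_bochner_integral_iff)
 next
  case Circle
  interpret pair_sigma_finite "mX Circle" "nX Circle" by (rule pair_sigma_finite_mn)
  have w: "integrable (nX Circle) (wt e)" using integrable_wt_cis[OF e(1), of Circle 0] by simp
  have eq: "complex_of_real (pk Circle e u) = (LINT z|nX Circle. cis (1 * z * (u - 0)) * 1 * wt e z)" for u
   using integral_wt_cis[OF e(1), of Circle u] by (simp add: mult_ac)
  have int: "integrable (mX Circle \<Otimes>\<^sub>M nX Circle) (\<lambda>(x, y). cis (1 * y * (x - 0)) * 1 * wt e y)"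
   by (rule integrable_weighted[OF pair_sigma_finite_mn integrable_const_Circle w cis_kernel_measurable, where C = 1]) simp
  have "(LINT u|mX Circle. complex_of_real (pk Circle e u)) = (LINT z|nX Circle. LINT u|mX Circle. cis (1 * z * (u - 0)) * 1 * wt e z)"
   unfolding eq by (rule Fubini_weighted[OF pair_sigma_finite_mn integrable_const_Circle w cis_kernel_measurable, where C = 1]) simp
  also have "... = (LINT z|nX Circle. indicator {0} z * of_real (2 * pi))"
  proof (rule integral_cong_AE)
   show "AE z in nX Circle. (LINT u|mX Circle. cis (1 * z * (u - 0)) * 1 * wt e z) = indicator {0} z * of_real (2 * pi)"
    using AE_nX_frequencies
   proof eventually_elim
    case (elim z)
    then obtain k where "z = of_int k" by (auto elim: Ints_cases)
    then show ?case using integral_cis_Circle[of k] by (auto simp: wt_def)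
   qed
  qed (auto intro!: M1.borel_measurable_lebesgue_integral)
  also have "... = of_real (2 * pi)" using nX_zero[of Circle] by (simp add: nu0_def)
  finally have 1: "(LINT u|mX Circle. complex_of_real (pk Circle e u)) = of_real (2 * pi)" .
  have "integrable (mX Circle) (\<lambda>u. complex_of_real (pk Circle e u))"
   unfolding eq using integrable_fst'[OF int] by simp
  with 1 show ?thesis by (simp add: Circle)
 qed
 then show "integrable (mX X) (\<lambda>u. complex_of_real (pk X e u))" "(LINT u|mX X. complex_of_real (pk X e u)) = of_real (2 * pi)" by auto
qed

lemma poisson_tendsto:
 fixes f :: "real => complex"
 assumes f: "sqi (mX X) f" and per: "on_base X f" and pt: "lebesgue_pt f x"
 shows "((\<lambda>d. LINT u|mX X. of_real (pk X d u) * f (x - u)) \<longlongrightarrow> 2 * pi * f x) (at_right 0)"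
proof -
 have "((\<lambda>d. (LINT u|mX X. of_real (pk X d u) * (f (x - u) - f x)) + 2 * pi * f x) \<longlongrightarrow> 0 + 2 * pi * f x) (at_right 0)"
  by (intro tendsto_add tendsto_const dominated_kernel_tendsto_0[OF f per pt, where C = 48])
    (use pk_le_pw pk_nonneg in auto)
 moreover have "\<forall>\<^sub>F d in at_right 0. (LINT u|mX X. of_real (pk X d u) * (f (x - u) - f x)) + 2 * pi * f x
   = (LINT u|mX X. of_real (pk X d u) * f (x - u))"
 proof (rule eventually_at_rightI[of 0 1])
  fix d :: real assume e: "d \<in> {0<..<1}"
  have "(LINT u|mX X. of_real (pk X d u) * (f (x - u) - f x))
    = (LINT u|mX X. of_real (pk X d u) * f (x - u) - of_real (pk X d u) * f x)"
   by (simp add: right_diff_distrib)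
  also have "... = (LINT u|mX X. of_real (pk X d u) * f (x - u)) - 2 * pi * f x"
   using e integral_pk[of d X]
   by (subst Bochner_Integration.integral_diff) (auto intro!: sqi_integrable_mult sqi_pk sqi_mX_reflect f per)
  finally show "(LINT u|mX X. of_real (pk X d u) * (f (x - u) - f x)) + 2 * pi * f x
   = (LINT u|mX X. of_real (pk X d u) * f (x - u))" by simp
 qed simp
 ultimately show ?thesis by (simp add: tendsto_cong)
qed

lemma integral_odd:
 fixes g :: "real => complex"
 assumes [measurable]: "g \<in> bm" and "\<And>u. g (- u) = - g u"
 shows "(LINT u|mX X. g u) = 0"
proof -
 have sym: "indicator (cell X) (- u) = (indicator (cell X) u :: real)" for u by (cases X) (auto simp: indicator_def)
 have "(LINT u|mX X. g u) = (LINT u|lborel. indicator (cell X) u *\<^sub>R g u)" by (simp add: integral_mX)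
 also have "... = (LINT u|lborel. indicator (cell X) (0 + -1 * u) *\<^sub>R g (0 + -1 * u))"
  by (subst lborel_integral_real_affine[where c = "-1" and t = 0]) auto
 also have "... = (LINT u|lborel. - (indicator (cell X) u *\<^sub>R g u))"
  by (simp add: sym assms)
 also have "... = - (LINT u|mX X. g u)" by (simp add: integral_mX)
 finally show ?thesis by simp
qed

lemma tk_odd: "tk X e (- u) = - tk X e u"
 by (cases X) (auto simp: tk_def indicator_def cot_def)

lemma qk_odd: "qk X e (- u) = - qk X e u"
 by (cases X) auto

text \<open>The difference of the two kernels is odd, so the constant \<open>f x\<close> may be
  subtracted from \<open>f (x - u)\<close> at no cost; what is left is dominated by
  \<open>pw\<close>.\<close>

lemma truncated_minus_qk_tendsto_0:
 assumes f: "sqi (mX X) f" and per: "on_base X f" and pt: "lebesgue_pt f x"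
 shows "((\<lambda>d. (LINT u|mX X. of_real (tk X d u) * f (x - u)) - (LINT u|mX X. of_real (qk X d u) * f (x - u))) \<longlongrightarrow> 0) (at_right 0)"
proof -
 define g where "g d u = tk X d u - qk X d u" for d u
 have [measurable]: "g d \<in> bm" for d unfolding g_def by measurable
 have bd: "\<bar>g d u\<bar> <= 400 * pw d u" if "0 < d" "d <= 1" "u \<in> cell X" for d u
  unfolding g_def by (rule tk_minus_qk_le[OF that])
 have "((\<lambda>d. (LINT u|mX X. of_real (g d u) * (f (x - u) - f x))) \<longlongrightarrow> 0) (at_right 0)"
  using bd by (intro dominated_kernel_tendsto_0[OF f per pt, where C = 400]) auto
 moreover have "\<forall>\<^sub>F d in at_right 0. (LINT u|mX X. of_real (g d u) * (f (x - u) - f x))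
   = (LINT u|mX X. of_real (tk X d u) * f (x - u)) - (LINT u|mX X. of_real (qk X d u) * f (x - u))"
 proof (rule eventually_at_rightI[of 0 1])
  fix d :: real assume e: "d \<in> {0<..<1}"
  have fr: "sqi (mX X) (\<lambda>u. f (x - u))" by (rule sqi_mX_reflect[OF f per])
  have i1: "integrable (mX X) (\<lambda>u. of_real (g d u) * f (x - u))"
   unfolding g_def using e by (intro sqi_integrable_mult fr sqi_tk_minus_qk) auto
  have i2: "integrable (mX X) (\<lambda>u. of_real (g d u) * f x)"
  proof (rule Bochner_Integration.integrable_bound)
   have "has_bochner_integral lborel (pw d) pi"
    using e nn_integral_pw[of d] by (intro has_bochner_integral_nn_integral) (auto simp: pw_nonneg)
   then have "integrable lborel (\<lambda>u. indicator (cell X) u *\<^sub>R complex_of_real (400 * pw d u))"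
    by (intro integrable_mult_indicator integrable_of_real integrable_mult_right) (auto simp: has_bochner_integral_iff)
   then show "integrable (mX X) (\<lambda>u. complex_of_real (400 * pw d u) * f x)"
    by (intro integrable_mult_left) (simp add: integrable_mX_iff)
   show "AE u in mX X. cmod (of_real (g d u) * f x) <= cmod (complex_of_real (400 * pw d u) * f x)"
    using AE_cell by eventually_elim (use e bd[of d] in \<open>auto simp: norm_mult pw_nonneg abs_mult intro!: mult_right_mono\<close>)
  qed simp
  have z: "(LINT u|mX X. of_real (g d u) * f x) = 0"
   by (rule integral_odd) (auto simp: g_def tk_odd qk_odd algebra_simps)
  have "(LINT u|mX X. of_real (g d u) * (f (x - u) - f x))
   = (LINT u|mX X. of_real (g d u) * f (x - u)) - (LINT u|mX X. of_real (g d u) * f x)"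
   unfolding right_diff_distrib by (rule Bochner_Integration.integral_diff[OF i1 i2])
  also have "... = (LINT u|mX X. of_real (tk X d u) * f (x - u) - of_real (qk X d u) * f (x - u))"
   unfolding z diff_zero by (simp add: g_def left_diff_distrib)
  also have "... = (LINT u|mX X. of_real (tk X d u) * f (x - u)) - (LINT u|mX X. of_real (qk X d u) * f (x - u))"
   using e by (intro Bochner_Integration.integral_diff sqi_integrable_mult fr sqi_tk sqi_qk) auto
  finally show "(LINT u|mX X. of_real (g d u) * (f (x - u) - f x))
   = (LINT u|mX X. of_real (tk X d u) * f (x - u)) - (LINT u|mX X. of_real (qk X d u) * f (x - u))" .
 qed simp
 ultimately show ?thesis by (simp add: tendsto_cong)
qed

section \<open>The Fourier transform on \<open>L\<^sup>2\<close>\<close>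

definition ft0 :: "base_space => (real => complex) => real => complex" where
 "ft0 X f k = (LINT x|mX X. cis (- (x * k)) * f x)"

text \<open>Without the factor \<open>1 / (2 * pi)\<close>; inversion therefore returns
  \<open>2 * pi * f\<close>.\<close>

definition ift :: "base_space => (real => complex) => real => complex" where
 "ift X F x = (LINT k|nX X. cis (x * k) * F k)"

text \<open>The truncation used in \<open>is_fourier_transform\<close>. On the cell of the circle it
  has no effect once \<open>R\<close> is at least \<open>pi\<close>.\<close>

definition cut :: "real => (real => complex) => real => complex" where
 "cut R f x = indicator {-R..R} x * f x"

lemma cut_measurable [measurable (raw)]: "f \<in> bm ==> cut R f \<in> bm"
 unfolding cut_def[abs_def] by measurable

lemma norm_cut_le: "cmod (cut R f x) <= cmod (f x)"
 by (simp add: cut_def indicator_def)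

lemma sqi_cut: "sqi (mX X) f ==> sqi (mX X) (cut R f)"
 unfolding cut_def[abs_def] by (rule sqi_bounded_mult[where C = 1]) (auto simp: indicator_def)

lemma sqn_cut_le: "sqn M (cut R f) <= sqn M f"
 by (intro sqn_mono_AE AE_I2 norm_cut_le)

lemma integrable_cut:
 assumes f: "sqi (mX X) f"
 shows "integrable (mX X) (cut R f)"
proof -
 have "sqi (mX X) (indicator {-R..R})"
 proof -
  have "sqn (mX X) (indicator {-R..R}) <= (\<integral>\<^sup>+x. indicator {-R..R} x \<partial>lborel)"
   unfolding sqn_def by (subst nn_integral_mX, simp, rule nn_integral_mono) (auto simp: indicator_def)
  also have "... < \<infinity>" using emeasure_bounded_finite[of "{-R..R}"] by simp
  finally show ?thesis by (simp add: sqi_def)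
 qed
 then show ?thesis unfolding cut_def[abs_def] using f by (rule sqi_integrable_mult)
qed

lemma cis_measurable1 [measurable]: "(\<lambda>(x, k). cis (x * k)) \<in> borel_measurable (mX X \<Otimes>\<^sub>M nX X)"
 by measurable

lemma cis_measurable2 [measurable]: "(\<lambda>(x, k). cis (- (x * k))) \<in> borel_measurable (mX X \<Otimes>\<^sub>M nX X)"
 by measurable

lemma ft0_measurable [measurable]:
 assumes [measurable]: "f \<in> bm"
 shows "ft0 X f \<in> bm"
proof -
 interpret sigma_finite_measure "mX X" by (rule sigma_finite_mX)
 have "(\<lambda>k. LINT x|mX X. cis (- (x * k)) * f x) \<in> bm"
  by (rule borel_measurable_lebesgue_integral) measurable
 then show ?thesis by (simp add: ft0_def[abs_def])
qed

lemma ift_measurable [measurable]: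
 assumes [measurable]: "F \<in> bm"
 shows "ift X F \<in> bm"
proof -
 interpret sigma_finite_measure "nX X" by (rule sigma_finite_nX)
 have "(\<lambda>x. LINT k|nX X. cis (x * k) * F k) \<in> bm"
  by (rule borel_measurable_lebesgue_integral) measurable
 then show ?thesis by (simp add: ift_def[abs_def])
qed

lemma integrable_cis_mult:
 assumes "integrable M f" "g \<in> borel_measurable M"
 shows "integrable M (\<lambda>x. cis (g x) * f x)"
 by (rule integrable_le[OF assms(1)]) (use assms in \<open>auto simp: norm_mult\<close>)

lemma norm_ft0_le: "integrable (mX X) f ==> cmod (ft0 X f k) <= (LINT x|mX X. cmod (f x))"
 unfolding ft0_def by (rule order_trans[OF integral_norm_bound]) (simp add: norm_mult)

lemma norm_ift_le: "integrable (nX X) F ==> cmod (ift X F x) <= (LINT k|nX X. cmod (F k))"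
 unfolding ift_def by (rule order_trans[OF integral_norm_bound]) (simp add: norm_mult)

lemma ft0_diff: "integrable (mX X) f ==> integrable (mX X) g ==> ft0 X (\<lambda>x. f x - g x) k = ft0 X f k - ft0 X g k"
 unfolding ft0_def right_diff_distrib
 by (intro Bochner_Integration.integral_diff integrable_cis_mult) measurable

lemma ft0_add: "integrable (mX X) f ==> integrable (mX X) g ==> ft0 X (\<lambda>x. f x + g x) k = ft0 X f k + ft0 X g k"
 unfolding ft0_def distrib_left
 by (intro Bochner_Integration.integral_add integrable_cis_mult) measurable

lemma ft0_cmult: "ft0 X (\<lambda>x. c * f x) k = c * ft0 X f k"
 unfolding ft0_def mult.left_commute[of _ c] by (rule integral_mult_right_zero)

lemma ift_diff: "integrable (nX X) f ==> integrable (nX X) g ==> ift X (\<lambda>x. f x - g x) k = ift X f k - ift X g k"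
 unfolding ift_def right_diff_distrib
 by (intro Bochner_Integration.integral_diff integrable_cis_mult) measurable

lemma ift_cmult: "ift X (\<lambda>x. c * f x) k = c * ift X f k"
 unfolding ift_def mult.left_commute[of _ c] by (rule integral_mult_right_zero)

lemma integrable_wt_mult: "sqi (nX X) F ==> e > 0 ==> integrable (nX X) (\<lambda>k. wt e k * F k)"
proof (rule sqi_integrable_mult)
 assume e: "e > 0"
 have "(\<integral>\<^sup>+k. ennreal (cmod (wt e k)) \<partial>nX X) < \<infinity>"
  using integrable_wt_cis[OF e, of X 0] by (simp add: integrable_iff_bounded)
 moreover have "sqn (nX X) (wt e) <= (\<integral>\<^sup>+k. ennreal (cmod (wt e k)) \<partial>nX X)"
  unfolding sqn_def using norm_wt_le[of e] e
  by (intro nn_integral_mono ennreal_leI) (simp add: power2_eq_square mult_left_le)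
 ultimately show "sqi (nX X) (wt e)" by (simp add: sqi_def)
qed

lemma integrable_wt: "e > 0 ==> integrable (nX X) (wt e)"
 using integrable_wt_cis[of e X 0] by simp

lemma sqi_wt_mult: "sqi (nX X) F ==> e \<ge> 0 ==> sqi (nX X) (\<lambda>k. wt e k * F k)"
 by (rule sqi_bounded_mult[where C = 1]) (auto simp: norm_wt_le)

lemma pk_even: "pk X e (- u) = pk X e u"
 by (cases X) auto

lemma pk_periodic: "on_base X (pk X e)"
 by (cases X) (auto simp: on_base_def)

lemma qk_periodic: "on_base X (qk X e)"
 by (cases X) (auto simp: on_base_def)

lemma nn_integral_pk:
 assumes e: "0 < e" "e <= 1"
 shows "(\<integral>\<^sup>+y. ennreal (pk X e (x - y)) \<partial>mX X) = ennreal (2 * pi)"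
proof -
 have "(\<integral>\<^sup>+y. ennreal (pk X e (x - y)) \<partial>mX X) = (\<integral>\<^sup>+y. ennreal (pk X e y) \<partial>mX X)"
  by (rule nn_integral_mX_translate) (auto intro: on_base_compose[OF pk_periodic, where g = ennreal])
 also have "... = (\<integral>\<^sup>+y. ennreal (cmod (complex_of_real (pk X e y))) \<partial>mX X)"
  using e by (simp add: pk_nonneg)
 also have "... = ennreal (LINT y|mX X. cmod (complex_of_real (pk X e y)))"
  by (intro nn_integral_eq_integral integrable_norm integral_pk e) auto
 also have "(LINT y|mX X. cmod (complex_of_real (pk X e y))) = 2 * pi"
 proof -
  have "complex_of_real (LINT y|mX X. cmod (complex_of_real (pk X e y))) = (LINT y|mX X. complex_of_real (pk X e y))"
   using e by (simp add: pk_nonneg)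
  then show ?thesis using integral_pk(2)[OF e, of X] by (metis of_real_eq_iff)
 qed
 finally show ?thesis .
qed

subsection \<open>Bessel inequalities\<close>

text \<open>The weight makes the squared transform absolutely integrable, so it may be expanded and
  the frequency integral carried out first; it yields the Poisson kernel. Schur's argument, the
  arithmetic-geometric mean followed by the mass \<open>2 * pi\<close> of the kernel, bounds the
  resulting quadratic form.\<close>

lemma Bessel_weighted:
 assumes f: "integrable (mX X) f" and f2: "sqi (mX X) f" and e: "0 < e" "e <= 1"
 shows "(\<integral>\<^sup>+k. ennreal (exp (- e * \<bar>k\<bar>) * (cmod (ft0 X f k))^2) \<partial>nX X) <= ennreal (2 * pi) * sqn (mX X) f"
proof -
 have [measurable]: "f \<in> bm" using f2 by (simp add: sqi_def)
 note ps = pair_sigma_finite_mn[of X]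
 define c where "c = (LINT x|mX X. cmod (f x))"
 have bd: "cmod (ft0 X f k) <= c" for k unfolding c_def by (rule norm_ft0_le[OF f])
 have w1: "integrable (nX X) (\<lambda>k. wt e k * cnj (ft0 X f k))"
  by (rule integrable_le[OF integrable_mult_left[OF integrable_wt[OF e(1)], of X "of_real c"]])
    (auto simp: norm_mult intro!: mult_left_mono AE_I2 order_trans[OF bd abs_ge_self])
 have cf: "integrable (mX X) (\<lambda>y. cnj (f y))" using f by simp
 have inner: "(LINT k|nX X. cis (- (x * k)) * f x * (wt e k * cnj (ft0 X f k)))
   = f x * (LINT y|mX X. of_real (pk X e (y - x)) * cnj (f y))" for x
 proof -
  have cc: "cnj (ft0 X f k) = (LINT y|mX X. cis (y * k) * cnj (f y))" for k
   unfolding ft0_def by (subst Bochner_Integration.integral_cnj[symmetric]) (simp add: cis_cnj)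
  have w2: "integrable (nX X) (\<lambda>k. cis (- (x * k)) * wt e k)" by (intro integrable_cis_mult integrable_wt e) auto
  have "(LINT k|nX X. cis (- (x * k)) * f x * (wt e k * cnj (ft0 X f k)))
    = f x * (LINT k|nX X. LINT y|mX X. cis (y * k) * cnj (f y) * (cis (- (x * k)) * wt e k))"
  proof -
   have "cis (- (x * k)) * f x * (wt e k * cnj (ft0 X f k)) = f x * (LINT y|mX X. cis (y * k) * cnj (f y) * (cis (- (x * k)) * wt e k))" for k
    unfolding cc integral_mult_left_zero by (simp add: mult_ac)
   then show ?thesis by (simp only: integral_mult_right_zero)
  qed
  also have "(LINT k|nX X. LINT y|mX X. cis (y * k) * cnj (f y) * (cis (- (x * k)) * wt e k))
    = (LINT y|mX X. LINT k|nX X. cis (y * k) * cnj (f y) * (cis (- (x * k)) * wt e k))"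
   by (rule Fubini_weighted[OF ps cf w2 cis_measurable1, where C = 1, symmetric]) simp
  also have "... = (LINT y|mX X. of_real (pk X e (y - x)) * cnj (f y))"
  proof (rule LINT_cong[OF refl])
   fix y
   have "cis (y * k) * cnj (f y) * (cis (- (x * k)) * wt e k) = (wt e k * cis ((y - x) * k)) * cnj (f y)" for k
   proof -
    have "cis (y * k) * cis (- (x * k)) = cis ((y - x) * k)" by (simp add: cis_mult left_diff_distrib)
    then show ?thesis by (metis (no_types, lifting) mult.assoc mult.commute)
   qed
   then show "(LINT k|nX X. cis (y * k) * cnj (f y) * (cis (- (x * k)) * wt e k)) = of_real (pk X e (y - x)) * cnj (f y)"
    by (simp only: integral_mult_left_zero integral_wt_cis[OF e(1)])
  qed
  finally show ?thesis .
 qed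
 have "(\<integral>\<^sup>+k. ennreal (exp (- e * \<bar>k\<bar>) * (cmod (ft0 X f k))^2) \<partial>nX X)
   = ennreal (LINT k|nX X. exp (- e * \<bar>k\<bar>) * (cmod (ft0 X f k))^2)"
 proof (rule nn_integral_eq_integral)
  have "integrable (nX X) (\<lambda>k. cmod ((wt e k * cnj (ft0 X f k)) * ft0 X f k))"
  proof (rule integrable_norm, rule integrable_le[OF integrable_mult_left[OF w1, of "of_real c"]])
   show "AE k in nX X. cmod (wt e k * cnj (ft0 X f k) * ft0 X f k) <= cmod (wt e k * cnj (ft0 X f k) * complex_of_real c)"
    by (auto simp: norm_mult intro!: mult_left_mono AE_I2 order_trans[OF bd abs_ge_self])
  qed simp
  then show "integrable (nX X) (\<lambda>k. exp (- e * \<bar>k\<bar>) * (cmod (ft0 X f k))^2)"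
   by (simp add: norm_mult norm_wt power2_eq_square mult.assoc)
 qed simp
 also have "(LINT k|nX X. exp (- e * \<bar>k\<bar>) * (cmod (ft0 X f k))^2) <= cmod (LINT k|nX X. wt e k * cnj (ft0 X f k) * ft0 X f k)"
 proof -
  have "wt e k * cnj (ft0 X f k) * ft0 X f k = complex_of_real (exp (- e * \<bar>k\<bar>) * (cmod (ft0 X f k))^2)" for k
   using complex_norm_square[of "ft0 X f k"] by (simp add: wt_def mult_ac)
  then have "(LINT k|nX X. wt e k * cnj (ft0 X f k) * ft0 X f k)
   = complex_of_real (LINT k|nX X. exp (- e * \<bar>k\<bar>) * (cmod (ft0 X f k))^2)"
   by (simp only: integral_complex_of_real)
  then show ?thesis by (simp only: norm_of_real abs_ge_self)
 qed
 also have "(LINT k|nX X. wt e k * cnj (ft0 X f k) * ft0 X f k)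
   = (LINT k|nX X. LINT x|mX X. cis (- (x * k)) * f x * (wt e k * cnj (ft0 X f k)))"
 proof -
  have "wt e k * cnj (ft0 X f k) * ft0 X f k = (LINT x|mX X. cis (- (x * k)) * f x * (wt e k * cnj (ft0 X f k)))" for k
   unfolding integral_mult_left_zero ft0_def[symmetric] by (rule mult.commute)
  then show ?thesis by (intro Bochner_Integration.integral_cong refl)
 qed
 also have "... = (LINT x|mX X. LINT k|nX X. cis (- (x * k)) * f x * (wt e k * cnj (ft0 X f k)))"
  by (rule Fubini_weighted[OF ps f w1 cis_measurable2, where C = 1, symmetric]) simp
 also have "... = (LINT x|mX X. f x * (LINT y|mX X. of_real (pk X e (y - x)) * cnj (f y)))"
  unfolding inner ..
 also have "ennreal (cmod ...) <= (\<integral>\<^sup>+x. ennreal (cmod (f x * (LINT y|mX X. of_real (pk X e (y - x)) * cnj (f y)))) \<partial>mX X)"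
  by (cases "integrable (mX X) (\<lambda>x. f x * (LINT y|mX X. of_real (pk X e (y - x)) * cnj (f y)))")
    (auto intro: integral_norm_bound_ennreal simp: not_integrable_integral_eq)
 also have "... <= (\<integral>\<^sup>+x. \<integral>\<^sup>+y. ennreal (cmod (f x)) * ennreal (pk X e (x - y) * cmod (f y)) \<partial>mX X \<partial>mX X)"
 proof (rule nn_integral_mono)
  fix x
  have pe: "pk X e (y - x) = pk X e (x - y)" for y using pk_even[of X e "y - x"] by simp
  have "ennreal (cmod (LINT y|mX X. of_real (pk X e (y - x)) * cnj (f y))) <= (\<integral>\<^sup>+y. ennreal (cmod (of_real (pk X e (y - x)) * cnj (f y))) \<partial>mX X)"
   by (cases "integrable (mX X) (\<lambda>y. of_real (pk X e (y - x)) * cnj (f y))")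
     (auto intro: integral_norm_bound_ennreal simp: not_integrable_integral_eq)
  also have "... = (\<integral>\<^sup>+y. ennreal (pk X e (x - y) * cmod (f y)) \<partial>mX X)"
   using e by (simp add: norm_mult pk_nonneg pe)
  finally have "ennreal (cmod (f x)) * ennreal (cmod (LINT y|mX X. of_real (pk X e (y - x)) * cnj (f y))) <= ennreal (cmod (f x)) * (\<integral>\<^sup>+y. ennreal (pk X e (x - y) * cmod (f y)) \<partial>mX X)"
   by (intro mult_left_mono) auto
  then show "ennreal (cmod (f x * (LINT y|mX X. of_real (pk X e (y - x)) * cnj (f y)))) <= (\<integral>\<^sup>+y. ennreal (cmod (f x)) * ennreal (pk X e (x - y) * cmod (f y)) \<partial>mX X)"
   by (subst nn_integral_cmult) (auto simp: norm_mult ennreal_mult)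
 qed
 \<comment> \<open>The two halves are mirror images of each other, so that exchanging the integrals
   shows them to be equal.\<close>
 also have "... <= (\<integral>\<^sup>+x. \<integral>\<^sup>+y. ennreal (1/2) * ((esq (f x)) * ennreal (pk X e (x - y))) + ennreal (1/2) * ((esq (f y)) * ennreal (pk X e (y - x))) \<partial>mX X \<partial>mX X)"
 proof (intro nn_integral_mono)
  fix x y
  have pe: "pk X e (y - x) = pk X e (x - y)" using pk_even[of X e "y - x"] by simp
  have "2 * cmod (f x) * cmod (f y) <= (cmod (f x))^2 + (cmod (f y))^2" by (rule sum_squares_bound)
  then have "cmod (f x) * cmod (f y) * pk X e (x - y) <= ((cmod (f x))^2 + (cmod (f y))^2) / 2 * pk X e (x - y)"
   using e by (intro mult_right_mono pk_nonneg) auto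
  then have le: "cmod (f x) * (pk X e (x - y) * cmod (f y)) <= 1/2 * ((cmod (f x))^2 * pk X e (x - y)) + 1/2 * ((cmod (f y))^2 * pk X e (x - y))"
   by (simp add: algebra_simps add_divide_distrib)
  have e2: "ennreal h * (ennreal A * ennreal P) + ennreal h * (ennreal B * ennreal P) = ennreal (h * (A * P) + h * (B * P))"
   if "h \<ge> 0" "A \<ge> 0" "B \<ge> 0" "P \<ge> 0" for h A B P :: real
   using that by (simp add: ennreal_mult[symmetric] ennreal_plus[symmetric] del: ennreal_plus)
  have "ennreal (cmod (f x)) * ennreal (pk X e (x - y) * cmod (f y)) = ennreal (cmod (f x) * (pk X e (x - y) * cmod (f y)))"
   by (rule ennreal_mult'[symmetric]) simp
  also have "... <= ennreal (1/2 * ((cmod (f x))^2 * pk X e (x - y)) + 1/2 * ((cmod (f y))^2 * pk X e (x - y)))"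
   using le by (rule ennreal_leI)
  also have "... = ennreal (1/2) * ((esq (f x)) * ennreal (pk X e (x - y))) + ennreal (1/2) * ((esq (f y)) * ennreal (pk X e (y - x)))"
   unfolding pe by (rule e2[symmetric]) (use pk_nonneg[OF e(1)] in auto)
  finally show "ennreal (cmod (f x)) * ennreal (pk X e (x - y) * cmod (f y)) <= ennreal (1/2) * ((esq (f x)) * ennreal (pk X e (x - y))) + ennreal (1/2) * ((esq (f y)) * ennreal (pk X e (y - x)))" .
 qed
 also have "... = (\<integral>\<^sup>+x. \<integral>\<^sup>+y. ennreal (1/2) * ((esq (f x)) * ennreal (pk X e (x - y))) \<partial>mX X \<partial>mX X)
   + (\<integral>\<^sup>+x. \<integral>\<^sup>+y. ennreal (1/2) * ((esq (f y)) * ennreal (pk X e (y - x))) \<partial>mX X \<partial>mX X)"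
 proof -
  interpret mm: pair_sigma_finite "mX X" "mX X" by (rule pair_sigma_finite_mm)
  define A where "A x y = ennreal (1/2) * ((esq (f x)) * ennreal (pk X e (x - y)))" for x y
  define B where "B x y = ennreal (1/2) * ((esq (f y)) * ennreal (pk X e (y - x)))" for x y
  have [measurable]: "case_prod A \<in> borel_measurable (mX X \<Otimes>\<^sub>M mX X)" "case_prod B \<in> borel_measurable (mX X \<Otimes>\<^sub>M mX X)"
   unfolding A_def B_def by measurable
  have "(\<integral>\<^sup>+x. \<integral>\<^sup>+y. A x y + B x y \<partial>mX X \<partial>mX X) = (\<integral>\<^sup>+x. (\<integral>\<^sup>+y. A x y \<partial>mX X) + (\<integral>\<^sup>+y. B x y \<partial>mX X) \<partial>mX X)"
   by (intro nn_integral_cong nn_integral_add) measurable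
  also have "... = (\<integral>\<^sup>+x. \<integral>\<^sup>+y. A x y \<partial>mX X \<partial>mX X) + (\<integral>\<^sup>+x. \<integral>\<^sup>+y. B x y \<partial>mX X \<partial>mX X)"
   by (intro nn_integral_add sigma_finite_measure.borel_measurable_nn_integral[OF sigma_finite_mX]) measurable
  finally show ?thesis unfolding A_def B_def .
 qed
 also have "(\<integral>\<^sup>+x. \<integral>\<^sup>+y. ennreal (1/2) * ((esq (f y)) * ennreal (pk X e (y - x))) \<partial>mX X \<partial>mX X)
   = (\<integral>\<^sup>+x. \<integral>\<^sup>+y. ennreal (1/2) * ((esq (f x)) * ennreal (pk X e (x - y))) \<partial>mX X \<partial>mX X)"
 proof -
  interpret mm: pair_sigma_finite "mX X" "mX X" by (rule pair_sigma_finite_mm)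
  show ?thesis by (rule mm.Fubini') measurable
 qed
 also have "(\<integral>\<^sup>+x. \<integral>\<^sup>+y. ennreal (1/2) * ((esq (f x)) * ennreal (pk X e (x - y))) \<partial>mX X \<partial>mX X)
   = ennreal (1/2) * (sqn (mX X) f * ennreal (2 * pi))"
  by (simp add: nn_integral_cmult nn_integral_multc nn_integral_pk[OF e] sqn_def)
 also have "ennreal (1/2) * (sqn (mX X) f * ennreal (2 * pi)) + ennreal (1/2) * (sqn (mX X) f * ennreal (2 * pi)) = ennreal (2 * pi) * sqn (mX X) f"
 proof -
  have "ennreal (1/2) + ennreal (1/2) = ennreal (1/2 + 1/2)" by (rule ennreal_plus[symmetric]) auto
  then have "ennreal (1/2) + ennreal (1/2) = 1" by (simp only:) simp
  then have "ennreal (1/2) * t + ennreal (1/2) * t = t" for t by (metis distrib_right mult_1)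
  from this[of "sqn (mX X) f * ennreal (2 * pi)"] show ?thesis by (simp only: mult.commute[of "ennreal (2 * pi)"])
 qed
 finally show ?thesis by (simp add: ennreal_leI)
qed

abbreviation eps :: "nat => real" where "eps n \<equiv> 1 / real (Suc n)"

lemma eps_pos: "0 < eps n" "eps n <= 1" by auto

lemma eps_tendsto: "eps \<longlonglongrightarrow> 0"
 by (rule LIMSEQ_Suc[OF lim_1_over_n])

lemma eps_at_right: "filterlim eps (at_right 0) sequentially"
 unfolding filterlim_at using eps_tendsto by (auto simp del: of_nat_Suc)

lemma wt_eps_tendsto: "(\<lambda>n. wt (eps n) k) \<longlonglongrightarrow> 1"
proof -
 have "(\<lambda>n. complex_of_real (exp (- eps n * \<bar>k\<bar>))) \<longlonglongrightarrow> complex_of_real (exp (- 0 * \<bar>k\<bar>))"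
  by (intro tendsto_intros eps_tendsto)
 then show ?thesis by (simp add: wt_def)
qed

text \<open>Fatou as the weight tends to 1. The rate is halved because the norm squares the
  weight.\<close>

proposition Bessel:
 assumes f: "integrable (mX X) f" and f2: "sqi (mX X) f"
 shows "sqn (nX X) (ft0 X f) <= ennreal (2 * pi) * sqn (mX X) f"
proof (rule sqn_Fatou_bound[where f = "\<lambda>n k. wt (eps n / 2) k * ft0 X f k"])
 have [measurable]: "f \<in> bm" using f2 by (simp add: sqi_def)
 show "(\<lambda>k. wt (eps n / 2) k * ft0 X f k) \<in> borel_measurable (nX X)" for n by measurable
 show "AE k in nX X. (\<lambda>n. wt (eps n / 2) k * ft0 X f k) \<longlonglongrightarrow> ft0 X f k"
 proof (rule AE_I2)
  fix k
  have "(\<lambda>n. complex_of_real (exp (- (eps n / 2) * \<bar>k\<bar>)) * ft0 X f k) \<longlonglongrightarrow> complex_of_real (exp (- (0 / 2) * \<bar>k\<bar>)) * ft0 X f k"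
   by (intro tendsto_intros eps_tendsto) auto
  then show "(\<lambda>n. wt (eps n / 2) k * ft0 X f k) \<longlonglongrightarrow> ft0 X f k" by (simp add: wt_def)
 qed
 show "\<forall>\<^sub>F n in sequentially. sqn (nX X) (\<lambda>k. wt (eps n / 2) k * ft0 X f k) <= ennreal (2 * pi) * sqn (mX X) f"
 proof (rule always_eventually, rule allI)
  fix n
  have "(exp (- (eps n / 2) * \<bar>k\<bar>))^2 = exp (- eps n * \<bar>k\<bar>)" for k
   by (simp add: power2_eq_square exp_add[symmetric] del: of_nat_Suc)
  then have "sqn (nX X) (\<lambda>k. wt (eps n / 2) k * ft0 X f k) = (\<integral>\<^sup>+k. ennreal (exp (- eps n * \<bar>k\<bar>) * (cmod (ft0 X f k))^2) \<partial>nX X)"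
   unfolding sqn_def by (simp only: norm_mult norm_wt power_mult_distrib)
  then show "sqn (nX X) (\<lambda>k. wt (eps n / 2) k * ft0 X f k) <= ennreal (2 * pi) * sqn (mX X) f"
   using Bessel_weighted[OF f f2, of "eps n"] eps_pos[of n] by simp
 qed
qed

lemma sqi_ft0: "integrable (mX X) f ==> sqi (mX X) f ==> sqi (nX X) (ft0 X f)"
proof -
 assume f: "integrable (mX X) f" "sqi (mX X) f"
 then have "f \<in> bm" by (simp add: sqi_def)
 moreover have "ennreal (2 * pi) * sqn (mX X) f < \<infinity>" using f by (auto simp: sqi_def ennreal_mult_less_top)
 ultimately show ?thesis using Bessel[OF f] by (auto simp: sqi_def intro: le_less_trans)
qed

text \<open>Duality: the pairing of the inverse transform with itself is the pairing of
  \<open>F\<close> with a transform, to which Cauchy-Schwarz and \<open>Bessel\<close> apply; one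
  factor of the norm then cancels. Cutting off first makes that norm finite and the function
  integrable.\<close>

proposition inverse_Bessel:
 assumes F: "integrable (nX X) F" and F2: "sqi (nX X) F"
 shows "sqn (mX X) (ift X F) <= ennreal (2 * pi) * sqn (nX X) F"
proof (rule sqn_Fatou_bound[where f = "\<lambda>n. cut (real n) (ift X F)"])
 have [measurable]: "F \<in> bm" using F2 by (simp add: sqi_def)
 show "cut (real n) (ift X F) \<in> borel_measurable (mX X)" for n by simp
 show "AE x in mX X. (\<lambda>n. cut (real n) (ift X F) x) \<longlonglongrightarrow> ift X F x"
 proof (intro AE_I2 tendsto_eventually)
  fix x :: real
  obtain N where N: "\<bar>x\<bar> <= real N" using real_arch_simple by blast
  show "\<forall>\<^sub>F n in sequentially. cut (real n) (ift X F) x = ift X F x"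
   using eventually_ge_at_top[of N]
  proof eventually_elim
   case (elim n)
   then have "\<bar>x\<bar> <= real n" using N by linarith
   then have "x \<in> {- real n..real n}" by auto
   then show ?case by (simp add: cut_def)
  qed
 qed
 show "\<forall>\<^sub>F n in sequentially. sqn (mX X) (cut (real n) (ift X F)) <= ennreal (2 * pi) * sqn (nX X) F"
 proof (rule always_eventually, rule allI)
  fix n
  define h where "h = cut (real n) (ift X F)"
  define c where "c = (LINT k|nX X. cmod (F k))"
  have [measurable]: "h \<in> bm" unfolding h_def by measurable
  have hb: "cmod (h x) <= c * indicator {-real n..real n} x" for x
   using norm_ift_le[OF F, of x] by (simp add: h_def cut_def c_def indicator_def)
  have hs: "sqi (mX X) h"
  proof -
   have "sqn (mX X) h <= (\<integral>\<^sup>+x. ennreal (c^2) * indicator {-real n..real n} x \<partial>lborel)"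
    unfolding sqn_def
   proof (subst nn_integral_mX, simp, rule nn_integral_mono)
    fix x :: real
    have "(cmod (h x))^2 <= (c * indicator {-real n..real n} x)^2" by (intro power_mono hb) auto
    then have "(esq (h x)) <= ennreal (c^2) * indicator {-real n..real n} x"
     by (cases "x \<in> {-real n..real n}") (auto intro: ennreal_leI)
    then show "(esq (h x)) * indicator (cell X) x <= ennreal (c^2) * indicator {-real n..real n} x"
     by (auto simp: indicator_def)
   qed
   also have "... < \<infinity>" by (subst nn_integral_cmult) (auto simp: ennreal_mult_less_top)
   finally show ?thesis by (simp add: sqi_def)
  qed
  have hi: "integrable (mX X) h"
  proof -
   have "cut (real n) h = h" by (auto simp: h_def cut_def fun_eq_iff indicator_def)
   then show ?thesis using integrable_cut[OF hs, of "real n"] by simp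
  qed
  have hci: "integrable (mX X) (\<lambda>x. cnj (h x))" using hi by simp
  have fh: "sqi (nX X) (ft0 X h)" by (rule sqi_ft0[OF hi hs])
  have "sqn (mX X) h = ennreal (LINT x|mX X. (cmod (h x))^2)"
   unfolding sqn_def
  proof (rule nn_integral_eq_integral)
   have "integrable (mX X) (\<lambda>x. cmod (h x * h x))"
    by (intro integrable_norm sqi_integrable_mult hs)
   then show "integrable (mX X) (\<lambda>x. (cmod (h x))^2)" by (simp add: norm_mult power2_eq_square)
  qed simp
  also have "(LINT x|mX X. (cmod (h x))^2) <= cmod (LINT x|mX X. cnj (h x) * h x)"
  proof -
   have "cnj (h x) * h x = complex_of_real ((cmod (h x))^2)" for x
    by (simp only: complex_norm_square mult.commute[of "cnj (h x)"])
   then have "(LINT x|mX X. cnj (h x) * h x) = complex_of_real (LINT x|mX X. (cmod (h x))^2)"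
    by (simp only: integral_complex_of_real)
   then show ?thesis by (simp only: norm_of_real abs_ge_self)
  qed
  also have "(LINT x|mX X. cnj (h x) * h x) = (LINT x|mX X. LINT k|nX X. cis (x * k) * cnj (h x) * F k)"
  proof (rule LINT_cong[OF refl])
   fix x
   have "cnj (h x) * h x = cnj (h x) * ift X F x" by (simp add: h_def cut_def indicator_def)
   then show "cnj (h x) * h x = (LINT k|nX X. cis (x * k) * cnj (h x) * F k)"
    by (simp add: ift_def mult.assoc[symmetric] mult.commute[of _ "cnj (h x)"] flip: integral_mult_right_zero)
  qed
  also have "... = (LINT k|nX X. LINT x|mX X. cis (x * k) * cnj (h x) * F k)"
   by (rule Fubini_weighted[OF pair_sigma_finite_mn hci F cis_measurable1, where C = 1]) simp
  also have "... = (LINT k|nX X. F k * cnj (ft0 X h k))"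
  proof (rule LINT_cong[OF refl])
   fix k
   have "cnj (ft0 X h k) = (LINT x|mX X. cis (x * k) * cnj (h x))"
    unfolding ft0_def by (subst Bochner_Integration.integral_cnj[symmetric]) (simp add: cis_cnj)
   then show "(LINT x|mX X. cis (x * k) * cnj (h x) * F k) = F k * cnj (ft0 X h k)"
    by (simp add: mult.commute)
  qed
  finally have "sqn (mX X) h <= ennreal (cmod (LINT k|nX X. F k * cnj (ft0 X h k)))" by (simp add: ennreal_leI)
  then have "(sqn (mX X) h)^2 <= (ennreal (cmod (LINT k|nX X. F k * cnj (ft0 X h k))))^2" by (intro power_mono) auto
  also have "... <= sqn (nX X) F * sqn (nX X) (\<lambda>k. cnj (ft0 X h k))"
   using sqi_Cauchy_Schwarz[OF F2 sqi_cnj[OF fh]] by (simp add: ennreal_power)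
  also have "sqn (nX X) (\<lambda>k. cnj (ft0 X h k)) = sqn (nX X) (ft0 X h)" by (simp add: sqn_def)
  also have "sqn (nX X) F * sqn (nX X) (ft0 X h) <= sqn (nX X) F * (ennreal (2 * pi) * sqn (mX X) h)"
   by (intro mult_left_mono Bessel hi hs) auto
  finally have le: "(sqn (mX X) h)^2 <= sqn (nX X) F * (ennreal (2 * pi) * sqn (mX X) h)" .
  \<comment> \<open>Finiteness of both norms permits the cancellation in real numbers.\<close>
  have "sqn (mX X) h < top" using hs by (simp add: sqi_def)
  then obtain a where a: "sqn (mX X) h = ennreal a" "a \<ge> 0" by (cases "sqn (mX X) h") auto
  have "sqn (nX X) F < top" using F2 by (simp add: sqi_def)
  then obtain b where b: "sqn (nX X) F = ennreal b" "b \<ge> 0" by (cases "sqn (nX X) F") auto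
  have "ennreal (a^2) <= ennreal (b * (2 * pi * a))"
   using le a b by (simp add: ennreal_power ennreal_mult)
  then have "a * a <= b * (2 * pi) * a" using a b by (simp add: power2_eq_square mult.assoc)
  then have "a <= b * (2 * pi)" using a b by (cases "a = 0") auto
  then show "sqn (mX X) (cut (real n) (ift X F)) <= ennreal (2 * pi) * sqn (nX X) F"
   using a b unfolding h_def[symmetric] by (simp add: ennreal_mult[symmetric] mult.commute ennreal_leI)
 qed
qed

lemma sqi_borel: "sqi (mX X) f ==> f \<in> bm" "sqi (nX X) F ==> F \<in> bm"
 by (simp_all add: sqi_def)

section \<open>From truncated transforms to the transform on square-integrable functions\<close>

lemma sqn_cut_tendsto:
 assumes f: "sqi (mX X) f"
 shows "((\<lambda>R. sqn (mX X) (\<lambda>x. cut R f x - f x)) \<longlongrightarrow> 0) at_top"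
proof -
 have [measurable]: "f \<in> bm" using f by (rule sqi_borel)
 have fin: "(\<integral>\<^sup>+x. (esq (f x)) \<partial>mX X) < \<infinity>" using f by (simp add: sqi_def sqn_def)
 have "(\<lambda>n. \<integral>\<^sup>+x. (esq (cut (real n) f x - f x)) \<partial>mX X) \<longlonglongrightarrow> (\<integral>\<^sup>+x. 0 \<partial>mX X)"
 proof (rule nn_integral_dominated_convergence[OF _ _ _ _ fin])
  show "AE x in mX X. (esq (cut (real n) f x - f x)) <= (esq (f x))" for n
   by (auto simp: cut_def indicator_def)
  show "AE x in mX X. (\<lambda>n. (esq (cut (real n) f x - f x))) \<longlonglongrightarrow> 0"
  proof (intro AE_I2 tendsto_eventually)
   fix x :: real
   obtain N where N: "\<bar>x\<bar> <= real N" using real_arch_simple by blast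
   show "\<forall>\<^sub>F n in sequentially. (esq (cut (real n) f x - f x)) = 0"
    using eventually_ge_at_top[of N]
   proof eventually_elim
    case (elim n)
    then have "\<bar>x\<bar> <= real n" using N by linarith
    then have "x \<in> {- real n..real n}" by auto
    then show ?case by (simp add: cut_def)
   qed
  qed
 qed measurable
 then have seq: "(\<lambda>n. sqn (mX X) (\<lambda>x. cut (real n) f x - f x)) \<longlonglongrightarrow> 0" by (simp add: sqn_def)
 show ?thesis
 proof (rule ennreal_tendsto_0I)
  fix e :: real assume "e > 0"
  then have "\<forall>\<^sub>F n in sequentially. sqn (mX X) (\<lambda>x. cut (real n) f x - f x) < ennreal e"
   by (intro order_tendstoD(2)[OF seq]) simp
  then obtain n where n: "sqn (mX X) (\<lambda>x. cut (real n) f x - f x) < ennreal e" by (auto dest: eventually_happens)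
  show "\<forall>\<^sub>F R in at_top. sqn (mX X) (\<lambda>x. cut R f x - f x) <= ennreal e"
   using eventually_ge_at_top[of "real n"]
  proof eventually_elim
   case (elim R)
   have "sqn (mX X) (\<lambda>x. cut R f x - f x) <= sqn (mX X) (\<lambda>x. cut (real n) f x - f x)"
    using elim by (intro sqn_mono_AE AE_I2) (auto simp: cut_def indicator_def)
   with n show ?case by simp
  qed
 qed
qed

lemma Bessel_diff:
 assumes "sqi (mX X) f" "sqi (mX X) g" "integrable (mX X) f" "integrable (mX X) g"
 shows "sqn (nX X) (\<lambda>k. ft0 X f k - ft0 X g k) <= ennreal (2 * pi) * sqn (mX X) (\<lambda>x. f x - g x)"
proof -
 have "sqn (nX X) (ft0 X (\<lambda>x. f x - g x)) <= ennreal (2 * pi) * sqn (mX X) (\<lambda>x. f x - g x)"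
  using assms by (intro Bessel Bochner_Integration.integrable_diff sqi_diff)
 moreover have "ft0 X (\<lambda>x. f x - g x) = (\<lambda>k. ft0 X f k - ft0 X g k)"
  using assms by (simp add: fun_eq_iff ft0_diff)
 ultimately show ?thesis by simp
qed

text \<open>The same limit of truncated integrals as in \<open>is_fourier_transform\<close>, for
  Borel functions. A relation suits a transform that is determined only almost everywhere, and it
  can be used before existence is proved.\<close>

definition ftp :: "base_space => (real => complex) => (real => complex) => bool" where
 "ftp X f F \<longleftrightarrow> sqi (mX X) f \<and> sqi (nX X) F \<and>
   ((\<lambda>R. sqn (nX X) (\<lambda>k. F k - ft0 X (cut R f) k)) \<longlongrightarrow> 0) at_top"

lemma ftp_sqi: "ftp X f F ==> sqi (mX X) f" "ftp X f F ==> sqi (nX X) F"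
 by (auto simp: ftp_def)

lemma ftp_tendsto: "ftp X f F ==> ((\<lambda>R. sqn (nX X) (\<lambda>k. F k - ft0 X (cut R f) k)) \<longlongrightarrow> 0) at_top"
 by (auto simp: ftp_def)

lemma ennreal_cmult_add_tendsto_0:
 fixes a b :: "'a => ennreal"
 assumes "(a \<longlongrightarrow> 0) F" "(b \<longlongrightarrow> 0) F" "c < \<infinity>" "d < \<infinity>"
 shows "((\<lambda>x. c * a x + d * b x) \<longlongrightarrow> 0) F"
 using tendsto_add[OF ennreal_cmult_tendsto_0[OF assms(1,3)] ennreal_cmult_tendsto_0[OF assms(2,4)]] by simp

text \<open>By \<open>Bessel\<close>, truncated transforms at two radii differ by no more than a
  multiple of the truncations, so one sequence of radii decides the limit. The constant
  \<open>8 * pi\<close> consists of two squared triangle inequalities and one \<open>2 * pi\<close>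
  from \<open>Bessel\<close>.\<close>

lemma ftp_limit_at:
 assumes f: "sqi (mX X) f" and F: "sqi (nX X) F"
  and "filterlim r at_top sequentially"
  and lim: "(\<lambda>n. sqn (nX X) (\<lambda>k. ft0 X (cut (r n) f) k - F k)) \<longlonglongrightarrow> 0"
 shows "ftp X f F"
 unfolding ftp_def
proof (intro conjI f F ennreal_tendsto_0I)
 fix e :: real assume e: "e > 0"
 have [measurable]: "f \<in> bm" "F \<in> bm" using f F by (auto dest: sqi_borel)
 define a where "a R = sqn (mX X) (\<lambda>x. cut R f x - f x)" for R
 have a: "(a \<longlongrightarrow> 0) at_top" unfolding a_def by (rule sqn_cut_tendsto[OF f])
 have b: "(\<lambda>n. 2 * sqn (nX X) (\<lambda>k. ft0 X (cut (r n) f) k - F k) + ennreal (8 * pi) * a (r n)) \<longlonglongrightarrow> 0"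
  by (intro ennreal_cmult_add_tendsto_0 lim filterlim_compose[OF a assms(3)]) auto
 have c: "((\<lambda>R. ennreal (8 * pi) * a R) \<longlongrightarrow> 0) at_top"
  by (intro ennreal_cmult_tendsto_0 a) auto
 have "\<forall>\<^sub>F n in sequentially. 2 * sqn (nX X) (\<lambda>k. ft0 X (cut (r n) f) k - F k) + ennreal (8 * pi) * a (r n) < ennreal (e / 2)"
  using e by (intro order_tendstoD(2)[OF b]) simp
 then obtain n where n: "2 * sqn (nX X) (\<lambda>k. ft0 X (cut (r n) f) k - F k) + ennreal (8 * pi) * a (r n) < ennreal (e / 2)"
  by (auto dest: eventually_happens)
 have "\<forall>\<^sub>F R in at_top. ennreal (8 * pi) * a R < ennreal (e / 2)"
  using e by (intro order_tendstoD(2)[OF c]) simp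
 then show "\<forall>\<^sub>F R in at_top. sqn (nX X) (\<lambda>k. F k - ft0 X (cut R f) k) <= ennreal e"
 proof eventually_elim
  case (elim R)
  have "sqn (nX X) (\<lambda>k. F k - ft0 X (cut R f) k) <= 2 * sqn (nX X) (\<lambda>k. F k - ft0 X (cut (r n) f) k) + 2 * sqn (nX X) (\<lambda>k. ft0 X (cut (r n) f) k - ft0 X (cut R f) k)"
   by (rule sqn_triangle) auto
  also have "... <= 2 * sqn (nX X) (\<lambda>k. ft0 X (cut (r n) f) k - F k) + 2 * (ennreal (2 * pi) * (2 * a (r n) + 2 * a R))"
  proof (intro add_mono mult_left_mono)
   show "sqn (nX X) (\<lambda>k. F k - ft0 X (cut (r n) f) k) <= sqn (nX X) (\<lambda>k. ft0 X (cut (r n) f) k - F k)"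
    by (subst sqn_minus_commute) simp
   have "sqn (nX X) (\<lambda>k. ft0 X (cut (r n) f) k - ft0 X (cut R f) k) <= ennreal (2 * pi) * sqn (mX X) (\<lambda>x. cut (r n) f x - cut R f x)"
    by (intro Bessel_diff sqi_cut integrable_cut f)
   also have "... <= ennreal (2 * pi) * (2 * a (r n) + 2 * a R)"
   proof (intro mult_left_mono)
    have "sqn (mX X) (\<lambda>x. cut (r n) f x - cut R f x) <= 2 * a (r n) + 2 * sqn (mX X) (\<lambda>x. f x - cut R f x)"
     unfolding a_def by (rule sqn_triangle) auto
    also have "sqn (mX X) (\<lambda>x. f x - cut R f x) = a R" unfolding a_def by (rule sqn_minus_commute)
    finally show "sqn (mX X) (\<lambda>x. cut (r n) f x - cut R f x) <= 2 * a (r n) + 2 * a R" .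
   qed simp
   finally show "sqn (nX X) (\<lambda>k. ft0 X (cut (r n) f) k - ft0 X (cut R f) k) <= ennreal (2 * pi) * (2 * a (r n) + 2 * a R)" .
  qed auto
  also have "... = (2 * sqn (nX X) (\<lambda>k. ft0 X (cut (r n) f) k - F k) + ennreal (8 * pi) * a (r n)) + ennreal (8 * pi) * a R"
  proof -
   have "2 * (ennreal (2 * pi) * 2) = ennreal (8 * pi)"
    by (simp add: ennreal_mult[symmetric] flip: ennreal_numeral)
   then have "2 * (ennreal (2 * pi) * (2 * x)) = ennreal (8 * pi) * x" for x by (metis mult.assoc)
   then show ?thesis by (simp add: distrib_left add.assoc)
  qed
  also have "... <= ennreal (e / 2) + ennreal (e / 2)" using n elim by (intro add_mono) auto
  also have "... = ennreal e" using e by (simp add: ennreal_plus[symmetric] del: ennreal_plus)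
  finally show ?case .
 qed
qed

text \<open>\<open>Bessel\<close> makes the truncated transforms a Cauchy sequence, and completeness
  supplies the limit.\<close>

proposition ftp_exists:
 assumes f: "sqi (mX X) f"
 obtains F where "ftp X f F"
proof -
 have [measurable]: "f \<in> bm" using f by (rule sqi_borel)
 define a where "a R = sqn (mX X) (\<lambda>x. cut R f x - f x)" for R
 have a: "(a \<longlongrightarrow> 0) at_top" unfolding a_def by (rule sqn_cut_tendsto[OF f])
 have an: "(\<lambda>n. ennreal (4 * pi) * a (real n)) \<longlonglongrightarrow> 0"
  by (intro ennreal_cmult_tendsto_0 filterlim_compose[OF a filterlim_real_sequentially]) auto
 obtain F where F: "sqi (nX X) F" "(\<lambda>n. sqn (nX X) (\<lambda>k. ft0 X (cut (real n) f) k - F k)) \<longlonglongrightarrow> 0"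
 proof (rule sqi_complete)
  show "sqi (nX X) (ft0 X (cut (real n) f))" for n by (intro sqi_ft0 integrable_cut sqi_cut f)
  fix e :: real assume e: "e > 0"
  have "\<forall>\<^sub>F n in sequentially. ennreal (4 * pi) * a (real n) < ennreal (e / 2)"
   using e by (intro order_tendstoD(2)[OF an]) simp
  then obtain N where N: "\<And>n. n \<ge> N ==> ennreal (4 * pi) * a (real n) < ennreal (e / 2)"
   by (auto simp: eventually_sequentially)
  show "\<exists>N. \<forall>m\<ge>N. \<forall>n\<ge>N. sqn (nX X) (\<lambda>k. ft0 X (cut (real m) f) k - ft0 X (cut (real n) f) k) <= ennreal e"
  proof (intro exI[of _ N] allI impI)
   fix m n assume mn: "m \<ge> N" "n \<ge> N"
   have "sqn (nX X) (\<lambda>k. ft0 X (cut (real m) f) k - ft0 X (cut (real n) f) k) <= ennreal (2 * pi) * sqn (mX X) (\<lambda>x. cut (real m) f x - cut (real n) f x)"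
    by (intro Bessel_diff sqi_cut integrable_cut f)
   also have "... <= ennreal (2 * pi) * (2 * a (real m) + 2 * a (real n))"
   proof (intro mult_left_mono)
    have "sqn (mX X) (\<lambda>x. cut (real m) f x - cut (real n) f x) <= 2 * a (real m) + 2 * sqn (mX X) (\<lambda>x. f x - cut (real n) f x)"
     unfolding a_def by (rule sqn_triangle) auto
    also have "sqn (mX X) (\<lambda>x. f x - cut (real n) f x) = a (real n)" unfolding a_def by (rule sqn_minus_commute)
    finally show "sqn (mX X) (\<lambda>x. cut (real m) f x - cut (real n) f x) <= 2 * a (real m) + 2 * a (real n)" .
   qed simp
   also have "... = ennreal (4 * pi) * a (real m) + ennreal (4 * pi) * a (real n)"
   proof -
    have "ennreal (2 * pi) * 2 = ennreal (4 * pi)"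
     by (simp add: ennreal_mult[symmetric] flip: ennreal_numeral)
    then have "ennreal (2 * pi) * (2 * x) = ennreal (4 * pi) * x" for x by (metis mult.assoc)
    then show ?thesis by (simp add: distrib_left)
   qed
   also have "... <= ennreal (e / 2) + ennreal (e / 2)" using N mn by (intro add_mono) (auto intro: less_imp_le)
   also have "... = ennreal e" using e by (simp add: ennreal_plus[symmetric] del: ennreal_plus)
   finally show "sqn (nX X) (\<lambda>k. ft0 X (cut (real m) f) k - ft0 X (cut (real n) f) k) <= ennreal e" .
  qed
 qed
 have "ftp X f F" by (rule ftp_limit_at[OF f F(1) filterlim_real_sequentially F(2)])
 then show ?thesis using that by blast
qed

lemma ftp_cong_right:
 assumes "ftp X f F" "AE k in nX X. F k = G k" "G \<in> bm"
 shows "ftp X f G"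
proof -
 have "sqn (nX X) (\<lambda>k. F k - ft0 X (cut R f) k) = sqn (nX X) (\<lambda>k. G k - ft0 X (cut R f) k)" for R
  using assms(2) by (intro sqn_cong_AE) auto
 moreover have "sqn (nX X) F = sqn (nX X) G" using assms(2) by (intro sqn_cong_AE) auto
 ultimately show ?thesis using assms by (auto simp: ftp_def sqi_def)
qed

lemma ftp_cong_left:
 assumes "ftp X f F" "AE x in mX X. f x = g x" "g \<in> bm"
 shows "ftp X g F"
proof -
 have [measurable]: "f \<in> bm" "g \<in> bm"
  using assms by (auto simp: ftp_def sqi_def)
 have "ft0 X (cut R f) k = ft0 X (cut R g) k" for R k
  unfolding ft0_def by (rule integral_cong_AE) (use assms(2) in \<open>auto simp: cut_def\<close>)
 moreover have "sqn (mX X) f = sqn (mX X) g" using assms(2) by (intro sqn_cong_AE) auto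
 ultimately show ?thesis using assms by (auto simp: ftp_def sqi_def)
qed

lemma ftp_unique:
 assumes "ftp X f F" "ftp X f G"
 shows "AE k in nX X. F k = G k"
proof -
 have f: "sqi (mX X) f" using assms by (auto simp: ftp_def)
 have [measurable]: "F \<in> bm" "G \<in> bm" "f \<in> bm"
  using assms by (auto simp: ftp_def dest: sqi_borel)
 have "((\<lambda>R::real. sqn (nX X) (\<lambda>k. F k - G k)) \<longlongrightarrow> 0) at_top"
 proof (rule tendsto_0_le_ennreal)
  show "((\<lambda>R. 2 * sqn (nX X) (\<lambda>k. F k - ft0 X (cut R f) k) + 2 * sqn (nX X) (\<lambda>k. G k - ft0 X (cut R f) k)) \<longlongrightarrow> 0) at_top"
   using assms by (intro ennreal_cmult_add_tendsto_0) (auto simp: ftp_def)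
  show "\<forall>\<^sub>F R in at_top. sqn (nX X) (\<lambda>k. F k - G k) <= 2 * sqn (nX X) (\<lambda>k. F k - ft0 X (cut R f) k) + 2 * sqn (nX X) (\<lambda>k. G k - ft0 X (cut R f) k)"
   by (intro always_eventually allI, subst (3) sqn_minus_commute, rule sqn_triangle) auto
 qed
 then have "sqn (nX X) (\<lambda>k. F k - G k) = 0"
  using tendsto_unique[OF trivial_limit_at_top_linorder tendsto_const, of "sqn (nX X) (\<lambda>k. F k - G k)" 0] by blast
 then have "AE k in nX X. F k - G k = 0" by (subst (asm) sqn_eq_0_iff) auto
 then show ?thesis by eventually_elim simp
qed

text \<open>Twice the constant \<open>2 * pi\<close> of \<open>Bessel\<close>; the factor is lost in
  the squared triangle inequality.\<close>

lemma ftp_bound: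
 assumes "ftp X f F"
 shows "sqn (nX X) F <= ennreal (4 * pi) * sqn (mX X) f"
proof -
 have f: "sqi (mX X) f" using assms by (auto simp: ftp_def)
 have [measurable]: "F \<in> bm" "f \<in> bm"
  using assms by (auto simp: ftp_def dest: sqi_borel)
 have "((\<lambda>R. 2 * sqn (nX X) (\<lambda>k. F k - ft0 X (cut R f) k) + 2 * (ennreal (2 * pi) * sqn (mX X) f)) \<longlongrightarrow> 0 + 2 * (ennreal (2 * pi) * sqn (mX X) f)) at_top"
  using assms by (intro tendsto_add tendsto_const ennreal_cmult_tendsto_0) (auto simp: ftp_def)
 then have "sqn (nX X) F <= 0 + 2 * (ennreal (2 * pi) * sqn (mX X) f)"
 proof (rule tendsto_lowerbound)
  show "\<forall>\<^sub>F R in at_top. sqn (nX X) F <= 2 * sqn (nX X) (\<lambda>k. F k - ft0 X (cut R f) k) + 2 * (ennreal (2 * pi) * sqn (mX X) f)"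
  proof (intro always_eventually allI)
   fix R
   have "sqn (nX X) (\<lambda>k. (F k - ft0 X (cut R f) k) + ft0 X (cut R f) k) <= 2 * sqn (nX X) (\<lambda>k. F k - ft0 X (cut R f) k) + 2 * sqn (nX X) (ft0 X (cut R f))"
    by (rule sqn_add) auto
   also have "sqn (nX X) (ft0 X (cut R f)) <= ennreal (2 * pi) * sqn (mX X) (cut R f)"
    by (intro Bessel integrable_cut sqi_cut f)
   also have "... <= ennreal (2 * pi) * sqn (mX X) f" by (intro mult_left_mono sqn_cut_le) auto
   finally show "sqn (nX X) F <= 2 * sqn (nX X) (\<lambda>k. F k - ft0 X (cut R f) k) + 2 * (ennreal (2 * pi) * sqn (mX X) f)"
    by (simp add: add_left_mono mult_left_mono)
  qed
 qed simp
 also have "... = ennreal (4 * pi) * sqn (mX X) f"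
 proof -
  have "2 * ennreal (2 * pi) = ennreal (4 * pi)" by (simp add: ennreal_mult[symmetric] flip: ennreal_numeral)
  then show ?thesis by (simp add: mult.assoc[symmetric])
 qed
 finally show ?thesis .
qed

lemma ftp_lin:
 assumes "ftp X f F" "ftp X g G"
 shows "ftp X (\<lambda>x. a * f x + b * g x) (\<lambda>k. a * F k + b * G k)"
 unfolding ftp_def
proof (intro conjI)
 have f: "sqi (mX X) f" "sqi (mX X) g" "sqi (nX X) F" "sqi (nX X) G" using assms by (auto simp: ftp_def)
 have [measurable]: "F \<in> bm" "G \<in> bm" "f \<in> bm" "g \<in> bm"
  using f by (auto dest: sqi_borel)
 show "sqi (mX X) (\<lambda>x. a * f x + b * g x)" "sqi (nX X) (\<lambda>k. a * F k + b * G k)"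
  by (intro sqi_add sqi_cmult f)+
 have eq: "ft0 X (cut R (\<lambda>x. a * f x + b * g x)) k = a * ft0 X (cut R f) k + b * ft0 X (cut R g) k" for R k
 proof -
  have "cut R (\<lambda>x. a * f x + b * g x) = (\<lambda>x. a * cut R f x + b * cut R g x)" by (simp add: cut_def fun_eq_iff algebra_simps)
  then show ?thesis
   by (simp add: ft0_add ft0_cmult integrable_cut f)
 qed
 show "((\<lambda>R. sqn (nX X) (\<lambda>k. a * F k + b * G k - ft0 X (cut R (\<lambda>x. a * f x + b * g x)) k)) \<longlongrightarrow> 0) at_top"
 proof (rule tendsto_0_le_ennreal)
  show "((\<lambda>R. (2 * (esq a)) * sqn (nX X) (\<lambda>k. F k - ft0 X (cut R f) k) + (2 * (esq b)) * sqn (nX X) (\<lambda>k. G k - ft0 X (cut R g) k)) \<longlongrightarrow> 0) at_top"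
   using assms by (intro ennreal_cmult_add_tendsto_0) (auto simp: ftp_def ennreal_mult_less_top)
  show "\<forall>\<^sub>F R in at_top. sqn (nX X) (\<lambda>k. a * F k + b * G k - ft0 X (cut R (\<lambda>x. a * f x + b * g x)) k)
   <= (2 * (esq a)) * sqn (nX X) (\<lambda>k. F k - ft0 X (cut R f) k) + (2 * (esq b)) * sqn (nX X) (\<lambda>k. G k - ft0 X (cut R g) k)"
  proof (intro always_eventually allI)
   fix R
   have "sqn (nX X) (\<lambda>k. a * F k + b * G k - ft0 X (cut R (\<lambda>x. a * f x + b * g x)) k)
    = sqn (nX X) (\<lambda>k. a * (F k - ft0 X (cut R f) k) + b * (G k - ft0 X (cut R g) k))"
    unfolding eq by (simp add: algebra_simps)
   also have "... <= 2 * sqn (nX X) (\<lambda>k. a * (F k - ft0 X (cut R f) k)) + 2 * sqn (nX X) (\<lambda>k. b * (G k - ft0 X (cut R g) k))"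
    by (rule sqn_add) auto
   finally show "sqn (nX X) (\<lambda>k. a * F k + b * G k - ft0 X (cut R (\<lambda>x. a * f x + b * g x)) k)
   <= (2 * (esq a)) * sqn (nX X) (\<lambda>k. F k - ft0 X (cut R f) k) + (2 * (esq b)) * sqn (nX X) (\<lambda>k. G k - ft0 X (cut R g) k)"
    by (simp add: sqn_cmult mult.assoc)
  qed
 qed
qed

lemma ftp_cmult: "ftp X f F ==> ftp X (\<lambda>x. a * f x) (\<lambda>k. a * F k)"
 using ftp_lin[of X f F f F a 0] by simp

lemma ftp_diff: "ftp X f F ==> ftp X g G ==> ftp X (\<lambda>x. f x - g x) (\<lambda>k. F k - G k)"
 using ftp_lin[of X f F g G 1 "-1"] by simp

lemma ftp_add: "ftp X f F ==> ftp X g G ==> ftp X (\<lambda>x. f x + g x) (\<lambda>k. F k + G k)"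
 using ftp_lin[of X f F g G 1 1] by simp

text \<open>The graph of the transform is closed: a transform of the limit exists, and by
  boundedness it must be the limit of the transforms.\<close>

lemma ftp_limit:
 assumes fF: "\<And>n. ftp X (f n) (F n)" and f0: "sqi (mX X) f0" and F0: "sqi (nX X) F0"
  and limf: "(\<lambda>n. sqn (mX X) (\<lambda>x. f n x - f0 x)) \<longlonglongrightarrow> 0" and limF: "(\<lambda>n. sqn (nX X) (\<lambda>k. F n k - F0 k)) \<longlonglongrightarrow> 0"
 shows "ftp X f0 F0"
proof -
 obtain G where G: "ftp X f0 G" using ftp_exists[OF f0] by blast
 have [measurable]: "\<And>n. F n \<in> bm" "F0 \<in> bm" "G \<in> bm"
  using fF F0 G by (auto simp: ftp_def dest: sqi_borel)
 have "(\<lambda>n. sqn (nX X) (\<lambda>k. G k - F0 k)) \<longlonglongrightarrow> 0"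
 proof (rule tendsto_0_le_ennreal)
  show "(\<lambda>n. (2 * ennreal (4 * pi)) * sqn (mX X) (\<lambda>x. f n x - f0 x) + 2 * sqn (nX X) (\<lambda>k. F n k - F0 k)) \<longlonglongrightarrow> 0"
   by (intro ennreal_cmult_add_tendsto_0 limf limF) (auto simp: ennreal_mult_less_top)
  show "\<forall>\<^sub>F n in sequentially. sqn (nX X) (\<lambda>k. G k - F0 k) <= (2 * ennreal (4 * pi)) * sqn (mX X) (\<lambda>x. f n x - f0 x) + 2 * sqn (nX X) (\<lambda>k. F n k - F0 k)"
  proof (intro always_eventually allI)
   fix n
   have "sqn (nX X) (\<lambda>k. G k - F0 k) <= 2 * sqn (nX X) (\<lambda>k. G k - F n k) + 2 * sqn (nX X) (\<lambda>k. F n k - F0 k)"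
    by (rule sqn_triangle) auto
   also have "sqn (nX X) (\<lambda>k. G k - F n k) = sqn (nX X) (\<lambda>k. F n k - G k)" by (rule sqn_minus_commute)
   also have "... <= ennreal (4 * pi) * sqn (mX X) (\<lambda>x. f n x - f0 x)" by (rule ftp_bound[OF ftp_diff[OF fF G]])
   finally show "sqn (nX X) (\<lambda>k. G k - F0 k) <= (2 * ennreal (4 * pi)) * sqn (mX X) (\<lambda>x. f n x - f0 x) + 2 * sqn (nX X) (\<lambda>k. F n k - F0 k)"
    by (simp add: mult_left_mono mult.assoc)
  qed
 qed
 then have "sqn (nX X) (\<lambda>k. G k - F0 k) = 0" by (simp add: LIMSEQ_const_iff)
 then have "AE k in nX X. G k - F0 k = 0" by (subst (asm) sqn_eq_0_iff) auto
 then have "AE k in nX X. G k = F0 k" by eventually_elim simp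
 then show ?thesis by (rule ftp_cong_right[OF G]) measurable
qed

lemma ftp_ft0:
 assumes f: "integrable (mX X) f" "sqi (mX X) f"
 shows "ftp X f (ft0 X f)"
proof (rule ftp_limit_at[OF f(2) sqi_ft0[OF f] filterlim_real_sequentially])
 show "(\<lambda>n. sqn (nX X) (\<lambda>k. ft0 X (cut (real n) f) k - ft0 X f k)) \<longlonglongrightarrow> 0"
 proof (rule tendsto_0_le_ennreal)
  show "(\<lambda>n. ennreal (2 * pi) * sqn (mX X) (\<lambda>x. cut (real n) f x - f x)) \<longlonglongrightarrow> 0"
   by (intro ennreal_cmult_tendsto_0 filterlim_compose[OF sqn_cut_tendsto[OF f(2)] filterlim_real_sequentially]) auto
  show "\<forall>\<^sub>F n in sequentially. sqn (nX X) (\<lambda>k. ft0 X (cut (real n) f) k - ft0 X f k) <= ennreal (2 * pi) * sqn (mX X) (\<lambda>x. cut (real n) f x - f x)"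
   by (intro always_eventually allI Bessel_diff sqi_cut integrable_cut f)
 qed
qed

subsection \<open>Poisson regularisation\<close>

text \<open>Convolution theorem for a kernel given as the inverse transform of an integrable
  \<open>g\<close>: Fubini for truncated \<open>f\<close>, then passage to the limit on both sides
  by continuity of the pairing.\<close>

lemma kernel_identity:
 assumes fF: "ftp X f F" and g: "integrable (nX X) g" "sqi (nX X) g"
  and K: "\<And>x. K x = (LINT k|nX X. g k * cis (x * k))" and K2: "sqi (mX X) (\<lambda>y. K (x - y))"
 shows "(LINT y|mX X. K (x - y) * f y) = ift X (\<lambda>k. g k * F k) x"
proof -
 have f: "sqi (mX X) f" and F: "sqi (nX X) F" using fF by (auto simp: ftp_def)
 have [measurable]: "f \<in> bm" "F \<in> bm" "g \<in> bm"
  using f F g by (auto dest: sqi_borel)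
 have eq: "(LINT y|mX X. cut (real n) f y * K (x - y)) = (LINT k|nX X. ft0 X (cut (real n) f) k * (cis (x * k) * g k))" for n
 proof -
  have "(LINT y|mX X. cut (real n) f y * K (x - y)) = (LINT y|mX X. LINT k|nX X. cis (- 1 * k * (y - x)) * cut (real n) f y * g k)"
  proof (rule LINT_cong[OF refl])
   fix y
   have "cis (- 1 * k * (y - x)) * cut (real n) f y * g k = cut (real n) f y * (g k * cis ((x - y) * k))" for k
    by (simp add: algebra_simps)
   then show "cut (real n) f y * K (x - y) = (LINT k|nX X. cis (- 1 * k * (y - x)) * cut (real n) f y * g k)"
    by (simp only: K integral_mult_right_zero)
  qed
  also have "... = (LINT k|nX X. LINT y|mX X. cis (- 1 * k * (y - x)) * cut (real n) f y * g k)"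
   by (rule Fubini_weighted[OF pair_sigma_finite_mn integrable_cut[OF f] g(1) cis_kernel_measurable, where C = 1]) simp
  also have "... = (LINT k|nX X. ft0 X (cut (real n) f) k * (cis (x * k) * g k))"
  proof (rule LINT_cong[OF refl])
   fix k
   have "cis (- 1 * k * (y - x)) * cut (real n) f y * g k = (cis (- (y * k)) * cut (real n) f y) * (cis (x * k) * g k)" for y
   proof -
    have "cis (- 1 * k * (y - x)) = cis (- (y * k)) * cis (x * k)" by (simp add: cis_mult algebra_simps)
    then show ?thesis by (simp only: mult_ac)
   qed
   then show "(LINT y|mX X. cis (- 1 * k * (y - x)) * cut (real n) f y * g k) = ft0 X (cut (real n) f) k * (cis (x * k) * g k)"
    by (simp only: ft0_def integral_mult_left_zero)
  qed
  finally show ?thesis .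
 qed
 have l1: "(\<lambda>n. LINT y|mX X. cut (real n) f y * K (x - y)) \<longlonglongrightarrow> (LINT y|mX X. f y * K (x - y))"
  by (intro sqi_tendsto_integral sqi_cut f K2 filterlim_compose[OF sqn_cut_tendsto[OF f] filterlim_real_sequentially])
 have "sqi (nX X) (\<lambda>k. cis (x * k) * g k)" by (rule sqi_bounded_mult[OF g(2), where C = 1]) auto
 moreover have "(\<lambda>n. sqn (nX X) (\<lambda>k. ft0 X (cut (real n) f) k - F k)) \<longlonglongrightarrow> 0"
  by (subst sqn_minus_commute) (rule filterlim_compose[OF ftp_tendsto[OF fF] filterlim_real_sequentially])
 ultimately have l2: "(\<lambda>n. LINT k|nX X. ft0 X (cut (real n) f) k * (cis (x * k) * g k)) \<longlonglongrightarrow> (LINT k|nX X. F k * (cis (x * k) * g k))"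
  by (intro sqi_tendsto_integral sqi_ft0 integrable_cut sqi_cut f F)
 have "(LINT y|mX X. f y * K (x - y)) = (LINT k|nX X. F k * (cis (x * k) * g k))"
  using LIMSEQ_unique[OF l1[unfolded eq] l2] .
 then show ?thesis by (simp add: ift_def mult_ac)
qed

text \<open>The sign fits the transform with \<open>exp (- i x k)\<close>. Since
  \<open>sgn 0 = 0\<close>, constants on the circle are annihilated.\<close>

definition hilb :: "real => complex" where
 "hilb k = - \<i> * of_real (sgn k)"

lemma hilb_measurable [measurable]: "hilb \<in> bm"
 unfolding hilb_def[abs_def] by measurable

lemma norm_hilb_le: "cmod (hilb k) <= 1"
 by (simp add: hilb_def norm_mult sgn_real_def)

lemma sqi_wt: "e > 0 ==> sqi (nX X) (wt e)"
proof -
 assume e: "e > 0"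
 have "(\<integral>\<^sup>+k. ennreal (cmod (wt e k)) \<partial>nX X) < \<infinity>"
  using integrable_wt[OF e, of X] by (simp add: integrable_iff_bounded)
 moreover have "sqn (nX X) (wt e) <= (\<integral>\<^sup>+k. ennreal (cmod (wt e k)) \<partial>nX X)"
  unfolding sqn_def using norm_wt_le[of e] e
  by (intro nn_integral_mono ennreal_leI) (simp add: power2_eq_square mult_left_le)
 ultimately show ?thesis by (simp add: sqi_def)
qed

lemma conv_swap:
 assumes k: "sqi (mX X) (\<lambda>u. complex_of_real (k u))" "on_base X k" and f: "sqi (mX X) f" "on_base X f"
 shows "(LINT u|mX X. of_real (k u) * f (x - u)) = (LINT y|mX X. of_real (k (x - y)) * f y)"
proof -
 have kp: "on_base X (\<lambda>u. complex_of_real (k u))" by (rule on_base_compose[OF k(2)])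
 have "(LINT u|mX X. (\<lambda>y. of_real (k (x - y)) * f y) (x - u)) = (LINT y|mX X. of_real (k (x - y)) * f y)"
 proof (rule integral_mX_translate)
  show "integrable (mX X) (\<lambda>y. of_real (k (x - y)) * f y)"
   by (intro sqi_integrable_mult f sqi_mX_reflect(1)[OF k(1) kp])
  show "on_base X (\<lambda>y. complex_of_real (k (x - y)) * f y)"
   by (intro on_base_compose2[where h = "(*)"] on_base_reflect[OF kp] f)
 qed
 then show ?thesis by simp
qed

lemma poisson_identity:
 assumes fF: "ftp X f F" and per: "on_base X f" and e: "0 < e" "e <= 1"
 shows "(LINT u|mX X. of_real (pk X e u) * f (x - u)) = ift X (\<lambda>k. wt e k * F k) x"
  and "(LINT u|mX X. of_real (qk X e u) * f (x - u)) = ift X (\<lambda>k. wt e k * (hilb k * F k)) x"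
proof -
 have f: "sqi (mX X) f" using fF by (auto simp: ftp_def)
 have pp: "on_base X (\<lambda>u. complex_of_real (pk X e u))" "on_base X (\<lambda>u. complex_of_real (qk X e u))"
  by (intro on_base_compose[OF pk_periodic] on_base_compose[OF qk_periodic])+
 have "(LINT u|mX X. of_real (pk X e u) * f (x - u)) = (LINT y|mX X. of_real (pk X e (x - y)) * f y)"
  by (intro conv_swap sqi_pk e pk_periodic f per)
 also have "... = ift X (\<lambda>k. wt e k * F k) x"
  by (rule kernel_identity[OF fF integrable_wt[OF e(1)] sqi_wt[OF e(1)] integral_wt_cis[OF e(1), symmetric]])
    (intro sqi_mX_reflect(1)[OF sqi_pk[OF e] pp(1)])
 finally show "(LINT u|mX X. of_real (pk X e u) * f (x - u)) = ift X (\<lambda>k. wt e k * F k) x" .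
 have w: "integrable (nX X) (\<lambda>k. hilb k * wt e k)"
  by (rule integrable_le[OF integrable_wt[OF e(1)]])
    (auto simp: norm_mult intro!: mult_left_le_one_le norm_hilb_le)
 have w2: "sqi (nX X) (\<lambda>k. hilb k * wt e k)"
  by (rule sqi_bounded_mult[OF sqi_wt[OF e(1)], where C = 1]) (auto simp: norm_hilb_le)
 have "(LINT u|mX X. of_real (qk X e u) * f (x - u)) = (LINT y|mX X. of_real (qk X e (x - y)) * f y)"
  by (intro conv_swap sqi_qk e qk_periodic f per)
 also have "... = ift X (\<lambda>k. hilb k * wt e k * F k) x"
  by (rule kernel_identity[OF fF w w2 integral_wt_sgn_cis[OF e(1), symmetric, folded hilb_def]])
    (intro sqi_mX_reflect(1)[OF sqi_qk[OF e] pp(2)])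
 also have "... = ift X (\<lambda>k. wt e k * (hilb k * F k)) x" by (simp add: mult_ac)
 finally show "(LINT u|mX X. of_real (qk X e u) * f (x - u)) = ift X (\<lambda>k. wt e k * (hilb k * F k)) x" .
qed

text \<open>Abel summation of the inverse Fourier integral is convolution with the Poisson kernel,
  which converges at Lebesgue points. This is inversion without integrability of
  \<open>F\<close>.\<close>

lemma ift_wt_tendsto_AE:
 fixes f :: "real => complex"
 assumes fF: "ftp X f F" and per: "on_base X f"
 shows "AE x in lborel. ((\<lambda>e. ift X (\<lambda>k. wt e k * F k) x) \<longlongrightarrow> 2 * pi * f x) (at_right 0)"
proof -
 have f: "sqi (mX X) f" using fF by (auto simp: ftp_def)
 show ?thesis using AE_lebesgue_pt_sqi[OF f per]
 proof eventually_elim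
  case (elim x)
  from poisson_tendsto[OF f per elim] show ?case
  proof (rule Lim_transform_eventually)
   show "\<forall>\<^sub>F e in at_right 0. (LINT u|mX X. of_real (pk X e u) * f (x - u)) = ift X (\<lambda>k. wt e k * F k) x"
    by (rule eventually_at_rightI[of 0 1]) (auto intro: poisson_identity fF per)
  qed
 qed
qed

lemma wt_tendsto_sqn:
 assumes F: "sqi (nX X) F"
 shows "(\<lambda>n. sqn (nX X) (\<lambda>k. wt (eps n) k * F k - F k)) \<longlonglongrightarrow> 0"
proof -
 have [measurable]: "F \<in> bm" using F by (rule sqi_borel)
 have fin: "(\<integral>\<^sup>+k. (esq (F k)) \<partial>nX X) < \<infinity>" using F by (simp add: sqi_def sqn_def)
 have "(\<lambda>n. \<integral>\<^sup>+k. (esq (wt (eps n) k * F k - F k)) \<partial>nX X) \<longlonglongrightarrow> (\<integral>\<^sup>+k. 0 \<partial>nX X)"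
 proof (rule nn_integral_dominated_convergence[OF _ _ _ _ fin])
  show "AE k in nX X. (esq (wt (eps n) k * F k - F k)) <= (esq (F k))" for n
  proof (intro AE_I2 ennreal_leI power_mono norm_ge_zero)
   fix k
   have "wt (eps n) k * F k - F k = of_real (exp (- eps n * \<bar>k\<bar>) - 1) * F k" by (simp add: wt_def algebra_simps)
   then have "cmod (wt (eps n) k * F k - F k) = \<bar>exp (- eps n * \<bar>k\<bar>) - 1\<bar> * cmod (F k)" by (simp only: norm_mult norm_of_real)
   also have "... <= 1 * cmod (F k)"
   proof (intro mult_right_mono norm_ge_zero)
    have "0 < exp (- eps n * \<bar>k\<bar>)" "exp (- eps n * \<bar>k\<bar>) <= 1" by auto
    then show "\<bar>exp (- eps n * \<bar>k\<bar>) - 1\<bar> <= 1" by linarith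
   qed
   finally show "cmod (wt (eps n) k * F k - F k) <= cmod (F k)" by simp
  qed
  show "AE k in nX X. (\<lambda>n. (esq (wt (eps n) k * F k - F k))) \<longlonglongrightarrow> 0"
  proof (rule AE_I2)
   fix k
   have "(\<lambda>n. (esq (wt (eps n) k * F k - F k))) \<longlonglongrightarrow> (esq (1 * F k - F k))"
    by (intro tendsto_ennrealI tendsto_intros wt_eps_tendsto)
   then show "(\<lambda>n. (esq (wt (eps n) k * F k - F k))) \<longlonglongrightarrow> 0" by simp
  qed
 qed measurable
 then show ?thesis by (simp add: sqn_def)
qed

lemma inverse_Bessel_diff:
 assumes "sqi (nX X) F" "sqi (nX X) G" "integrable (nX X) F" "integrable (nX X) G"
 shows "sqn (mX X) (\<lambda>x. ift X F x - ift X G x) <= ennreal (2 * pi) * sqn (nX X) (\<lambda>k. F k - G k)"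
proof -
 have "sqn (mX X) (ift X (\<lambda>x. F x - G x)) <= ennreal (2 * pi) * sqn (nX X) (\<lambda>x. F x - G x)"
  using assms by (intro inverse_Bessel Bochner_Integration.integrable_diff sqi_diff)
 moreover have "ift X (\<lambda>x. F x - G x) = (\<lambda>k. ift X F k - ift X G k)"
  using assms by (simp add: fun_eq_iff ift_diff)
 ultimately show ?thesis by simp
qed

text \<open>Norm convergence from pointwise convergence: two Abel means are compared by
  \<open>inverse_Bessel\<close>, and one of them is sent to its limit by Fatou.\<close>

lemma ift_wt_tendsto_sqn:
 fixes f :: "real => complex"
 assumes fF: "ftp X f F" and per: "on_base X f"
 shows "(\<lambda>n. sqn (mX X) (\<lambda>x. ift X (\<lambda>z. wt (eps n) z * F z) x - 2 * pi * f x)) \<longlonglongrightarrow> 0"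
proof -
 have f: "sqi (mX X) f" and F: "sqi (nX X) F" using fF by (auto simp: ftp_def)
 have [measurable]: "f \<in> bm" "F \<in> bm" using f F by (auto dest: sqi_borel)
 have w: "sqi (nX X) (\<lambda>z. wt (eps n) z * F z)" "integrable (nX X) (\<lambda>z. wt (eps n) z * F z)" for n
  by (intro sqi_wt_mult integrable_wt_mult F; simp)+
 have ae: "AE x in mX X. (\<lambda>n. ift X (\<lambda>z. wt (eps n) z * F z) x) \<longlonglongrightarrow> 2 * pi * f x"
  using AE_mX_I[OF ift_wt_tendsto_AE[OF fF per]]
  by eventually_elim (rule filterlim_compose[OF _ eps_at_right])
 define b where "b n = sqn (nX X) (\<lambda>z. wt (eps n) z * F z - F z)" for n
 have le: "sqn (mX X) (\<lambda>x. ift X (\<lambda>z. wt (eps n) z * F z) x - 2 * pi * f x) <= ennreal (2 * pi) * b n" for n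
 proof (rule sqn_Fatou_bound[where f = "\<lambda>k x. ift X (\<lambda>z. wt (eps n) z * F z) x - ift X (\<lambda>z. wt (eps k) z * F z) x"])
  show "AE x in mX X. (\<lambda>k. ift X (\<lambda>z. wt (eps n) z * F z) x - ift X (\<lambda>z. wt (eps k) z * F z) x)
   \<longlonglongrightarrow> ift X (\<lambda>z. wt (eps n) z * F z) x - 2 * pi * f x"
   using ae by eventually_elim (intro tendsto_intros)
  show "\<forall>\<^sub>F k in sequentially. sqn (mX X) (\<lambda>x. ift X (\<lambda>z. wt (eps n) z * F z) x - ift X (\<lambda>z. wt (eps k) z * F z) x) <= ennreal (2 * pi) * b n"
   using eventually_ge_at_top[of n]
  proof eventually_elim
   case (elim k)
   have "sqn (mX X) (\<lambda>x. ift X (\<lambda>z. wt (eps n) z * F z) x - ift X (\<lambda>z. wt (eps k) z * F z) x)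
     <= ennreal (2 * pi) * sqn (nX X) (\<lambda>z. wt (eps n) z * F z - wt (eps k) z * F z)"
    by (rule inverse_Bessel_diff[OF w(1) w(1) w(2) w(2)])
   also have "... <= ennreal (2 * pi) * b n"
    unfolding b_def
   \<comment> \<open>For \<open>k\<close> beyond \<open>n\<close> the weight lies between that at
     \<open>n\<close> and 1, so the difference of the weights is largest in the limit.\<close>
   proof (intro mult_left_mono sqn_mono_AE AE_I2)
    fix z
    have "eps k <= eps n" using elim by (intro divide_left_mono) auto
    then have "- eps n * \<bar>z\<bar> <= - eps k * \<bar>z\<bar>" by (intro mult_right_mono) auto
    then have 1: "exp (- eps n * \<bar>z\<bar>) <= exp (- eps k * \<bar>z\<bar>)" by (simp only: exp_le_cancel_iff)
    have 2: "exp (- eps k * \<bar>z\<bar>) <= 1" by simp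
    have "cmod (wt (eps n) z * F z - wt (eps k) z * F z) = cmod (of_real (exp (- eps n * \<bar>z\<bar>) - exp (- eps k * \<bar>z\<bar>)) * F z)"
     by (simp add: wt_def algebra_simps)
    also have "... = \<bar>exp (- eps n * \<bar>z\<bar>) - exp (- eps k * \<bar>z\<bar>)\<bar> * cmod (F z)"
     by (simp only: norm_mult norm_of_real)
    also have "... <= \<bar>exp (- eps n * \<bar>z\<bar>) - 1\<bar> * cmod (F z)"
     using 1 2 by (intro mult_right_mono norm_ge_zero) linarith
    also have "... = cmod (of_real (exp (- eps n * \<bar>z\<bar>) - 1) * F z)" by (simp only: norm_mult norm_of_real)
    also have "... = cmod (wt (eps n) z * F z - F z)" by (simp add: wt_def algebra_simps)
    finally show "cmod (wt (eps n) z * F z - wt (eps k) z * F z) <= cmod (wt (eps n) z * F z - F z)" .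
   qed simp
   finally show ?case .
  qed
 qed measurable
 show ?thesis
  by (rule tendsto_0_le_ennreal[OF ennreal_cmult_tendsto_0[OF wt_tendsto_sqn[OF F], of "ennreal (2 * pi)"]])
    (simp, intro always_eventually allI le[unfolded b_def])
qed

text \<open>\<open>inverse_Bessel\<close> for the Abel means, and Fatou. The proof yields the factor
  \<open>1 / (2 * pi)\<close>, weakened to 1 for ease of use.\<close>

lemma ftp_lower:
 assumes fF: "ftp X f F" and per: "on_base X f"
 shows "sqn (mX X) f <= sqn (nX X) F"
proof -
 have f: "sqi (mX X) f" and F: "sqi (nX X) F" using fF by (auto simp: ftp_def)
 have [measurable]: "f \<in> bm" "F \<in> bm" using f F by (auto dest: sqi_borel)
 have "sqn (mX X) (\<lambda>x. 2 * pi * f x) <= ennreal (2 * pi) * sqn (nX X) F"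
 proof (rule sqn_Fatou_bound[where f = "\<lambda>n. ift X (\<lambda>k. wt (eps n) k * F k)"])
  show "AE x in mX X. (\<lambda>n. ift X (\<lambda>k. wt (eps n) k * F k) x) \<longlonglongrightarrow> complex_of_real (2 * pi) * f x"
   using AE_mX_I[OF ift_wt_tendsto_AE[OF fF per]]
   by eventually_elim (rule filterlim_compose[OF _ eps_at_right], simp)
  show "\<forall>\<^sub>F n in sequentially. sqn (mX X) (ift X (\<lambda>k. wt (eps n) k * F k)) <= ennreal (2 * pi) * sqn (nX X) F"
  proof (intro always_eventually allI)
   fix n
   have "sqn (mX X) (ift X (\<lambda>k. wt (eps n) k * F k)) <= ennreal (2 * pi) * sqn (nX X) (\<lambda>k. wt (eps n) k * F k)"
    using eps_pos[of n] by (intro inverse_Bessel integrable_wt_mult sqi_wt_mult F) auto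
   also have "... <= ennreal (2 * pi) * sqn (nX X) F"
    using norm_wt_le[of "eps n"]
    by (intro mult_left_mono sqn_mono_AE AE_I2) (auto simp: norm_mult intro!: mult_left_le_one_le)
   finally show "sqn (mX X) (ift X (\<lambda>k. wt (eps n) k * F k)) <= ennreal (2 * pi) * sqn (nX X) F" .
  qed
 qed measurable
 then have le: "ennreal ((2 * pi)^2) * sqn (mX X) f <= ennreal (2 * pi) * sqn (nX X) F"
  by (subst (asm) sqn_cmult) (auto simp: norm_mult)
 obtain a where a: "sqn (mX X) f = ennreal a" "a \<ge> 0" using f by (cases "sqn (mX X) f") (auto simp: sqi_def)
 obtain b where b: "sqn (nX X) F = ennreal b" "b \<ge> 0" using F by (cases "sqn (nX X) F") (auto simp: sqi_def)
 have "ennreal ((2 * pi)^2 * a) <= ennreal (2 * pi * b)" using le a b by (simp add: ennreal_mult)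
 then have "(2 * pi)^2 * a <= 2 * pi * b" using b by (subst (asm) ennreal_le_iff) auto
 then have "(2 * pi) * (2 * pi * a) <= (2 * pi) * b" by (simp add: power2_eq_square mult_ac)
 then have 1: "2 * pi * a <= b" by simp
 have "1 * a <= 2 * pi * a" using a pi_gt3 by (intro mult_right_mono) auto
 with 1 show ?thesis by (simp add: a b ennreal_leI)
qed

lemma ftp_zero_imp:
 assumes fF: "ftp X f F" and per: "on_base X f" and 0: "AE k in nX X. F k = 0"
 shows "AE x in lborel. f x = 0"
 using ift_wt_tendsto_AE[OF fF per]
proof eventually_elim
 case (elim x)
 have [measurable]: "F \<in> bm" using ftp_sqi(2)[OF fF] by (rule sqi_borel)
 have "ift X (\<lambda>k. wt e k * F k) x = 0" for e
 proof -
  have "ift X (\<lambda>k. wt e k * F k) x = (LINT k|nX X. 0)"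
   unfolding ift_def using 0 by (intro integral_cong_AE) auto
  then show ?thesis by simp
 qed
 then have "((\<lambda>e::real. 0) \<longlongrightarrow> 2 * pi * f x) (at_right 0)" using elim by simp
 then have "2 * pi * f x = 0" by (rule tendsto_unique[OF _ _ tendsto_const, rotated]) simp
 then show ?case by simp
qed

lemma ftp_inj:
 assumes "ftp X f F" "ftp X g G" "on_base X f" "on_base X g" "AE k in nX X. F k = G k"
 shows "AE x in lborel. f x = g x"
proof -
 have "AE x in lborel. f x - g x = 0"
 proof (rule ftp_zero_imp[OF ftp_diff[OF assms(1,2)]])
  show "on_base X (\<lambda>x. f x - g x)" by (rule on_base_compose2[OF assms(3,4)])
  show "AE k in nX X. F k - G k = 0" using assms(5) by eventually_elim simp
 qed
 then show ?thesis by eventually_elim simp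
qed

subsection \<open>Inversion\<close>

lemma lebesgue_pt_continuous:
 assumes "isCont f x"
 shows "lebesgue_pt f x"
 unfolding lebesgue_pt_def
proof (intro allI impI)
 fix e :: real assume eta: "e > 0"
 then obtain d where d: "d > 0" "\<And>y. dist y x < d ==> dist (f y) (f x) < e / 2"
  using assms unfolding continuous_at_eps_delta by (metis half_gt_zero)
 show "\<exists>r>0. \<forall>h. 0 < h \<and> h < r \<longrightarrow> (\<integral>\<^sup>+y. ennreal (cmod (f y - f x)) * indicator (ball x h) y \<partial>lborel) <= ennreal (e * h)"
 proof (intro exI[of _ d] conjI d allI impI)
  fix h assume h: "0 < h \<and> h < d"
  have "(\<integral>\<^sup>+y. ennreal (cmod (f y - f x)) * indicator (ball x h) y \<partial>lborel) <= (\<integral>\<^sup>+y. ennreal (e / 2) * indicator (ball x h) y \<partial>lborel)"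
  proof (rule nn_integral_mono)
   fix y
   have "cmod (f y - f x) <= e / 2" if "y \<in> ball x h"
   proof -
    have "dist y x < d" using that h by (simp add: dist_commute)
    from d(2)[OF this] show ?thesis by (simp add: dist_norm)
   qed
   then show "ennreal (cmod (f y - f x)) * indicator (ball x h) y <= ennreal (e / 2) * indicator (ball x h) y"
    by (cases "y \<in> ball x h") (auto intro: ennreal_leI)
  qed
  also have "... = ennreal (e / 2) * ennreal (2 * h)"
   using h by (subst nn_integral_cmult_indicator) (auto simp: emeasure_lborel_ball)
  also have "... = ennreal (e * h)" using h eta by (subst ennreal_mult[symmetric]) auto
  finally show "(\<integral>\<^sup>+y. ennreal (cmod (f y - f x)) * indicator (ball x h) y \<partial>lborel) <= ennreal (e * h)" .
 qed
qed

lemma uminus_frequencies: "k \<in> frequencies X ==> - k \<in> frequencies X"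
 by (cases X) auto

lemma integral_nX_Circle_point:
 assumes "a \<in> frequencies Circle"
 shows "(LINT k|nX Circle. indicator {0} (a - k) * (c::complex)) = c"
proof -
 have "(LINT k|nX Circle. indicator {0} (a - k) * c) = (LINT k|nX Circle. indicator {0} k * c)"
  by (rule integral_nX_reflect[OF assms]) measurable
 then show ?thesis using nX_zero[of Circle] by (simp add: nu0_def)
qed

lemma integrable_pk: "0 < e ==> e <= 1 ==> integrable (mX X) (\<lambda>u. complex_of_real (pk X e u))"
 by (rule integral_pk(1))

text \<open>On the line \<open>wt\<close> is also a function of space, with transform
  \<open>pk\<close>; inversion at a point of continuity gives the formula. On the circle the kernel
  is expanded and orthogonality picks one frequency.\<close>

lemma integral_pk_cis:
 assumes e: "0 < e" "e <= 1" and xi: "z \<in> frequencies X"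
 shows "(LINT u|mX X. cis (u * z) * of_real (pk X e u)) = 2 * pi * wt e z"
proof (cases X)
 case Line
 have h: "integrable (mX Line) (wt e)" "sqi (mX Line) (wt e)"
  using integrable_wt[OF e(1), of Line] sqi_wt[OF e(1), of Line] by simp_all
 have F: "ft0 Line (wt e) = (\<lambda>h. of_real (pk Line e h))"
 proof
  fix h
  have "ft0 Line (wt e) h = (LINT x|nX Line. wt e x * cis ((- h) * x))"
   by (simp add: ft0_def mult_ac)
  also have "... = of_real (pk Line e (- h))" by (rule integral_wt_cis[OF e(1)])
  finally show "ft0 Line (wt e) h = of_real (pk Line e h)" by (simp only: pk_even)
 qed
 have fF: "ftp Line (wt e) (\<lambda>h. of_real (pk Line e h))" using ftp_ft0[OF h] by (simp only: F)
 have ob: "on_base Line (wt e)" by (simp add: on_base_def)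
 have "isCont (wt e) z" unfolding wt_def by (intro continuous_intros)
 then have "lebesgue_pt (wt e) z" by (rule lebesgue_pt_continuous)
 from filterlim_compose[OF poisson_tendsto[OF h(2) ob this] eps_at_right]
 have l1: "(\<lambda>n. ift Line (\<lambda>h. wt (eps n) h * of_real (pk Line e h)) z) \<longlonglongrightarrow> 2 * pi * wt e z"
  by (simp only: poisson_identity(1)[OF fF ob eps_pos])
 have l2: "(\<lambda>n. ift Line (\<lambda>h. wt (eps n) h * of_real (pk Line e h)) z) \<longlonglongrightarrow> ift Line (\<lambda>h. 1 * of_real (pk Line e h)) z"
  unfolding ift_def
 proof (rule integral_dominated_convergence[where w = "\<lambda>h. pk Line e h"])
  show "integrable (nX Line) (pk Line e)"
   using integrable_norm[OF integrable_pk[OF e, of Line]] e by (simp add: pk_nonneg del: pk.simps)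
  show "AE h in nX Line. (\<lambda>n. cis (z * h) * (wt (eps n) h * of_real (pk Line e h))) \<longlonglongrightarrow> cis (z * h) * (1 * of_real (pk Line e h))"
   by (intro AE_I2 tendsto_intros wt_eps_tendsto)
  show "AE h in nX Line. cmod (cis (z * h) * (wt (eps n) h * of_real (pk Line e h))) <= pk Line e h" for n
   using norm_wt_le[of "eps n"] pk_nonneg[OF e(1), of Line]
   by (intro AE_I2) (auto simp: norm_mult intro!: mult_left_le_one_le simp del: pk.simps)
 qed measurable
 have "ift Line (\<lambda>h. 1 * of_real (pk Line e h)) z = 2 * pi * wt e z" by (rule LIMSEQ_unique[OF l2 l1])
 then show ?thesis by (simp add: ift_def Line mult.commute[of z] del: pk.simps)
next
 case Circle
 have w: "integrable (nX Circle) (wt e)" by (rule integrable_wt[OF e(1)])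
 have ic: "integrable (mX Circle) (\<lambda>u. cis (u * z))"
  by (rule integrable_le[OF integrable_const_Circle[of 1]]) auto
 have eq: "cis (u * z) * of_real (pk Circle e u) = (LINT h|nX Circle. cis (1 * h * (u - 0)) * cis (u * z) * wt e h)" for u
 proof -
  have "cis (1 * h * (u - 0)) * cis (u * z) * wt e h = cis (u * z) * (wt e h * cis (u * h))" for h by (simp add: mult_ac)
  then show ?thesis by (simp only: integral_mult_right_zero integral_wt_cis[OF e(1)])
 qed
 have "(LINT u|mX Circle. cis (u * z) * of_real (pk Circle e u)) = (LINT h|nX Circle. LINT u|mX Circle. cis (1 * h * (u - 0)) * cis (u * z) * wt e h)"
  unfolding eq by (rule Fubini_weighted[OF pair_sigma_finite_mn ic w cis_kernel_measurable, where C = 1]) simp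
 also have "... = (LINT h|nX Circle. indicator {0} (- z - h) * (2 * pi * wt e (- z)))"
 proof (rule integral_cong_AE)
  show "AE h in nX Circle. (LINT u|mX Circle. cis (1 * h * (u - 0)) * cis (u * z) * wt e h) = indicator {0} (- z - h) * (2 * pi * wt e (- z))"
   using AE_nX_frequencies
  proof eventually_elim
   case (elim h)
   then obtain k where k: "h = of_int k" by (auto elim: Ints_cases)
   obtain l where l: "z = of_int l" using xi Circle by (auto elim: Ints_cases)
   have "cis (1 * h * (u - 0)) * cis (u * z) * wt e h = cis (of_int (k + l) * u) * wt e h" for u
    by (simp add: k l cis_mult algebra_simps)
   then have "(LINT u|mX Circle. cis (1 * h * (u - 0)) * cis (u * z) * wt e h) = (if k + l = 0 then of_real (2 * pi) else 0) * wt e h"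
    by (simp only: integral_mult_left_zero integral_cis_Circle)
   moreover have "k + l = 0 \<longleftrightarrow> - z - h = 0" unfolding k l by linarith
   ultimately show ?case by (auto simp: indicator_def)
  qed
 qed (rule sigma_finite_measure.borel_measurable_lebesgue_integral[OF sigma_finite_mX], measurable)
 also have "... = 2 * pi * wt e (- z)"
  using xi Circle by (intro integral_nX_Circle_point) auto
 finally show ?thesis by (simp add: Circle)
qed

lemma pk_conv_cis:
 assumes e: "0 < e" "e <= 1" and xi: "k \<in> frequencies X"
 shows "(LINT y|mX X. cis (y * k) * of_real (pk X e (x - y))) = 2 * pi * (cis (x * k) * wt e k)"
proof -
 define G where "G u = cis ((x - u) * k) * complex_of_real (pk X e u)" for u
 have G: "integrable (mX X) G" unfolding G_def by (intro integrable_cis_mult integrable_pk e) simp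
 have "on_base X (\<lambda>u. cis (k * u))" by (rule cis_period[OF xi])
 from on_base_reflect[OF this, of x] have "on_base X (\<lambda>u. cis ((x - u) * k))" by (simp add: mult.commute)
 then have "on_base X G" unfolding G_def
  by (rule on_base_compose2[where h = "(*)"]) (rule on_base_compose[OF pk_periodic])
 from integral_mX_translate[OF G this, of x]
 have "(LINT y|mX X. cis (y * k) * of_real (pk X e (x - y))) = (LINT u|mX X. G u)"
  by (simp add: G_def)
 also have "... = (LINT u|mX X. cis (x * k) * (cis (u * (- k)) * of_real (pk X e u)))"
 proof (rule LINT_cong[OF refl])
  fix u
  have "cis ((x - u) * k) = cis (x * k) * cis (u * (- k))" by (simp add: cis_mult algebra_simps)
  then show "G u = cis (x * k) * (cis (u * (- k)) * of_real (pk X e u))" by (simp only: G_def mult.assoc)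
 qed
 also have "... = cis (x * k) * (2 * pi * wt e (- k))"
  by (simp only: integral_mult_right_zero integral_pk_cis[OF e uminus_frequencies[OF xi]])
 finally show ?thesis by (simp add: mult_ac)
qed

lemma integrable_pk_reflect: "0 < e ==> e <= 1 ==> integrable (mX X) (\<lambda>y. complex_of_real (pk X e (x - y)))"
 by (intro integrable_mX_translate[where f = "\<lambda>u. complex_of_real (pk X e u)"] integrable_pk on_base_compose[OF pk_periodic])

lemma pk_conv_ift:
 fixes K :: "real => complex"
 assumes K: "integrable (nX X) K" and e: "0 < e" "e <= 1"
 shows "(LINT y|mX X. of_real (pk X e (x - y)) * ift X K y) = 2 * pi * ift X (\<lambda>k. wt e k * K k) x"
proof -
 have [measurable]: "K \<in> bm" using K by auto
 have "(LINT y|mX X. of_real (pk X e (x - y)) * ift X K y) = (LINT y|mX X. LINT k|nX X. cis (y * k) * of_real (pk X e (x - y)) * K k)"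
 proof (rule LINT_cong[OF refl])
  fix y
  have "cis (y * k) * of_real (pk X e (x - y)) * K k = of_real (pk X e (x - y)) * (cis (y * k) * K k)" for k
   by (simp add: mult_ac)
  then show "of_real (pk X e (x - y)) * ift X K y = (LINT k|nX X. cis (y * k) * of_real (pk X e (x - y)) * K k)"
   by (simp only: ift_def integral_mult_right_zero)
 qed
 also have "... = (LINT k|nX X. LINT y|mX X. cis (y * k) * of_real (pk X e (x - y)) * K k)"
  by (rule Fubini_weighted[OF pair_sigma_finite_mn integrable_pk_reflect[OF e] K cis_measurable1, where C = 1]) simp
 also have "... = (LINT k|nX X. 2 * pi * (cis (x * k) * (wt e k * K k)))"
 proof (rule integral_cong_AE)
  show "AE k in nX X. (LINT y|mX X. cis (y * k) * of_real (pk X e (x - y)) * K k) = 2 * pi * (cis (x * k) * (wt e k * K k))"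
   using AE_nX_frequencies
  proof eventually_elim
   case (elim k)
   show ?case unfolding integral_mult_left_zero pk_conv_cis[OF e elim] by (simp add: mult_ac)
  qed
 qed (rule sigma_finite_measure.borel_measurable_lebesgue_integral[OF sigma_finite_mX], measurable)
 also have "... = 2 * pi * ift X (\<lambda>k. wt e k * K k) x" unfolding ift_def by (rule integral_mult_right_zero)
 finally show ?thesis .
qed

text \<open>On the line \<open>ift\<close> is the transform of \<open>K\<close> at the reflected
  point, so \<open>ftp_zero_imp\<close> applies with \<open>K\<close> as a function of space; on the
  circle the coefficients are recovered by orthogonality.\<close>

lemma ift_inj:
 fixes K :: "real => complex"
 assumes K: "integrable (nX X) K" "sqi (nX X) K" and 0: "\<And>x. ift X K x = 0"
 shows "AE z in nX X. K z = 0"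
proof (cases X)
 case Line
 have K': "integrable (mX Line) K" "sqi (mX Line) K" using K Line by simp_all
 have "ft0 Line K z = 0" for z using 0[of "- z"] by (simp add: ft0_def ift_def Line mult.commute)
 then have "AE x in lborel. K x = 0"
  by (intro ftp_zero_imp[OF ftp_ft0[OF K']]) (auto simp: on_base_def)
 then show ?thesis unfolding Line nX.simps .
next
 case Circle
 have [measurable]: "K \<in> bm" using K by auto
 have "K (of_int k) = 0" for k
 proof -
  have ic: "integrable (mX Circle) (\<lambda>u. cis (- (of_int k * u)))"
   by (rule integrable_le[OF integrable_const_Circle[of 1]]) auto
  have Kc: "integrable (nX Circle) K" using K Circle by simp
  have "0 = (LINT x|mX Circle. LINT z|nX Circle. cis (x * z) * cis (- (of_int k * x)) * K z)"
  proof -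
   have "(LINT z|nX Circle. cis (x * z) * cis (- (of_int k * x)) * K z) = cis (- (of_int k * x)) * ift Circle K x" for x
   proof -
    have "cis (x * z) * cis (- (of_int k * x)) * K z = cis (- (of_int k * x)) * (cis (x * z) * K z)" for z by (simp add: mult_ac)
    then show ?thesis by (simp only: ift_def integral_mult_right_zero)
   qed
   then show ?thesis using 0 Circle by simp
  qed
  also have "... = (LINT z|nX Circle. LINT x|mX Circle. cis (x * z) * cis (- (of_int k * x)) * K z)"
   by (rule Fubini_weighted[OF pair_sigma_finite_mn ic Kc cis_measurable1, where C = 1]) simp
  also have "... = (LINT z|nX Circle. indicator {0} (of_int k - z) * (2 * pi * K (of_int k)))"
  proof (rule integral_cong_AE)
   show "AE z in nX Circle. (LINT x|mX Circle. cis (x * z) * cis (- (of_int k * x)) * K z) = indicator {0} (of_int k - z) * (2 * pi * K (of_int k))"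
    using AE_nX_frequencies
   proof eventually_elim
    case (elim z)
    then obtain l where l: "z = of_int l" by (auto elim: Ints_cases)
    have "cis (x * z) * cis (- (of_int k * x)) * K z = cis (of_int (l - k) * x) * K z" for x
     by (simp add: l cis_mult algebra_simps)
    then have "(LINT x|mX Circle. cis (x * z) * cis (- (of_int k * x)) * K z) = (if l - k = 0 then of_real (2 * pi) else 0) * K z"
     by (simp only: integral_mult_left_zero integral_cis_Circle)
    then show ?case by (auto simp: indicator_def l)
   qed
  qed (rule sigma_finite_measure.borel_measurable_lebesgue_integral[OF sigma_finite_mX], measurable)
  also have "... = 2 * pi * K (of_int k)" by (rule integral_nX_Circle_point) auto
  finally show ?thesis by simp
 qed
 then show ?thesis unfolding Circle using AE_nX_frequencies[of Circle]
  by (auto elim!: eventually_mono Ints_cases)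
qed

lemma ift_on_base:
 assumes [measurable]: "F \<in> bm"
 shows "on_base X (ift X F)"
proof (cases X)
 case Circle
 have "ift Circle F (x + 2 * pi) = ift Circle F x" for x
  unfolding ift_def
 proof (rule integral_cong_AE)
  show "AE k in nX Circle. cis ((x + 2 * pi) * k) * F k = cis (x * k) * F k"
   using AE_nX_frequencies
  proof eventually_elim
   case (elim k)
   from cis_period[OF elim] have "cis (k * (x + 2 * pi)) = cis (k * x)" by (simp add: on_base_def)
   then show ?case by (simp only: mult.commute[of k])
  qed
 qed measurable
 then show ?thesis by (simp add: on_base_def Circle)
qed (simp add: on_base_def)

lemma sqi_ift:
 fixes K :: "real => complex"
 assumes "integrable (nX X) K" "sqi (nX X) K"
 shows "sqi (mX X) (ift X K)"
proof -
 have "K \<in> bm" using assms by (auto dest: sqi_borel)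
 moreover have "ennreal (2 * pi) * sqn (nX X) K < \<infinity>" using assms by (auto simp: sqi_def ennreal_mult_less_top)
 ultimately show ?thesis using inverse_Bessel[OF assms] by (auto simp: sqi_def intro: le_less_trans)
qed

text \<open>The Poisson integral of \<open>ift X K\<close> is computed twice, through its unknown
  transform \<open>K'\<close> and directly from \<open>K\<close>. By \<open>ift_inj\<close> the
  weighted transforms agree, and the weight vanishes nowhere.\<close>

lemma ftp_ift:
 fixes K :: "real => complex"
 assumes K: "integrable (nX X) K" "sqi (nX X) K"
 shows "ftp X (ift X K) (\<lambda>k. 2 * pi * K k)"
proof -
 have [measurable]: "K \<in> bm" using K by auto
 have s: "sqi (mX X) (ift X K)" by (rule sqi_ift[OF K])
 have ob: "on_base X (ift X K)" by (rule ift_on_base) measurable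
 obtain K' where K': "ftp X (ift X K) K'" using ftp_exists[OF s] by blast
 have sK': "sqi (nX X) K'" using K' by (auto simp: ftp_def)
 have w: "integrable (nX X) (\<lambda>k. wt 1 k * K' k)" "integrable (nX X) (\<lambda>k. wt 1 k * (2 * pi * K k))"
  "sqi (nX X) (\<lambda>k. wt 1 k * K' k)" "sqi (nX X) (\<lambda>k. wt 1 k * (2 * pi * K k))"
  by (intro integrable_wt_mult sqi_wt_mult sK' sqi_cmult[of "nX X" K "2 * pi"] K; simp)+
 have "ift X (\<lambda>k. wt 1 k * K' k) x = ift X (\<lambda>k. wt 1 k * (2 * pi * K k)) x" for x
 proof -
  have "ift X (\<lambda>k. wt 1 k * K' k) x = (LINT u|mX X. of_real (pk X 1 u) * ift X K (x - u))"
   by (rule poisson_identity(1)[OF K' ob, symmetric]) auto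
  also have "... = (LINT y|mX X. of_real (pk X 1 (x - y)) * ift X K y)"
   by (intro conv_swap sqi_pk pk_periodic s ob) auto
  also have "... = 2 * pi * ift X (\<lambda>k. wt 1 k * K k) x" by (rule pk_conv_ift[OF K(1)]) auto
  also have "... = ift X (\<lambda>k. 2 * pi * (wt 1 k * K k)) x" by (rule ift_cmult[symmetric])
  finally show ?thesis by (simp add: mult_ac)
 qed
 then have "ift X (\<lambda>k. wt 1 k * K' k - wt 1 k * (2 * pi * K k)) x = 0" for x
  by (subst ift_diff) (use w in auto)
 then have "AE k in nX X. wt 1 k * K' k - wt 1 k * (2 * pi * K k) = 0"
  using w by (intro ift_inj Bochner_Integration.integrable_diff sqi_diff) auto
 then have "AE k in nX X. K' k = 2 * pi * K k"
  by eventually_elim (simp add: wt_def)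
 then show ?thesis by (rule ftp_cong_right[OF K']) measurable
qed

text \<open>A limit in norm is only determined on the cell, whereas \<open>on_base\<close> is
  demanded at every point; so the values on one period are repeated.\<close>

fun periodize :: "base_space => (real => 'a) => real => 'a" where
 "periodize Line f x = f x"
| "periodize Circle f x = f (x - 2 * pi * of_int \<lfloor>(x + pi) / (2 * pi)\<rfloor>)"

lemma on_base_periodize: "on_base X (periodize X f)"
proof (cases X)
 case Circle
 have "(x + 2 * pi + pi) / (2 * pi) = (x + pi) / (2 * pi) + 1" for x by (simp add: field_simps)
 then have "\<lfloor>(x + 2 * pi + pi) / (2 * pi)\<rfloor> = \<lfloor>(x + pi) / (2 * pi)\<rfloor> + 1" for x by simp
 then show ?thesis by (simp add: on_base_def Circle algebra_simps)
qed (simp add: on_base_def)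

lemma periodize_measurable [measurable (raw)]:
 assumes [measurable]: "f \<in> bm"
 shows "periodize X f \<in> bm"
 by (cases X) (simp_all add: periodize.simps[abs_def])

lemma periodize_eq_AE: "AE x in mX X. periodize X f x = f x"
proof (cases X)
 case Circle
 have "AE x in lborel. x \<in> {-pi..pi} \<longrightarrow> periodize Circle f x = f x"
  using AE_lborel_singleton[of pi]
 proof eventually_elim
  case (elim x)
  show ?case
  proof
   assume x: "x \<in> {-pi..pi}"
   then have "0 <= (x + pi) / (2 * pi)" "(x + pi) / (2 * pi) < 1" using elim by (auto simp: field_simps)
   then have "\<lfloor>(x + pi) / (2 * pi)\<rfloor> = 0" by linarith
   then show "periodize Circle f x = f x" by simp
  qed
 qed
 then show ?thesis unfolding AE_mX_iff Circle by simp
qed simp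

text \<open>The inverse transforms of the Abel-weighted \<open>G\<close> form a Cauchy sequence by
  \<open>ftp_lower\<close>, and the relation passes to their limit.\<close>

proposition ftp_surj:
 assumes G: "sqi (nX X) G"
 obtains g where "on_base X g" "ftp X g G"
proof -
 have [measurable]: "G \<in> bm" using G by (rule sqi_borel)
 define K where "K n k = (1 / (2 * pi)) * (wt (eps n) k * G k)" for n k
 have K: "integrable (nX X) (K n)" "sqi (nX X) (K n)" for n
  unfolding K_def by (intro integrable_mult_right integrable_wt_mult sqi_cmult sqi_wt_mult G; simp)+
 have eqK: "(\<lambda>k. 2 * pi * K n k) = (\<lambda>k. wt (eps n) k * G k)" for n by (simp add: K_def fun_eq_iff)
 have ft: "ftp X (ift X (K n)) (\<lambda>k. wt (eps n) k * G k)" for n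
  using ftp_ift[OF K] by (simp only: eqK)
 define b where "b n = sqn (nX X) (\<lambda>k. wt (eps n) k * G k - G k)" for n
 have b: "(\<lambda>n. 2 * b n) \<longlonglongrightarrow> 0"
  unfolding b_def by (intro ennreal_cmult_tendsto_0 wt_tendsto_sqn G) simp
 obtain g where g: "sqi (mX X) g" "(\<lambda>n. sqn (mX X) (\<lambda>x. ift X (K n) x - g x)) \<longlonglongrightarrow> 0"
 proof (rule sqi_complete)
  show "sqi (mX X) (ift X (K n))" for n by (rule sqi_ift[OF K])
  fix e :: real assume e: "e > 0"
  have "\<forall>\<^sub>F n in sequentially. 2 * b n < ennreal (e / 2)"
   using e by (intro order_tendstoD(2)[OF b]) simp
  then obtain N where N: "\<And>n. n \<ge> N ==> 2 * b n < ennreal (e / 2)" by (auto simp: eventually_sequentially)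
  show "\<exists>N. \<forall>m\<ge>N. \<forall>n\<ge>N. sqn (mX X) (\<lambda>x. ift X (K m) x - ift X (K n) x) <= ennreal e"
  proof (intro exI[of _ N] allI impI)
   fix m n assume mn: "m \<ge> N" "n \<ge> N"
   have "sqn (mX X) (\<lambda>x. ift X (K m) x - ift X (K n) x) <= sqn (nX X) (\<lambda>k. wt (eps m) k * G k - wt (eps n) k * G k)"
   proof (rule ftp_lower[OF ftp_diff[OF ft ft]])
    have "K n \<in> bm" for n unfolding K_def by measurable
    then show "on_base X (\<lambda>x. ift X (K m) x - ift X (K n) x)"
     by (intro on_base_compose2[where h = "(-)"] ift_on_base)
   qed
   also have "... <= 2 * b m + 2 * sqn (nX X) (\<lambda>k. G k - wt (eps n) k * G k)"
    unfolding b_def by (rule sqn_triangle) auto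
   also have "sqn (nX X) (\<lambda>k. G k - wt (eps n) k * G k) = b n" unfolding b_def by (rule sqn_minus_commute)
   also have "2 * b m + 2 * b n <= ennreal (e / 2) + ennreal (e / 2)" using N mn by (intro add_mono) (auto intro: less_imp_le)
   also have "... = ennreal e" using e by (simp add: ennreal_plus[symmetric] del: ennreal_plus)
   finally show "sqn (mX X) (\<lambda>x. ift X (K m) x - ift X (K n) x) <= ennreal e" .
  qed
 qed
 have "ftp X g G" by (rule ftp_limit[OF ft g(1) G g(2) wt_tendsto_sqn[OF G]])
 moreover have "AE x in mX X. g x = periodize X g x"
  using periodize_eq_AE[of X g] by eventually_elim simp
 ultimately have "ftp X (periodize X g) G"
  by (rule ftp_cong_left) (use g in \<open>auto dest: sqi_borel\<close>)
 then show ?thesis using that on_base_periodize by blast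
qed

subsection \<open>Parseval and products\<close>

text \<open>The bilinear form of the identity: without conjugation the second transform is
  reflected. Abel weights justify Fubini and are then removed by continuity of the pairing.\<close>

proposition Parseval:
 fixes f g F G :: "real => complex"
 assumes fF: "ftp X f F" and gG: "ftp X g G" and per: "on_base X f"
 shows "2 * pi * (LINT x|mX X. f x * g x) = (LINT z|nX X. F z * G (- z))"
proof -
 have s: "sqi (mX X) f" "sqi (mX X) g" "sqi (nX X) F" "sqi (nX X) G" using fF gG by (auto simp: ftp_def)
 have [measurable]: "f \<in> bm" "F \<in> bm" "g \<in> bm" "G \<in> bm"
  using s by (auto dest: sqi_borel)
 have refl_sqn: "sqn (nX X) (\<lambda>z. A (- z)) = sqn (nX X) A" if "A \<in> bm" for A
 proof -
  have "(\<integral>\<^sup>+z. (\<lambda>z. (esq (A z))) (0 - z) \<partial>nX X) = (\<integral>\<^sup>+z. (esq (A z)) \<partial>nX X)"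
   using that by (intro nn_integral_nX_reflect) auto
  then show ?thesis by (simp add: sqn_def)
 qed
 have refl_sqi: "sqi (nX X) (\<lambda>z. A (- z))" if "sqi (nX X) A" for A
 proof -
  have [measurable]: "A \<in> bm" using that by (rule sqi_borel)
  have "(\<lambda>z. A (- z)) \<in> bm" by measurable
  then show ?thesis using that refl_sqn[of A] by (simp add: sqi_def)
 qed
 have w: "integrable (nX X) (\<lambda>z. wt (eps n) z * F z)" "sqi (nX X) (\<lambda>z. wt (eps n) z * F z)" for n
  by (intro integrable_wt_mult sqi_wt_mult s; simp)+
 have 1: "(LINT x|mX X. ift X (\<lambda>z. wt (eps n) z * F z) x * g x) = (LINT z|nX X. (wt (eps n) z * F z) * G (- z))" for n
 proof -
  have eq: "(LINT x|mX X. cut (real k) g x * ift X (\<lambda>z. wt (eps n) z * F z) x) = (LINT z|nX X. ft0 X (cut (real k) g) (- z) * (wt (eps n) z * F z))" for k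
  proof -
   have "(LINT x|mX X. cut (real k) g x * ift X (\<lambda>z. wt (eps n) z * F z) x) = (LINT x|mX X. LINT z|nX X. cis (x * z) * cut (real k) g x * (wt (eps n) z * F z))"
   proof (rule LINT_cong[OF refl])
    fix x
    have "cis (x * z) * cut (real k) g x * (wt (eps n) z * F z) = cut (real k) g x * (cis (x * z) * (wt (eps n) z * F z))" for z
     by (simp only: mult_ac)
    then show "cut (real k) g x * ift X (\<lambda>z. wt (eps n) z * F z) x = (LINT z|nX X. cis (x * z) * cut (real k) g x * (wt (eps n) z * F z))"
     by (simp only: ift_def integral_mult_right_zero)
   qed
   also have "... = (LINT z|nX X. LINT x|mX X. cis (x * z) * cut (real k) g x * (wt (eps n) z * F z))"
    by (rule Fubini_weighted[OF pair_sigma_finite_mn integrable_cut[OF s(2)] w(1) cis_measurable1, where C = 1]) simp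
   finally show ?thesis by (simp add: ft0_def)
  qed
  have "(\<lambda>k. LINT x|mX X. cut (real k) g x * ift X (\<lambda>z. wt (eps n) z * F z) x) \<longlonglongrightarrow> (LINT x|mX X. g x * ift X (\<lambda>z. wt (eps n) z * F z) x)"
   by (intro sqi_tendsto_integral sqi_cut s sqi_ift w filterlim_compose[OF sqn_cut_tendsto[OF s(2)] filterlim_real_sequentially])
  moreover have "(\<lambda>k. LINT z|nX X. ft0 X (cut (real k) g) (- z) * (wt (eps n) z * F z)) \<longlonglongrightarrow> (LINT z|nX X. G (- z) * (wt (eps n) z * F z))"
  proof (rule sqi_tendsto_integral)
   show "sqi (nX X) (\<lambda>z. ft0 X (cut (real k) g) (- z))" for k by (intro refl_sqi sqi_ft0 integrable_cut sqi_cut s)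
   show "sqi (nX X) (\<lambda>z. G (- z))" by (intro refl_sqi s)
   have "sqn (nX X) (\<lambda>z. ft0 X (cut (real k) g) (- z) - G (- z)) = sqn (nX X) (\<lambda>z. G z - ft0 X (cut (real k) g) z)" for k
    by (subst refl_sqn[of "\<lambda>z. ft0 X (cut (real k) g) z - G z"]) (auto intro: sqn_minus_commute)
   then show "(\<lambda>k. sqn (nX X) (\<lambda>z. ft0 X (cut (real k) g) (- z) - G (- z))) \<longlonglongrightarrow> 0"
    using filterlim_compose[OF ftp_tendsto[OF gG] filterlim_real_sequentially] by simp
  qed (rule w)
  ultimately show ?thesis unfolding eq using LIMSEQ_unique by (fastforce simp: mult.commute)
 qed
 have "(\<lambda>n. LINT x|mX X. ift X (\<lambda>z. wt (eps n) z * F z) x * g x) \<longlonglongrightarrow> (LINT x|mX X. 2 * pi * f x * g x)"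
  by (intro sqi_tendsto_integral sqi_ift w s sqi_cmult[of "mX X" f "2 * pi"] ift_wt_tendsto_sqn fF per)
 moreover have "(\<lambda>n. LINT z|nX X. (wt (eps n) z * F z) * G (- z)) \<longlonglongrightarrow> (LINT z|nX X. F z * G (- z))"
  by (intro sqi_tendsto_integral w s refl_sqi wt_tendsto_sqn)
 ultimately have "(LINT x|mX X. 2 * pi * f x * g x) = (LINT z|nX X. F z * G (- z))"
  unfolding 1 by (rule LIMSEQ_unique)
 then show ?thesis by (simp only: mult.assoc integral_mult_right_zero)
qed

lemma ftp_modulate:
 assumes gG: "ftp X g G" and a: "a \<in> frequencies X"
 shows "ftp X (\<lambda>x. cis (- (x * a)) * g x) (\<lambda>k. G (a + k))"
proof -
 have s: "sqi (mX X) g" "sqi (nX X) G" using gG by (auto simp: ftp_def)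
 have [measurable]: "g \<in> bm" "G \<in> bm" using s by (auto dest: sqi_borel)
 have shift: "sqn (nX X) (\<lambda>k. A (a + k)) = sqn (nX X) A" if [measurable]: "A \<in> bm" for A
 proof -
  have "(\<integral>\<^sup>+k. (\<lambda>z. (esq (A (a - z)))) (0 - k) \<partial>nX X) = (\<integral>\<^sup>+z. (esq (A (a - z))) \<partial>nX X)"
   by (intro nn_integral_nX_reflect) auto
  also have "... = (\<integral>\<^sup>+z. (esq (A z)) \<partial>nX X)"
   by (intro nn_integral_nX_reflect[where f = "\<lambda>z. (esq (A z))"] a) auto
  finally show ?thesis by (simp add: sqn_def)
 qed
 have eq: "ft0 X (cut R (\<lambda>x. cis (- (x * a)) * g x)) k = ft0 X (cut R g) (a + k)" for R k
  unfolding ft0_def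
 proof (rule LINT_cong[OF refl])
  fix x
  have "cis (- (x * k)) * cis (- (x * a)) = cis (- (x * (a + k)))" by (simp add: cis_mult algebra_simps)
  then show "cis (- (x * k)) * cut R (\<lambda>x. cis (- (x * a)) * g x) x = cis (- (x * (a + k))) * cut R g x"
   by (simp add: cut_def mult_ac)
 qed
 show ?thesis
  unfolding ftp_def eq
 proof (intro conjI)
  show "sqi (mX X) (\<lambda>x. cis (- (x * a)) * g x)" by (rule sqi_bounded_mult[OF s(1), where C = 1]) auto
  show "sqi (nX X) (\<lambda>k. G (a + k))" using s(2) shift[of G] by (simp add: sqi_def)
  have "sqn (nX X) (\<lambda>k. G (a + k) - ft0 X (cut R g) (a + k)) = sqn (nX X) (\<lambda>k. G k - ft0 X (cut R g) k)" for R
   by (rule shift[of "\<lambda>k. G k - ft0 X (cut R g) k"]) measurable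
  then show "((\<lambda>R. sqn (nX X) (\<lambda>k. G (a + k) - ft0 X (cut R g) (a + k))) \<longlongrightarrow> 0) at_top"
   using ftp_tendsto[OF gG] by simp
 qed
qed

section \<open>The Hilbert transform\<close>

lemma sqi_hilb: "sqi (nX X) F ==> sqi (nX X) (\<lambda>k. hilb k * F k)"
 by (rule sqi_bounded_mult[where C = 1]) (auto simp: norm_hilb_le)

text \<open>At a Lebesgue point the truncated integral may be replaced by the conjugate Poisson
  integral, which is the Abel mean of \<open>hilb k * F k\<close> and tends to
  \<open>2 * pi * g\<close> almost everywhere.\<close>

proposition truncated_tendsto:
 fixes f g :: "real => complex"
 assumes fF: "ftp X f F" "on_base X f" and g: "ftp X g (\<lambda>k. hilb k * F k)" "on_base X g"
 shows "AE x in lborel. ((\<lambda>e. LINT u|mX X. of_real (tk X e u) * f (x - u)) \<longlongrightarrow> 2 * pi * g x) (at_right 0)"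
proof -
 have f: "sqi (mX X) f" using fF by (auto simp: ftp_def)
 show ?thesis using AE_lebesgue_pt_sqi[OF f fF(2)] ift_wt_tendsto_AE[OF g]
 proof eventually_elim
  case (elim x)
  have "((\<lambda>e. LINT u|mX X. of_real (qk X e u) * f (x - u)) \<longlongrightarrow> 2 * pi * g x) (at_right 0)"
  proof (rule Lim_transform_eventually[OF elim(2)])
   show "\<forall>\<^sub>F e in at_right 0. ift X (\<lambda>k. wt e k * (hilb k * F k)) x = (LINT u|mX X. of_real (qk X e u) * f (x - u))"
    by (rule eventually_at_rightI[of 0 1]) (auto intro: poisson_identity(2)[symmetric] fF)
  qed
  from tendsto_add[OF truncated_minus_qk_tendsto_0[OF f fF(2) elim(1)] this] show ?case by simp
 qed
qed

lemma AE_nX_reflect: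
 assumes "a \<in> frequencies X" "{k. P k} \<in> sets borel" "AE k in nX X. P k"
 shows "AE k in nX X. P (a - k)"
proof -
 have "AE k in distr (nX X) borel (\<lambda>k. a - k). P k" using assms(3) by (simp only: distr_nX_reflect[OF assms(1)])
 then show ?thesis by (subst (asm) AE_distr_iff) (use assms(2) in auto)
qed

lemma sqi_bounded_product:
 assumes P: "sqi (mX X) P" and Q: "sqi (mX X) Q" and bd: "AE x in mX X. cmod (P x) <= C"
 shows "sqi (mX X) (\<lambda>x. P x * Q x)" "integrable (mX X) (\<lambda>x. P x * Q x)"
proof -
 have "P \<in> bm" using P by (rule sqi_borel)
 then show "sqi (mX X) (\<lambda>x. P x * Q x)" by (intro sqi_bounded_mult[OF Q _ bd]) simp
 show "integrable (mX X) (\<lambda>x. P x * Q x)" by (rule sqi_integrable_mult[OF P Q])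
qed

text \<open>The frequencies of a product are sums of frequencies of the factors, so a product of two
 functions with frequencies on one side has its frequencies on that side.\<close>

lemma one_sided_product:
 fixes P Q :: "real => complex"
 assumes P: "ftp X P F" "on_base X P" and Q: "ftp X Q G" and bd: "AE x in mX X. cmod (P x) <= C"
  and s: "s = 1 \<or> s = (-1::real)"
  and F0: "AE k in nX X. s * k < 0 \<longrightarrow> F k = 0" and G0: "AE k in nX X. s * k < 0 \<longrightarrow> G k = 0"
  and Fz: "X = Circle ==> F 0 = 0"
 shows "ftp X (\<lambda>x. P x * Q x) (ft0 X (\<lambda>x. P x * Q x))"
  and "AE k in nX X. hilb k * ft0 X (\<lambda>x. P x * Q x) k = - \<i> * of_real s * ft0 X (\<lambda>x. P x * Q x) k"
proof -
 have s2: "sqi (mX X) P" "sqi (mX X) Q" "sqi (nX X) F" "sqi (nX X) G" using P Q by (auto simp: ftp_def)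
 have [measurable]: "P \<in> bm" "F \<in> bm" "Q \<in> bm" "G \<in> bm"
  using s2 by (auto dest: sqi_borel)
 note PQ = sqi_bounded_product[OF s2(1,2) bd]
 show "ftp X (\<lambda>x. P x * Q x) (ft0 X (\<lambda>x. P x * Q x))" by (rule ftp_ft0[OF PQ(2,1)])
 have zero: "ft0 X (\<lambda>x. P x * Q x) a = 0" if a: "a \<in> frequencies X" and neg: "s * a < 0 \<or> (X = Circle \<and> a = 0)" for a
 proof -
  \<comment> \<open>A single frequency of the product is the Parseval pairing of one factor with the
    modulated other, that is, a convolution of the two transforms.\<close>
  have "2 * pi * ft0 X (\<lambda>x. P x * Q x) a = 2 * pi * (LINT x|mX X. P x * (cis (- (x * a)) * Q x))"
   by (simp add: ft0_def mult_ac)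
  also have "... = (LINT k|nX X. F k * G (a + - k))"
   by (rule Parseval[OF P(1) ftp_modulate[OF Q a] P(2)])
  also have "... = (LINT k|nX X. 0)"
  proof (rule integral_cong_AE)
   have "AE k in nX X. s * (a - k) < 0 \<longrightarrow> G (a - k) = 0"
    by (rule AE_nX_reflect[OF a _ G0]) measurable
   then show "AE k in nX X. F k * G (a + - k) = 0"
    using F0
   proof eventually_elim
    case (elim k)
    show ?case
    proof (cases "F k = 0")
     case False
     then have "0 <= s * k" using elim(2) by linarith
     \<comment> \<open>For \<open>a = 0\<close> on the circle both arguments could vanish together;
       \<open>F 0 = 0\<close> excludes this and makes the inequality below strict.\<close>
     moreover have "s * a < 0 \<or> (s * a = 0 \<and> s * k \<noteq> 0)" using neg Fz False s by auto
     ultimately have "s * (a - k) < 0" unfolding right_diff_distrib by linarith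
     then show ?thesis using elim(1) by simp
    qed simp
   qed
  qed measurable
  finally show ?thesis by simp
 qed
 have nz: "AE k in nX X. X = Line \<longrightarrow> k \<noteq> 0"
 proof (cases X)
  case Line
  have "AE k in nX Line. k \<noteq> 0" unfolding nX.simps by (rule AE_lborel_singleton)
  then show ?thesis unfolding Line by eventually_elim simp
 qed simp
 show "AE k in nX X. hilb k * ft0 X (\<lambda>x. P x * Q x) k = - \<i> * of_real s * ft0 X (\<lambda>x. P x * Q x) k"
  using AE_nX_frequencies nz
 proof eventually_elim
  case (elim k)
  show ?case
  proof (cases "s * k < 0 \<or> (X = Circle \<and> k = 0)")
   case True
   then show ?thesis using zero[OF elim(1)] by simp
  next
   case False
   then have "k \<noteq> 0" using elim(2) by (cases X) auto
   then have "sgn k = s" using s False by (auto simp: sgn_real_def)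
   then show ?thesis by (simp add: hilb_def)
  qed
 qed
qed

text \<open>The transform of \<open>P s = f + i s Hf\<close> is \<open>F k\<close> times
  \<open>1 + s * sgn k\<close>, so it lives on the side of \<open>s\<close>, and on products of two
  such functions \<open>hilb\<close> acts as \<open>- i s\<close>. The products for
  \<open>s = 1\<close> and \<open>s = -1\<close> recombine into the two stated expressions. Bounds
  on \<open>f\<close> and \<open>Hf\<close> keep the products square-integrable. On the circle the
  mean must vanish: for \<open>f = g = 1\<close> the identity would read
  \<open>0 = -1\<close>.\<close>

proposition Cotlar:
 fixes f g Hf Hg :: "real => complex"
 assumes f: "ftp X f F" "on_base X f" and Hf: "ftp X Hf (\<lambda>k. hilb k * F k)" "on_base X Hf"
  and g: "ftp X g G" and Hg: "ftp X Hg (\<lambda>k. hilb k * G k)"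
  and bd: "AE x in mX X. cmod (f x) <= C" "AE x in mX X. cmod (Hf x) <= C"
  and Fz: "X = Circle ==> F 0 = 0"
 obtains U where "ftp X (\<lambda>x. Hf x * g x + f x * Hg x) U" "ftp X (\<lambda>x. Hf x * Hg x - f x * g x) (\<lambda>k. hilb k * U k)"
proof -
 have s2: "sqi (mX X) f" "sqi (mX X) g" "sqi (mX X) Hf" "sqi (mX X) Hg" "sqi (nX X) F" "sqi (nX X) G"
  using f g Hf Hg by (auto simp: ftp_def)
 have [measurable]: "f \<in> bm" "F \<in> bm" "g \<in> bm" "G \<in> bm"
  "Hf \<in> bm" "Hg \<in> bm"
  using s2 by (auto dest: sqi_borel)
 define P where "P s x = f x + (\<i> * of_real s) * Hf x" for s :: real and x
 define Q where "Q s x = g x + (\<i> * of_real s) * Hg x" for s :: real and x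
 define A where "A s x = P s x * Q s x" for s x
 have P: "ftp X (P s) (\<lambda>k. F k + (\<i> * of_real s) * (hilb k * F k))" for s
  unfolding P_def by (intro ftp_add f ftp_cmult Hf)
 have Q: "ftp X (Q s) (\<lambda>k. G k + (\<i> * of_real s) * (hilb k * G k))" for s
  unfolding Q_def by (intro ftp_add g ftp_cmult Hg)
 have Pb: "AE x in mX X. cmod (P s x) <= 2 * C" if "s = 1 \<or> s = -1" for s
  using bd
 proof eventually_elim
  case (elim x)
  have "cmod (P s x) <= cmod (f x) + cmod ((\<i> * of_real s) * Hf x)" unfolding P_def by (rule norm_triangle_ineq)
  also have "cmod ((\<i> * of_real s) * Hf x) = cmod (Hf x)" using that by (auto simp: norm_mult)
  finally show ?case using elim by simp
 qed
 have z: "Z k + (\<i> * of_real s) * (hilb k * Z k) = 0" if "s = 1 \<or> s = -1" "s * k < 0" for s k and Z :: "real => complex"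
  using that by (auto simp: hilb_def sgn_real_def)
 have Pb': "on_base X (P s)" for s unfolding P_def by (rule on_base_compose2[OF f(2) Hf(2)])
 have A: "ftp X (A s) (ft0 X (A s))" "AE k in nX X. hilb k * ft0 X (A s) k = - \<i> * of_real s * ft0 X (A s) k"
  if s: "s = 1 \<or> s = -1" for s
  unfolding A_def
  by (rule one_sided_product[OF P Pb' Q Pb[OF s] s]; use z[OF s] Fz in \<open>auto\<close>)+
 define U where "U k = (1 / (2 * \<i>)) * ft0 X (A 1) k + (- 1 / (2 * \<i>)) * ft0 X (A (-1)) k" for k
 have [measurable]: "A s \<in> bm" for s unfolding A_def P_def Q_def by measurable
 have "ftp X (\<lambda>x. (1 / (2 * \<i>)) * A 1 x + (- 1 / (2 * \<i>)) * A (-1) x) U"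
  unfolding U_def by (intro ftp_lin A) auto
 moreover have "(\<lambda>x. (1 / (2 * \<i>)) * A 1 x + (- 1 / (2 * \<i>)) * A (-1) x) = (\<lambda>x. Hf x * g x + f x * Hg x)"
  by (simp add: fun_eq_iff A_def P_def Q_def field_simps)
 ultimately have 1: "ftp X (\<lambda>x. Hf x * g x + f x * Hg x) U" by simp
 have "ftp X (\<lambda>x. (- 1 / 2) * A 1 x + (- 1 / 2) * A (-1) x) (\<lambda>k. (- 1 / 2) * ft0 X (A 1) k + (- 1 / 2) * ft0 X (A (-1)) k)"
  by (intro ftp_lin A) auto
 moreover have "(\<lambda>x. (- 1 / 2) * A 1 x + (- 1 / 2) * A (-1) x) = (\<lambda>x. Hf x * Hg x - f x * g x)"
  by (simp add: fun_eq_iff A_def P_def Q_def field_simps)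
 ultimately have 2: "ftp X (\<lambda>x. Hf x * Hg x - f x * g x) (\<lambda>k. (- 1 / 2) * ft0 X (A 1) k + (- 1 / 2) * ft0 X (A (-1)) k)" by simp
 have a1: "AE k in nX X. hilb k * ft0 X (A 1) k = - \<i> * ft0 X (A 1) k" using A(2)[of 1] by simp
 have a2: "AE k in nX X. hilb k * ft0 X (A (-1)) k = \<i> * ft0 X (A (-1)) k" using A(2)[of "-1"] by simp
 have "AE k in nX X. (- 1 / 2) * ft0 X (A 1) k + (- 1 / 2) * ft0 X (A (-1)) k = hilb k * U k"
  using a1 a2
 proof eventually_elim
  case (elim k)
  have "hilb k * U k = (1 / (2 * \<i>)) * (hilb k * ft0 X (A 1) k) + (- 1 / (2 * \<i>)) * (hilb k * ft0 X (A (-1)) k)"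
   by (simp add: U_def algebra_simps)
  also have "... = (1 / (2 * \<i>)) * (- \<i> * ft0 X (A 1) k) + (- 1 / (2 * \<i>)) * (\<i> * ft0 X (A (-1)) k)"
   by (simp only: elim)
  also have "... = (- 1 / 2) * ft0 X (A 1) k + (- 1 / 2) * ft0 X (A (-1)) k" by (simp add: field_simps)
  finally show ?case by simp
 qed
 then have "ftp X (\<lambda>x. Hf x * Hg x - f x * g x) (\<lambda>k. hilb k * U k)"
  by (rule ftp_cong_right[OF 2]) (unfold U_def, measurable)
 with 1 show ?thesis using that by blast
qed

subsection \<open>Supremum bounds\<close>

text \<open>On the circle the sum over the integers is compared with an integral: the value of the
  kernel at \<open>n\<close> is at most 4 times its value anywhere on the unit interval starting at
  \<open>n\<close>.\<close>

lemma nn_integral_nX_pw: "(\<integral>\<^sup>+k. ennreal (pw 1 k) \<partial>nX X) <= ennreal (4 * pi)"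
proof (cases X)
 case Line
 then show ?thesis by (simp add: nn_integral_pw ennreal_leI)
next
 case Circle
 have aux: "1 + b <= 4 * (1 + c)" if "a <= (1::real)" "b <= 2 * a + 2 * c" "0 <= c" for a b c
  using that by (simp add: distrib_left)
 have le: "pw 1 (real_of_int n) <= 4 * pw 1 x" if "x \<in> {real_of_int n..<real_of_int n + 1}" for n x
 proof -
  have "\<bar>x - real_of_int n\<bar> <= 1" using that by auto
  then have "(x - real_of_int n)^2 <= 1" by (simp add: abs_square_le_1)
  moreover have "x\<^sup>2 <= 2 * (x - real_of_int n)^2 + 2 * (real_of_int n)^2"
   using sum_squares_bound[of "x - real_of_int n" "real_of_int n"] power2_sum[of "x - real_of_int n" "real_of_int n"] by simp
  ultimately have "1 + x^2 <= 4 * (1 + (real_of_int n)^2)" using aux zero_le_power2[of "real_of_int n"] by blast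
  moreover have "1 + x^2 > 0" "1 + (real_of_int n)^2 > 0" by (simp_all add: add_pos_nonneg)
  ultimately have "1 / (1 + (real_of_int n)^2) <= 4 / (1 + x^2)" by (simp add: divide_simps mult.commute)
  then show ?thesis by (simp add: pw_def)
 qed
 have "(\<integral>\<^sup>+k. ennreal (pw 1 k) \<partial>nX X) = (\<integral>\<^sup>+n. ennreal (pw 1 (real_of_int n)) \<partial>count_space UNIV)"
  by (simp add: Circle nn_integral_distr)
 also have "... <= (\<integral>\<^sup>+n. \<integral>\<^sup>+x. ennreal (4 * pw 1 x) * indicator {real_of_int n..<real_of_int n + 1} x \<partial>lborel \<partial>count_space UNIV)"
 proof (rule nn_integral_mono)
  fix n :: int
  have "ennreal (pw 1 (real_of_int n)) = (\<integral>\<^sup>+x. ennreal (pw 1 (real_of_int n)) * indicator {real_of_int n..<real_of_int n + 1} x \<partial>lborel)"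
   by (subst nn_integral_cmult_indicator) auto
  also have "... <= (\<integral>\<^sup>+x. ennreal (4 * pw 1 x) * indicator {real_of_int n..<real_of_int n + 1} x \<partial>lborel)"
   using le[of _ n] by (intro nn_integral_mono) (auto simp: indicator_def intro: ennreal_leI)
  finally show "ennreal (pw 1 (real_of_int n)) <= (\<integral>\<^sup>+x. ennreal (4 * pw 1 x) * indicator {real_of_int n..<real_of_int n + 1} x \<partial>lborel)" .
 qed
 also have "... = (\<integral>\<^sup>+x. \<integral>\<^sup>+n. ennreal (4 * pw 1 x) * indicator {real_of_int n..<real_of_int n + 1} x \<partial>count_space UNIV \<partial>lborel)"
  by (intro nn_integral_count_space_nn_integral[symmetric]) auto
 also have "... = (\<integral>\<^sup>+x. ennreal (4 * pw 1 x) \<partial>lborel)"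
 proof (rule nn_integral_cong)
  fix x :: real
  have "(\<integral>\<^sup>+n. ennreal (4 * pw 1 x) * indicator {real_of_int n..<real_of_int n + 1} x \<partial>count_space UNIV) = (\<integral>\<^sup>+n. ennreal (4 * pw 1 x) * indicator {\<lfloor>x\<rfloor>} n \<partial>count_space UNIV)"
  proof (rule nn_integral_cong)
   fix n :: int
   have "x \<in> {real_of_int n..<real_of_int n + 1} \<longleftrightarrow> n \<in> {\<lfloor>x\<rfloor>}" by (metis atLeastLessThan_iff floor_eq_iff singleton_iff)
   then show "ennreal (4 * pw 1 x) * indicator {real_of_int n..<real_of_int n + 1} x = ennreal (4 * pw 1 x) * indicator {\<lfloor>x\<rfloor>} n"
    unfolding indicator_def by simp
  qed
  then show "(\<integral>\<^sup>+n. ennreal (4 * pw 1 x) * indicator {real_of_int n..<real_of_int n + 1} x \<partial>count_space UNIV) = ennreal (4 * pw 1 x)"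
   by (simp add: nn_integral_cmult)
 qed
 also have "... = ennreal (4 * pi)"
  using pw_nonneg[of 1] by (simp add: ennreal_mult nn_integral_cmult nn_integral_pw)
 finally show ?thesis .
qed

text \<open>Sobolev embedding by Cauchy-Schwarz, writing \<open>F\<close> as the square root of
  \<open>pw 1\<close> times \<open>sqrt (1 + k^2) * F k\<close>. The explicit bound later gives
  uniformity in time on the line.\<close>

lemma Sobolev_integrable:
 assumes F: "sqi (nX X) F" "sqi (nX X) (\<lambda>k. of_real k * F k)"
 shows "integrable (nX X) F"
  and "ennreal ((LINT k|nX X. cmod (F k))^2) <= ennreal (4 * pi) * (2 * sqn (nX X) F + 2 * sqn (nX X) (\<lambda>k. of_real k * F k))"
proof -
 have [measurable]: "F \<in> bm" using F by (auto dest: sqi_borel)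
 define a where "a k = complex_of_real (sqrt (pw 1 k))" for k
 define b where "b k = complex_of_real (sqrt (1 + k^2)) * F k" for k
 have [measurable]: "a \<in> bm" "b \<in> bm" unfolding a_def b_def by measurable
 have a: "sqn (nX X) a <= ennreal (4 * pi)"
  using nn_integral_nX_pw[of X] pw_nonneg[of 1] by (simp add: sqn_def a_def)
 have as: "sqi (nX X) a" using a by (auto simp: sqi_def intro: le_less_trans)
 have b: "sqn (nX X) b <= 2 * sqn (nX X) F + 2 * sqn (nX X) (\<lambda>k. of_real k * F k)"
 proof -
  have "sqn (nX X) b = (\<integral>\<^sup>+k. (esq (F k)) + (esq (of_real k * F k)) \<partial>nX X)"
   unfolding sqn_def
  proof (rule nn_integral_cong)
   fix k
   have "(cmod (b k))^2 = (cmod (F k))^2 + (cmod (of_real k * F k))^2"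
    by (simp add: b_def norm_mult power_mult_distrib algebra_simps)
   then show "(esq (b k)) = (esq (F k)) + (esq (of_real k * F k))"
    by simp
  qed
  also have "... = sqn (nX X) F + sqn (nX X) (\<lambda>k. of_real k * F k)"
   unfolding sqn_def by (intro nn_integral_add) auto
  also have "... <= 2 * sqn (nX X) F + 2 * sqn (nX X) (\<lambda>k. of_real k * F k)"
   by (intro add_mono) (simp_all add: mult_2)
  finally show ?thesis .
 qed
 have bs: "sqi (nX X) b"
  using F le_less_trans[OF b] by (auto simp: sqi_def ennreal_mult_less_top)
 have ab: "a k * b k = F k" for k
 proof -
  have p: "1 + k^2 > 0" by (simp add: add_pos_nonneg)
  have "sqrt (pw 1 k) * sqrt (1 + k^2) = sqrt (pw 1 k * (1 + k^2))" by (simp add: real_sqrt_mult)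
  also have "pw 1 k * (1 + k^2) = 1" using p by (simp add: pw_def)
  finally have "complex_of_real (sqrt (pw 1 k)) * complex_of_real (sqrt (1 + k^2)) = 1"
   by (simp flip: of_real_mult)
  then show ?thesis by (simp add: a_def b_def mult.assoc[symmetric])
 qed
 show int: "integrable (nX X) F"
  using sqi_integrable_mult[OF as bs] by (simp add: ab)
 have "ennreal (LINT k|nX X. cmod (F k)) = (\<integral>\<^sup>+k. cmod (a k * b k) \<partial>nX X)"
  unfolding ab using int by (intro nn_integral_eq_integral[symmetric]) auto
 then have "ennreal ((LINT k|nX X. cmod (F k))^2) = (\<integral>\<^sup>+k. cmod (a k * b k) \<partial>nX X)^2"
  by (metis ennreal_power integral_nonneg_AE AE_I2 norm_ge_zero)
 also have "... <= sqn (nX X) a * sqn (nX X) b" by (rule sqi_Cauchy_Schwarz_nn[OF as bs])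
 also have "... <= ennreal (4 * pi) * (2 * sqn (nX X) F + 2 * sqn (nX X) (\<lambda>k. of_real k * F k))"
  by (rule mult_mono[OF a b]) auto
 finally show "ennreal ((LINT k|nX X. cmod (F k))^2) <= ennreal (4 * pi) * (2 * sqn (nX X) F + 2 * sqn (nX X) (\<lambda>k. of_real k * F k))" .
qed

lemma ftp_sup_bound:
 fixes f :: "real => complex"
 assumes fF: "ftp X f F" "on_base X f" and F: "integrable (nX X) F"
 shows "AE x in lborel. cmod (f x) <= (LINT k|nX X. cmod (F k))"
 using ift_wt_tendsto_AE[OF fF]
proof eventually_elim
 case (elim x)
 have bd: "cmod (ift X (\<lambda>k. wt e k * F k) x) <= (LINT k|nX X. cmod (F k))" if "e > 0" for e
 proof -
  have m: "AE k in nX X. cmod (wt e k * F k) <= cmod (F k)"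
   using norm_wt_le[of e] that by (intro AE_I2) (auto simp: norm_mult intro!: mult_left_le_one_le)
  have [measurable]: "F \<in> bm" using F by auto
  have i: "integrable (nX X) (\<lambda>k. wt e k * F k)"
   by (rule integrable_le[OF F _ m]) measurable
  have "cmod (ift X (\<lambda>k. wt e k * F k) x) <= (LINT k|nX X. cmod (wt e k * F k))" by (rule norm_ift_le[OF i])
  also have "... <= (LINT k|nX X. cmod (F k))" using i F m by (intro integral_mono_AE) auto
  finally show ?thesis .
 qed
 have "cmod (2 * pi * f x) <= (LINT k|nX X. cmod (F k))"
 proof (rule tendsto_upperbound[OF tendsto_norm[OF elim]])
  show "\<forall>\<^sub>F e in at_right 0. cmod (ift X (\<lambda>k. wt e k * F k) x) <= (LINT k|nX X. cmod (F k))"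
   using bd by (intro eventually_at_rightI[of 0 1]) auto
 qed simp
 then have "2 * pi * cmod (f x) <= (LINT k|nX X. cmod (F k))" by (simp add: norm_mult)
 moreover have "1 * cmod (f x) <= 2 * pi * cmod (f x)" using pi_gt3 by (intro mult_right_mono) auto
 ultimately show ?case by simp
qed

section \<open>Derivatives\<close>

text \<open>Weak differentiation expressed by transforms, for Borel functions with fixed values;
  \<open>drel\<close> is the version modulo null sets.\<close>

definition dft :: "base_space => (real => complex) => (real => complex) => bool" where
 "dft X f g \<longleftrightarrow> on_base X f \<and> on_base X g \<and> (\<exists>F. ftp X f F \<and> ftp X g (\<lambda>k. \<i> * of_real k * F k))"

lemma dftE:
 assumes "dft X f g"
 obtains F where "ftp X f F" "ftp X g (\<lambda>k. \<i> * of_real k * F k)" "on_base X f" "on_base X g"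
 using assms unfolding dft_def by blast

text \<open>Multiplication by the frequency is unbounded, so the limit is taken on each window
  \<open>{-M..M}\<close>, where its norm is at most \<open>M\<close>; the windows exhaust all
  frequencies.\<close>

lemma derivative_limit:
 assumes F: "\<And>n. sqi (nX X) (F n)" "sqi (nX X) F0" "\<And>n. sqi (nX X) (G n)" "sqi (nX X) G0"
  and lF: "(\<lambda>n. sqn (nX X) (\<lambda>k. F n k - F0 k)) \<longlonglongrightarrow> 0" and lG: "(\<lambda>n. sqn (nX X) (\<lambda>k. G n k - G0 k)) \<longlonglongrightarrow> 0"
  and l: "\<And>M. (\<lambda>n. sqn (nX X) (\<lambda>k. indicator {-real M..real M} k * (G n k - \<i> * of_real k * F n k))) \<longlonglongrightarrow> 0"
 shows "AE k in nX X. G0 k = \<i> * of_real k * F0 k"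
proof -
 have [measurable]: "F n \<in> bm" "G n \<in> bm" "F0 \<in> bm" "G0 \<in> bm" for n
  using F by (auto dest: sqi_borel)
 have "AE k in nX X. indicator {-real M..real M} k * (G0 k - \<i> * of_real k * F0 k) = 0" for M :: nat
 proof -
  define h where "h k = indicator {-real M..real M} k * (G0 k - \<i> * of_real k * F0 k)" for k
  have [measurable]: "h \<in> bm" unfolding h_def by measurable
  define a where "a n k = indicator {-real M..real M} k * (G n k - \<i> * of_real k * F n k)" for n k
  define c where "c n k = (indicator {-real M..real M} k * \<i> * of_real k) * (F n k - F0 k)" for n k
  have [measurable]: "a n \<in> bm" "c n \<in> bm" for n unfolding a_def c_def by measurable
  have "(\<lambda>n. sqn (nX X) h) \<longlonglongrightarrow> 0"
  proof (rule tendsto_0_le_ennreal)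
   have "(\<lambda>n. 2 * (2 * sqn (nX X) (a n) + 2 * sqn (nX X) (\<lambda>k. G n k - G0 k)) + (2 * ennreal ((real M)^2)) * sqn (nX X) (\<lambda>k. F n k - F0 k)) \<longlonglongrightarrow> 0"
    using l[of M] unfolding a_def[symmetric]
    by (intro ennreal_cmult_add_tendsto_0 lF lG) (auto simp: ennreal_mult_less_top)
   then show "(\<lambda>n. 2 * (2 * sqn (nX X) (a n) + 2 * sqn (nX X) (\<lambda>k. G n k - G0 k)) + (2 * ennreal ((real M)^2)) * sqn (nX X) (\<lambda>k. F n k - F0 k)) \<longlonglongrightarrow> 0" .
   show "\<forall>\<^sub>F n in sequentially. sqn (nX X) h <= 2 * (2 * sqn (nX X) (a n) + 2 * sqn (nX X) (\<lambda>k. G n k - G0 k)) + (2 * ennreal ((real M)^2)) * sqn (nX X) (\<lambda>k. F n k - F0 k)"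
   proof (intro always_eventually allI)
    fix n
    define d where "d k = a n k - indicator {-real M..real M} k * (G n k - G0 k)" for k
    have [measurable]: "d \<in> bm" unfolding d_def by measurable
    have "h k = d k + c n k" for k by (simp add: h_def a_def c_def d_def indicator_def algebra_simps)
    then have "sqn (nX X) h = sqn (nX X) (\<lambda>k. d k + c n k)" by (intro sqn_cong_AE) auto
    also have "... <= 2 * sqn (nX X) d + 2 * sqn (nX X) (c n)" by (rule sqn_add) auto
    also have "... <= 2 * (2 * sqn (nX X) (a n) + 2 * sqn (nX X) (\<lambda>k. G n k - G0 k)) + 2 * (ennreal ((real M)^2) * sqn (nX X) (\<lambda>k. F n k - F0 k))"
    proof (intro add_mono mult_left_mono)
     have "sqn (nX X) d <= 2 * sqn (nX X) (a n) + 2 * sqn (nX X) (\<lambda>k. indicator {-real M..real M} k * (G n k - G0 k))"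
      unfolding d_def by (rule sqn_diff) auto
     also have "... <= 2 * sqn (nX X) (a n) + 2 * sqn (nX X) (\<lambda>k. G n k - G0 k)"
      by (intro add_mono mult_left_mono sqn_mono_AE AE_I2) (auto simp: indicator_def)
     finally show "sqn (nX X) d <= 2 * sqn (nX X) (a n) + 2 * sqn (nX X) (\<lambda>k. G n k - G0 k)" .
     show "sqn (nX X) (c n) <= ennreal ((real M)^2) * sqn (nX X) (\<lambda>k. F n k - F0 k)"
      unfolding c_def by (rule sqn_bounded_mult) (auto simp: norm_mult indicator_def)
    qed auto
    finally show "sqn (nX X) h <= 2 * (2 * sqn (nX X) (a n) + 2 * sqn (nX X) (\<lambda>k. G n k - G0 k)) + (2 * ennreal ((real M)^2)) * sqn (nX X) (\<lambda>k. F n k - F0 k)"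
     by (simp add: mult.assoc)
   qed
  qed
  then have "sqn (nX X) h = 0" by (simp add: LIMSEQ_const_iff)
  then show ?thesis unfolding h_def[symmetric] by (subst (asm) sqn_eq_0_iff) auto
 qed
 then have "AE k in nX X. \<forall>M::nat. indicator {-real M..real M} k * (G0 k - \<i> * of_real k * F0 k) = 0"
  unfolding AE_all_countable by (rule allI)
 then show ?thesis
 proof eventually_elim
  case (elim k)
  obtain M where "\<bar>k\<bar> <= real M" using real_arch_simple by blast
  then have "k \<in> {-real M..real M}" by auto
  then show ?case using elim[rule_format, of M] by simp
 qed
qed

lemma dft_limit:
 assumes d: "\<And>n. dft X (f n) (g n)" and f0: "sqi (mX X) f0" "on_base X f0" and g0: "sqi (mX X) g0" "on_base X g0"
  and lf: "(\<lambda>n. sqn (mX X) (\<lambda>x. f n x - f0 x)) \<longlonglongrightarrow> 0" and lg: "(\<lambda>n. sqn (mX X) (\<lambda>x. g n x - g0 x)) \<longlonglongrightarrow> 0"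
 shows "dft X f0 g0"
proof -
 obtain F where F: "\<And>n. ftp X (f n) (F n)" "\<And>n. ftp X (g n) (\<lambda>k. \<i> * of_real k * F n k)"
  using d unfolding dft_def by metis
 obtain F0 where F0: "ftp X f0 F0" using ftp_exists[OF f0(1)] by blast
 obtain G0 where G0: "ftp X g0 G0" using ftp_exists[OF g0(1)] by blast
 have "AE k in nX X. G0 k = \<i> * of_real k * F0 k"
 proof (rule derivative_limit[where F = F and G = "\<lambda>n k. \<i> * of_real k * F n k"])
  show "(\<lambda>n. sqn (nX X) (\<lambda>k. F n k - F0 k)) \<longlonglongrightarrow> 0"
   by (rule tendsto_0_le_ennreal[OF ennreal_cmult_tendsto_0[OF lf, of "ennreal (4 * pi)"]])
     (simp, intro always_eventually allI ftp_bound ftp_diff F F0)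
  show "(\<lambda>n. sqn (nX X) (\<lambda>k. \<i> * of_real k * F n k - G0 k)) \<longlonglongrightarrow> 0"
   by (rule tendsto_0_le_ennreal[OF ennreal_cmult_tendsto_0[OF lg, of "ennreal (4 * pi)"]])
     (simp, intro always_eventually allI ftp_bound ftp_diff F G0)
 qed (use F F0 G0 in \<open>auto dest: ftp_sqi\<close>)
 moreover have "F0 \<in> bm" using F0 by (auto dest: ftp_sqi sqi_borel)
 ultimately have "ftp X g0 (\<lambda>k. \<i> * of_real k * F0 k)" by (intro ftp_cong_right[OF G0]) measurable
 then show ?thesis using F0 f0 g0 unfolding dft_def by blast
qed

lemma norm_cis_diff_le: "cmod (cis a - cis b) <= \<bar>a - b\<bar>"
proof -
 have "(cmod (cis a - cis b))^2 = (cos a - cos b)^2 + (sin a - sin b)^2" by (simp add: cmod_power2)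
 also have "... = 2 - 2 * cos (a - b)"
  using sin_cos_squared_add[of a] sin_cos_squared_add[of b] unfolding cos_diff by algebra
 also have "... = (2 * sin ((a - b) / 2))^2"
 proof -
  have "2 * ((a - b) / 2) = a - b" by simp
  then show ?thesis using cos_double_sin[of "(a - b) / 2"] by (simp only:) (simp add: power_mult_distrib)
 qed
 finally have "cmod (cis a - cis b) = \<bar>2 * sin ((a - b) / 2)\<bar>"
  by (metis norm_ge_zero power2_abs power2_eq_imp_eq abs_ge_zero)
 also have "... <= 2 * \<bar>(a - b) / 2\<bar>" using abs_sin_x_le_abs_x[of "(a - b) / 2"] by (simp add: abs_mult)
 finally show ?thesis by simp
qed

section \<open>Classical derivatives: inverse transforms and integration by parts\<close>

lemma ift_continuous:
 assumes F: "integrable (nX X) F"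
 shows "continuous_on UNIV (ift X F)"
proof -
 have [measurable]: "F \<in> bm" using F by auto
 have "isCont (ift X F) x" for x
  unfolding continuous_at_sequentially comp_def
 proof (intro allI impI)
  fix y :: "nat => real" assume y: "y \<longlonglongrightarrow> x"
  show "(\<lambda>n. ift X F (y n)) \<longlonglongrightarrow> ift X F x"
   unfolding ift_def
  proof (rule integral_dominated_convergence[where w = "\<lambda>k. cmod (F k)"])
   show "AE k in nX X. (\<lambda>n. cis (y n * k) * F k) \<longlonglongrightarrow> cis (x * k) * F k"
    by (intro AE_I2 tendsto_intros y)
  qed (use F in \<open>auto simp: norm_mult\<close>)
 qed
 then show ?thesis by (simp add: continuous_on_eq_continuous_at)
qed

lemma has_vector_derivative_quotient:
 "(f has_vector_derivative D) (at x) \<longleftrightarrow> ((\<lambda>h. (1 / h) *\<^sub>R (f (x + h) - f x)) \<longlongrightarrow> D) (at 0)"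
proof -
 have "(f has_vector_derivative D) (at x) \<longleftrightarrow> ((\<lambda>h. norm (f (x + h) - f x - h *\<^sub>R D) / norm h) \<longlongrightarrow> 0) (at 0)"
  unfolding has_vector_derivative_def has_derivative_at by (simp add: bounded_linear_scaleR_left)
 also have "... \<longleftrightarrow> ((\<lambda>h. norm ((1 / h) *\<^sub>R (f (x + h) - f x) - D)) \<longlongrightarrow> 0) (at 0)"
 proof (rule tendsto_cong, unfold eventually_at_filter, intro always_eventually allI impI)
  fix h :: real assume h: "h \<noteq> 0"
  have "f (x + h) - f x - h *\<^sub>R D = h *\<^sub>R ((1 / h) *\<^sub>R (f (x + h) - f x) - D)" using h by (simp add: scaleR_diff_right)
  then show "norm (f (x + h) - f x - h *\<^sub>R D) / norm h = norm ((1 / h) *\<^sub>R (f (x + h) - f x) - D)" using h by simp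
 qed
 also have "... \<longleftrightarrow> ((\<lambda>h. (1 / h) *\<^sub>R (f (x + h) - f x)) \<longlongrightarrow> D) (at 0)"
  by (simp add: tendsto_norm_zero_iff LIM_zero_iff)
 finally show ?thesis .
qed

lemma ift_derivative:
 assumes F: "integrable (nX X) F" "integrable (nX X) (\<lambda>k. \<i> * of_real k * F k)"
 shows "(ift X F has_vector_derivative ift X (\<lambda>k. \<i> * of_real k * F k) x) (at x)"
proof -
 have [measurable]: "F \<in> bm" using F by auto
 define G where "G = (\<lambda>k. \<i> * of_real k * F k)"
 have [measurable]: "G \<in> bm" unfolding G_def by measurable
 have G: "integrable (nX X) G" using F by (simp add: G_def)
 have "((\<lambda>h. (1 / h) *\<^sub>R (ift X F (x + h) - ift X F x)) \<longlongrightarrow> ift X G x) (at 0)"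
  unfolding tendsto_at_iff_sequentially comp_def
 proof (intro allI impI)
  fix h :: "nat => real" assume h0: "\<forall>i. h i \<in> UNIV - {0}" and h: "h \<longlonglongrightarrow> 0"
  have eq: "(1 / h n) *\<^sub>R (ift X F (x + h n) - ift X F x) = (LINT k|nX X. (1 / h n) *\<^sub>R ((cis ((x + h n) * k) - cis (x * k)) * F k))" for n
  proof -
   have "ift X F (x + h n) - ift X F x = (LINT k|nX X. cis ((x + h n) * k) * F k - cis (x * k) * F k)"
    unfolding ift_def by (intro Bochner_Integration.integral_diff[symmetric] integrable_cis_mult F) auto
   then show ?thesis by (simp add: left_diff_distrib)
  qed
  show "(\<lambda>n. (1 / h n) *\<^sub>R (ift X F (x + h n) - ift X F x)) \<longlonglongrightarrow> ift X G x"
   unfolding eq ift_def[of X G]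
  proof (rule integral_dominated_convergence[where w = "\<lambda>k. cmod (G k)"])
   show "AE k in nX X. (\<lambda>n. (1 / h n) *\<^sub>R ((cis ((x + h n) * k) - cis (x * k)) * F k)) \<longlonglongrightarrow> cis (x * k) * G k"
   proof (rule AE_I2)
    fix k
    have "((\<lambda>y. exp (\<i> * of_real k * y)) has_field_derivative exp (\<i> * of_real k * of_real x) * (\<i> * of_real k)) (at (of_real x))"
     by (auto intro!: derivative_eq_intros)
    from has_vector_derivative_real_field[OF this, of UNIV]
    have "((\<lambda>y. cis (y * k)) has_vector_derivative (\<i> * of_real k) * cis (x * k)) (at x)"
     by (simp add: cis_conv_exp mult_ac)
    then have "((\<lambda>h. (1 / h) *\<^sub>R (cis ((x + h) * k) - cis (x * k))) \<longlongrightarrow> (\<i> * of_real k) * cis (x * k)) (at 0)"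
     by (simp only: has_vector_derivative_quotient)
    then have "(\<lambda>n. (1 / h n) *\<^sub>R (cis ((x + h n) * k) - cis (x * k))) \<longlonglongrightarrow> (\<i> * of_real k) * cis (x * k)"
     using h0 h unfolding tendsto_at_iff_sequentially comp_def by blast
    then have "(\<lambda>n. ((1 / h n) *\<^sub>R (cis ((x + h n) * k) - cis (x * k))) * F k) \<longlonglongrightarrow> ((\<i> * of_real k) * cis (x * k)) * F k"
     by (intro tendsto_intros)
    then show "(\<lambda>n. (1 / h n) *\<^sub>R ((cis ((x + h n) * k) - cis (x * k)) * F k)) \<longlonglongrightarrow> cis (x * k) * G k"
     by (simp add: G_def mult_ac)
   qed
   show "AE k in nX X. cmod ((1 / h n) *\<^sub>R ((cis ((x + h n) * k) - cis (x * k)) * F k)) <= cmod (G k)" for n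
   proof (rule AE_I2)
    fix k
    have hn: "h n \<noteq> 0" using h0 by auto
    have "cmod (cis ((x + h n) * k) - cis (x * k)) <= \<bar>h n\<bar> * \<bar>k\<bar>"
     using norm_cis_diff_le[of "(x + h n) * k" "x * k"] by (simp add: algebra_simps abs_mult)
    then have "cmod (cis ((x + h n) * k) - cis (x * k)) * cmod (F k) / \<bar>h n\<bar> <= \<bar>h n\<bar> * \<bar>k\<bar> * cmod (F k) / \<bar>h n\<bar>"
     by (intro divide_right_mono mult_right_mono) auto
    then show "cmod ((1 / h n) *\<^sub>R ((cis ((x + h n) * k) - cis (x * k)) * F k)) <= cmod (G k)"
     using hn by (simp add: G_def norm_mult)
   qed
  qed (use G in auto)
 qed
 then show ?thesis unfolding G_def by (simp only: has_vector_derivative_quotient)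
qed

lemma sqn_indicator_nX: "sqn (nX X) (indicator {-M..M}) < \<infinity>"
proof -
 have "sqn (nX X) (indicator {-M..M}) <= (\<integral>\<^sup>+k. ennreal (1 + M^2) * ennreal (pw 1 k) \<partial>nX X)"
  unfolding sqn_def
 proof (rule nn_integral_mono)
  fix k :: real
  show "(esq (indicator {-M..M} k)) <= ennreal (1 + M^2) * ennreal (pw 1 k)"
  proof (cases "k \<in> {-M..M}")
   case True
   then have "\<bar>k\<bar> <= \<bar>M\<bar>" by auto
   then have "k\<^sup>2 <= M^2" by (simp only: abs_le_square_iff)
   moreover have "1 + k^2 > 0" by (simp add: add_pos_nonneg)
   ultimately have "1 <= (1 + M^2) * pw 1 k" by (simp add: pw_def pos_le_divide_eq)
   then have "ennreal 1 <= ennreal ((1 + M^2) * pw 1 k)" by (rule ennreal_leI)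
   also have "... = ennreal (1 + M^2) * ennreal (pw 1 k)" by (rule ennreal_mult) (auto simp: pw_nonneg)
   finally show ?thesis using True by simp
  qed simp
 qed
 also have "... = ennreal (1 + M^2) * (\<integral>\<^sup>+k. ennreal (pw 1 k) \<partial>nX X)" by (rule nn_integral_cmult) simp
 also have "... <= ennreal (1 + M^2) * ennreal (4 * pi)" by (intro mult_left_mono nn_integral_nX_pw) simp
 also have "... < \<infinity>" by (simp add: ennreal_mult_less_top del: ennreal_plus)
 finally show ?thesis .
qed

text \<open>If the values at \<open>R\<close> and \<open>- R\<close> stayed above a fixed level for
  all large \<open>R\<close>, the square integral would diverge. The radii make boundary terms
  vanish in integrations by parts over the line.\<close>

lemma small_at_infinity:
 assumes f: "sqi lborel f"
 obtains r :: "nat => real" where "\<And>n. r n \<ge> real n" "\<And>n. (cmod (f (r n)))^2 + (cmod (f (- r n)))^2 <= eps n"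
proof -
 have [measurable]: "f \<in> bm" using f by (simp add: sqi_def)
 have "\<exists>R\<ge>real n. (cmod (f R))^2 + (cmod (f (- R)))^2 <= eps n" for n
 proof (rule ccontr)
  assume neg: "\<not> (\<exists>R\<ge>real n. (cmod (f R))^2 + (cmod (f (- R)))^2 <= eps n)"
  have "\<infinity> = (\<integral>\<^sup>+x. ennreal (eps n) * indicator {real n..} x \<partial>lborel)"
  proof -
   have "emeasure lborel {real n..} = \<infinity>"
   proof (rule ccontr)
    assume "emeasure lborel {real n..} \<noteq> \<infinity>"
    then obtain a where a: "emeasure lborel {real n..} = ennreal a" "a \<ge> 0" by (cases "emeasure lborel {real n..}") auto
    have "ennreal (a + 1) = emeasure lborel {real n..real n + (a + 1)}" using a by simp
    also have "... <= emeasure lborel {real n..}" by (intro emeasure_mono) auto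
    finally show False using a by simp
   qed
   then show ?thesis by (subst nn_integral_cmult_indicator) (auto simp: ennreal_mult_top ennreal_divide_eq_0_iff)
  qed
  also have "... <= (\<integral>\<^sup>+x. (esq (f x)) + (esq (f (0 + -1 * x))) \<partial>lborel)"
  proof (rule nn_integral_mono)
   fix x
   show "ennreal (eps n) * indicator {real n..} x <= (esq (f x)) + (esq (f (0 + -1 * x)))"
   proof (cases "x \<in> {real n..}")
    case True
    then have "eps n <= (cmod (f x))^2 + (cmod (f (- x)))^2" using neg by force
    then have "ennreal (eps n) <= ennreal ((cmod (f x))^2 + (cmod (f (- x)))^2)" by (rule ennreal_leI)
    then show ?thesis using True by simp
   qed simp
  qed
  also have "... = sqn lborel f + sqn lborel f"
   unfolding sqn_def by (subst nn_integral_add, simp, simp, subst (3) nn_integral_real_affine[where c = "-1" and t = 0]) auto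
  also have "... < \<infinity>" using f by (simp add: sqi_def)
  finally show False by simp
 qed
 then obtain r where "\<And>n. r n \<ge> real n \<and> (cmod (f (r n)))^2 + (cmod (f (- r n)))^2 <= eps n" by metis
 then show ?thesis using that by blast
qed

lemma integration_by_parts_cis:
 assumes d: "\<And>x. (f has_vector_derivative g x) (at x)" and g: "continuous_on UNIV g" and R: "R \<ge> 0"
 shows "(LINT x|lborel. indicator {-R..R} x *\<^sub>R (cis (- (x * k)) * (g x - \<i> * of_real k * f x)))
  = cis (- (R * k)) * f R - cis (R * k) * f (- R)"
proof -
 have c: "continuous_on UNIV f"
  using d by (auto intro!: continuous_at_imp_continuous_on has_vector_derivative_continuous)
 have "(LINT x|lborel. indicator {-R..R} x *\<^sub>R (cis (- (x * k)) * (g x - \<i> * of_real k * f x)))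
  = cis (- (R * k)) * f R - cis (- ((- R) * k)) * f (- R)"
 proof (rule integral_FTC_Icc)
  fix x
  have "((\<lambda>y. exp (- (\<i> * of_real k * y))) has_field_derivative exp (- (\<i> * of_real k * of_real x)) * (- (\<i> * of_real k))) (at (of_real x))"
   by (auto intro!: derivative_eq_intros)
  from has_vector_derivative_real_field[OF this, of UNIV]
  have "((\<lambda>y. cis (- (y * k))) has_vector_derivative (- (\<i> * of_real k)) * cis (- (x * k))) (at x)"
   by (simp add: cis_conv_exp mult_ac)
  from has_vector_derivative_mult[OF this d]
  have "((\<lambda>x. cis (- (x * k)) * f x) has_vector_derivative cis (- (x * k)) * (g x - \<i> * of_real k * f x)) (at x)"
   by (simp add: algebra_simps)
  then show "((\<lambda>x. cis (- (x * k)) * f x) has_vector_derivative cis (- (x * k)) * (g x - \<i> * of_real k * f x)) (at x within {-R..R})"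
   by (rule has_vector_derivative_at_within)
 qed (use R in \<open>auto intro!: continuous_intros continuous_on_subset[OF c] continuous_on_subset[OF g]\<close>)
 then show ?thesis by simp
qed

text \<open>Integration by parts on truncated intervals leaves boundary terms that tend to zero
  uniformly in the frequency: on the line along the radii of \<open>small_at_infinity\<close>, on
  the circle by periodicity. \<open>derivative_limit\<close> concludes.\<close>

proposition dft_C1:
 assumes d: "\<And>x. (f has_vector_derivative g x) (at x)" and cg: "continuous_on UNIV g"
  and f: "sqi (mX X) f" "on_base X f" and g: "sqi (mX X) g" "on_base X g"
 shows "dft X f g"
proof -
 have [measurable]: "f \<in> bm" "g \<in> bm" using f g by (auto dest: sqi_borel)
 \<comment> \<open>The end point of the truncated cell: on the circle the truncation stops at
   \<open>pi\<close>.\<close>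
 define h where "h R = (case X of Line => R | Circle => min R pi)" for R
 have ibp: "ft0 X (cut R g) k - \<i> * of_real k * ft0 X (cut R f) k = cis (- (h R * k)) * f (h R) - cis (h R * k) * f (- h R)" if "R \<ge> 0" for R k
 proof -
  have ind: "indicator (cell X) x * indicator {-R..R} x = (indicator {-h R..h R} x :: real)" for x
   unfolding h_def by (cases X) (auto simp: indicator_def)
  have "ft0 X (cut R g) k - \<i> * of_real k * ft0 X (cut R f) k = ft0 X (\<lambda>x. cut R g x - (\<i> * of_real k) * cut R f x) k"
   by (simp add: ft0_diff ft0_cmult integrable_cut f g)
  also have "... = (LINT x|lborel. indicator (cell X) x *\<^sub>R (cis (- (x * k)) * (cut R g x - (\<i> * of_real k) * cut R f x)))"
   unfolding ft0_def by (rule integral_mX) measurable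
  also have "... = (LINT x|lborel. indicator {-h R..h R} x *\<^sub>R (cis (- (x * k)) * (g x - \<i> * of_real k * f x)))"
  proof (rule LINT_cong[OF refl])
   fix x
   have "indicator (cell X) x *\<^sub>R (cis (- (x * k)) * (cut R g x - (\<i> * of_real k) * cut R f x))
    = (indicator (cell X) x * indicator {-R..R} x) *\<^sub>R (cis (- (x * k)) * (g x - \<i> * of_real k * f x))"
    by (auto simp: cut_def indicator_def)
   then show "indicator (cell X) x *\<^sub>R (cis (- (x * k)) * (cut R g x - (\<i> * of_real k) * cut R f x)) = indicator {-h R..h R} x *\<^sub>R (cis (- (x * k)) * (g x - \<i> * of_real k * f x))"
    by (simp only: ind)
  qed
  also have "... = cis (- (h R * k)) * f (h R) - cis (h R * k) * f (- h R)"
   using that by (intro integration_by_parts_cis d cg) (auto simp: h_def split: base_space.split)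
  finally show ?thesis .
 qed
 obtain r b where r: "filterlim r at_top sequentially" "\<And>n. r n \<ge> (0::real)" and b: "b \<longlonglongrightarrow> (0::real)"
  and bd: "\<And>n. AE k in nX X. cmod (ft0 X (cut (r n) g) k - \<i> * of_real k * ft0 X (cut (r n) f) k) <= b n"
 proof (cases X)
  case Line
  obtain r where r: "\<And>n. r n \<ge> real n" "\<And>n. (cmod (f (r n)))^2 + (cmod (f (- r n)))^2 <= eps n"
   using small_at_infinity[of f] f Line by auto
  have "filterlim r at_top sequentially"
   by (rule filterlim_at_top_mono[OF filterlim_real_sequentially]) (use r in auto)
  moreover have r0: "r n \<ge> 0" for n using r(1)[of n] by (meson of_nat_0_le_iff order_trans)
  moreover have "(\<lambda>n. 2 * sqrt (eps n)) \<longlonglongrightarrow> 2 * sqrt 0" by (intro tendsto_intros eps_tendsto)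
  then have "(\<lambda>n. 2 * sqrt (eps n)) \<longlonglongrightarrow> 0" by simp
  moreover have "AE k in nX X. cmod (ft0 X (cut (r n) g) k - \<i> * of_real k * ft0 X (cut (r n) f) k) <= 2 * sqrt (eps n)" for n
  proof (rule AE_I2)
   fix k
   have "(cmod (f (r n)))^2 <= eps n" "(cmod (f (- r n)))^2 <= eps n"
    using r(2)[of n] zero_le_power2[of "cmod (f (r n))"] zero_le_power2[of "cmod (f (- r n))"] by linarith+
   then have "cmod (f (r n)) <= sqrt (eps n)" "cmod (f (- r n)) <= sqrt (eps n)" by (auto intro: real_le_rsqrt)
   moreover have "cmod (cis (- (r n * k)) * f (r n) - cis (r n * k) * f (- r n)) <= cmod (f (r n)) + cmod (f (- r n))"
    using norm_triangle_ineq4[of "cis (- (r n * k)) * f (r n)" "cis (r n * k) * f (- r n)"] by (simp add: norm_mult)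
   ultimately show "cmod (ft0 X (cut (r n) g) k - \<i> * of_real k * ft0 X (cut (r n) f) k) <= 2 * sqrt (eps n)"
    using ibp[OF r0, of n k] by (simp add: h_def Line)
  qed
  ultimately show ?thesis using that by blast
 next
  case Circle
  \<comment> \<open>Adding \<open>pi\<close> makes every interval a full period, so that the
    boundary terms cancel exactly for integer frequencies.\<close>
  have "filterlim (\<lambda>n. real n + pi) at_top sequentially"
   by (rule filterlim_at_top_mono[OF filterlim_real_sequentially]) auto
  moreover have "AE k in nX X. cmod (ft0 X (cut (real n + pi) g) k - \<i> * of_real k * ft0 X (cut (real n + pi) f) k) <= 0" for n
   using AE_nX_frequencies
  proof eventually_elim
   case (elim k)
   have "f (- pi + 2 * pi) = f (- pi)" using f(2) unfolding on_base_def Circle by blast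
   then have fp: "f pi = f (- pi)" by simp
   have "cis (k * (- pi + 2 * pi)) = cis (k * (- pi))" using cis_period[OF elim] unfolding on_base_def Circle by blast
   then have cp: "cis (pi * k) = cis (- (pi * k))" by (simp add: mult.commute)
   show ?case using ibp[of "real n + pi" k] by (simp add: h_def Circle fp cp)
  qed
  ultimately show ?thesis using that[of "\<lambda>n. real n + pi" "\<lambda>n. 0"] by simp
 qed
 obtain F where F: "ftp X f F" using ftp_exists[OF f(1)] by blast
 obtain G where G: "ftp X g G" using ftp_exists[OF g(1)] by blast
 have "AE k in nX X. G k = \<i> * of_real k * F k"
 proof (rule derivative_limit[where F = "\<lambda>n. ft0 X (cut (r n) f)" and G = "\<lambda>n. ft0 X (cut (r n) g)"])
  show "(\<lambda>n. sqn (nX X) (\<lambda>k. ft0 X (cut (r n) f) k - F k)) \<longlonglongrightarrow> 0"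
   by (subst sqn_minus_commute) (rule filterlim_compose[OF ftp_tendsto[OF F] r(1)])
  show "(\<lambda>n. sqn (nX X) (\<lambda>k. ft0 X (cut (r n) g) k - G k)) \<longlonglongrightarrow> 0"
   by (subst sqn_minus_commute) (rule filterlim_compose[OF ftp_tendsto[OF G] r(1)])
  fix M :: nat
  show "(\<lambda>n. sqn (nX X) (\<lambda>k. indicator {- real M..real M} k * (ft0 X (cut (r n) g) k - \<i> * of_real k * ft0 X (cut (r n) f) k))) \<longlonglongrightarrow> 0"
  proof (rule tendsto_0_le_ennreal)
   have "(\<lambda>n. ennreal ((b n)^2)) \<longlonglongrightarrow> ennreal (0\<^sup>2)" by (intro tendsto_ennrealI tendsto_intros b)
   then have "(\<lambda>n. ennreal ((b n)^2)) \<longlonglongrightarrow> 0" by simp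
   then show "(\<lambda>n. sqn (nX X) (indicator {- real M..real M}) * ennreal ((b n)^2)) \<longlonglongrightarrow> 0"
    by (intro ennreal_cmult_tendsto_0 sqn_indicator_nX)
   show "\<forall>\<^sub>F n in sequentially. sqn (nX X) (\<lambda>k. indicator {- real M..real M} k * (ft0 X (cut (r n) g) k - \<i> * of_real k * ft0 X (cut (r n) f) k))
    <= sqn (nX X) (indicator {- real M..real M}) * ennreal ((b n)^2)"
   proof (intro always_eventually allI)
    fix n
    have "sqn (nX X) (\<lambda>k. (ft0 X (cut (r n) g) k - \<i> * of_real k * ft0 X (cut (r n) f) k) * indicator {- real M..real M} k)
     <= ennreal ((b n)^2) * sqn (nX X) (indicator {- real M..real M})"
     by (rule sqn_bounded_mult[OF _ bd]) simp
    then show "sqn (nX X) (\<lambda>k. indicator {- real M..real M} k * (ft0 X (cut (r n) g) k - \<i> * of_real k * ft0 X (cut (r n) f) k))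
    <= sqn (nX X) (indicator {- real M..real M}) * ennreal ((b n)^2)"
     by (simp only: mult.commute)
   qed
  qed
 qed (use F G f g in \<open>auto dest: ftp_sqi intro: sqi_ft0 integrable_cut sqi_cut\<close>)
 moreover have "F \<in> bm" using F by (auto dest: ftp_sqi sqi_borel)
 ultimately have "ftp X g (\<lambda>k. \<i> * of_real k * F k)" by (intro ftp_cong_right[OF G]) measurable
 then show ?thesis using F f g unfolding dft_def by blast
qed

text \<open>\<open>f\<close> may have no classical derivative, so it is replaced by its Abel means,
  which are continuously differentiable and obey the product rule; boundedness of \<open>s\<close>
  and \<open>s'\<close> carries the result to the limit.\<close>

proposition dft_mult:
 assumes d: "dft X f g" and s: "\<And>x. (s has_vector_derivative s' x) (at x)" "continuous_on UNIV s'"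
  and sb: "\<And>x. cmod (s x) <= C" "\<And>x. cmod (s' x) <= C" "on_base X s" "on_base X s'"
 shows "dft X (\<lambda>x. s x * f x) (\<lambda>x. s' x * f x + s x * g x)"
proof -
 obtain F where F: "ftp X f F" "ftp X g (\<lambda>z. \<i> * of_real z * F z)" "on_base X f" "on_base X g"
  using dftE[OF d] by blast
 define G where "G z = \<i> * of_real z * F z" for z
 have G: "ftp X g G" using F(2) by (simp add: G_def[abs_def])
 have sq: "sqi (nX X) F" "sqi (nX X) G" "sqi (mX X) f" "sqi (mX X) g" using F(1) G by (auto simp: ftp_def)
 have cs: "continuous_on UNIV s"
  using s by (auto intro!: continuous_at_imp_continuous_on has_vector_derivative_continuous)
 have [measurable]: "f \<in> bm" "g \<in> bm" "F \<in> bm" "G \<in> bm"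
  "s \<in> bm" "s' \<in> bm"
  using sq cs s by (auto dest: sqi_borel intro: borel_measurable_continuous_onI)
 define c where "c = complex_of_real (1 / (2 * pi))"
 define K where "K n z = c * (wt (eps n) z * F z)" for n z
 have K: "integrable (nX X) (K n)" "sqi (nX X) (K n)" for n
  unfolding K_def by (intro integrable_mult_right integrable_wt_mult sqi_cmult sqi_wt_mult sq; simp)+
 have KG: "\<i> * of_real z * K n z = c * (wt (eps n) z * G z)" for n z by (simp add: K_def G_def)
 have K': "integrable (nX X) (\<lambda>z. \<i> * of_real z * K n z)" "sqi (nX X) (\<lambda>z. \<i> * of_real z * K n z)" for n
  unfolding KG by (intro integrable_mult_right integrable_wt_mult sqi_cmult sqi_wt_mult sq; simp)+
 define fn where "fn n = ift X (K n)" for n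
 define gn where "gn n = ift X (\<lambda>z. \<i> * of_real z * K n z)" for n
 have [measurable]: "K n \<in> bm" for n unfolding K_def by measurable
 have [measurable]: "fn n \<in> bm" "gn n \<in> bm" for n unfolding fn_def gn_def by measurable
 have fgs: "sqi (mX X) (fn n)" "sqi (mX X) (gn n)" for n unfolding fn_def gn_def by (rule sqi_ift[OF K] sqi_ift[OF K'])+
 have fgo: "on_base X (fn n)" "on_base X (gn n)" for n unfolding fn_def gn_def by (rule ift_on_base, measurable)+
 have der: "(fn n has_vector_derivative gn n x) (at x)" for n x unfolding fn_def gn_def by (rule ift_derivative[OF K(1) K'(1)])
 have cf: "continuous_on UNIV (fn n)" "continuous_on UNIV (gn n)" for n
  unfolding fn_def gn_def by (rule ift_continuous[OF K(1)] ift_continuous[OF K'(1)])+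
 have scale: "(\<lambda>n. sqn (mX X) (\<lambda>x. ift X (\<lambda>z. c * (wt (eps n) z * H z)) x - h x)) \<longlonglongrightarrow> 0"
  if H: "ftp X h H" "on_base X h" for h H
 proof -
  have [measurable]: "h \<in> bm" "H \<in> bm" using H(1) by (auto dest: ftp_sqi sqi_borel)
  have "ift X (\<lambda>z. c * (wt (eps n) z * H z)) x - h x = c * (ift X (\<lambda>z. wt (eps n) z * H z) x - complex_of_real (2 * pi) * h x)" for n x
   unfolding ift_cmult by (simp add: c_def right_diff_distrib)
  then have "sqn (mX X) (\<lambda>x. ift X (\<lambda>z. c * (wt (eps n) z * H z)) x - h x) = (esq c) * sqn (mX X) (\<lambda>x. ift X (\<lambda>z. wt (eps n) z * H z) x - complex_of_real (2 * pi) * h x)" for n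
   by (simp only:) (rule sqn_cmult, measurable)
  then show ?thesis
   using ennreal_cmult_tendsto_0[OF ift_wt_tendsto_sqn[OF H], of "(esq c)"] by simp
 qed
 have lf: "(\<lambda>n. sqn (mX X) (\<lambda>x. fn n x - f x)) \<longlonglongrightarrow> 0" unfolding fn_def K_def by (rule scale[OF F(1,3)])
 have lg: "(\<lambda>n. sqn (mX X) (\<lambda>x. gn n x - g x)) \<longlonglongrightarrow> 0" unfolding gn_def KG by (rule scale[OF G F(4)])
 have ss: "sqi (mX X) (\<lambda>x. s x * h x)" "sqi (mX X) (\<lambda>x. s' x * h x)" if "sqi (mX X) h" for h
  by (rule sqi_bounded_mult[OF that]; use sb in auto)+
 have sle: "sqn (mX X) (\<lambda>x. s x * h x) <= ennreal (C^2) * sqn (mX X) h" "sqn (mX X) (\<lambda>x. s' x * h x) <= ennreal (C^2) * sqn (mX X) h"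
  if "h \<in> bm" for h
  by (rule sqn_bounded_mult; use sb that in auto)+
 have ob: "on_base X (\<lambda>x. s x * h x)" if "on_base X h" for h using that sb by (auto simp: on_base_def)
 have ob': "on_base X (\<lambda>x. s' x * h x + s x * k x)" if "on_base X h" "on_base X k" for h k
  using that sb by (auto simp: on_base_def)
 show ?thesis
 proof (rule dft_limit)
  show "dft X (\<lambda>x. s x * fn n x) (\<lambda>x. s' x * fn n x + s x * gn n x)" for n
  proof (rule dft_C1)
   show "((\<lambda>x. s x * fn n x) has_vector_derivative s' x * fn n x + s x * gn n x) (at x)" for x
    using has_vector_derivative_mult[OF s(1) der] by (simp add: add.commute)
   show "continuous_on UNIV (\<lambda>x. s' x * fn n x + s x * gn n x)" by (intro continuous_intros s cs cf)
   show "sqi (mX X) (\<lambda>x. s x * fn n x)" "sqi (mX X) (\<lambda>x. s' x * fn n x + s x * gn n x)"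
    by (intro sqi_add ss fgs)+
   show "on_base X (\<lambda>x. s x * fn n x)" "on_base X (\<lambda>x. s' x * fn n x + s x * gn n x)"
    by (intro ob ob' fgo)+
  qed
  show "sqi (mX X) (\<lambda>x. s x * f x)" "sqi (mX X) (\<lambda>x. s' x * f x + s x * g x)" by (intro sqi_add ss sq)+
  show "on_base X (\<lambda>x. s x * f x)" "on_base X (\<lambda>x. s' x * f x + s x * g x)" by (intro ob ob' F)+
  show "(\<lambda>n. sqn (mX X) (\<lambda>x. s x * fn n x - s x * f x)) \<longlonglongrightarrow> 0"
   by (rule tendsto_0_le_ennreal[OF ennreal_cmult_tendsto_0[OF lf, of "ennreal (C^2)"]])
     (simp, intro always_eventually allI, unfold right_diff_distrib[symmetric], rule sle, measurable)
  show "(\<lambda>n. sqn (mX X) (\<lambda>x. s' x * fn n x + s x * gn n x - (s' x * f x + s x * g x))) \<longlonglongrightarrow> 0"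
  proof (rule tendsto_0_le_ennreal)
   show "(\<lambda>n. (2 * ennreal (C^2)) * sqn (mX X) (\<lambda>x. fn n x - f x) + (2 * ennreal (C^2)) * sqn (mX X) (\<lambda>x. gn n x - g x)) \<longlonglongrightarrow> 0"
    by (intro ennreal_cmult_add_tendsto_0 lf lg) (auto simp: ennreal_mult_less_top)
   show "\<forall>\<^sub>F n in sequentially. sqn (mX X) (\<lambda>x. s' x * fn n x + s x * gn n x - (s' x * f x + s x * g x))
    <= (2 * ennreal (C^2)) * sqn (mX X) (\<lambda>x. fn n x - f x) + (2 * ennreal (C^2)) * sqn (mX X) (\<lambda>x. gn n x - g x)"
   proof (intro always_eventually allI)
    fix n
    have "sqn (mX X) (\<lambda>x. s' x * fn n x + s x * gn n x - (s' x * f x + s x * g x)) = sqn (mX X) (\<lambda>x. s' x * (fn n x - f x) + s x * (gn n x - g x))"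
     by (simp add: algebra_simps)
    also have "... <= 2 * sqn (mX X) (\<lambda>x. s' x * (fn n x - f x)) + 2 * sqn (mX X) (\<lambda>x. s x * (gn n x - g x))"
     by (rule sqn_add) auto
    also have "... <= 2 * (ennreal (C^2) * sqn (mX X) (\<lambda>x. fn n x - f x)) + 2 * (ennreal (C^2) * sqn (mX X) (\<lambda>x. gn n x - g x))"
     by (intro add_mono mult_left_mono sle) auto
    finally show "sqn (mX X) (\<lambda>x. s' x * fn n x + s x * gn n x - (s' x * f x + s x * g x))
    <= (2 * ennreal (C^2)) * sqn (mX X) (\<lambda>x. fn n x - f x) + (2 * ennreal (C^2)) * sqn (mX X) (\<lambda>x. gn n x - g x)"
     by (simp only: mult.assoc)
   qed
  qed
 qed
qed

section \<open>Square-integrable functions modulo null sets\<close>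

text \<open>Completeness of Lebesgue measure: a change on a null set keeps a function measurable,
  which fails for Borel measurability.\<close>

lemma lebesgue_measurable_AE_cong:
 fixes f g :: "real => 'b::topological_space"
 assumes "g \<in> borel_measurable lebesgue" "AE x in lborel. f x = g x"
 shows "f \<in> borel_measurable lebesgue"
proof (rule measurableI)
 fix A :: "'b set" assume "A \<in> sets borel"
 then have 1: "g -` A \<inter> space lebesgue \<in> sets lebesgue" using assms(1) by (rule measurable_sets[rotated])
 have 2: "AE x in lebesgue. x \<in> g -` A \<inter> space lebesgue \<longleftrightarrow> x \<in> f -` A \<inter> space lebesgue"
  unfolding AE_completion_iff using assms(2) by eventually_elim auto
 show "f -` A \<inter> space lebesgue \<in> sets lebesgue" by (rule completion.in_sets_AE[OF 2 1]) auto
qed simp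

lemma l2_sq_cong: "AE x in lborel. norm (f x) = norm (g x) ==> l2_sq X f = l2_sq X g"
 unfolding l2_sq_def nn_integral_completion by (intro nn_integral_cong_AE) (auto elim: AE_mp)

lemma l2_sq_sqn: "f \<in> bm ==> l2_sq X f = sqn (mX X) f"
 unfolding l2_sq_def nn_integral_completion sqn_def by (subst nn_integral_mX) auto

text \<open>\<open>L2\<close> speaks of Lebesgue measurable functions, the Fourier part of Borel
  ones. The representative is Borel, periodic at every point, and carries the transform.\<close>

definition rep :: "base_space => (real => complex) => (real => complex) => bool" where
 "rep X f f' \<longleftrightarrow> on_base X f \<and> on_base X f' \<and> sqi (mX X) f' \<and> (AE x in lborel. f x = f' x)"

lemma rep_borel: "rep X f f' ==> f' \<in> bm"
 by (auto simp: rep_def dest: sqi_borel)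

lemma rep_sqn: "rep X f f' ==> l2_sq X f = sqn (mX X) f'"
 using rep_borel[of X f f'] by (subst l2_sq_cong[of f f']) (auto simp: rep_def l2_sq_sqn elim: AE_mp)

lemma rep_L2: "rep X f f' ==> L2 X f"
 unfolding L2_def
proof (intro conjI)
 assume r: "rep X f f'"
 show "f \<in> borel_measurable lebesgue"
  by (rule lebesgue_measurable_AE_cong[of f']) (use r rep_borel[OF r] in \<open>auto simp: rep_def intro: measurable_completion\<close>)
 show "l2_sq X f < \<infinity>" using r by (simp only: rep_sqn[OF r]) (simp add: rep_def sqi_def)
qed (simp add: rep_def)

lemma rep_refl: "sqi (mX X) f ==> on_base X f ==> rep X f f"
 by (simp add: rep_def)

text \<open>Real and imaginary parts have Borel versions; these need not be periodic, so one period
  is repeated, and \<open>AE_periodic\<close> shows that nothing changed outside a null set.\<close>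

lemma rep_exists:
 assumes f: "L2 X f"
 obtains f' where "rep X f f'"
proof -
 have [measurable]: "f \<in> borel_measurable lebesgue" and p: "on_base X f" using f by (auto simp: L2_def)
 have "(\<lambda>x. Re (f x)) \<in> borel_measurable lebesgue" "(\<lambda>x. Im (f x)) \<in> borel_measurable lebesgue" by measurable
 then obtain a b where ab: "a \<in> borel_measurable lborel" "AE x in lborel. Re (f x) = a x"
  "b \<in> borel_measurable lborel" "AE x in lborel. Im (f x) = b x"
  using completion_ex_borel_measurable_real by metis
 define g where "g x = Complex (a x) (b x)" for x
 have "g = (\<lambda>x. complex_of_real (a x) + \<i> * complex_of_real (b x))" by (simp add: g_def fun_eq_iff complex_eq_iff)
 then have g: "g \<in> bm" using ab by simp
 have fg: "AE x in lborel. f x = g x" using ab(2,4) by eventually_elim (simp add: g_def complex_eq_iff)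
 have o: "on_base X (\<lambda>x. f x = periodize X g x)" by (rule on_base_compose2[OF p on_base_periodize])
 have "AE x in mX X. f x = periodize X g x"
  using AE_mX_I[OF fg] periodize_eq_AE[of X g] by eventually_elim simp
 then have eq: "AE x in lborel. f x = periodize X g x" using AE_periodic[OF _ o] by blast
 have m: "periodize X g \<in> bm" using g by (rule periodize_measurable)
 have "l2_sq X f = l2_sq X (periodize X g)" using eq by (intro l2_sq_cong) (auto elim: AE_mp)
 then have "sqi (mX X) (periodize X g)" using f m by (simp add: L2_def l2_sq_sqn sqi_def)
 then show ?thesis using eq p that[of "periodize X g"] by (simp add: rep_def on_base_periodize)
qed

lemma rep_AE: "sqi (mX X) f' ==> AE x in lborel. f x = f' x ==> on_base X f ==> on_base X f' ==> rep X f f'"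
 by (simp add: rep_def)

lemma rep_cong: "rep X f f' ==> AE x in lborel. f x = g x ==> on_base X g ==> rep X g f'"
 unfolding rep_def by (auto elim: AE_mp)

lemma rep_lin: "rep X f f' ==> rep X g g' ==> rep X (\<lambda>x. a * f x + b * g x) (\<lambda>x. a * f' x + b * g' x)"
 unfolding rep_def
proof (elim conjE, intro conjI sqi_add sqi_cmult)
 assume "on_base X f" "on_base X g" "on_base X f'" "on_base X g'"
 then show "on_base X (\<lambda>x. a * f x + b * g x)" "on_base X (\<lambda>x. a * f' x + b * g' x)" by (simp_all add: on_base_def)
 assume "AE x in lborel. f x = f' x" "AE x in lborel. g x = g' x"
 then show "AE x in lborel. a * f x + b * g x = a * f' x + b * g' x" by eventually_elim simp
qed

text \<open>\<open>hrel X f g\<close>: up to null sets, \<open>g\<close> is the image of \<open>f\<close> under the multiplier \<open>hilb\<close>;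
 \<open>drel X f g\<close>: up to null sets, \<open>g\<close> is the derivative of \<open>f\<close>.\<close>

definition hrel :: "base_space => (real => complex) => (real => complex) => bool" where
 "hrel X f g \<longleftrightarrow> (\<exists>f' g' F. rep X f f' \<and> rep X g g' \<and> ftp X f' F \<and> ftp X g' (\<lambda>k. hilb k * F k))"

definition drel :: "base_space => (real => complex) => (real => complex) => bool" where
 "drel X f g \<longleftrightarrow> (\<exists>f' g' F. rep X f f' \<and> rep X g g' \<and> ftp X f' F \<and> ftp X g' (\<lambda>k. \<i> * of_real k * F k))"

lemma rep_unique_AE:
 assumes "rep X f f'" "rep X g g'" "AE x in lborel. f x = g x"
 shows "AE x in lborel. f' x = g' x"
proof -
 have "AE x in lborel. f x = f' x" "AE x in lborel. g x = g' x" using assms by (auto simp: rep_def)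
 with assms(3) show ?thesis by eventually_elim simp
qed

lemma rep_ftp_unique:
 assumes "rep X f f'" "rep X g g'" "AE x in lborel. f x = g x" "ftp X f' F" "ftp X g' G"
 shows "AE k in nX X. F k = G k"
proof -
 have "ftp X g' F"
  by (rule ftp_cong_left[OF assms(4) AE_mX_I]) (use rep_unique_AE[OF assms(1-3)] rep_borel[OF assms(2)] in auto)
 then show ?thesis by (rule ftp_unique[OF _ assms(5)])
qed

lemma rep_ftp_inj:
 assumes "rep X f f'" "rep X g g'" "ftp X f' F" "ftp X g' G" "AE k in nX X. F k = G k"
 shows "AE x in lborel. f x = g x"
proof -
 have "AE x in lborel. f' x = g' x" using assms by (intro ftp_inj) (auto simp: rep_def)
 moreover have "AE x in lborel. f x = f' x" "AE x in lborel. g x = g' x" using assms by (auto simp: rep_def)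
 ultimately show ?thesis by eventually_elim simp
qed

lemma hrel_exists:
 assumes "L2 X f" obtains g where "hrel X f g"
proof -
 obtain f' where f': "rep X f f'" using rep_exists[OF assms] .
 obtain F where F: "ftp X f' F" using f' ftp_exists unfolding rep_def by blast
 have "sqi (nX X) (\<lambda>k. hilb k * F k)" using F by (intro sqi_hilb ftp_sqi)
 then obtain g where g: "on_base X g" "ftp X g (\<lambda>k. hilb k * F k)" using ftp_surj by blast
 then have "rep X g g" by (intro rep_refl ftp_sqi)
 then show ?thesis using that f' F g unfolding hrel_def by blast
qed

lemma hrel_cong:
 assumes "hrel X f g" "AE x in lborel. f x = f2 x" "AE x in lborel. g x = g2 x" "on_base X f2" "on_base X g2"
 shows "hrel X f2 g2"
 using assms unfolding hrel_def by (blast intro: rep_cong)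

lemma drel_cong:
 assumes "drel X f g" "AE x in lborel. f x = f2 x" "AE x in lborel. g x = g2 x" "on_base X f2" "on_base X g2"
 shows "drel X f2 g2"
 using assms unfolding drel_def by (blast intro: rep_cong)

lemma hrel_unique:
 assumes "hrel X f g" "hrel X f2 g2" "AE x in lborel. f x = f2 x"
 shows "AE x in lborel. g x = g2 x"
proof -
 obtain f' g' F f2' g2' F2 where r: "rep X f f'" "rep X g g'" "ftp X f' F" "ftp X g' (\<lambda>k. hilb k * F k)"
  "rep X f2 f2'" "rep X g2 g2'" "ftp X f2' F2" "ftp X g2' (\<lambda>k. hilb k * F2 k)"
  using assms unfolding hrel_def by blast
 have "AE k in nX X. F k = F2 k" by (rule rep_ftp_unique[OF r(1,5) assms(3) r(3,7)])
 then have "AE k in nX X. hilb k * F k = hilb k * F2 k" by eventually_elim simp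
 then show ?thesis by (rule rep_ftp_inj[OF r(2,6,4,8)])
qed

lemma hrel_lin:
 assumes "hrel X f p" "hrel X g q"
 shows "hrel X (\<lambda>x. a * f x + b * g x) (\<lambda>x. a * p x + b * q x)"
proof -
 obtain f' p' F g' q' G where r: "rep X f f'" "rep X p p'" "ftp X f' F" "ftp X p' (\<lambda>k. hilb k * F k)"
  "rep X g g'" "rep X q q'" "ftp X g' G" "ftp X q' (\<lambda>k. hilb k * G k)"
  using assms unfolding hrel_def by blast
 have "ftp X (\<lambda>x. a * p' x + b * q' x) (\<lambda>k. hilb k * (a * F k + b * G k))"
  using ftp_lin[OF r(4,8), of a b] by (simp add: algebra_simps)
 then show ?thesis unfolding hrel_def using rep_lin[OF r(1,5)] rep_lin[OF r(2,6)] ftp_lin[OF r(3,7)] by blast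
qed

lemma drel_lin:
 assumes "drel X f p" "drel X g q"
 shows "drel X (\<lambda>x. a * f x + b * g x) (\<lambda>x. a * p x + b * q x)"
proof -
 obtain f' p' F g' q' G where r: "rep X f f'" "rep X p p'" "ftp X f' F" "ftp X p' (\<lambda>k. \<i> * of_real k * F k)"
  "rep X g g'" "rep X q q'" "ftp X g' G" "ftp X q' (\<lambda>k. \<i> * of_real k * G k)"
  using assms unfolding drel_def by blast
 have "ftp X (\<lambda>x. a * p' x + b * q' x) (\<lambda>k. \<i> * of_real k * (a * F k + b * G k))"
  using ftp_lin[OF r(4,8), of a b] by (simp add: algebra_simps)
 then show ?thesis unfolding drel_def using rep_lin[OF r(1,5)] rep_lin[OF r(2,6)] ftp_lin[OF r(3,7)] by blast
qed

text \<open>Multipliers commute; the work lies in matching the representatives and transforms of the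
  three hypotheses.\<close>

lemma drel_hrel:
 assumes "drel X f g" "hrel X f p" "hrel X g q"
 shows "drel X p q"
proof -
 obtain f' g' F where d: "rep X f f'" "rep X g g'" "ftp X f' F" "ftp X g' (\<lambda>k. \<i> * of_real k * F k)"
  using assms unfolding drel_def by blast
 obtain f2 p' F2 where p: "rep X f f2" "rep X p p'" "ftp X f2 F2" "ftp X p' (\<lambda>k. hilb k * F2 k)"
  using assms unfolding hrel_def by blast
 obtain g2 q' G2 where q: "rep X g g2" "rep X q q'" "ftp X g2 G2" "ftp X q' (\<lambda>k. hilb k * G2 k)"
  using assms unfolding hrel_def by blast
 have m: "F2 \<in> bm" using ftp_sqi(2)[OF p(3)] by (rule sqi_borel)
 have "AE k in nX X. F2 k = F k" "AE k in nX X. G2 k = \<i> * of_real k * F k"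
  using rep_ftp_unique[OF p(1) d(1) _ p(3) d(3)] rep_ftp_unique[OF q(1) d(2) _ q(3) d(4)] by auto
 then have "AE k in nX X. hilb k * G2 k = \<i> * of_real k * (hilb k * F2 k)" by eventually_elim (simp add: mult_ac)
 then have "ftp X q' (\<lambda>k. \<i> * of_real k * (hilb k * F2 k))" by (rule ftp_cong_right[OF q(4)]) (use m in measurable)
 then show ?thesis using p q unfolding drel_def by blast
qed

text \<open>The square of the Hilbert multiplier is \<open>-1\<close> away from frequency zero, and derivatives have no
 component there.\<close>

lemma drel_hrel_hrel:
 assumes "drel X f g" "hrel X g k"
 shows "hrel X k (\<lambda>x. - g x)"
proof -
 obtain f' g' F where d: "rep X f f'" "rep X g g'" "ftp X f' F" "ftp X g' (\<lambda>z. \<i> * of_real z * F z)"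
  using assms unfolding drel_def by blast
 obtain g2 k' G2 where q: "rep X g g2" "rep X k k'" "ftp X g2 G2" "ftp X k' (\<lambda>z. hilb z * G2 z)"
  using assms unfolding hrel_def by blast
 have m: "G2 \<in> bm" using ftp_sqi(2)[OF q(3)] by (rule sqi_borel)
 have "AE z in nX X. G2 z = \<i> * of_real z * F z"
  using rep_ftp_unique[OF q(1) d(2) _ q(3) d(4)] by auto
 then have "AE z in nX X. (-1) * (\<i> * of_real z * F z) = hilb z * (hilb z * G2 z)"
 proof eventually_elim
  case (elim z)
  have "hilb z * hilb z * of_real z = - of_real z" by (auto simp: hilb_def sgn_real_def)
  then show ?case unfolding elim by (simp add: mult.assoc[symmetric]) (simp add: mult_ac)
 qed
 then have "ftp X (\<lambda>x. (-1) * g' x) (\<lambda>z. hilb z * (hilb z * G2 z))"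
  by (rule ftp_cong_right[OF ftp_cmult[OF d(4)]]) (use m in measurable)
 moreover have "rep X (\<lambda>x. - g x) (\<lambda>x. (-1) * g' x)" using rep_lin[OF d(2) d(2), of "-1" 0] by simp
 ultimately show ?thesis using q unfolding hrel_def by blast
qed

lemma hrel_L2: "hrel X f g ==> L2 X f" "hrel X f g ==> L2 X g"
 unfolding hrel_def by (blast intro: rep_L2)+

lemma drel_L2: "drel X f g ==> L2 X f" "drel X f g ==> L2 X g"
 unfolding drel_def by (blast intro: rep_L2)+

text \<open>The multiplier has modulus at most 1; the constant only reflects the crude bounds
  \<open>ftp_lower\<close> and \<open>ftp_bound\<close>.\<close>

lemma hrel_bound:
 assumes "hrel X f g"
 shows "l2_sq X g <= ennreal (4 * pi) * l2_sq X f"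
proof -
 obtain f' g' F where r: "rep X f f'" "rep X g g'" "ftp X f' F" "ftp X g' (\<lambda>k. hilb k * F k)"
  using assms unfolding hrel_def by blast
 have "l2_sq X g = sqn (mX X) g'" by (rule rep_sqn[OF r(2)])
 also have "... <= sqn (nX X) (\<lambda>k. hilb k * F k)" using r(2,4) by (intro ftp_lower) (simp_all add: rep_def)
 also have "... <= sqn (nX X) F"
  by (intro sqn_mono_AE AE_I2) (auto simp: norm_mult norm_hilb_le intro: mult_left_le_one_le)
 also have "... <= ennreal (4 * pi) * sqn (mX X) f'" by (rule ftp_bound[OF r(3)])
 finally show ?thesis by (simp add: rep_sqn[OF r(1)])
qed

text \<open>The Hilbert transform does not preserve boundedness, so the bound for \<open>p\<close>
  is taken from the integral of the modulus of the transform, which \<open>hilb\<close> does not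
  increase.\<close>

lemma hrel_sup_bound:
 assumes "rep X f f'" "ftp X f' F" "sqi (nX X) (\<lambda>k. of_real k * F k)"
 defines "C \<equiv> LINT k|nX X. cmod (F k)"
 shows "AE x in lborel. cmod (f x) <= C" and "hrel X f p ==> AE x in lborel. cmod (p x) <= C"
  and "ennreal (C^2) <= ennreal (4 * pi) * (2 * sqn (nX X) F + 2 * sqn (nX X) (\<lambda>k. of_real k * F k))"
proof -
 note F = Sobolev_integrable[OF ftp_sqi(2)[OF assms(2)] assms(3)]
 show "ennreal (C^2) <= ennreal (4 * pi) * (2 * sqn (nX X) F + 2 * sqn (nX X) (\<lambda>k. of_real k * F k))"
  unfolding C_def by (rule F(2))
 have "AE x in lborel. cmod (f' x) <= C" unfolding C_def by (rule ftp_sup_bound[OF assms(2) _ F(1)]) (use assms in \<open>simp add: rep_def\<close>)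
 moreover have "AE x in lborel. f x = f' x" using assms by (simp add: rep_def)
 ultimately show "AE x in lborel. cmod (f x) <= C" by eventually_elim simp
 assume "hrel X f p"
 then obtain f2 p' F2 where p: "rep X f f2" "rep X p p'" "ftp X f2 F2" "ftp X p' (\<lambda>k. hilb k * F2 k)"
  unfolding hrel_def by blast
 have [measurable]: "F \<in> bm" "F2 \<in> bm" using ftp_sqi(2)[OF p(3)] ftp_sqi(2)[OF assms(2)] by (auto dest: sqi_borel)
 have "AE k in nX X. F2 k = F k" using rep_ftp_unique[OF p(1) assms(1) _ p(3) assms(2)] by auto
 then have le: "AE k in nX X. cmod (hilb k * F2 k) <= cmod (F k)"
  by eventually_elim (auto simp: norm_mult norm_hilb_le intro: mult_left_le_one_le)
 have i: "integrable (nX X) (\<lambda>k. hilb k * F2 k)" by (rule integrable_le[OF F(1) _ le]) measurable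
 have "AE x in lborel. cmod (p' x) <= (LINT k|nX X. cmod (hilb k * F2 k))"
  by (rule ftp_sup_bound[OF p(4) _ i]) (use p in \<open>simp add: rep_def\<close>)
 moreover have "AE x::real in lborel. (LINT k|nX X. cmod (hilb k * F2 k)) <= C"
  by (rule AE_I2, unfold C_def, rule integral_mono_AE) (use i F(1) le in auto)
 moreover have "AE x in lborel. p x = p' x" using p by (simp add: rep_def)
 ultimately show "AE x in lborel. cmod (p x) <= C" by eventually_elim simp
qed

lemma drel_sup_bound:
 assumes "drel X f g"
 obtains C where "AE x in lborel. cmod (f x) <= C" "\<And>p. hrel X f p ==> AE x in lborel. cmod (p x) <= C"
proof -
 obtain f' g' F where d: "rep X f f'" "rep X g g'" "ftp X f' F" "ftp X g' (\<lambda>k. \<i> * of_real k * F k)"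
  using assms unfolding drel_def by blast
 have "sqi (nX X) (\<lambda>k. - \<i> * (\<i> * of_real k * F k))" by (rule sqi_cmult[OF ftp_sqi(2)[OF d(4)]])
 then have "sqi (nX X) (\<lambda>k. of_real k * F k)" by (simp add: mult.assoc[symmetric])
 from hrel_sup_bound(1,2)[OF d(1,3) this] show ?thesis using that by blast
qed

text \<open>\<open>drel X f f1\<close> bounds \<open>f\<close> and its Hilbert transform. On the
  circle \<open>F0\<close> is a periodic primitive of \<open>f\<close>; it supplies the vanishing
  mean.\<close>

lemma hrel_Cotlar:
 assumes f: "X = Circle ==> drel X F0 f" "drel X f f1" "hrel X f Hf" and g: "hrel X g Hg"
 shows "hrel X (\<lambda>x. Hf x * g x + f x * Hg x) (\<lambda>x. Hf x * Hg x - f x * g x)"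
proof -
 obtain f' Hf' F where a: "rep X f f'" "rep X Hf Hf'" "ftp X f' F" "ftp X Hf' (\<lambda>k. hilb k * F k)"
  using f unfolding hrel_def by blast
 obtain g' Hg' G where b: "rep X g g'" "rep X Hg Hg'" "ftp X g' G" "ftp X Hg' (\<lambda>k. hilb k * G k)"
  using g unfolding hrel_def by blast
 have AEs: "AE x in lborel. f x = f' x" "AE x in lborel. Hf x = Hf' x" "AE x in lborel. g x = g' x" "AE x in lborel. Hg x = Hg' x"
  using a b by (auto simp: rep_def)
 have obs: "on_base X f" "on_base X f'" "on_base X g" "on_base X g'" "on_base X Hf" "on_base X Hf'" "on_base X Hg" "on_base X Hg'"
  using a b by (auto simp: rep_def)
 obtain C where C: "AE x in lborel. cmod (f x) <= C" "AE x in lborel. cmod (Hf x) <= C"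
  using drel_sup_bound[OF f(2)] f(3) by metis
 have "AE x in lborel. cmod (f' x) <= C" "AE x in lborel. cmod (Hf' x) <= C"
  using C(1) AEs(1) by (eventually_elim, simp) (use C(2) AEs(2) in \<open>eventually_elim, simp\<close>)
 note bd = this[THEN AE_mX_I]
 have Fz: "F 0 = 0" if C: "X = Circle"
 proof -
  obtain F0' f2 K where c: "rep X F0 F0'" "rep X f f2" "ftp X F0' K" "ftp X f2 (\<lambda>k. \<i> * of_real k * K k)"
   using f(1)[OF C] unfolding drel_def by blast
  have "AE k in nX X. F k = \<i> * of_real k * K k" using rep_ftp_unique[OF a(1) c(2) _ a(3) c(4)] by auto
  \<comment> \<open>For counting measure almost everywhere means everywhere, so frequency 0 may be
    inserted.\<close>
  then have "AE n in count_space (UNIV::int set). F (of_int n) = \<i> * of_real (of_int n) * K (of_int n)"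
   using ftp_sqi(2)[OF a(3)] ftp_sqi(2)[OF c(3)]
   unfolding C nX.simps by (subst (asm) AE_distr_iff) (auto dest!: sqi_borel)
  then show ?thesis by (simp add: AE_count_space) (metis mult_zero_left mult_zero_right of_int_0 of_real_0)
 qed
 obtain U where U: "ftp X (\<lambda>x. Hf' x * g' x + f' x * Hg' x) U" "ftp X (\<lambda>x. Hf' x * Hg' x - f' x * g' x) (\<lambda>k. hilb k * U k)"
  using Cotlar[OF a(3) obs(2) a(4) obs(6) b(3,4) bd Fz] by blast
 have "rep X (\<lambda>x. Hf x * g x + f x * Hg x) (\<lambda>x. Hf' x * g' x + f' x * Hg' x)"
  by (rule rep_AE[OF ftp_sqi(1)[OF U(1)]], use AEs in \<open>eventually_elim, simp\<close>, use obs in \<open>simp_all add: on_base_def\<close>)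
 moreover have "rep X (\<lambda>x. Hf x * Hg x - f x * g x) (\<lambda>x. Hf' x * Hg' x - f' x * g' x)"
  by (rule rep_AE[OF ftp_sqi(1)[OF U(2)]], use AEs in \<open>eventually_elim, simp\<close>, use obs in \<open>simp_all add: on_base_def\<close>)
 ultimately show ?thesis using U unfolding hrel_def by blast
qed

lemma drel_mult:
 assumes d: "drel X f g" and s: "\<And>x. (s has_vector_derivative s' x) (at x)" "continuous_on UNIV s'"
  and sb: "\<And>x. cmod (s x) <= C" "\<And>x. cmod (s' x) <= C" "on_base X s" "on_base X s'"
 shows "drel X (\<lambda>x. s x * f x) (\<lambda>x. s' x * f x + s x * g x)"
proof -
 obtain f' g' F where r: "rep X f f'" "rep X g g'" "ftp X f' F" "ftp X g' (\<lambda>k. \<i> * of_real k * F k)"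
  using d unfolding drel_def by blast
 then have "dft X f' g'" unfolding dft_def rep_def by blast
 from dftE[OF dft_mult[OF this s sb]] obtain G where
  G: "ftp X (\<lambda>x. s x * f' x) G" "ftp X (\<lambda>x. s' x * f' x + s x * g' x) (\<lambda>k. \<i> * of_real k * G k)"
  "on_base X (\<lambda>x. s x * f' x)" "on_base X (\<lambda>x. s' x * f' x + s x * g' x)" by blast
 have AEs: "AE x in lborel. f x = f' x" "AE x in lborel. g x = g' x" using r by (auto simp: rep_def)
 have obs: "on_base X f" "on_base X g" using r by (auto simp: rep_def)
 have "rep X (\<lambda>x. s x * f x) (\<lambda>x. s x * f' x)"
  by (rule rep_AE[OF ftp_sqi(1)[OF G(1)]], use AEs(1) in \<open>eventually_elim, simp\<close>, use obs sb G(3) in \<open>simp_all add: on_base_def\<close>)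
 moreover have "rep X (\<lambda>x. s' x * f x + s x * g x) (\<lambda>x. s' x * f' x + s x * g' x)"
  by (rule rep_AE[OF ftp_sqi(1)[OF G(2)]], use AEs in \<open>eventually_elim, simp\<close>, use obs sb G(4) in \<open>simp_all add: on_base_def\<close>)
 ultimately show ?thesis using G unfolding drel_def by blast
qed

section \<open>Sobolev spaces and \<open>|\<nabla>|\<close> in terms of multipliers\<close>

lemma lebesgue_integral_AE_borel:
 fixes f g :: "real => 'b::{banach, second_countable_topology}"
 assumes "g \<in> bm" "AE x in lborel. f x = g x"
 shows "integral\<^sup>L lebesgue f = integral\<^sup>L lborel g"
proof -
 have m: "g \<in> borel_measurable lebesgue" using assms(1) by (intro measurable_completion) simp
 have "integral\<^sup>L lebesgue f = integral\<^sup>L lebesgue g"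
  by (rule integral_cong_AE[OF lebesgue_measurable_AE_cong[OF m assms(2)] m]) (use assms(2) in \<open>simp add: AE_completion_iff\<close>)
 also have "... = integral\<^sup>L lborel g" by (rule integral_completion) (use assms(1) in simp)
 finally show ?thesis .
qed

lemma truncated_Fourier_integral:
 assumes "rep Line f f'"
 shows "(LINT x:{-R..R}|lebesgue. cis (- (x * k)) * f x) = ft0 Line (cut R f') k"
proof -
 have [measurable]: "f' \<in> bm" by (rule rep_borel[OF assms])
 have "AE x in lborel. f x = f' x" using assms by (simp add: rep_def)
 then have "AE x in lborel. indicator {-R..R} x *\<^sub>R (cis (- (x * k)) * f x) = cis (- (x * k)) * cut R f' x"
  by eventually_elim (simp add: cut_def indicator_def)
 then show ?thesis unfolding set_lebesgue_integral_def ft0_def mX_Line by (intro lebesgue_integral_AE_borel) measurable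
qed

lemma ftp_borel: "ftp X f F ==> F \<in> bm"
 by (rule sqi_borel(2)[OF ftp_sqi(2)])

lemma is_fourier_transform_iff:
 assumes f: "rep Line f f'"
 shows "is_fourier_transform f F \<longleftrightarrow> (\<exists>F'. rep Line F F' \<and> ftp Line f' F')"
proof -
 have fs: "sqi lborel f'" using f by (simp add: rep_def)
 have eq: "l2_sq Line (\<lambda>k. F k - ft0 Line (cut R f') k) = sqn lborel (\<lambda>k. F' k - ft0 Line (cut R f') k)"
  if F': "rep Line F F'" for F' R
 proof -
  have [measurable]: "F' \<in> bm" "cut R f' \<in> bm"
   using rep_borel[OF F'] rep_borel[OF f] by simp_all
  have "AE x in lborel. F x = F' x" using F' by (simp add: rep_def)
  then have "AE x in lborel. cmod (F x - ft0 Line (cut R f') x) = cmod (F' x - ft0 Line (cut R f') x)" by eventually_elim simp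
  then have "l2_sq Line (\<lambda>k. F k - ft0 Line (cut R f') k) = l2_sq Line (\<lambda>k. F' k - ft0 Line (cut R f') k)" by (rule l2_sq_cong)
  also have "... = sqn lborel (\<lambda>k. F' k - ft0 Line (cut R f') k)" by (subst l2_sq_sqn) simp_all
  finally show ?thesis .
 qed
 show ?thesis
 proof
  assume a: "is_fourier_transform f F"
  then obtain F' where F': "rep Line F F'" using rep_exists unfolding is_fourier_transform_def by blast
  have "ftp Line f' F'" using a F' fs unfolding is_fourier_transform_def truncated_Fourier_integral[OF f] eq[OF F']
   by (simp add: ftp_def rep_def)
  then show "\<exists>F'. rep Line F F' \<and> ftp Line f' F'" using F' by blast
 next
  assume "\<exists>F'. rep Line F F' \<and> ftp Line f' F'"
  then obtain F' where F': "rep Line F F'" "ftp Line f' F'" by blast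
  then show "is_fourier_transform f F" unfolding is_fourier_transform_def truncated_Fourier_integral[OF f] eq[OF F'(1)]
   by (simp add: ftp_def rep_L2[OF f] rep_L2[OF F'(1)])
 qed
qed

lemma fourier_transform_AE:
 assumes f: "rep Line f f'" "ftp Line f' F"
 shows "AE k in lborel. fourier_transform f k = F k"
proof -
 have "rep Line F F" using ftp_sqi(2)[OF f(2)] by (simp add: rep_def on_base_def)
 then have "is_fourier_transform f F" using is_fourier_transform_iff[OF f(1)] f(2) by blast
 then have "is_fourier_transform f (fourier_transform f)" unfolding fourier_transform_def by (rule someI[of "is_fourier_transform f"])
 then obtain F' where F': "rep Line (fourier_transform f) F'" "ftp Line f' F'" using is_fourier_transform_iff[OF f(1)] by blast
 have "AE k in lborel. F' k = F k" using ftp_unique[OF F'(2) f(2)] unfolding nX.simps .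
 moreover have "AE k in lborel. fourier_transform f k = F' k" using F'(1) by (simp add: rep_def)
 ultimately show ?thesis by eventually_elim simp
qed

lemma AE_nX_Circle: "{k. P k} \<in> sets borel ==> (AE k in nX Circle. P k) \<longleftrightarrow> (\<forall>n::int. P (of_int n))"
 unfolding nX.simps by (subst AE_distr_iff) (auto simp: AE_count_space)

lemma fourier_coeff_eq:
 assumes f: "rep Circle f f'" "ftp Circle f' F"
 shows "2 * pi * fourier_coeff f n = F (of_int n)"
proof -
 have [measurable]: "f' \<in> bm" "F \<in> bm" by (rule rep_borel[OF f(1)] ftp_borel[OF f(2)])+
 have "AE x in lborel. f x = f' x" using f by (simp add: rep_def)
 then have "AE x in lborel. indicator {-pi..pi} x *\<^sub>R (cis (- (of_int n * x)) * f x) = indicator {-pi..pi} x *\<^sub>R (cis (- (x * of_int n)) * f' x)"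
  by eventually_elim (simp add: mult.commute)
 then have "(LINT x:{-pi..pi}|lebesgue. cis (- (of_int n * x)) * f x) = (LINT x|lborel. indicator {-pi..pi} x *\<^sub>R (cis (- (x * of_int n)) * f' x))"
  unfolding set_lebesgue_integral_def by (intro lebesgue_integral_AE_borel) measurable
 also have "... = ft0 Circle f' (of_int n)" unfolding ft0_def by (subst integral_mX) simp_all
 finally have 1: "(LINT x:{-pi..pi}|lebesgue. cis (- (of_int n * x)) * f x) = ft0 Circle f' (of_int n)" .
 have s: "sqi (mX Circle) f'" using f by (simp add: rep_def)
 have one: "sqi (mX Circle) (\<lambda>x. 1)"
  by (simp add: sqi_def sqn_def finite_mX_Circle)
 have i: "integrable (mX Circle) f'" using sqi_integrable_mult[OF one s] by simp
 have "AE k in nX Circle. F k = ft0 Circle f' k" by (rule ftp_unique[OF f(2) ftp_ft0[OF i s]])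
 then have "F (of_int n) = ft0 Circle f' (of_int n)" by (subst (asm) AE_nX_Circle) auto
 then show ?thesis by (simp add: fourier_coeff_def 1 scaleR_conv_of_real)
qed

lemma ftp_Circle_iff:
 assumes "rep Circle f f'" "sqi (nX Circle) F"
 shows "ftp Circle f' F \<longleftrightarrow> (\<forall>n. 2 * pi * fourier_coeff f n = F (of_int n))"
proof
 assume a: "\<forall>n. 2 * pi * fourier_coeff f n = F (of_int n)"
 obtain G where G: "ftp Circle f' G" using assms ftp_exists unfolding rep_def by blast
 have [measurable]: "F \<in> bm" "G \<in> bm" using sqi_borel(2)[OF assms(2)] ftp_borel[OF G] by simp_all
 have "G (of_int n) = F (of_int n)" for n using fourier_coeff_eq[OF assms(1) G] a by simp
 then have "AE k in nX Circle. G k = F k" by (subst AE_nX_Circle) auto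
 then show "ftp Circle f' F" by (rule ftp_cong_right[OF G]) simp
qed (use fourier_coeff_eq[OF assms(1)] in blast)

text \<open>On the line the definition asks for some transform of \<open>f\<close>, on the circle it
  compares coefficients; uniqueness of transforms reduces both to the fixed
  \<open>F\<close>.\<close>

lemma is_abs_nabla_iff:
 assumes f: "rep X f f'" "ftp X f' F" and s: "sqi (nX X) (\<lambda>z. of_real \<bar>z\<bar> * F z)"
 shows "is_abs_nabla X f k \<longleftrightarrow> (\<exists>k'. rep X k k' \<and> ftp X k' (\<lambda>z. of_real \<bar>z\<bar> * F z))"
proof (cases X)
 case Line
 note f = f[unfolded Line] and s = s[unfolded Line nX.simps]
 have [measurable]: "F \<in> bm" by (rule ftp_borel[OF f(2)])
 have "rep Line F F" using ftp_sqi(2)[OF f(2)] by (simp add: rep_def on_base_def)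
 then have ft: "is_fourier_transform f F" using is_fourier_transform_iff[OF f(1)] f(2) by blast
 have eq: "AE z in lborel. G z = F z" if G: "is_fourier_transform f G" for G
 proof -
  obtain G' where G': "rep Line G G'" "ftp Line f' G'" using G is_fourier_transform_iff[OF f(1)] by blast
  have "AE z in lborel. G' z = F z" using ftp_unique[OF G'(2) f(2)] unfolding nX.simps .
  moreover have "AE z in lborel. G z = G' z" using G'(1) by (simp add: rep_def)
  ultimately show ?thesis by eventually_elim simp
 qed
 show ?thesis
 proof
  assume "is_abs_nabla X f k"
  then obtain G where G: "is_fourier_transform f G" "is_fourier_transform k (\<lambda>z. of_real \<bar>z\<bar> * G z)"
   using Line by auto
  then have "L2 Line k" unfolding is_fourier_transform_def by blast
  then obtain k' where k': "rep Line k k'" by (rule rep_exists)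
  obtain H where H: "rep Line (\<lambda>z. of_real \<bar>z\<bar> * G z) H" "ftp Line k' H" using G(2) is_fourier_transform_iff[OF k'] by blast
  have "AE z in lborel. of_real \<bar>z\<bar> * G z = H z" using H(1) by (simp add: rep_def)
  then have "AE z in nX Line. H z = of_real \<bar>z\<bar> * F z" using eq[OF G(1)] unfolding nX.simps by eventually_elim simp
  then have "ftp Line k' (\<lambda>z. of_real \<bar>z\<bar> * F z)" by (rule ftp_cong_right[OF H(2)]) measurable
  then show "\<exists>k'. rep X k k' \<and> ftp X k' (\<lambda>z. of_real \<bar>z\<bar> * F z)" using k' Line by blast
 next
  assume "\<exists>k'. rep X k k' \<and> ftp X k' (\<lambda>z. of_real \<bar>z\<bar> * F z)"
  then obtain k' where k': "rep Line k k'" "ftp Line k' (\<lambda>z. of_real \<bar>z\<bar> * F z)" using Line by blast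
  have "rep Line (\<lambda>z. of_real \<bar>z\<bar> * F z) (\<lambda>z. of_real \<bar>z\<bar> * F z)" using s by (simp add: rep_def on_base_def)
  then have "is_fourier_transform k (\<lambda>z. of_real \<bar>z\<bar> * F z)" using is_fourier_transform_iff[OF k'(1)] k'(2) by blast
  then show "is_abs_nabla X f k" using ft Line by auto
 qed
next
 case Circle
 note f = f[unfolded Circle] and s = s[unfolded Circle]
 have eq: "(\<forall>n. fourier_coeff k n = of_int \<bar>n\<bar> * fourier_coeff f n) \<longleftrightarrow> ftp Circle k' (\<lambda>z. of_real \<bar>z\<bar> * F z)"
  if "rep Circle k k'" for k'
 proof -
  have "fourier_coeff k n = of_int \<bar>n\<bar> * fourier_coeff f n \<longleftrightarrow> 2 * pi * fourier_coeff k n = of_real \<bar>real_of_int n\<bar> * F (of_int n)" for n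
  proof -
   have "of_real \<bar>real_of_int n\<bar> * F (of_int n) = 2 * pi * (of_int \<bar>n\<bar> * fourier_coeff f n)"
    using fourier_coeff_eq[OF f, of n, symmetric] by (simp add: mult_ac flip: of_int_abs)
   then show ?thesis by simp
  qed
  then show ?thesis unfolding ftp_Circle_iff[OF that s] by simp
 qed
 show ?thesis
 proof
  assume a: "is_abs_nabla X f k"
  then have "L2 Circle k" using Circle by simp
  then obtain k' where k': "rep Circle k k'" by (rule rep_exists)
  then show "\<exists>k'. rep X k k' \<and> ftp X k' (\<lambda>z. of_real \<bar>z\<bar> * F z)" using a eq[OF k'] Circle by auto
 next
  assume "\<exists>k'. rep X k k' \<and> ftp X k' (\<lambda>z. of_real \<bar>z\<bar> * F z)"
  then obtain k' where k': "rep Circle k k'" "ftp Circle k' (\<lambda>z. of_real \<bar>z\<bar> * F z)" using Circle by blast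
  then show "is_abs_nabla X f k" using eq[OF k'(1)] rep_L2[OF k'(1)] rep_L2[OF f(1)] Circle by simp
 qed
qed

text \<open>\<open>hilb k * (i * k)\<close> is the absolute value of \<open>k\<close>. The function
  picked by \<open>abs_nabla\<close> is then determined up to a null set by its transform.\<close>

lemma abs_nabla_hrel:
 assumes "drel X f g" "hrel X g k"
 shows "AE x in lborel. abs_nabla X f x = k x" "L2 X (abs_nabla X f)"
proof -
 obtain f' g' F where d: "rep X f f'" "rep X g g'" "ftp X f' F" "ftp X g' (\<lambda>z. \<i> * of_real z * F z)"
  using assms unfolding drel_def by blast
 obtain g2 k' G where q: "rep X g g2" "rep X k k'" "ftp X g2 G" "ftp X k' (\<lambda>z. hilb z * G z)"
  using assms unfolding hrel_def by blast
 have [measurable]: "F \<in> bm" by (rule ftp_borel[OF d(3)])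
 have "AE z in nX X. G z = \<i> * of_real z * F z" using rep_ftp_unique[OF q(1) d(2) _ q(3) d(4)] by auto
 then have "AE z in nX X. hilb z * G z = of_real \<bar>z\<bar> * F z"
  by eventually_elim (auto simp: hilb_def sgn_real_def mult.assoc[symmetric])
 then have k: "ftp X k' (\<lambda>z. of_real \<bar>z\<bar> * F z)" by (rule ftp_cong_right[OF q(4)]) measurable
 note iff = is_abs_nabla_iff[OF d(1,3) ftp_sqi(2)[OF k]]
 have "is_abs_nabla X f k" using iff q(2) k by blast
 \<comment> \<open>The choice is not void: a continuous candidate serves if there is one, and
   \<open>k\<close> otherwise.\<close>
 then have "\<exists>g. is_abs_nabla X f g \<and> ((\<exists>h. is_abs_nabla X f h \<and> continuous_on UNIV h) \<longrightarrow> continuous_on UNIV g)" by blast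
 from someI_ex[OF this] have "is_abs_nabla X f (abs_nabla X f)" unfolding abs_nabla_def by blast
 then obtain a where a: "rep X (abs_nabla X f) a" "ftp X a (\<lambda>z. of_real \<bar>z\<bar> * F z)" using iff by blast
 show "AE x in lborel. abs_nabla X f x = k x" by (rule rep_ftp_inj[OF a(1) q(2) a(2) k]) simp
 show "L2 X (abs_nabla X f)" by (rule rep_L2[OF a(1)])
qed

text \<open>Fourier coefficients are the transform divided by \<open>2 * pi\<close>; this factor
  enters the Sobolev norm squared.\<close>

fun csob :: "base_space => real" where
 "csob Line = 1"
| "csob Circle = 1 / (2 * pi)^2"

lemma sobolev_sq_eq:
 assumes f: "rep X f f'" "ftp X f' F"
 shows "sobolev_sq X 1 f = ennreal (csob X) * (sqn (nX X) F + sqn (nX X) (\<lambda>k. of_real k * F k))"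
proof -
 have [measurable]: "F \<in> bm" by (rule ftp_borel[OF f(2)])
 have pt: "ennreal ((1 + k^2) powr 1 * (cmod z)^2) = (esq z) + (esq (of_real k * z))" for k z
 proof -
  have "1 + k^2 > 0" by (simp add: add_pos_nonneg)
  then have "(1 + k^2) powr 1 * (cmod z)^2 = (cmod z)^2 + (cmod (of_real k * z))^2"
   by (simp add: norm_mult power_mult_distrib algebra_simps)
  then show ?thesis by simp
 qed
 have sum: "(\<integral>\<^sup>+k. ennreal ((1 + k^2) powr 1 * (cmod (F k))^2) \<partial>nX X) = sqn (nX X) F + sqn (nX X) (\<lambda>k. of_real k * F k)"
  unfolding pt sqn_def by (rule nn_integral_add) simp_all
 show ?thesis
 proof (cases X)
  case Line
  have "AE k in lborel. fourier_transform f k = F k" using f unfolding Line by (rule fourier_transform_AE)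
  then have "AE k in lborel. ennreal ((1 + k^2) powr 1 * (cmod (fourier_transform f k))^2) = ennreal ((1 + k^2) powr 1 * (cmod (F k))^2)"
   by eventually_elim simp
  then have "sobolev_sq Line 1 f = (\<integral>\<^sup>+k. ennreal ((1 + k^2) powr 1 * (cmod (F k))^2) \<partial>lborel)"
   unfolding sobolev_sq.simps nn_integral_completion by (rule nn_integral_cong_AE)
  then show ?thesis using sum unfolding Line by simp
 next
  case Circle
  have "fourier_coeff f n = of_real (1 / (2 * pi)) * F (of_int n)" for n
   using fourier_coeff_eq[OF f[unfolded Circle], of n, symmetric] by simp
  then have "(cmod (fourier_coeff f n))^2 = csob Circle * (cmod (F (of_int n)))^2" for n
   by (simp add: norm_mult norm_divide power_divide power_mult_distrib)
  then have "sobolev_sq Circle 1 f = (\<integral>\<^sup>+n. ennreal (csob Circle) * ennreal ((1 + (real_of_int n)^2) powr 1 * (cmod (F (of_int n)))^2) \<partial>count_space UNIV)"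
   unfolding sobolev_sq.simps by (intro nn_integral_cong) (simp add: ennreal_mult[symmetric] mult_ac)
  also have "... = ennreal (csob Circle) * (\<integral>\<^sup>+n. ennreal ((1 + (real_of_int n)^2) powr 1 * (cmod (F (of_int n)))^2) \<partial>count_space UNIV)"
   by (rule nn_integral_cmult) simp
  also have "(\<integral>\<^sup>+n. ennreal ((1 + (real_of_int n)^2) powr 1 * (cmod (F (of_int n)))^2) \<partial>count_space UNIV)
   = (\<integral>\<^sup>+k. ennreal ((1 + k^2) powr 1 * (cmod (F k))^2) \<partial>nX Circle)"
   unfolding nX.simps by (subst nn_integral_distr) auto
  finally show ?thesis using sum unfolding Circle by simp
 qed
qed

text \<open>Square-integrability of \<open>k * F k\<close> yields a derivative by surjectivity of
  the transform; conversely the transform of the derivative shows it.\<close>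

lemma sobolev_iff_drel: "sobolev X 1 f \<longleftrightarrow> (\<exists>g. drel X f g)"
proof
 assume a: "sobolev X 1 f"
 then obtain f' where f': "rep X f f'" using rep_exists unfolding sobolev_def by blast
 obtain F where F: "ftp X f' F" using f' ftp_exists unfolding rep_def by blast
 have [measurable]: "F \<in> bm" by (rule ftp_borel[OF F])
 have "csob X > 0" by (cases X) auto
 then have "sqn (nX X) (\<lambda>k. of_real k * F k) < \<infinity>"
  using a unfolding sobolev_def sobolev_sq_eq[OF f' F] by (auto simp: ennreal_mult_less_top)
 then have "sqi (nX X) (\<lambda>k. of_real k * F k)" by (simp add: sqi_def)
 then have "sqi (nX X) (\<lambda>k. \<i> * (of_real k * F k))" by (rule sqi_cmult)
 then obtain g where g: "on_base X g" "ftp X g (\<lambda>k. \<i> * (of_real k * F k))" using ftp_surj by blast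
 then have "rep X g g" by (intro rep_refl ftp_sqi)
 then show "\<exists>g. drel X f g" using f' F g unfolding drel_def by (auto simp: mult.assoc)
next
 assume "\<exists>g. drel X f g"
 then obtain g f' g' F where d: "rep X f f'" "rep X g g'" "ftp X f' F" "ftp X g' (\<lambda>k. \<i> * of_real k * F k)"
  unfolding drel_def by blast
 have "sqi (nX X) (\<lambda>k. - \<i> * (\<i> * of_real k * F k))" by (rule sqi_cmult[OF ftp_sqi(2)[OF d(4)]])
 then have "sqi (nX X) (\<lambda>k. of_real k * F k)" by (simp add: mult.assoc[symmetric])
 then show "sobolev X 1 f" using ftp_sqi(2)[OF d(3)] unfolding sobolev_def sobolev_sq_eq[OF d(1,3)]
  by (simp add: rep_L2[OF d(1)] sqi_def ennreal_mult_less_top)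
qed

text \<open>Meant for the difference of the field's derivatives at two times: a small Sobolev norm
  makes the Hilbert transforms uniformly close.\<close>

lemma hrel_sup_bound_sobolev:
 assumes f: "sobolev X 1 f" "hrel X f p"
 shows "AE x in lborel. (esq (p x)) <= ennreal (8 * pi / csob X) * sobolev_sq X 1 f"
proof -
 obtain g f' g' F where d: "rep X f f'" "rep X g g'" "ftp X f' F" "ftp X g' (\<lambda>k. \<i> * of_real k * F k)"
  using f(1) unfolding sobolev_iff_drel drel_def by blast
 have "sqi (nX X) (\<lambda>k. - \<i> * (\<i> * of_real k * F k))" by (rule sqi_cmult[OF ftp_sqi(2)[OF d(4)]])
 then have s: "sqi (nX X) (\<lambda>k. of_real k * F k)" by (simp add: mult.assoc[symmetric])
 define C where "C = (LINT k|nX X. cmod (F k))"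
 note b = hrel_sup_bound(2,3)[OF d(1,3) s, folded C_def]
 have c: "csob X > 0" by (cases X) auto
 have "ennreal (8 * pi / csob X) * sobolev_sq X 1 f = ennreal (8 * pi / csob X * csob X) * (sqn (nX X) F + sqn (nX X) (\<lambda>k. of_real k * F k))"
  unfolding sobolev_sq_eq[OF d(1,3)] using c by (subst ennreal_mult) (auto simp: mult.assoc)
 also have "8 * pi / csob X * csob X = 4 * pi * 2" using c by simp
 also have "ennreal (4 * pi * 2) * (sqn (nX X) F + sqn (nX X) (\<lambda>k. of_real k * F k)) = ennreal (4 * pi) * (2 * sqn (nX X) F + 2 * sqn (nX X) (\<lambda>k. of_real k * F k))"
  by (subst ennreal_mult) (auto simp: distrib_left mult.assoc)
 finally have le: "ennreal (C^2) <= ennreal (8 * pi / csob X) * sobolev_sq X 1 f" using b(2) by simp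
 show ?thesis using b(1)[OF f(2)]
 proof eventually_elim
  case (elim x)
  have "(esq (p x)) <= ennreal (C^2)" using elim by (intro ennreal_leI power_mono) auto
  then show ?case using le by (rule order_trans)
 qed
qed

section \<open>Vector-valued functions\<close>

lemma l2_sq_le:
 assumes "AE x in lborel. norm (f x) <= K * norm (g x)" "g \<in> borel_measurable lebesgue"
 shows "l2_sq X f <= ennreal (K^2) * l2_sq X g"
proof -
 have [measurable]: "g \<in> borel_measurable lebesgue" "cell X \<in> sets lebesgue" using assms(2) by simp_all
 have "l2_sq X f <= (\<integral>\<^sup>+x. ennreal (K^2) * (ennreal ((norm (g x))^2) * indicator (cell X) x) \<partial>lebesgue)"
  unfolding l2_sq_def
 proof (rule nn_integral_mono_AE, unfold AE_completion_iff, use assms(1) in eventually_elim)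
  case (elim x)
  then have "(norm (f x))^2 <= (K * norm (g x))^2" by (intro power_mono) auto
  then have "ennreal ((norm (f x))^2) <= ennreal (K^2 * (norm (g x))^2)" by (intro ennreal_leI) (simp add: power_mult_distrib)
  also have "... = ennreal (K^2) * ennreal ((norm (g x))^2)" by (rule ennreal_mult) simp_all
  finally show ?case unfolding mult.assoc[symmetric] by (rule mult_right_mono) simp
 qed
 also have "... = ennreal (K^2) * l2_sq X g" unfolding l2_sq_def by (rule nn_integral_cmult) measurable
 finally show ?thesis .
qed

lemma L2_bounded_linear:
 assumes T: "bounded_linear T" and f: "L2 X f"
 shows "L2 X (\<lambda>x. T (f x))"
 unfolding L2_def
proof (intro conjI)
 show "on_base X (\<lambda>x. T (f x))" using f by (auto simp: L2_def on_base_def)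
 have m: "f \<in> borel_measurable lebesgue" using f by (simp add: L2_def)
 have "T \<in> bm" by (intro borel_measurable_continuous_onI linear_continuous_on T)
 with m show "(\<lambda>x. T (f x)) \<in> borel_measurable lebesgue" by (rule measurable_compose)
 obtain K where K: "\<And>x. norm (T x) <= norm x * K" using bounded_linear.bounded[OF T] by blast
 have "l2_sq X (\<lambda>x. T (f x)) <= ennreal (K^2) * l2_sq X f" by (rule l2_sq_le[OF AE_I2 m]) (use K in \<open>simp add: mult.commute\<close>)
 also have "... < \<infinity>" using f by (simp add: L2_def ennreal_mult_less_top)
 finally show "l2_sq X (\<lambda>x. T (f x)) < \<infinity>" .
qed

lemma norm_vec_sq: "(norm (v :: 'a::real_normed_vector ^ 'n))^2 = (\<Sum>i\<in>UNIV. (norm (v $ i))^2)"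
 by (simp add: norm_vec_def L2_set_def sum_nonneg)

lemma lebesgue_measurable_vec:
 fixes f :: "real => 'a::euclidean_space ^ 'n"
 assumes "\<And>i. (\<lambda>x. f x $ i) \<in> borel_measurable M"
 shows "f \<in> borel_measurable M"
proof (rule borel_measurable_euclidean_space[THEN iffD2], rule ballI)
 fix b :: "'a ^ 'n" assume "b \<in> Basis"
 then obtain i u where b: "b = axis i u" by (auto simp: Basis_vec_def)
 have "(\<lambda>x. f x $ i \<bullet> u) \<in> borel_measurable M" by (rule borel_measurable_inner[OF assms borel_measurable_const])
 then show "(\<lambda>x. f x \<bullet> b) \<in> borel_measurable M" by (simp only: b inner_axis)
qed

lemma l2_sq_vec:
 fixes f :: "real => 'a::euclidean_space ^ 'n"
 assumes "\<And>i. (\<lambda>x. f x $ i) \<in> borel_measurable lebesgue"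
 shows "l2_sq X f = (\<Sum>i\<in>UNIV. l2_sq X (\<lambda>x. f x $ i))"
proof -
 have [measurable]: "cell X \<in> sets lebesgue" by simp
 note [measurable] = assms
 have "l2_sq X f = (\<integral>\<^sup>+x. (\<Sum>i\<in>UNIV. ennreal ((norm (f x $ i))^2) * indicator (cell X) x) \<partial>lebesgue)"
  unfolding l2_sq_def norm_vec_sq 
  by (rule nn_integral_cong, subst sum_ennreal[symmetric]) (simp_all only: zero_le_power2 sum_distrib_right)
 also have "... = (\<Sum>i\<in>UNIV. l2_sq X (\<lambda>x. f x $ i))" unfolding l2_sq_def by (rule nn_integral_sum) measurable
 finally show ?thesis .
qed

lemma L2_vec:
 fixes f :: "real => 'a::euclidean_space ^ 'n"
 shows "L2 X f \<longleftrightarrow> (\<forall>i. L2 X (\<lambda>x. f x $ i))"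
proof
 assume "L2 X f" then show "\<forall>i. L2 X (\<lambda>x. f x $ i)" by (intro allI L2_bounded_linear[OF bounded_linear_vec_nth])
next
 assume a: "\<forall>i. L2 X (\<lambda>x. f x $ i)"
 then have m: "\<And>i. (\<lambda>x. f x $ i) \<in> borel_measurable lebesgue" by (simp add: L2_def)
 have "on_base X f" using a by (auto simp: L2_def on_base_def vec_eq_iff)
 then show "L2 X f" using a lebesgue_measurable_vec[of f, OF m] by (simp add: L2_def l2_sq_vec[OF m])
qed

section \<open>Principal values\<close>

fun pv_dom :: "base_space => real => real => real set" where
 "pv_dom Line e x = {y. e < \<bar>x - y\<bar>}"
| "pv_dom Circle e x = {y. e < \<bar>x - y\<bar> \<and> \<bar>x - y\<bar> <= pi}"

fun pv_ker :: "base_space => real => real" where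
 "pv_ker Line u = 1 / u"
| "pv_ker Circle u = cot (u / 2)"

fun pv_scale :: "base_space => real" where
 "pv_scale Line = 1 / pi"
| "pv_scale Circle = 1"

text \<open>On the line \<open>tk\<close> is built on \<open>2 / u\<close>, whereas the principal
  value uses \<open>1 / u\<close>.\<close>

fun tk_scale :: "base_space => real" where
 "tk_scale Line = 1 / 2"
| "tk_scale Circle = 1"

definition trunc :: "base_space => (real => 'a::euclidean_space) => real => real => 'a" where
 "trunc X f x e = (LINT y|lebesgue. indicator (pv_dom X e x) y *\<^sub>R (pv_ker X (x - y) *\<^sub>R f y))"

text \<open>The factor by which \<open>hilbert\<close> differs from the multiplier \<open>hilb\<close>.\<close>

fun hc :: "base_space => real" where
 "hc Line = 1"
| "hc Circle = 2 * pi"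

lemma hc_pos: "hc X > 0" by (cases X) auto

lemma hilbert_trunc: "hilbert X f x = pv_scale X *\<^sub>R Lim (at_right 0) (trunc X f x)"
 by (cases X) (simp_all add: trunc_def[abs_def] set_lebesgue_integral_def)

lemma pv_ker_tk:
 "indicator (pv_dom X e x) (x - u) * pv_ker X u = indicator (cell X) u * (tk_scale X * tk X e u)"
 by (cases X) (auto simp: tk_def indicator_def abs_le_iff)

lemma trunc_rep:
 fixes f f' :: "real => complex"
 assumes f: "rep X f f'" and e: "e > 0"
 shows "integrable lebesgue (\<lambda>y. indicator (pv_dom X e x) y *\<^sub>R (pv_ker X (x - y) *\<^sub>R f y))"
  and "trunc X f x e = tk_scale X * (LINT u|mX X. of_real (tk X e u) * f' (x - u))"
proof -
 have [measurable]: "f' \<in> bm" by (rule rep_borel[OF f])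
 have [measurable]: "pv_dom X e x \<in> sets borel" by (cases X) simp_all
 have [measurable]: "pv_ker X \<in> bm" by (cases X) (simp_all add: pv_ker.simps[abs_def] cot_def)
 define B where "B y = indicator (pv_dom X e x) y *\<^sub>R (pv_ker X (x - y) *\<^sub>R f' y)" for y
 have [measurable]: "B \<in> bm" unfolding B_def by measurable
 have Bu: "B (x + -1 * u) = indicator (cell X) u *\<^sub>R (of_real (tk_scale X) * (of_real (tk X e u) * f' (x - u)))" for u
 proof -
  have "B (x + -1 * u) = (indicator (pv_dom X e x) (x - u) * pv_ker X u) *\<^sub>R f' (x - u)" by (simp add: B_def)
  then show ?thesis unfolding pv_ker_tk by (simp add: scaleR_conv_of_real mult_ac)
 qed
 have "sqi (mX X) (\<lambda>u. f' (x - u))" using f by (intro sqi_mX_reflect) (simp_all add: rep_def)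
 from sqi_integrable_mult[OF sqi_tk[OF e] this]
 have "integrable (mX X) (\<lambda>u. of_real (tk_scale X) * (of_real (tk X e u) * f' (x - u)))" by (rule integrable_mult_right)
 then have "integrable lborel (\<lambda>u. B (x + -1 * u))" unfolding Bu by (subst (asm) integrable_mX_iff) simp_all
 then have B: "integrable lborel B" by (subst (asm) lborel_integrable_real_affine_iff) simp
 have "AE y in lborel. f y = f' y" using f by (simp add: rep_def)
 then have ae: "AE y in lborel. indicator (pv_dom X e x) y *\<^sub>R (pv_ker X (x - y) *\<^sub>R f y) = B y"
  by eventually_elim (simp add: B_def)
 have BL: "integrable lebesgue B" using B by (simp add: integrable_completion)
 show "integrable lebesgue (\<lambda>y. indicator (pv_dom X e x) y *\<^sub>R (pv_ker X (x - y) *\<^sub>R f y))"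
 proof (rule Bochner_Integration.integrable_cong_AE_imp[OF BL])
  show "(\<lambda>y. indicator (pv_dom X e x) y *\<^sub>R (pv_ker X (x - y) *\<^sub>R f y)) \<in> borel_measurable lebesgue"
   by (rule lebesgue_measurable_AE_cong[OF _ ae]) (use BL in auto)
  show "AE y in lebesgue. B y = indicator (pv_dom X e x) y *\<^sub>R (pv_ker X (x - y) *\<^sub>R f y)"
   unfolding AE_completion_iff using ae by eventually_elim simp
 qed
 have "trunc X f x e = integral\<^sup>L lborel B" unfolding trunc_def by (rule lebesgue_integral_AE_borel[OF _ ae]) simp
 also have "... = (LINT u|lborel. B (x + -1 * u))" by (subst lborel_integral_real_affine[where c = "-1" and t = x]) simp_all
 also have "... = (LINT u|mX X. of_real (tk_scale X) * (of_real (tk X e u) * f' (x - u)))"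
  unfolding Bu by (subst integral_mX) simp_all
 finally show "trunc X f x e = tk_scale X * (LINT u|mX X. of_real (tk X e u) * f' (x - u))" by simp
qed

text \<open>Reduced to the scalar function \<open>norm (f x)\<close>, embedded in the complex
  numbers, to which \<open>trunc_rep\<close> applies with the same kernel.\<close>

lemma trunc_integrable:
 fixes f :: "real => 'a::euclidean_space"
 assumes f: "L2 X f" and e: "e > 0"
 shows "integrable lebesgue (\<lambda>y. indicator (pv_dom X e x) y *\<^sub>R (pv_ker X (x - y) *\<^sub>R f y))"
proof -
 have m: "f \<in> borel_measurable lebesgue" using f by (simp add: L2_def)
 have "L2 X (\<lambda>x. complex_of_real (norm (f x)))"
  using f unfolding L2_def l2_sq_def by (auto simp: on_base_def intro!: borel_measurable_of_real)
 then obtain n' where "rep X (\<lambda>x. complex_of_real (norm (f x))) n'" by (rule rep_exists)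
 from trunc_rep(1)[OF this e] show ?thesis
 proof (rule Bochner_Integration.integrable_bound)
  have 1: "pv_dom X e x \<in> sets borel" by (cases X) simp_all
  have 2: "pv_ker X \<in> bm" by (cases X) (simp_all add: pv_ker.simps[abs_def] cot_def)
  have "(\<lambda>y. indicator (pv_dom X e x) y * pv_ker X (x - y)) \<in> borel_measurable lborel" using 1 2 by simp
  then have "(\<lambda>y. indicator (pv_dom X e x) y * pv_ker X (x - y)) \<in> borel_measurable lebesgue" by (rule measurable_completion)
  then have "(\<lambda>y. (indicator (pv_dom X e x) y * pv_ker X (x - y)) *\<^sub>R f y) \<in> borel_measurable lebesgue"
   using m by (rule borel_measurable_scaleR)
  then show "(\<lambda>y. indicator (pv_dom X e x) y *\<^sub>R (pv_ker X (x - y) *\<^sub>R f y)) \<in> borel_measurable lebesgue" by simp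
 qed (auto simp: norm_mult)
qed

lemma trunc_bounded_linear:
 assumes "bounded_linear T" "L2 X f" "e > 0"
 shows "trunc X (\<lambda>y. T (f y)) x e = T (trunc X f x e)"
 unfolding trunc_def
 by (subst integral_bounded_linear[OF assms(1) trunc_integrable[OF assms(2,3)], symmetric])
   (simp add: linear_simps[OF assms(1)])

lemma trunc_tendsto_hrel:
 fixes f g :: "real => complex"
 assumes "hrel X f g"
 shows "AE x in lborel. (trunc X f x \<longlongrightarrow> (tk_scale X * 2 * pi) * g x) (at_right 0)"
proof -
 obtain f' g' F where r: "rep X f f'" "rep X g g'" "ftp X f' F" "ftp X g' (\<lambda>k. hilb k * F k)"
  using assms unfolding hrel_def by blast
 have "AE x in lborel. ((\<lambda>e. LINT u|mX X. of_real (tk X e u) * f' (x - u)) \<longlongrightarrow> 2 * pi * g' x) (at_right 0)"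
  using r by (intro truncated_tendsto) (simp_all add: rep_def)
 moreover have "AE x in lborel. g x = g' x" using r by (simp add: rep_def)
 ultimately show ?thesis
 proof eventually_elim
  case (elim x)
  have "((\<lambda>e. tk_scale X * (LINT u|mX X. of_real (tk X e u) * f' (x - u))) \<longlongrightarrow> tk_scale X * (2 * pi * g' x)) (at_right 0)"
   by (intro tendsto_intros elim)
  then have "(trunc X f x \<longlongrightarrow> tk_scale X * (2 * pi * g' x)) (at_right 0)"
   by (rule Lim_transform_eventually) (auto intro!: eventually_at_rightI[of 0 1] simp: trunc_rep(2)[OF r(1)])
  then show ?case by (simp add: elim mult_ac)
 qed
qed

text \<open>Each coordinate, embedded in the complex numbers, is covered by
  \<open>trunc_tendsto_hrel\<close>; finitely many null sets are discarded.\<close>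

lemma trunc_convergent:
 fixes f :: "real => 'a::euclidean_space"
 assumes f: "L2 X f"
 shows "AE x in lborel. \<exists>l. (trunc X f x \<longlongrightarrow> l) (at_right 0)"
proof -
 have "AE x in lborel. \<exists>l. ((\<lambda>e. trunc X f x e \<bullet> b) \<longlongrightarrow> l) (at_right 0)" for b
 proof -
  have T: "bounded_linear (\<lambda>v::'a. complex_of_real (v \<bullet> b))"
   by (rule bounded_linear_compose[OF bounded_linear_of_real bounded_linear_inner_left])
  obtain g where "hrel X (\<lambda>x. complex_of_real (f x \<bullet> b)) g" using hrel_exists[OF L2_bounded_linear[OF T f]] .
  from trunc_tendsto_hrel[OF this] show ?thesis
  proof eventually_elim
   case (elim x)
   have "((\<lambda>e. Re (trunc X (\<lambda>x. complex_of_real (f x \<bullet> b)) x e)) \<longlongrightarrow> Re ((tk_scale X * 2 * pi) * g x)) (at_right 0)"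
    by (intro tendsto_intros elim)
   then have "((\<lambda>e. trunc X f x e \<bullet> b) \<longlongrightarrow> Re ((tk_scale X * 2 * pi) * g x)) (at_right 0)"
    by (rule Lim_transform_eventually) (auto intro!: eventually_at_rightI[of 0 1] simp: trunc_bounded_linear[OF T f])
   then show ?case by blast
  qed
 qed
 then have "AE x in lborel. \<forall>b\<in>Basis. \<exists>l. ((\<lambda>e. trunc X f x e \<bullet> b) \<longlongrightarrow> l) (at_right 0)" by (simp add: AE_finite_all)
 then show ?thesis
 proof eventually_elim
  case (elim x)
  then obtain l where l: "\<And>b. b \<in> Basis ==> ((\<lambda>e. trunc X f x e \<bullet> b) \<longlongrightarrow> l b) (at_right 0)" by metis
  have "(trunc X f x \<longlongrightarrow> (\<Sum>b\<in>Basis. l b *\<^sub>R b)) (at_right 0)"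
   by (subst tendsto_componentwise_iff) (use l in simp)
  then show ?case by blast
 qed
qed

text \<open>\<open>Lim\<close> has no meaning where the limit fails to exist, so \<open>T\<close> is
  moved out only at points of convergence; hence almost everywhere.\<close>

lemma hilbert_bounded_linear:
 fixes f :: "real => 'a::euclidean_space" and T :: "'a => 'b::euclidean_space"
 assumes T: "bounded_linear T" and f: "L2 X f"
 shows "AE x in lborel. hilbert X (\<lambda>y. T (f y)) x = T (hilbert X f x)"
 using trunc_convergent[OF f]
proof eventually_elim
 case (elim x)
 then obtain l where l: "(trunc X f x \<longlongrightarrow> l) (at_right 0)" by blast
 have "((\<lambda>e. T (trunc X f x e)) \<longlongrightarrow> T l) (at_right 0)" by (rule bounded_linear.tendsto[OF T l])
 then have "(trunc X (\<lambda>y. T (f y)) x \<longlongrightarrow> T l) (at_right 0)"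
  by (rule Lim_transform_eventually) (auto intro!: eventually_at_rightI[of 0 1] simp: trunc_bounded_linear[OF T f])
 then show ?case using l unfolding hilbert_trunc by (simp add: tendsto_Lim linear_simps[OF T])
qed

text \<open>The constants combine as \<open>pv_scale X * tk_scale X * 2 * pi = hc X\<close>.\<close>

lemma hilbert_hrel:
 fixes f g :: "real => complex"
 assumes "hrel X f g"
 shows "AE x in lborel. hilbert X f x = hc X * g x"
 using trunc_tendsto_hrel[OF assms]
proof eventually_elim
 case (elim x)
 have "Lim (at_right 0) (trunc X f x) = (tk_scale X * 2 * pi) * g x" by (rule tendsto_Lim[OF _ elim]) simp
 then show ?case unfolding hilbert_trunc by (cases X) (simp_all add: scaleR_conv_of_real)
qed

text \<open>Required at every point, also where the principal value diverges: the truncations at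
  \<open>x\<close> and at \<open>x + 2 * pi\<close> coincide, so they have the same limits and
  \<open>Lim\<close> makes the same choice.\<close>

lemma hilbert_on_base:
 fixes f :: "real => 'a::euclidean_space"
 assumes f: "L2 X f"
 shows "on_base X (hilbert X f)"
 unfolding on_base_def
proof (intro impI allI)
 fix x assume C: "X = Circle"
 have "trunc X f (x + 2 * pi) e = trunc X f x e" if e: "e > 0" for e
 proof (rule euclidean_eqI)
  fix b :: 'a
  have T: "bounded_linear (\<lambda>v::'a. complex_of_real (v \<bullet> b))"
   by (rule bounded_linear_compose[OF bounded_linear_of_real bounded_linear_inner_left])
  obtain f' where f': "rep X (\<lambda>x. complex_of_real (f x \<bullet> b)) f'" using rep_exists[OF L2_bounded_linear[OF T f]] .
  have p: "f' (x + 2 * pi - u) = f' (x - u)" for u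
  proof -
   have "f' ((x - u) + 2 * pi) = f' (x - u)" using f' C unfolding rep_def on_base_def by blast
   then show ?thesis by (simp add: algebra_simps)
  qed
  have "complex_of_real (trunc X f (x + 2 * pi) e \<bullet> b) = complex_of_real (trunc X f x e \<bullet> b)"
   unfolding trunc_bounded_linear[OF T f e, symmetric] trunc_rep(2)[OF f' e] p ..
  then show "trunc X f (x + 2 * pi) e \<bullet> b = trunc X f x e \<bullet> b" by simp
 qed
 then have ev: "\<forall>\<^sub>F e in at_right 0. trunc X f (x + 2 * pi) e = trunc X f x e" by (intro eventually_at_rightI[of 0 1]) auto
 have "(trunc X f (x + 2 * pi) \<longlongrightarrow> l) (at_right 0) \<longleftrightarrow> (trunc X f x \<longlongrightarrow> l) (at_right 0)" for l
  by (rule tendsto_cong[OF ev])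
 then show "hilbert X f (x + 2 * pi) = hilbert X f x" unfolding hilbert_trunc Topological_Spaces.Lim_def by simp
qed

lemma L2_AE_cong: "L2 X f ==> AE x in lborel. f x = g x ==> on_base X g ==> L2 X g"
 unfolding L2_def
proof (elim conjE, intro conjI)
 assume a: "f \<in> borel_measurable lebesgue" "AE x in lborel. f x = g x" "l2_sq X f < \<infinity>"
 have "AE x in lborel. g x = f x" using a(2) by eventually_elim simp
 then show "g \<in> borel_measurable lebesgue" by (rule lebesgue_measurable_AE_cong[OF a(1)])
 have "AE x in lborel. norm (f x) = norm (g x)" using a(2) by eventually_elim simp
 then show "l2_sq X g < \<infinity>" using a(3) l2_sq_cong by metis
qed
lemma L2_mult:
 fixes a f :: "real => complex"
 assumes a: "a \<in> borel_measurable lebesgue" "AE x in lborel. cmod (a x) <= C" "on_base X a" and f: "L2 X f"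
 shows "L2 X (\<lambda>x. a x * f x)"
 unfolding L2_def
proof (intro conjI)
 have m: "f \<in> borel_measurable lebesgue" using f by (simp add: L2_def)
 show "on_base X (\<lambda>x. a x * f x)" using a f by (auto simp: L2_def on_base_def)
 show "(\<lambda>x. a x * f x) \<in> borel_measurable lebesgue" using a(1) m by (rule borel_measurable_times)
 have "AE x in lborel. cmod (a x * f x) <= C * cmod (f x)"
  using a(2) by eventually_elim (simp add: norm_mult mult_right_mono)
 then have "l2_sq X (\<lambda>x. a x * f x) <= ennreal (C^2) * l2_sq X f" by (rule l2_sq_le[OF _ m])
 also have "... < \<infinity>" using f by (simp add: L2_def ennreal_mult_less_top)
 finally show "l2_sq X (\<lambda>x. a x * f x) < \<infinity>" .
qed

lemma L2_lin:
 fixes f g :: "real => complex"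
 assumes "L2 X f" "L2 X g"
 shows "L2 X (\<lambda>x. a * f x + b * g x)"
 using assms by (elim rep_exists) (rule rep_L2, rule rep_lin)

section \<open>The commutator identity\<close>

definition hv :: "base_space => (real => complex^2) => (real => complex^2) => bool" where
 "hv X f p \<longleftrightarrow> (\<forall>i. hrel X (\<lambda>x. f x $ i) (\<lambda>x. p x $ i))"

definition dv :: "base_space => (real => complex^2) => (real => complex^2) => bool" where
 "dv X f d \<longleftrightarrow> (\<forall>i. drel X (\<lambda>x. f x $ i) (\<lambda>x. d x $ i))"

lemma AE_vec_iff: "(AE x in M. f x = g x) \<longleftrightarrow> (\<forall>i::'n::finite. AE x in M. f x $ i = g x $ i)"
 unfolding vec_eq_iff by (rule AE_all_countable)

lemma hv_L2: "hv X f p ==> L2 X f" "hv X f p ==> L2 X p"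
 unfolding hv_def L2_vec by (auto dest: hrel_L2)

lemma dv_L2: "dv X f p ==> L2 X f" "dv X f p ==> L2 X p"
 unfolding dv_def L2_vec by (auto dest: drel_L2)

lemma L2_on_base: "L2 X f ==> on_base X f"
 by (simp add: L2_def)

lemma on_base_nth: "on_base X f ==> on_base X (\<lambda>x. f x $ i)"
 by (rule on_base_compose)

lemma hv_exists:
 assumes "L2 X f" obtains p where "hv X f p"
proof -
 have "\<forall>i. \<exists>g. hrel X (\<lambda>x. f x $ i) g" using assms unfolding L2_vec by (meson hrel_exists)
 then obtain g where "\<And>i. hrel X (\<lambda>x. f x $ i) (g i)" by metis
 then have "hv X f (\<lambda>x. \<chi> i. g i x)" by (simp add: hv_def)
 then show ?thesis by (rule that)
qed

lemma hv_unique: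
 assumes "hv X f p" "hv X g q" "AE x in lborel. f x = g x"
 shows "AE x in lborel. p x = q x"
 unfolding AE_vec_iff
proof
 fix i
 show "AE x in lborel. p x $ i = q x $ i"
  by (rule hrel_unique[of X "\<lambda>x. f x $ i" _ "\<lambda>x. g x $ i"]) (use assms in \<open>auto simp: hv_def AE_vec_iff\<close>)
qed

lemma hv_cong:
 assumes "hv X f p" "AE x in lborel. f x = g x" "AE x in lborel. p x = q x" "on_base X g" "on_base X q"
 shows "hv X g q"
 using assms on_base_nth[OF assms(4)] on_base_nth[OF assms(5)] unfolding hv_def AE_vec_iff by (blast intro: hrel_cong)

lemma dv_cong:
 assumes "dv X f p" "AE x in lborel. f x = g x" "AE x in lborel. p x = q x" "on_base X g" "on_base X q"
 shows "dv X g q"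
 using assms on_base_nth[OF assms(4)] on_base_nth[OF assms(5)] unfolding dv_def AE_vec_iff by (blast intro: drel_cong)

lemma hv_lin: "hv X f p ==> hv X g q ==> hv X (\<lambda>x. a *s f x + b *s g x) (\<lambda>x. a *s p x + b *s q x)"
 unfolding hv_def by (simp add: hrel_lin)

lemma dv_lin: "dv X f p ==> dv X g q ==> dv X (\<lambda>x. a *s f x + b *s g x) (\<lambda>x. a *s p x + b *s q x)"
 unfolding dv_def by (simp add: drel_lin)

lemma dv_hv: "dv X f d ==> hv X f p ==> hv X d q ==> dv X p q"
 unfolding dv_def hv_def by (blast intro: drel_hrel)

lemma dv_hv_hv: "dv X f d ==> hv X d q ==> hv X q (\<lambda>x. - d x)"
 unfolding dv_def hv_def by (auto intro: drel_hrel_hrel)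

lemma hv_hilbert:
 assumes "hv X f p"
 shows "AE x in lborel. hilbert X f x = of_real (hc X) *s p x"
 unfolding AE_vec_iff
proof
 fix i
 have "AE x in lborel. hilbert X (\<lambda>y. f y $ i) x = hilbert X f x $ i"
  by (rule hilbert_bounded_linear[OF bounded_linear_vec_nth hv_L2(1)[OF assms]])
 moreover have "AE x in lborel. hilbert X (\<lambda>y. f y $ i) x = hc X * p x $ i"
  using assms unfolding hv_def by (intro hilbert_hrel) simp
 ultimately show "AE x in lborel. hilbert X f x $ i = (of_real (hc X) *s p x) $ i" by eventually_elim simp
qed

lemma H1_iff_dv: "H1 X f \<longleftrightarrow> (\<exists>d. dv X f d)"
proof
 assume "H1 X f"
 then obtain g where g: "\<And>i. drel X (\<lambda>x. f x $ i) (g i)" unfolding H1_def sobolev_iff_drel by metis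
 have "dv X f (\<lambda>x. \<chi> i. g i x)" using g by (simp add: dv_def)
 then show "\<exists>d. dv X f d" by blast
qed (auto simp: H1_def sobolev_iff_drel dv_def)

lemma abs_nabla_vec_AE:
 assumes "dv X f d" "hv X d q"
 shows "AE x in lborel. abs_nabla_vec X f x = q x" "L2 X (abs_nabla_vec X f)"
 using assms unfolding AE_vec_iff L2_vec abs_nabla_vec_def[abs_def] dv_def hv_def
 by (auto intro: abs_nabla_hrel)

lemma L2_matrix_mult:
 fixes A :: "real => complex^2^2"
 assumes A: "\<And>i j. (\<lambda>x. A x $ i $ j) \<in> borel_measurable lebesgue" "\<And>i j. AE x in lborel. cmod (A x $ i $ j) <= C" "on_base X A" and f: "L2 X f"
 shows "L2 X (\<lambda>x. A x *v f x)"
 unfolding L2_vec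
proof
 fix i
 have o: "on_base X (\<lambda>x. A x $ i $ j)" for j using A(3) by (rule on_base_compose)
 have "L2 X (\<lambda>x. A x $ i $ j * f x $ j)" for j
  by (rule L2_mult[OF A(1,2) o]) (use f in \<open>simp add: L2_vec\<close>)
 from L2_lin[OF this this, of 1 _ 1] show "L2 X (\<lambda>x. (A x *v f x) $ i)" by (simp add: matrix_vector_mult_def sum_2)
qed

lemma matrix_vector_mult_uminus: "A *v (- v) = - (A *v (v :: complex^2))"
 by (simp add: matrix_vector_mult_def vec_eq_iff sum_negf)

text \<open>One time slice of the field as matrices: \<open>T\<close> is the derivative of
  \<open>S\<close> in space, \<open>W\<close> the multiplier image of \<open>T\<close>,
  \<open>C\<close> a common bound. On the circle \<open>S_drel\<close> provides the primitive that
  Cotlar's identity requires; on the line \<open>S\<close> is not square-integrable and has no such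
  relation. The choice behind \<open>abs_nabla_matrix\<close> enters only through
  \<open>abs_nabla_W\<close>.\<close>

locale lax_data =
 fixes X :: base_space and S T W :: "real => complex^2^2" and C :: real
 assumes S_derivative: "\<And>i j x. ((\<lambda>x. S x $ i $ j) has_vector_derivative T x $ i $ j) (at x)"
  and T_continuous: "\<And>i j. continuous_on UNIV (\<lambda>x. T x $ i $ j)"
  and S_bound: "\<And>i j x. cmod (S x $ i $ j) <= C" and T_bound: "\<And>i j x. cmod (T x $ i $ j) <= C"
  and W_bound: "\<And>i j. AE x in lborel. cmod (W x $ i $ j) <= C"
  and base: "on_base X S" "on_base X T" "on_base X W"
  and S_square: "\<And>x. S x ** S x = mat 1"
  and S_drel: "\<And>i j. X = Circle ==> drel X (\<lambda>x. S x $ i $ j) (\<lambda>x. T x $ i $ j)"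
  and T_drel: "\<And>i j. \<exists>f. drel X (\<lambda>x. T x $ i $ j) f"
  and W_hrel: "\<And>i j. hrel X (\<lambda>x. T x $ i $ j) (\<lambda>x. W x $ i $ j)"
  and abs_nabla_W: "AE x in lborel. abs_nabla_matrix X S x = W x" "on_base X (abs_nabla_matrix X S)"
begin

lemma S_continuous: "continuous_on UNIV (\<lambda>x. S x $ i $ j)"
 using S_derivative by (auto intro!: continuous_at_imp_continuous_on has_vector_derivative_continuous)

lemma measurable:
 "(\<lambda>x. S x $ i $ j) \<in> borel_measurable lebesgue" "(\<lambda>x. T x $ i $ j) \<in> borel_measurable lebesgue"
 "(\<lambda>x. W x $ i $ j) \<in> borel_measurable lebesgue"
 using borel_measurable_continuous_onI[OF S_continuous[of i j]] borel_measurable_continuous_onI[OF T_continuous[of i j]] hrel_L2(2)[OF W_hrel[of i j]]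
 by (auto intro: measurable_completion simp: L2_def)

lemma L2_mult_S: "L2 X f ==> L2 X (\<lambda>x. S x *v f x)"
 by (rule L2_matrix_mult[where C = C]) (use measurable S_bound base in auto)

lemma L2_mult_T: "L2 X f ==> L2 X (\<lambda>x. T x *v f x)"
 by (rule L2_matrix_mult[where C = C]) (use measurable T_bound base in auto)

lemma L2_mult_W: "L2 X f ==> L2 X (\<lambda>x. W x *v f x)"
 by (rule L2_matrix_mult[where C = C]) (use measurable W_bound base in auto)

lemma SS: "S x *v (S x *v v) = v"
 by (simp add: matrix_vector_mul_assoc S_square)

text \<open>Differentiation of \<open>S_square\<close> in space.\<close>

lemma TS: "T x *v (S x *v v) = - (S x *v (T x *v v))"
proof -
 have "(S x ** T x + T x ** S x) $ i $ j = 0" for i j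
 proof -
  have "((\<lambda>x. (S x ** S x) $ i $ j) has_vector_derivative
    (S x $ i $ 1 * T x $ 1 $ j + T x $ i $ 1 * S x $ 1 $ j) + (S x $ i $ 2 * T x $ 2 $ j + T x $ i $ 2 * S x $ 2 $ j)) (at x)"
   unfolding matrix_matrix_mult_def sum_2 vec_lambda_beta
   by (intro has_vector_derivative_add has_vector_derivative_mult S_derivative)
  moreover have "((\<lambda>x. (S x ** S x) $ i $ j) has_vector_derivative 0) (at x)" unfolding S_square by simp
  ultimately have "(S x $ i $ 1 * T x $ 1 $ j + T x $ i $ 1 * S x $ 1 $ j) + (S x $ i $ 2 * T x $ 2 $ j + T x $ i $ 2 * S x $ 2 $ j) = 0"
   by (rule vector_derivative_unique_at)
  then show ?thesis by (simp add: matrix_matrix_mult_def sum_2 algebra_simps)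
 qed
 then have "S x ** T x + T x ** S x = 0" by (simp add: vec_eq_iff)
 then have "(S x ** T x + T x ** S x) *v v = 0" by simp
 then show ?thesis by (simp add: matrix_vector_mult_add_rdistrib matrix_vector_mul_assoc eq_neg_iff_add_eq_0 add.commute)
qed

lemma dv_S:
 assumes "dv X f d"
 shows "dv X (\<lambda>x. S x *v f x) (\<lambda>x. T x *v f x + S x *v d x)"
 unfolding dv_def
proof
 fix i
 have o: "on_base X (\<lambda>x. S x $ i $ j)" "on_base X (\<lambda>x. T x $ i $ j)" for j using base by (auto intro: on_base_compose)
 have "drel X (\<lambda>x. S x $ i $ j * f x $ j) (\<lambda>x. T x $ i $ j * f x $ j + S x $ i $ j * d x $ j)" for j
  using assms by (intro drel_mult[OF _ S_derivative T_continuous S_bound T_bound o]) (simp add: dv_def)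
 from drel_lin[OF this[of 1] this[of 2], of 1 1]
 show "drel X (\<lambda>x. (S x *v f x) $ i) (\<lambda>x. (T x *v f x + S x *v d x) $ i)"
  by (simp add: matrix_vector_mult_def sum_2 algebra_simps)
qed

lemma Cotlar_vec:
 assumes "hv X g h"
 shows "hv X (\<lambda>x. W x *v g x + T x *v h x) (\<lambda>x. W x *v h x - T x *v g x)"
 unfolding hv_def
proof
 fix i
 have "hrel X (\<lambda>x. W x $ i $ j * g x $ j + T x $ i $ j * h x $ j) (\<lambda>x. W x $ i $ j * h x $ j - T x $ i $ j * g x $ j)" for j
 proof -
  obtain f where f: "drel X (\<lambda>x. T x $ i $ j) f" using T_drel by blast
  show ?thesis using assms unfolding hv_def by (intro hrel_Cotlar[OF S_drel f W_hrel]) simp_all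
 qed
 from hrel_lin[OF this[of 1] this[of 2], of 1 1]
 show "hrel X (\<lambda>x. (W x *v g x + T x *v h x) $ i) (\<lambda>x. (W x *v h x - T x *v g x) $ i)"
  by (simp add: matrix_vector_mult_def sum_2 algebra_simps)
qed

lemma lax_L_AE:
 assumes "hv X f p" "hv X (\<lambda>x. S x *v f x) r"
 shows "AE x in lborel. lax_L X S f x = of_real (hc X) *s (r x - S x *v p x)" "on_base X (lax_L X S f)"
proof -
 show "AE x in lborel. lax_L X S f x = of_real (hc X) *s (r x - S x *v p x)"
  using hv_hilbert[OF assms(1)] hv_hilbert[OF assms(2)]
  by eventually_elim (simp add: lax_L_def commutator_def mult_op_def[abs_def] vector_sub_rdistrib vector_ssub_ldistrib vector_scalar_commute)
 have "on_base X (hilbert X (\<lambda>x. S x *v f x))" "on_base X (hilbert X f)"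
  by (rule hilbert_on_base hv_L2[OF assms(1)] hv_L2[OF assms(2)])+
 then show "on_base X (lax_L X S f)" using base(1)
  by (simp add: lax_L_def commutator_def[abs_def] mult_op_def[abs_def] on_base_def)
qed

lemma lax_B_AE:
 assumes "dv X g d" "hv X d y" "hv X (\<lambda>x. T x *v g x + S x *v d x) z"
 shows "AE x in lborel. lax_B X S g x = (- (\<i> / 2)) *s (S x *v y x + z x) + (\<i> / 2) *s (W x *v g x)" "on_base X (lax_B X S g)"
proof -
 note 1 = abs_nabla_vec_AE[OF assms(1,2)] and 2 = abs_nabla_vec_AE[OF dv_S[OF assms(1)] assms(3)]
 show "AE x in lborel. lax_B X S g x = (- (\<i> / 2)) *s (S x *v y x + z x) + (\<i> / 2) *s (W x *v g x)"
  using 1(1) 2(1) abs_nabla_W(1) by eventually_elim (simp add: lax_B_def mult_op_def[abs_def])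
 show "on_base X (lax_B X S g)"
  using base(1) abs_nabla_W(2) L2_on_base[OF 1(2)] L2_on_base[OF 2(2)] L2_on_base[OF dv_L2(1)[OF assms(1)]]
  by (simp add: lax_B_def[abs_def] mult_op_def[abs_def] on_base_def)
qed

text \<open>The identity follows from Cotlar's identity for the pairs \<open>(T, \<phi>)\<close> and \<open>(T, S \<phi>)\<close>, from
 \<open>S\<^sup>2 = 1\<close> and from \<open>S T + T S = 0\<close>.\<close>

proposition lax_commutator:
 assumes n: "dv X n d" and p: "hv X n p"
  and g: "hv X (\<lambda>x. S x *v (W x *v n x)) g" and k: "hv X (\<lambda>x. W x *v (S x *v n x)) k"
 shows "\<exists>d'. dv X (lax_L X S n) d'"
  and "AE x in lborel. commutator (lax_B X S) (lax_L X S) n x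
   = of_real (hc X) *s ((- (\<i> / 2)) *s (g x - k x - (S x *v (W x *v p x) - W x *v (S x *v p x))))"
  and "on_base X (commutator (lax_B X S) (lax_L X S) n)"
proof -
 define c where "c = complex_of_real (hc X)"
 \<comment> \<open>A prime marks a derivative in space. Images under the multiplier:
   \<open>p\<close>, \<open>q\<close>, \<open>r\<close>, \<open>s\<close> of \<open>n\<close>,
   \<open>d\<close>, \<open>u\<close>, \<open>u'\<close>; \<open>a\<close>, \<open>b\<close>,
   \<open>e\<close>, \<open>f\<close> of \<open>T p\<close>, \<open>S q\<close>, \<open>T r\<close>,
   \<open>S s\<close>; \<open>w\<close> of \<open>W n\<close>.\<close>
 define u u' where "u x = S x *v n x" and "u' x = T x *v n x + S x *v d x" for x
 have u: "dv X u u'" using dv_S[OF n] by (simp add: u_def[abs_def] u'_def[abs_def])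
 obtain q where q: "hv X d q" using hv_exists[OF dv_L2(2)[OF n]] .
 obtain r where r: "hv X u r" using hv_exists[OF dv_L2(1)[OF u]] .
 obtain s where s: "hv X u' s" using hv_exists[OF dv_L2(2)[OF u]] .
 have pq: "dv X p q" by (rule dv_hv[OF n p q])
 have rs: "dv X r s" by (rule dv_hv[OF u r s])
 obtain a where a: "hv X (\<lambda>x. T x *v p x) a" using hv_exists[OF L2_mult_T[OF dv_L2(1)[OF pq]]] .
 obtain b where b: "hv X (\<lambda>x. S x *v q x) b" using hv_exists[OF L2_mult_S[OF dv_L2(2)[OF pq]]] .
 obtain e where e: "hv X (\<lambda>x. T x *v r x) e" using hv_exists[OF L2_mult_T[OF dv_L2(1)[OF rs]]] .
 obtain f where f: "hv X (\<lambda>x. S x *v s x) f" using hv_exists[OF L2_mult_S[OF dv_L2(2)[OF rs]]] .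
 obtain w where w: "hv X (\<lambda>x. W x *v n x) w" using hv_exists[OF L2_mult_W[OF dv_L2(1)[OF n]]] .
 note hs = dv_hv_hv[OF u s] and hq = dv_hv_hv[OF n q]
 note rules = matrix_vector_right_distrib matrix_vector_mult_diff_distrib vector_scalar_commute matrix_vector_mult_uminus SS TS
 have uu: "(\<lambda>x. S x *v n x) = u" by (simp add: u_def[abs_def])
 note L = lax_L_AE[OF p, unfolded uu, OF r, folded c_def]
 define l l' where "l x = c *s r x + (- c) *s (S x *v p x)" and "l' x = c *s s x + (- c) *s (T x *v p x + S x *v q x)" for x
 have l: "dv X l l'" unfolding l_def[abs_def] l'_def[abs_def] by (rule dv_lin[OF rs dv_S[OF pq]])
 have Ll: "AE x in lborel. lax_L X S n x = l x"
  using L(1) by eventually_elim (simp add: l_def vector_ssub_ldistrib)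
 have "AE x in lborel. l x = lax_L X S n x" using Ll by eventually_elim simp
 then have L': "dv X (lax_L X S n) l'" by (rule dv_cong[OF l _ AE_I2 L(2) L2_on_base[OF dv_L2(2)[OF l]]]) simp
 then show "\<exists>d'. dv X (lax_L X S n) d'" by blast
 define y where "y x = c *s (- u' x) + (- c) *s (1 *s a x + 1 *s b x)" for x
 have y: "hv X l' y" unfolding l'_def[abs_def] y_def[abs_def]
  using hv_lin[OF hs hv_lin[OF a b, of 1 1], of c "- c"] by simp
 \<comment> \<open>The derivative of \<open>S l\<close> is \<open>T l + S l'\<close>. As
   \<open>T S = - S T\<close> and \<open>S S = 1\<close>, the terms with \<open>T p\<close> cancel
   and \<open>c\<close> times \<open>T r + S s - q\<close> remains, whose image is
   \<open>z\<close>.\<close>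
 define z where "z x = c *s (1 *s e x + 1 *s f x) + (- c) *s (- d x)" for x
 have z: "hv X (\<lambda>x. c *s (1 *s (T x *v r x) + 1 *s (S x *v s x)) + (- c) *s q x) z"
  unfolding z_def[abs_def] by (rule hv_lin[OF hv_lin[OF e f] hq])
 have z': "hv X (\<lambda>x. T x *v lax_L X S n x + S x *v l' x) z"
 proof (rule hv_cong[OF z _ AE_I2])
  show "AE x in lborel. c *s (1 *s (T x *v r x) + 1 *s (S x *v s x)) + (- c) *s q x = T x *v lax_L X S n x + S x *v l' x"
   using Ll
  proof eventually_elim
   case (elim x)
   show ?case unfolding elim by (simp add: l_def l'_def rules)
  qed
  show "on_base X (\<lambda>x. T x *v lax_L X S n x + S x *v l' x)" using L2_on_base[OF dv_L2(2)[OF dv_S[OF L']]] .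
 qed (use L2_on_base[OF hv_L2(2)[OF z]] in auto)
 note BL = lax_B_AE[OF L' y z']
 have s': "hv X (\<lambda>x. T x *v n x + S x *v d x) s" using s by (simp add: u'_def[abs_def])
 note B = lax_B_AE[OF n q s']
 define \<beta> where "\<beta> x = (- (\<i> / 2)) *s (1 *s (S x *v q x) + 1 *s s x) + (\<i> / 2) *s (W x *v n x)" for x
 have B\<beta>: "AE x in lborel. lax_B X S n x = \<beta> x" using B(1) by eventually_elim (simp add: \<beta>_def)
 define \<beta>h where "\<beta>h x = (- (\<i> / 2)) *s (1 *s b x + 1 *s (- u' x)) + (\<i> / 2) *s w x" for x
 have "hv X \<beta> \<beta>h" unfolding \<beta>_def[abs_def] \<beta>h_def[abs_def] by (rule hv_lin[OF hv_lin[OF b hs] w])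
 then have \<beta>h: "hv X (lax_B X S n) \<beta>h"
  by (rule hv_cong) (use B\<beta> B(2) L2_on_base[OF hv_L2(2)[OF \<open>hv X \<beta> \<beta>h\<close>]] in auto)
 define \<sigma>h where "\<sigma>h x = (- (\<i> / 2)) *s (1 *s (- d x) + 1 *s f x) + (\<i> / 2) *s g x" for x
 have \<sigma>: "hv X (\<lambda>x. (- (\<i> / 2)) *s (1 *s q x + 1 *s (S x *v s x)) + (\<i> / 2) *s (S x *v (W x *v n x))) \<sigma>h"
  unfolding \<sigma>h_def[abs_def] by (rule hv_lin[OF hv_lin[OF hq f] g])
 have \<sigma>h: "hv X (\<lambda>x. S x *v lax_B X S n x) \<sigma>h"
 proof (rule hv_cong[OF \<sigma> _ AE_I2])
  show "AE x in lborel. (- (\<i> / 2)) *s (1 *s q x + 1 *s (S x *v s x)) + (\<i> / 2) *s (S x *v (W x *v n x)) = S x *v lax_B X S n x"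
   using B\<beta> by eventually_elim (simp add: \<beta>_def rules)
  show "on_base X (\<lambda>x. S x *v lax_B X S n x)" using base(1) B(2) by (simp add: on_base_def)
 qed (use L2_on_base[OF hv_L2(2)[OF \<sigma>]] in auto)
 note LB = lax_L_AE[OF \<beta>h \<sigma>h, folded c_def]
 \<comment> \<open>Cotlar's identity eliminates the images of products: here it determines
   \<open>w + a\<close>, and in \<open>C2\<close> the sum \<open>k + e\<close>.\<close>
 have C1: "AE x in lborel. 1 *s w x + 1 *s a x = W x *v p x - T x *v n x"
  using hv_unique[OF hv_lin[OF w a, of 1 1] Cotlar_vec[OF p]] by simp
 have k': "hv X (\<lambda>x. W x *v u x) k" using k by (simp add: u_def)
 have C2: "AE x in lborel. 1 *s k x + 1 *s e x = W x *v r x - T x *v u x"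
  using hv_unique[OF hv_lin[OF k' e, of 1 1] Cotlar_vec[OF r]] by simp
 show "AE x in lborel. commutator (lax_B X S) (lax_L X S) n x
   = of_real (hc X) *s ((- (\<i> / 2)) *s (g x - k x - (S x *v (W x *v p x) - W x *v (S x *v p x))))"
  using BL(1) LB(1) Ll C1 C2
 proof eventually_elim
  case (elim x)
  have e: "e x = W x *v r x + S x *v (T x *v n x) - k x" using elim(5) by (simp add: u_def TS algebra_simps)
  have "S x *v w x + S x *v a x = S x *v (W x *v p x) - S x *v (T x *v n x)"
   using arg_cong[OF elim(4), of "(*v) (S x)"] by (simp add: rules)
  then have w: "S x *v w x = S x *v (W x *v p x) - S x *v (T x *v n x) - S x *v a x" by (simp add: algebra_simps)
  have "commutator (lax_B X S) (lax_L X S) n x = lax_B X S (lax_L X S n) x - lax_L X S (lax_B X S n) x"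
   by (simp add: commutator_def)
  also have "... = (- (\<i> / 2)) *s (S x *v y x + z x) + (\<i> / 2) *s (W x *v l x) - c *s (\<sigma>h x - S x *v \<beta>h x)"
   by (simp only: elim)
  also have "... = c *s ((- (\<i> / 2)) *s (g x - k x - (S x *v (W x *v p x) - W x *v (S x *v p x))))"
   unfolding y_def z_def l_def \<sigma>h_def \<beta>h_def u'_def e
   by (simp add: rules w) (simp add: vec_eq_iff algebra_simps)
  finally show ?case by (simp add: c_def)
 qed
 show "on_base X (commutator (lax_B X S) (lax_L X S) n)"
  using BL(2) LB(2) by (simp add: commutator_def[abs_def] on_base_def)
qed

end

section \<open>Spin fields\<close>

lemma pauli_component:
 "pauli v $ i $ j = sigma1 $ i $ j * of_real (v $ 1) + sigma2 $ i $ j * of_real (v $ 2) + sigma3 $ i $ j * of_real (v $ 3)"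
 by (simp add: pauli_def scaleR_conv_of_real[where 'a = complex] mult.commute)

lemma sigma_le: "cmod (sigma1 $ i $ j) <= 1" "cmod (sigma2 $ i $ j) <= 1" "cmod (sigma3 $ i $ j) <= 1"
 using exhaust_2[of i] exhaust_2[of j] by (auto simp: sigma1_def sigma2_def sigma3_def)

lemma pauli_component_le: "cmod (pauli v $ i $ j) <= \<bar>v $ 1\<bar> + \<bar>v $ 2\<bar> + \<bar>v $ 3\<bar>"
proof -
 have "cmod (pauli v $ i $ j) <= cmod (sigma1 $ i $ j * of_real (v $ 1)) + cmod (sigma2 $ i $ j * of_real (v $ 2)) + cmod (sigma3 $ i $ j * of_real (v $ 3))"
  unfolding pauli_component by (intro order_trans[OF norm_triangle_ineq] add_mono order_refl)
 also have "... <= \<bar>v $ 1\<bar> + \<bar>v $ 2\<bar> + \<bar>v $ 3\<bar>"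
  using sigma_le[of i j] by (intro add_mono) (auto simp: norm_mult intro!: mult_left_le_one_le)
 finally show ?thesis .
qed

lemma pauli_square:
 assumes "norm v = 1" shows "pauli v ** pauli v = mat 1"
proof -
 have "(v $ 1)^2 + (v $ 2)^2 + (v $ 3)^2 = 1" using assms norm_vec_sq[of v] by (simp add: sum_3)
 then show ?thesis
  by (simp add: vec_eq_iff forall_2 pauli_matrix matrix_matrix_mult_def sum_2 mat_def complex_eq_iff power2_eq_square algebra_simps)
qed

text \<open>The commutation relations of the Pauli matrices. They turn the vector product in the
  evolution equation into a commutator of matrices.\<close>

lemma pauli_cross: "pauli (cross3 a b) *v v = (- (\<i> / 2)) *s (pauli a *v (pauli b *v v) - pauli b *v (pauli a *v v))"
 by (simp add: vec_eq_iff forall_2 pauli_matrix matrix_vector_mult_def sum_2 cross3_def complex_eq_iff) (auto simp: field_simps)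

lemma bounded_linear_pauli: "bounded_linear pauli"
 unfolding pauli_def[abs_def]
 by (intro bounded_linear_add bounded_linear_compose[OF bounded_linear_scaleR_left bounded_linear_vec_nth])

lemma hrel_pauli:
 assumes "\<And>k. hrel X (\<lambda>x. of_real (f x $ k)) (\<lambda>x. of_real (g x $ k))"
 shows "hrel X (\<lambda>x. pauli (f x) $ i $ j) (\<lambda>x. pauli (g x) $ i $ j)"
 using hrel_lin[OF hrel_lin[OF assms[of 1] assms[of 2], of "sigma1 $ i $ j" "sigma2 $ i $ j"] assms[of 3], of 1 "sigma3 $ i $ j"]
 by (simp add: pauli_component)

lemma drel_pauli:
 assumes "\<And>k. drel X (\<lambda>x. of_real (f x $ k)) (g k)"
 shows "drel X (\<lambda>x. pauli (f x) $ i $ j) (\<lambda>x. sigma1 $ i $ j * g 1 x + sigma2 $ i $ j * g 2 x + sigma3 $ i $ j * g 3 x)"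
 using drel_lin[OF drel_lin[OF assms[of 1] assms[of 2], of "sigma1 $ i $ j" "sigma2 $ i $ j"] assms[of 3], of 1 "sigma3 $ i $ j"]
 by (simp add: pauli_component)

text \<open>The set where the bound fails is open, and an open null set is empty.\<close>

lemma continuous_AE_le:
 fixes f :: "real => real"
 assumes c: "continuous_on UNIV f" and ae: "AE x in lborel. f x <= C"
 shows "f x <= C"
proof (rule ccontr)
 assume n: "\<not> f x <= C"
 have o: "open (f -` {C<..})" using c by (intro open_vimage) auto
 have "AE x in lborel. x \<notin> f -` {C<..}" using ae by eventually_elim auto
 then have "f -` {C<..} \<in> null_sets lborel" using o by (subst AE_iff_null_sets) auto
 then have "negligible (f -` {C<..})" by (simp add: negligible_iff_null_sets null_sets_completionI)
 then show False using open_not_negligible[OF o] n by (metis empty_iff greaterThan_iff not_le vimageI)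
qed

lemma drel_C1_Circle:
 assumes d: "\<And>x. (f has_vector_derivative g x) (at x)" and g: "continuous_on UNIV g" and b: "on_base Circle f"
 shows "drel Circle f g"
proof -
 have cf: "continuous_on UNIV f"
  using d by (auto intro!: continuous_at_imp_continuous_on has_vector_derivative_continuous)
 have bg: "on_base Circle g"
  unfolding on_base_def
 proof (intro impI allI)
  fix x
  have "((\<lambda>y. f (y + 2 * pi)) has_vector_derivative g (x + 2 * pi)) (at x)"
   using d[of "x + 2 * pi"] unfolding has_vector_derivative_quotient by (simp add: add_ac)
  moreover have "(\<lambda>y. f (y + 2 * pi)) = f" using b by (auto simp: on_base_def)
  ultimately show "g (x + 2 * pi) = g x" using d[of x] by (metis vector_derivative_unique_at)
 qed
 have s: "sqi (mX Circle) h" if h: "continuous_on UNIV h" for h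
 proof -
  have "bounded (h ` {-pi..pi})" by (intro compact_imp_bounded compact_continuous_image continuous_on_subset[OF h]) auto
  then obtain B where B: "\<And>x. x \<in> {-pi..pi} ==> cmod (h x) <= B" unfolding bounded_iff by blast
  have "AE x in mX Circle. x \<in> cell Circle" by (rule AE_cell)
  then have "AE x in mX Circle. cmod (h x) <= B" by eventually_elim (use B in simp)
  moreover have "h \<in> bm" using h by (rule borel_measurable_continuous_onI)
  moreover have "sqi (mX Circle) (\<lambda>x. 1)" by (simp add: sqi_def sqn_def finite_mX_Circle)
  ultimately have "sqi (mX Circle) (\<lambda>x. h x * 1)" by (intro sqi_bounded_mult) simp_all
  then show ?thesis by simp
 qed
 have "dft Circle f g" by (rule dft_C1[OF d g s[OF cf] b s[OF g] bg])
 then show ?thesis using b bg s[OF cf] s[OF g] unfolding dft_def drel_def by (blast intro: rep_refl)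
qed

text \<open>The Hilbert transform with the factor \<open>hc\<close> removed, that is, the multiplier
  applied to \<open>u\<close>. For the derivative of the field it is almost everywhere |\<nabla>| of
  the field, on both spaces.\<close>

definition wX :: "base_space => (real => real^3) => real => real^3" where
 "wX X u x = (1 / hc X) *\<^sub>R hilbert X u x"

lemma bounded_linear_of_real_nth: "bounded_linear (\<lambda>v :: real^3. complex_of_real (v $ j))"
 by (rule bounded_linear_compose[OF bounded_linear_of_real bounded_linear_vec_nth])

lemma hrel_wX:
 assumes L: "\<And>j. L2 X (\<lambda>x. complex_of_real (u x $ j))"
 shows "hrel X (\<lambda>x. of_real (u x $ j)) (\<lambda>x. of_real (wX X u x $ j))" and "L2 X u"
proof -
 have "L2 X (\<lambda>x. u x $ j)" for j using L2_bounded_linear[OF bounded_linear_Re L[of j]] by simp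
 then show u: "L2 X u" by (simp add: L2_vec)
 obtain g where g: "hrel X (\<lambda>x. of_real (u x $ j)) g" using hrel_exists[OF L] .
 have "AE x in lborel. g x = of_real (wX X u x $ j)"
  using hilbert_hrel[OF g] hilbert_bounded_linear[OF bounded_linear_of_real_nth[of j] u]
  by eventually_elim (use hc_pos[of X] in \<open>simp add: wX_def\<close>)
 moreover have "on_base X (\<lambda>x. of_real (wX X u x $ j))" unfolding wX_def using hilbert_on_base[OF u] by (rule on_base_compose)
 ultimately show "hrel X (\<lambda>x. of_real (u x $ j)) (\<lambda>x. of_real (wX X u x $ j))"
  using L2_on_base[OF L] by (intro hrel_cong[OF g AE_I2]) auto
qed

text \<open>\<open>drel_sx\<close> asks for a square-integrable second derivative; through the
  Sobolev bound it controls both \<open>sx\<close> and its Hilbert transform.\<close>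

locale spin_field =
 fixes X :: base_space and s sx :: "real => real^3"
 assumes derivative: "\<And>x. (s has_vector_derivative sx x) (at x)" and sx_continuous: "continuous_on UNIV sx"
  and unit: "\<And>x. norm (s x) = 1" and on_base: "on_base X s"
  and drel_sx: "\<And>j. \<exists>g. drel X (\<lambda>x. of_real (sx x $ j)) g"
begin

abbreviation "w \<equiv> wX X sx"

lemma vector_derivative: "vector_derivative s (at x) = sx x"
 by (rule vector_derivative_at[OF derivative])

lemma L2_component: "L2 X (\<lambda>x. complex_of_real (sx x $ j))"
 using drel_sx drel_L2(1) by blast

lemmas w_hrel = hrel_wX(1)[OF L2_component] and L2_sx = hrel_wX(2)[OF L2_component]

lemma component_derivative: "((\<lambda>x. complex_of_real (s x $ j)) has_vector_derivative of_real (sx x $ j)) (at x)"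
 using bounded_linear.has_vector_derivative[OF bounded_linear_of_real_nth derivative] .

lemma drel_s: "X = Circle ==> drel X (\<lambda>x. of_real (s x $ j)) (\<lambda>x. of_real (sx x $ j))"
proof -
 assume C: "X = Circle"
 have "on_base Circle (\<lambda>x. complex_of_real (s x $ j))" using on_base unfolding C by (rule on_base_compose)
 then show ?thesis unfolding C
  by (intro drel_C1_Circle component_derivative continuous_intros continuous_on_component sx_continuous)
qed

lemma abs_nabla_matrix:
 "AE x in lborel. abs_nabla_matrix X (\<lambda>x. pauli (s x)) x = pauli (w x)" "on_base X (abs_nabla_matrix X (\<lambda>x. pauli (s x)))"
proof -
 have "(AE x in lborel. abs_nabla_matrix X (\<lambda>x. pauli (s x)) x = pauli (w x)) \<and> on_base X (abs_nabla_matrix X (\<lambda>x. pauli (s x)))"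
 proof (cases X)
  case Line
  have "vector_derivative (\<lambda>x. pauli (s x)) (at y) = pauli (sx y)" for y
   by (rule vector_derivative_at[OF bounded_linear.has_vector_derivative[OF bounded_linear_pauli derivative]])
  then show ?thesis using hilbert_bounded_linear[OF bounded_linear_pauli L2_sx] by (simp add: Line wX_def on_base_def)
 next
  case Circle
  have d: "drel Circle (\<lambda>x. pauli (s x) $ i $ j) (\<lambda>x. pauli (sx x) $ i $ j)" for i j
   using drel_pauli[OF drel_s] Circle by (simp add: pauli_component)
  have h: "hrel Circle (\<lambda>x. pauli (sx x) $ i $ j) (\<lambda>x. pauli (w x) $ i $ j)" for i j
   using hrel_pauli[OF w_hrel] Circle by simp
  note a = abs_nabla_hrel[OF d h]
  show ?thesis using a(1) L2_on_base[OF a(2)] unfolding Circle AE_vec_iff by (simp add: on_base_def vec_eq_iff Circle)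
 qed
 then show "AE x in lborel. abs_nabla_matrix X (\<lambda>x. pauli (s x)) x = pauli (w x)" "on_base X (abs_nabla_matrix X (\<lambda>x. pauli (s x)))" by auto
qed

lemma abs_nabla_field: "AE x in lborel. abs_nabla_field X s x = w x"
proof (cases X)
 case Line
 then show ?thesis by (simp add: vector_derivative wX_def)
next
 case Circle
 have a: "AE x in lborel. abs_nabla Circle (\<lambda>y. of_real (s y $ j)) x = of_real (w x $ j)" for j
  using abs_nabla_hrel(1)[OF drel_s w_hrel] Circle by simp
 have "AE x in lborel. Re (abs_nabla Circle (\<lambda>y. of_real (s y $ j)) x) = w x $ j" for j
  using a[of j] by eventually_elim simp
 then show ?thesis unfolding Circle AE_vec_iff by (simp add: Circle)
qed

text \<open>For \<open>sx\<close> the almost everywhere bound extends to every point by continuity;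
  \<open>w\<close> is known only up to null sets.\<close>

lemma w_bounded: "\<exists>C. \<forall>j. (AE x in lborel. \<bar>w x $ j\<bar> <= C) \<and> (\<forall>x. \<bar>sx x $ j\<bar> <= C)"
proof -
 have "\<exists>C. (AE x in lborel. \<bar>w x $ j\<bar> <= C) \<and> (\<forall>x. \<bar>sx x $ j\<bar> <= C)" for j
 proof -
  obtain g where "drel X (\<lambda>x. of_real (sx x $ j)) g" using drel_sx by blast
  from drel_sup_bound[OF this] obtain C where C: "AE x in lborel. cmod (of_real (sx x $ j)) <= C"
   "\<And>p. hrel X (\<lambda>x. of_real (sx x $ j)) p ==> AE x in lborel. cmod (p x) <= C" by blast
  have "AE x in lborel. \<bar>sx x $ j\<bar> <= C" "AE x in lborel. \<bar>w x $ j\<bar> <= C"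
   using C(1) C(2)[OF w_hrel[of j]] by simp_all
  moreover have "continuous_on UNIV (\<lambda>x. \<bar>sx x $ j\<bar>)" by (intro continuous_intros continuous_on_component sx_continuous)
  ultimately show ?thesis using continuous_AE_le by blast
 qed
 then obtain C where C: "\<And>j. (AE x in lborel. \<bar>w x $ j\<bar> <= C j) \<and> (\<forall>x. \<bar>sx x $ j\<bar> <= C j)" by metis
 have le: "C j <= Max (range C)" for j by (intro Max_ge) auto
 have "(AE x in lborel. \<bar>w x $ j\<bar> <= Max (range C)) \<and> (\<forall>x. \<bar>sx x $ j\<bar> <= Max (range C))" for j
 proof
  show "AE x in lborel. \<bar>w x $ j\<bar> <= Max (range C)" using conjunct1[OF C[of j]] by eventually_elim (use le[of j] in linarith)
  show "\<forall>x. \<bar>sx x $ j\<bar> <= Max (range C)" using C[of j] le[of j] by (meson order_trans)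
 qed
 then show ?thesis by blast
qed

lemma lax_data: "\<exists>C. lax_data X (\<lambda>x. pauli (s x)) (\<lambda>x. pauli (sx x)) (\<lambda>x. pauli (w x)) C"
proof -
 obtain C where C: "\<And>j. AE x in lborel. \<bar>w x $ j\<bar> <= C" "\<And>j x. \<bar>sx x $ j\<bar> <= C" using w_bounded by blast
 have bl: "bounded_linear (\<lambda>v. pauli v $ i $ j)" for i j
  by (rule bounded_linear_compose[OF bounded_linear_vec_nth bounded_linear_compose[OF bounded_linear_vec_nth bounded_linear_pauli]])
 have b: "on_base X sx"
  using L2_on_base[OF L2_sx] .
 show ?thesis
 \<comment> \<open>Three coordinates of modulus at most 1 for \<open>S\<close>, three of modulus at
   most \<open>C\<close> for \<open>T\<close> and \<open>W\<close>.\<close>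
 proof (intro exI[of _ "3 + 3 * \<bar>C\<bar>"] lax_data.intro)
  fix i j x
  show "((\<lambda>x. pauli (s x) $ i $ j) has_vector_derivative pauli (sx x) $ i $ j) (at x)"
   by (rule bounded_linear.has_vector_derivative[OF bl derivative])
  show "continuous_on UNIV (\<lambda>x. pauli (sx x) $ i $ j)" by (rule bounded_linear.continuous_on[OF bl sx_continuous])
  have "\<bar>s x $ k\<bar> <= 1" for k using component_le_norm_cart[of "s x" k] unit[of x] by simp
  from this[of 1] this[of 2] this[of 3] show "cmod (pauli (s x) $ i $ j) <= 3 + 3 * \<bar>C\<bar>"
   using pauli_component_le[of "s x" i j] by linarith
  show "cmod (pauli (sx x) $ i $ j) <= 3 + 3 * \<bar>C\<bar>"
   using pauli_component_le[of "sx x" i j] C(2)[of x 1] C(2)[of x 2] C(2)[of x 3] by linarith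
  show "AE x in lborel. cmod (pauli (w x) $ i $ j) <= 3 + 3 * \<bar>C\<bar>"
   using C(1)[of 1] C(1)[of 2] C(1)[of 3]
  proof eventually_elim
   case (elim x)
   then show ?case using pauli_component_le[of "w x" i j] by linarith
  qed
  show "pauli (s x) ** pauli (s x) = mat 1" by (rule pauli_square[OF unit])
  show "X = Circle ==> drel X (\<lambda>x. pauli (s x) $ i $ j) (\<lambda>x. pauli (sx x) $ i $ j)"
   using drel_pauli[OF drel_s] by (simp add: pauli_component)
  obtain g where "\<And>k. drel X (\<lambda>x. of_real (sx x $ k)) (g k)" using drel_sx by metis
  from drel_pauli[OF this] show "\<exists>f. drel X (\<lambda>x. pauli (sx x) $ i $ j) f" by blast
  show "hrel X (\<lambda>x. pauli (sx x) $ i $ j) (\<lambda>x. pauli (w x) $ i $ j)" by (rule hrel_pauli[OF w_hrel])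
  show "on_base X (\<lambda>x. pauli (s x))" "on_base X (\<lambda>x. pauli (sx x))" "on_base X (\<lambda>x. pauli (w x))"
   using on_base b hilbert_on_base[OF L2_sx] unfolding wX_def by (auto intro: on_base_compose)
 qed (fact abs_nabla_matrix)+
qed

end

section \<open>The time derivative\<close>

lemma has_vector_derivative_within_quotient:
 assumes "(f has_vector_derivative D) (at t within I)"
 shows "((\<lambda>r. (1 / (r - t)) *\<^sub>R (f r - f t) - D) \<longlongrightarrow> 0) (at t within I)"
proof (rule tendsto_norm_zero_cancel, rule Lim_transform_eventually)
 show "((\<lambda>r. norm ((1 / norm (r - t)) *\<^sub>R (f r - (f t + (r - t) *\<^sub>R D)))) \<longlongrightarrow> 0) (at t within I)"
  using assms unfolding has_vector_derivative_def has_derivative_within by (intro tendsto_norm_zero) simp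
 show "\<forall>\<^sub>F r in at t within I. norm ((1 / norm (r - t)) *\<^sub>R (f r - (f t + (r - t) *\<^sub>R D))) = norm ((1 / (r - t)) *\<^sub>R (f r - f t) - D)"
  unfolding eventually_at_filter
 proof (intro always_eventually allI impI)
  fix r assume "r \<noteq> t"
  then have "(1 / (r - t)) *\<^sub>R (f r - f t) - D = (1 / (r - t)) *\<^sub>R (f r - (f t + (r - t) *\<^sub>R D))"
   by (simp add: scaleR_diff_right scaleR_add_right)
  then show "norm ((1 / norm (r - t)) *\<^sub>R (f r - (f t + (r - t) *\<^sub>R D))) = norm ((1 / (r - t)) *\<^sub>R (f r - f t) - D)" by simp
 qed
qed

lemma norm_diff_sq_le: "(norm (a - b))^2 <= 2 * (norm a)^2 + 2 * (norm b)^2" for a b :: "'a::real_normed_vector"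
proof -
 have "(norm (a - b))^2 <= (norm a + norm b)^2" by (intro power_mono norm_triangle_ineq4) simp
 also have "... <= 2 * (norm a)^2 + 2 * (norm b)^2" using sum_squares_bound[of "norm a" "norm b"] by (simp add: power2_sum)
 finally show ?thesis .
qed

lemma l2_sq_diff:
 assumes [measurable]: "f \<in> borel_measurable lebesgue" "g \<in> borel_measurable lebesgue"
 shows "l2_sq X (\<lambda>x. f x - g x) <= 2 * l2_sq X f + 2 * l2_sq X g"
proof -
 have [measurable]: "cell X \<in> sets lebesgue" by simp
 have "l2_sq X (\<lambda>x. f x - g x) <= (\<integral>\<^sup>+x. 2 * (ennreal ((norm (f x))^2) * indicator (cell X) x) + 2 * (ennreal ((norm (g x))^2) * indicator (cell X) x) \<partial>lebesgue)"
  unfolding l2_sq_def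
 proof (rule nn_integral_mono)
  fix x
  have "ennreal ((norm (f x - g x))^2) <= ennreal (2 * (norm (f x))^2 + 2 * (norm (g x))^2)" by (rule ennreal_leI[OF norm_diff_sq_le])
  also have "... = 2 * ennreal ((norm (f x))^2) + 2 * ennreal ((norm (g x))^2)" by (simp add: ennreal_mult)
  finally show "ennreal ((norm (f x - g x))^2) * indicator (cell X) x <= 2 * (ennreal ((norm (f x))^2) * indicator (cell X) x) + 2 * (ennreal ((norm (g x))^2) * indicator (cell X) x)"
   unfolding mult.assoc[symmetric] distrib_right[symmetric] by (rule mult_right_mono) simp
 qed
 also have "... = 2 * l2_sq X f + 2 * l2_sq X g" unfolding l2_sq_def
  by (simp add: nn_integral_add nn_integral_cmult)
 finally show ?thesis .
qed

lemma hv_bound: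
 assumes "hv X f p"
 shows "l2_sq X p <= ennreal (4 * pi) * l2_sq X f"
proof -
 have "L2 X f" "L2 X p" using hv_L2[OF assms] by auto
 then have m: "\<And>i. (\<lambda>x. f x $ i) \<in> borel_measurable lebesgue" "\<And>i. (\<lambda>x. p x $ i) \<in> borel_measurable lebesgue"
  unfolding L2_vec by (simp_all add: L2_def)
 show ?thesis unfolding l2_sq_vec[OF m(1)] l2_sq_vec[OF m(2)] sum_distrib_left
  using assms by (intro sum_mono hrel_bound) (simp add: hv_def)
qed

lemma bounded_bilinear_pauli: "bounded_bilinear (\<lambda>q v. pauli q *v v)"
proof -
 have 1: "(c *\<^sub>R A) *v v = c *\<^sub>R (A *v v)" "A *v (c *\<^sub>R v) = c *\<^sub>R (A *v v)" for c and A :: "complex^2^2" and v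
  by (simp_all add: matrix_vector_mult_def vec_eq_iff scaleR_sum_right)
 note p = linear_simps[OF bounded_linear_pauli]
 have "linear (\<lambda>q. pauli q *v v)" for v by (rule linearI) (simp_all only: p 1 matrix_vector_mult_add_rdistrib)
 moreover have "linear (\<lambda>v. pauli q *v v)" for q by (rule linearI) (simp_all only: 1 matrix_vector_right_distrib)
 ultimately show ?thesis by (simp add: bilinear_def flip: bilinear_conv_bounded_bilinear)
qed

lemma L2_pauli_mult:
 assumes q: "continuous_on UNIV q" "\<And>x. norm (q x) <= C" "on_base X q" and f: "L2 X g"
 shows "L2 X (\<lambda>x. pauli (q x) *v g x)"
proof (rule L2_matrix_mult[OF _ _ _ f, where C = "3 * C"])
 fix i j
 have bl: "bounded_linear (\<lambda>v. pauli v $ i $ j)"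
  by (rule bounded_linear_compose[OF bounded_linear_vec_nth bounded_linear_compose[OF bounded_linear_vec_nth bounded_linear_pauli]])
 have "(\<lambda>x. pauli (q x) $ i $ j) \<in> borel_measurable lborel"
  using borel_measurable_continuous_onI[OF bounded_linear.continuous_on[OF bl q(1)]] by simp
 then show "(\<lambda>x. pauli (q x) $ i $ j) \<in> borel_measurable lebesgue" by (rule measurable_completion)
 show "AE x in lborel. cmod (pauli (q x) $ i $ j) <= 3 * C"
 proof (rule AE_I2)
  fix x
  have "\<bar>q x $ k\<bar> <= C" for k using component_le_norm_cart[of "q x" k] q(2)[of x] by linarith
  from this[of 1] this[of 2] this[of 3] show "cmod (pauli (q x) $ i $ j) <= 3 * C"
   using pauli_component_le[of "q x" i j] by linarith
 qed
 show "on_base X (\<lambda>x. pauli (q x))" using q(3) by (rule on_base_compose)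
qed

text \<open>Dominated convergence along sequences of times: \<open>q r\<close> tends to zero at each
  point of space, not necessarily uniformly, and the eventual bound \<open>C\<close> supplies the
  majorant.\<close>

lemma pauli_mult_tendsto_0:
 fixes I :: "real set"
 assumes f: "L2 X g" and q: "\<And>r. r \<in> I ==> continuous_on UNIV (q r)"
  and bd: "\<forall>\<^sub>F r in at t within I. \<forall>x. norm (q r x) <= C" and C: "C \<ge> 0"
  and lim: "\<And>x. ((\<lambda>r. q r x) \<longlongrightarrow> 0) (at t within I)"
 shows "((\<lambda>r. l2_sq X (\<lambda>x. pauli (q r x) *v g x)) \<longlongrightarrow> 0) (at t within I)"
 unfolding tendsto_at_iff_sequentially comp_def
proof (intro allI impI)
 fix Y :: "nat => real" assume Y: "\<forall>i. Y i \<in> I - {t}" "Y \<longlonglongrightarrow> t"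
 have fY: "filterlim Y (at t within I) sequentially" using Y by (auto simp: filterlim_at)
 obtain K where K: "K \<ge> 0" "\<And>a v. norm (pauli a *v v) <= norm a * norm v * K"
  using bounded_bilinear.nonneg_bounded[OF bounded_bilinear_pauli] by blast
 have mf: "g \<in> borel_measurable lebesgue" using f by (simp add: L2_def)
 have mq: "(\<lambda>x. norm (q (Y n) x)) \<in> borel_measurable lebesgue" for n
  by (rule measurable_completion, simp, rule borel_measurable_continuous_onI, intro continuous_on_norm q) (use Y in auto)
 note [measurable] = mf mq
 have [measurable]: "cell X \<in> sets lebesgue" by simp
 \<comment> \<open>The minimum with \<open>C\<close> makes the majorant valid for all
   \<open>n\<close>; it is dropped once the bound on \<open>q\<close> is in force.\<close>
 define h where "h n x = ennreal ((K * min (norm (q (Y n) x)) C * norm (g x))^2) * indicator (cell X) x" for n x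
 have "(\<lambda>n. \<integral>\<^sup>+x. h n x \<partial>lebesgue) \<longlonglongrightarrow> integral\<^sup>N lebesgue (\<lambda>x :: real. 0)"
 proof (rule nn_integral_dominated_convergence)
  show "h n \<in> borel_measurable lebesgue" for n unfolding h_def by measurable
  define w where "w x = ennreal ((K * C)^2) * (ennreal ((norm (g x))^2) * indicator (cell X) x)" for x
  show "w \<in> borel_measurable lebesgue" unfolding w_def by measurable
  have "(\<integral>\<^sup>+x. w x \<partial>lebesgue) = ennreal ((K * C)^2) * l2_sq X g"
   unfolding w_def l2_sq_def by (rule nn_integral_cmult) measurable
  also have "... < \<infinity>" using f by (simp add: L2_def ennreal_mult_less_top)
  finally show "(\<integral>\<^sup>+x. w x \<partial>lebesgue) < \<infinity>" .
  show "AE x in lebesgue. h n x <= w x" for n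
  proof (rule AE_I2)
   fix x
   have "(K * min (norm (q (Y n) x)) C * norm (g x))^2 <= (K * C * norm (g x))^2"
    using K C by (intro power_mono mult_right_mono mult_left_mono) auto
   then have "ennreal ((K * min (norm (q (Y n) x)) C * norm (g x))^2) <= ennreal ((K * C)^2 * (norm (g x))^2)"
    by (intro ennreal_leI) (simp add: power_mult_distrib)
   also have "... = ennreal ((K * C)^2) * ennreal ((norm (g x))^2)" by (rule ennreal_mult) simp_all
   finally show "h n x <= w x" unfolding h_def w_def mult.assoc[symmetric] by (rule mult_right_mono) simp
  qed
  show "AE x in lebesgue. (\<lambda>n. h n x) \<longlonglongrightarrow> 0"
  proof (rule AE_I2)
   fix x
   have "(\<lambda>n. q (Y n) x) \<longlonglongrightarrow> 0" by (rule filterlim_compose[OF lim fY])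
   then have "(\<lambda>n. norm (q (Y n) x)) \<longlonglongrightarrow> 0" by (rule tendsto_norm_zero)
   then have "(\<lambda>n. min (norm (q (Y n) x)) C) \<longlonglongrightarrow> min 0 C" by (intro tendsto_min tendsto_const)
   then have "(\<lambda>n. (K * min (norm (q (Y n) x)) C * norm (g x))^2) \<longlonglongrightarrow> (K * min 0 C * norm (g x))^2"
    by (intro tendsto_power tendsto_mult tendsto_const)
   moreover have "(K * min 0 C * norm (g x))^2 = 0" using C by simp
   ultimately have "(\<lambda>n. (K * min (norm (q (Y n) x)) C * norm (g x))^2) \<longlonglongrightarrow> 0" by (simp only:)
   then have "(\<lambda>n. ennreal ((K * min (norm (q (Y n) x)) C * norm (g x))^2)) \<longlonglongrightarrow> ennreal 0" by (rule tendsto_ennrealI)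
   then show "(\<lambda>n. h n x) \<longlonglongrightarrow> 0" unfolding h_def by (cases "x \<in> cell X") simp_all
  qed
 qed measurable
 then have 0: "(\<lambda>n. \<integral>\<^sup>+x. h n x \<partial>lebesgue) \<longlonglongrightarrow> 0" by simp
 have ev: "\<forall>\<^sub>F n in sequentially. \<forall>x. norm (q (Y n) x) <= C" using bd fY by (rule eventually_compose_filterlim)
 show "(\<lambda>n. l2_sq X (\<lambda>x. pauli (q (Y n) x) *v g x)) \<longlonglongrightarrow> 0"
 proof (rule tendsto_0_le_ennreal[OF 0], use ev in eventually_elim)
  case (elim n)
  show ?case unfolding l2_sq_def h_def
  proof (intro nn_integral_mono mult_right_mono ennreal_leI power_mono)
   fix x
   have "min (norm (q (Y n) x)) C = norm (q (Y n) x)" using elim by (simp add: min_def)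
   then show "norm (pauli (q (Y n) x) *v g x) <= K * min (norm (q (Y n) x)) C * norm (g x)"
    using K(2)[of "q (Y n) x" "g x"] by (simp add: mult_ac)
  qed simp_all
 qed
qed

text \<open>Mean value inequality on the convex set where the bound on \<open>g\<close> holds; the
  quotient and \<open>g t\<close> contribute \<open>C\<close> each.\<close>

lemma difference_quotient_bound:
 fixes f :: "real => real^3"
 assumes I: "is_interval I" "t \<in> I" and d: "\<And>r. r \<in> I ==> (f has_vector_derivative g r) (at r within I)"
  and bd: "\<And>u. u \<in> I ==> \<bar>u - t\<bar> < e ==> norm (g u) <= C" and e: "e > 0" and r: "r \<in> I" "r \<noteq> t" "\<bar>r - t\<bar> < e"
 shows "norm ((1 / (r - t)) *\<^sub>R (f r - f t) - g t) <= 2 * C"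
proof -
 define J where "J = I \<inter> {t - e<..<t + e}"
 have "norm (f r - f t) <= C * norm (r - t)"
 proof (rule differentiable_bound[where f' = "\<lambda>u h. h *\<^sub>R g u" and S = J])
  show "convex J" unfolding J_def using I by (intro convex_Int) (auto simp: is_interval_convex_1)
  show "r \<in> J" "t \<in> J" using r I e by (auto simp: J_def abs_if split: if_splits)
  fix u assume s: "u \<in> J"
  then have "(f has_vector_derivative g u) (at u within J)"
   by (intro has_vector_derivative_within_subset[OF d]) (auto simp: J_def)
  then show "(f has_derivative (\<lambda>h. h *\<^sub>R g u)) (at u within J)" by (simp add: has_vector_derivative_def)
  have "onorm (\<lambda>h. h *\<^sub>R g u) <= norm (g u)" by (rule onorm_bound) auto
  also have "... <= C" using s by (intro bd) (auto simp: J_def abs_if)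
  finally show "onorm (\<lambda>h. h *\<^sub>R g u) <= C" .
 qed
 then have "norm ((1 / (r - t)) *\<^sub>R (f r - f t)) <= C" using r(2)
  unfolding norm_scaleR by (simp add: divide_le_eq)
 moreover have "norm (g t) <= C" using I(2) e by (intro bd) auto
 moreover have "norm ((1 / (r - t)) *\<^sub>R (f r - f t) - g t) <= norm ((1 / (r - t)) *\<^sub>R (f r - f t)) + norm (g t)" by (rule norm_triangle_ineq4)
 ultimately show ?thesis by linarith
qed

text \<open>\<open>t\<close> may be interior or an end point, and \<open>I\<close> need not be
  closed. On a side where \<open>I\<close> has further points one of them ends the compact interval,
  otherwise \<open>t\<close> itself does.\<close>

lemma interval_compact_neighbourhood:
 fixes I :: "real set"
 assumes I: "is_interval I" "t \<in> I"
 obtains a b e where "e > 0" "{a..b} \<subseteq> I" "\<And>s. s \<in> I ==> \<bar>s - t\<bar> < e ==> s \<in> {a..b}"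
proof -
 have mem: "s \<in> I" if "a \<in> I" "b \<in> I" "a <= s" "s <= b" for a b s
  using I(1) that unfolding is_interval_1 by blast
 obtain b h where b: "b \<in> I" "h > 0" "\<And>s. s \<in> I ==> s < t + h ==> s <= b"
 proof (cases "\<exists>r\<in>I. r > t")
  case True
  then obtain r where "r \<in> I" "r > t" by blast
  then show ?thesis using that[of r "r - t"] by auto
 next
  case False
  then show ?thesis using that[of t 1] I(2) by force
 qed
 obtain a \<alpha> where a: "a \<in> I" "\<alpha> > 0" "\<And>s. s \<in> I ==> s > t - \<alpha> ==> s \<ge> a"
 proof (cases "\<exists>r\<in>I. r < t")
  case True
  then obtain r where "r \<in> I" "r < t" by blast
  then show ?thesis using that[of r "t - r"] by auto
 next
  case False
  then show ?thesis using that[of t 1] I(2) by force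
 qed
 show ?thesis
 proof (rule that[of "min \<alpha> h" a b])
  show "{a..b} \<subseteq> I" using mem[OF a(1) b(1)] by auto
  show "s \<in> {a..b}" if "s \<in> I" "\<bar>s - t\<bar> < min \<alpha> h" for s
   using a(3)[OF that(1)] b(3)[OF that(1)] that(2) by (auto simp: abs_if split: if_splits)
 qed (use a b in simp)
qed

lemma norm_cross3_le: "norm (cross3 a b) <= norm a * norm b"
proof (rule power2_le_imp_le)
 show "(norm (cross3 a b))^2 <= (norm a * norm b)^2" by (simp add: norm_cross power_mult_distrib)
qed simp
text \<open>A one-point interval has the trivial filter: derivatives in time are not unique there,
  and convergence is automatic.\<close>

lemma isolated_interval_point: "at t within {t} = (bot :: real filter)"
 by (simp add: at_within_def)

text \<open>\<open>D\<close> is the family of partial derivatives provided by smoothness, made a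
  parameter so that these derivatives are named continuous functions.\<close>

locale spin_evolution =
 fixes X :: base_space and I :: "real set" and S :: "real => real => real^3" and D :: "nat => nat => real => real => real^3"
 assumes interval: "is_interval I"
  and S_base: "\<And>t. t \<in> I ==> on_base X (S t)" and S_unit: "\<And>t x. t \<in> I ==> norm (S t x) = 1"
  and D0: "\<And>t x. t \<in> I ==> D 0 0 t x = S t x"
  and D_continuous: "\<And>j k. continuous_on (I \<times> UNIV) (\<lambda>(t, x). D j k t x)"
  and D_time: "\<And>j k t x. t \<in> I ==> ((\<lambda>\<tau>. D j k \<tau> x) has_vector_derivative D (Suc j) k t x) (at t within I)"
  and D_space: "\<And>j k t x. t \<in> I ==> ((\<lambda>y. D j k t y) has_vector_derivative D j (Suc k) t x) (at x)"
  and S_sobolev: "X = Line ==> sobolev_continuous_on I 1 (\<lambda>t x. vector_derivative (S t) (at x))"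
  and evolution: "half_wave_maps X I S"
begin

lemma D_continuous_space: "t \<in> I ==> continuous_on UNIV (D j k t)"
 using D_space by (auto intro!: continuous_at_imp_continuous_on has_vector_derivative_continuous)

lemma S_eq_D0: "t \<in> I ==> S t = D 0 0 t"
 using D0 by auto

lemma spin_field:
 assumes t: "t \<in> I"
 shows "spin_field X (S t) (D 0 1 t)"
proof
 show d: "(S t has_vector_derivative D 0 1 t x) (at x)" for x using D_space[OF t, of 0 0 x] S_eq_D0[OF t] by simp
 show "continuous_on UNIV (D 0 1 t)" by (rule D_continuous_space[OF t])
 show "norm (S t x) = 1" for x by (rule S_unit[OF t])
 show "on_base X (S t)" by (rule S_base[OF t])
 show "\<exists>g. drel X (\<lambda>x. of_real (D 0 1 t x $ j)) g" for j
 proof (cases X)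
  case Line
  have v: "vector_derivative (S t) (at x) = D 0 1 t x" for x by (rule vector_derivative_at[OF d])
  have "sobolev Line 1 (\<lambda>x. complex_of_real (vector_derivative (S t) (at x) $ j))"
   using S_sobolev[OF Line] t unfolding sobolev_continuous_on_def by blast
  then show ?thesis unfolding v Line sobolev_iff_drel .
 next
  case Circle
  have c: "((\<lambda>x. complex_of_real (D 0 k t x $ j)) has_vector_derivative of_real (D 0 (Suc k) t x $ j)) (at x)"
   "continuous_on UNIV (\<lambda>x. complex_of_real (D 0 k t x $ j))" for k x
   using bounded_linear.has_vector_derivative[OF bounded_linear_of_real_nth D_space[OF t]]
   by (auto intro!: continuous_intros continuous_on_component D_continuous_space[OF t])
  have "on_base Circle (\<lambda>x. complex_of_real (D 0 0 t x $ j))"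
   using S_base[OF t] unfolding Circle S_eq_D0[OF t] by (rule on_base_compose)
  from drel_C1_Circle[OF c(1) c(2) this] have "on_base Circle (\<lambda>x. complex_of_real (D 0 1 t x $ j))"
   by (auto dest: drel_L2 L2_on_base)
  then have "on_base Circle (\<lambda>x. complex_of_real (D 0 (Suc 0) t x $ j))" by simp
  from drel_C1_Circle[OF c(1) c(2) this] show ?thesis unfolding Circle by auto
 qed
qed

lemma limit_point: "I \<noteq> {t} ==> t \<in> I ==> at t within I \<noteq> bot"
 using connected_imp_perfect[of I t] interval by (auto simp: is_interval_connected_1 trivial_limit_within)

text \<open>Uniqueness of derivatives identifies the continuous function \<open>D 1 0 t\<close> with
  the right-hand side of the equation at every point, although \<open>abs_nabla_field\<close> is
  otherwise known only almost everywhere.\<close>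

lemma time_derivative:
 assumes "I \<noteq> {t}" "t \<in> I"
 shows "D 1 0 t x = cross3 (S t x) (abs_nabla_field X (S t) x)"
proof (rule vector_derivative_unique_within[OF limit_point[OF assms]])
 show "((\<lambda>r. D 0 0 r x) has_vector_derivative D 1 0 t x) (at t within I)" using D_time[OF assms(2), of 0 0 x] by simp
 have "((\<lambda>r. S r x) has_vector_derivative cross3 (S t x) (abs_nabla_field X (S t) x)) (at t within I)"
  using evolution assms(2) unfolding half_wave_maps_def by blast
 then show "((\<lambda>r. D 0 0 r x) has_vector_derivative cross3 (S t x) (abs_nabla_field X (S t) x)) (at t within I)"
  by (rule has_vector_derivative_transform[OF assms(2), rotated]) (simp add: D0)
qed

lemma time_derivative_base:
 assumes "I \<noteq> {t}" "t \<in> I"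
 shows "on_base X (D 1 0 t)"
 unfolding on_base_def
proof (intro impI allI)
 fix x assume C: "X = Circle"
 have d: "((\<lambda>r. D 0 0 r y) has_vector_derivative D 1 0 t y) (at t within I)" for y using D_time[OF assms(2), of 0 0 y] by simp
 have "((\<lambda>r. D 0 0 r x) has_vector_derivative D 1 0 t (x + 2 * pi)) (at t within I)"
  by (rule has_vector_derivative_transform[OF assms(2) _ d[of "x + 2 * pi"]]) (use S_base C in \<open>simp add: D0 on_base_def\<close>)
 then show "D 1 0 t (x + 2 * pi) = D 1 0 t x" using d by (rule vector_derivative_unique_within[OF limit_point[OF assms]])
qed

text \<open>The unit vector \<open>S\<close> does not enlarge the vector product, so the three
  coordinates of \<open>wX\<close> bound the time derivative almost everywhere; continuity removes
  the exception.\<close>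

lemma time_derivative_le:
 assumes t: "I \<noteq> {t}" "t \<in> I" and bd: "\<And>j. AE x in lborel. \<bar>wX X (D 0 1 t) x $ j\<bar> <= C"
 shows "norm (D 1 0 t x) <= 3 * C"
proof -
 have "AE x in lborel. norm (D 1 0 t x) <= 3 * C"
  using spin_field.abs_nabla_field[OF spin_field[OF t(2)]] bd[of 1] bd[of 2] bd[of 3]
 proof eventually_elim
  case (elim x)
  have "norm (D 1 0 t x) <= norm (wX X (D 0 1 t) x)"
   using norm_cross3_le[of "S t x" "wX X (D 0 1 t) x"] S_unit[OF t(2), of x]
   unfolding time_derivative[OF t] elim(1) by simp
  also have "... <= \<bar>wX X (D 0 1 t) x $ 1\<bar> + \<bar>wX X (D 0 1 t) x $ 2\<bar> + \<bar>wX X (D 0 1 t) x $ 3\<bar>"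
   using norm_le_l1_cart[of "wX X (D 0 1 t) x"] by (simp add: sum_3)
  finally show ?case using elim by linarith
 qed
 then show ?thesis by (rule continuous_AE_le[rotated]) (intro continuous_intros D_continuous_space t)
qed

text \<open>The bound must be uniform in space for the difference quotients to be dominated. On the
  line, where space is not compact, it is obtained at \<open>t\<close> and carried to nearby times
  by Sobolev continuity.\<close>

lemma time_derivative_bounded:
 assumes t: "I \<noteq> {t}" "t \<in> I"
 obtains C e where "e > 0" "\<And>s x. s \<in> I ==> \<bar>s - t\<bar> < e ==> norm (D 1 0 s x) <= C"
proof (cases X)
 case Circle
 obtain a b e where ab: "e > 0" "{a..b} \<subseteq> I" "\<And>s. s \<in> I ==> \<bar>s - t\<bar> < e ==> s \<in> {a..b}"
  by (rule interval_compact_neighbourhood[OF interval t(2)]) blast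
 have "compact ((\<lambda>(t, x). D 1 0 t x) ` ({a..b} \<times> {-pi..pi}))"
  by (intro compact_continuous_image compact_Times continuous_on_subset[OF D_continuous]) (use ab(2) in auto)
 then have "bounded ((\<lambda>(t, x). D 1 0 t x) ` ({a..b} \<times> {-pi..pi}))" by (rule compact_imp_bounded)
 then obtain C where "\<forall>y\<in>(\<lambda>(t, x). D 1 0 t x) ` ({a..b} \<times> {-pi..pi}). norm y <= C" unfolding bounded_iff ..
 then have C: "\<And>s x. s \<in> {a..b} ==> x \<in> {-pi..pi} ==> norm (D 1 0 s x) <= C"
  by (simp only: ball_simps) (simp add: Ball_def)
 have "norm (D 1 0 s x) <= C" if s: "s \<in> I" "\<bar>s - t\<bar> < e" for s x
 proof -
  define k where "k = - \<lfloor>(x + pi) / (2 * pi)\<rfloor>"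
  have "I \<noteq> {s}" using t by blast
  then have "on_base Circle (D 1 0 s)" using time_derivative_base[OF _ s(1)] Circle by simp
  then have eq: "D 1 0 s (x + 2 * pi * of_int k) = D 1 0 s x" by (rule on_base_of_int)
  have "x + 2 * pi * of_int k \<in> {-pi..pi}"
   using floor_divide_lower[of "2 * pi" "x + pi"] floor_divide_upper[of "2 * pi" "x + pi"] by (simp add: k_def algebra_simps)
  from C[OF ab(3)[OF s] this] show ?thesis unfolding eq .
 qed
 then show ?thesis by (rule that[OF ab(1)])
next
 case Line
 interpret t: spin_field X "S t" "D 0 1 t" by (rule spin_field[OF t(2)])
 obtain C where C: "\<And>j. AE x in lborel. \<bar>wX X (D 0 1 t) x $ j\<bar> <= C" using t.w_bounded by blast
 have v: "vector_derivative (S s) (at x) = D 0 1 s x" if "s \<in> I" for s x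
  by (rule spin_field.vector_derivative[OF spin_field[OF that]])
 define E where "E s j = (\<lambda>x. complex_of_real (D 0 1 s x $ j - D 0 1 t x $ j))" for s j
 have "\<forall>\<^sub>F s in at t within I. sobolev_sq Line 1 (E s j) < 1" for j
 proof -
  have "((\<lambda>r. sobolev_sq Line 1 (\<lambda>x. complex_of_real (vector_derivative (S r) (at x) $ j - vector_derivative (S t) (at x) $ j))) \<longlongrightarrow> 0) (at t within I)"
   using S_sobolev[OF Line] t(2) unfolding sobolev_continuous_on_def by blast
  then have "\<forall>\<^sub>F r in at t within I. sobolev_sq Line 1 (\<lambda>x. complex_of_real (vector_derivative (S r) (at x) $ j - vector_derivative (S t) (at x) $ j)) < 1"
   by (rule order_tendstoD) simp
  moreover have "\<forall>\<^sub>F r in at t within I. r \<in> I" by (simp add: eventually_at_filter)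
  ultimately show ?thesis by eventually_elim (simp add: v t(2) E_def)
 qed
 then have "\<forall>\<^sub>F s in at t within I. \<forall>j. sobolev_sq Line 1 (E s j) < 1" by (intro eventually_all_finite)
 then obtain e where e: "e > 0" "\<And>s j. s \<in> I ==> s \<noteq> t ==> \<bar>s - t\<bar> < e ==> sobolev_sq Line 1 (E s j) < 1"
  unfolding eventually_at dist_real_def by blast
 \<comment> \<open>With squared Sobolev norm below 1 and \<open>csob Line = 1\<close>, the Hilbert
   transforms at the times \<open>s\<close> and \<open>t\<close> differ by at most
   \<open>sqrt (8 * pi)\<close> in each coordinate.\<close>
 have "norm (D 1 0 s x) <= 3 * (C + sqrt (8 * pi))" if s: "s \<in> I" "\<bar>s - t\<bar> < e" for s x
 proof (rule time_derivative_le[OF _ s(1)])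
  show "I \<noteq> {s}" using t by blast
  interpret s: spin_field X "S s" "D 0 1 s" by (rule spin_field[OF s(1)])
  fix j
  show "AE x in lborel. \<bar>wX X (D 0 1 s) x $ j\<bar> <= C + sqrt (8 * pi)"
  proof (cases "s = t")
   case True
   have "sqrt (8 * pi) \<ge> 0" by simp
   then show ?thesis unfolding True by (intro eventually_mono[OF C[of j]]) linarith
  next
   case False
   have h: "hrel X (E s j) (\<lambda>x. of_real (wX X (D 0 1 s) x $ j) - of_real (wX X (D 0 1 t) x $ j))"
    using hrel_lin[OF s.w_hrel[of j] t.w_hrel[of j], of 1 "-1"] by (simp add: E_def)
   obtain g1 g2 where "drel X (\<lambda>x. of_real (D 0 1 s x $ j)) g1" "drel X (\<lambda>x. of_real (D 0 1 t x $ j)) g2"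
    using s.drel_sx t.drel_sx by blast
   from drel_lin[OF this, of 1 "-1"] have "sobolev X 1 (E s j)" unfolding sobolev_iff_drel E_def by auto
   from hrel_sup_bound_sobolev[OF this h] C[of j] show ?thesis
   proof eventually_elim
    case (elim x)
    define y where "y = wX X (D 0 1 s) x $ j - wX X (D 0 1 t) x $ j"
    have "ennreal (y^2) <= ennreal (8 * pi) * sobolev_sq Line 1 (E s j)"
     using elim(1) unfolding y_def Line by (simp flip: of_real_diff)
    also have "... <= ennreal (8 * pi) * 1" using e(2)[OF s(1) False s(2)] by (intro mult_left_mono) (auto intro: less_imp_le)
    finally have "y\<^sup>2 <= 8 * pi" by simp
    then have "\<bar>y\<bar> <= sqrt (8 * pi)" by (intro real_le_rsqrt) simp
    then show ?case using elim(2) unfolding y_def by linarith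
   qed
  qed
 qed
 then show ?thesis by (rule that[OF e(1)])
qed

lemma continuous_field: "t \<in> I ==> continuous_on UNIV (S t)"
 using D_continuous_space[of t 0 0] by (simp add: S_eq_D0)

lemma lax_L_pauli:
 assumes "t \<in> I" "hv X f p" "hv X (\<lambda>x. pauli (S t x) *v f x) r"
 shows "AE x in lborel. lax_L X (spin_matrix S t) f x = of_real (hc X) *s (r x - pauli (S t x) *v p x)"
 using lax_data.lax_L_AE(1) spin_field.lax_data[OF spin_field[OF assms(1)]] assms(2,3)
 unfolding spin_matrix_def[abs_def] by blast

text \<open>Let \<open>Q\<close> be the difference quotient of the matrix field minus its time
  derivative. Since \<open>lax_L\<close> is linear in the field, the difference quotient of
  \<open>L z\<close> minus the claimed derivative is \<open>hc\<close> times the commutator of the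
  multiplier with \<open>Q\<close>, applied to \<open>z\<close>. Boundedness of the multiplier
  leaves \<open>Q z\<close> and \<open>Q p\<close>, and both tend to zero by
  \<open>pauli_mult_tendsto_0\<close>.\<close>

proposition lax_equation:
 assumes t: "t \<in> I" and H: "H1 X z"
 shows "H1 X (lax_L X (spin_matrix S t) z) \<and>
  has_L2_derivative X (\<lambda>\<tau>. lax_L X (spin_matrix S \<tau>) z)
   (commutator (lax_B X (spin_matrix S t)) (lax_L X (spin_matrix S t)) z) t I"
proof -
 define v where "v = commutator (lax_B X (spin_matrix S t)) (lax_L X (spin_matrix S t)) z"
 define c where "c = complex_of_real (hc X)"
 obtain d where d: "dv X z d" using H unfolding H1_iff_dv by blast
 obtain p where p: "hv X z p" using hv_exists[OF dv_L2(1)[OF d]] .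
 note zp = dv_L2(1)[OF d] hv_L2(2)[OF p]
 have data: "\<exists>C. lax_data X (spin_matrix S \<tau>) (\<lambda>x. pauli (D 0 1 \<tau> x)) (\<lambda>x. pauli (wX X (D 0 1 \<tau>) x)) C" if "\<tau> \<in> I" for \<tau>
  using spin_field.lax_data[OF spin_field[OF that]] by (simp add: spin_matrix_def[abs_def])
 have H1L: "H1 X (lax_L X (spin_matrix S \<tau>) z)" if \<tau>: "\<tau> \<in> I" for \<tau>
 proof -
  obtain C where "lax_data X (spin_matrix S \<tau>) (\<lambda>x. pauli (D 0 1 \<tau> x)) (\<lambda>x. pauli (wX X (D 0 1 \<tau>) x)) C" using data[OF \<tau>] ..
  then interpret lax_data X "spin_matrix S \<tau>" "\<lambda>x. pauli (D 0 1 \<tau> x)" "\<lambda>x. pauli (wX X (D 0 1 \<tau>) x)" C .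
  obtain g where g: "hv X (\<lambda>x. spin_matrix S \<tau> x *v (pauli (wX X (D 0 1 \<tau>) x) *v z x)) g"
   by (rule hv_exists[OF L2_mult_S[OF L2_mult_W[OF zp(1)]]])
  obtain k where k: "hv X (\<lambda>x. pauli (wX X (D 0 1 \<tau>) x) *v (spin_matrix S \<tau> x *v z x)) k"
   by (rule hv_exists[OF L2_mult_W[OF L2_mult_S[OF zp(1)]]])
  from lax_commutator(1)[OF d p g k] show ?thesis by (simp add: H1_iff_dv)
 qed
 then have L2L: "L2 X (lax_L X (spin_matrix S \<tau>) z)" if "\<tau> \<in> I" for \<tau> using that by (auto simp: H1_iff_dv intro: dv_L2)
 obtain C where "lax_data X (spin_matrix S t) (\<lambda>x. pauli (D 0 1 t x)) (\<lambda>x. pauli (wX X (D 0 1 t) x)) C" using data[OF t] ..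
 then interpret lax_data X "spin_matrix S t" "\<lambda>x. pauli (D 0 1 t x)" "\<lambda>x. pauli (wX X (D 0 1 t) x)" C .
 define W where "W x = pauli (wX X (D 0 1 t) x)" for x
 note WS = L2_mult_W[OF L2_mult_S, folded W_def] and SW = L2_mult_S[OF L2_mult_W, folded W_def]
 obtain g where g: "hv X (\<lambda>x. spin_matrix S t x *v (W x *v z x)) g" using hv_exists[OF SW[OF zp(1)]] .
 obtain k where k: "hv X (\<lambda>x. W x *v (spin_matrix S t x *v z x)) k" using hv_exists[OF WS[OF zp(1)]] .
 \<comment> \<open>\<open>G - P\<close> is the commutator of the multiplier with
   \<open>- i/2 [S, W]\<close>, applied to \<open>z\<close>.\<close>
 define G where "G x = (- (\<i> / 2)) *s g x + (\<i> / 2) *s k x" for x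
 define P where "P x = (- (\<i> / 2)) *s (spin_matrix S t x *v (W x *v p x)) + (\<i> / 2) *s (W x *v (spin_matrix S t x *v p x))" for x
 have vec_L2: "L2 X (\<lambda>x. a *s f x + b *s h x)" if "L2 X f" "L2 X h" for f h :: "real => complex^2" and a b
  using that unfolding L2_vec by (simp add: L2_lin)
 have GP: "L2 X (\<lambda>x. c *s G x + (- c) *s P x)" unfolding G_def P_def
  by (intro vec_L2 SW WS zp hv_L2(2)[OF g] hv_L2(2)[OF k])
 have vGP: "AE x in lborel. v x = c *s G x + (- c) *s P x"
  using lax_commutator(2)[OF d p, folded W_def, OF g k]
 proof eventually_elim
  case (elim x)
  show ?case unfolding v_def elim c_def G_def P_def by (simp add: vec_eq_iff algebra_simps)
 qed
 have "AE x in lborel. c *s G x + (- c) *s P x = v x" using vGP by eventually_elim simp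
 then have L2v: "L2 X v" by (rule L2_AE_cong[OF GP]) (unfold v_def, rule lax_commutator(3)[OF d p, folded W_def, OF g k])
 have "((\<lambda>\<tau>. l2_sq X (\<lambda>x. (1 / (\<tau> - t)) *\<^sub>R (lax_L X (spin_matrix S \<tau>) z x - lax_L X (spin_matrix S t) z x) - v x)) \<longlongrightarrow> 0) (at t within I)"
 \<comment> \<open>For a one-point interval the limit is trivial, while the equation says nothing
   about \<open>D 1 0 t\<close>.\<close>
 proof (cases "I = {t}")
  case True
  show ?thesis unfolding True isolated_interval_point by (rule tendsto_bot)
 next
  case False
  define q where "q \<tau> x = (1 / (\<tau> - t)) *\<^sub>R (S \<tau> x - S t x) - D 1 0 t x" for \<tau> x
  have qc: "continuous_on UNIV (q \<tau>)" if "\<tau> \<in> I" for \<tau>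
   unfolding q_def using that t by (intro continuous_intros continuous_field D_continuous_space)
  have qb: "on_base X (q \<tau>)" if "\<tau> \<in> I" for \<tau>
   using S_base[OF that] S_base[OF t] time_derivative_base[OF False t] by (simp add: q_def[abs_def] on_base_def)
  obtain B e where B: "e > 0" "\<And>\<sigma> x. \<sigma> \<in> I ==> \<bar>\<sigma> - t\<bar> < e ==> norm (D 1 0 \<sigma> x) <= B"
   by (rule time_derivative_bounded[OF False t]) blast
  have "0 <= norm (D 1 0 t 0)" by simp
  also have "... <= B" using B(1) by (intro B(2) t) simp
  finally have B0: "0 <= 2 * B" by simp
  have St: "((\<lambda>\<tau>. S \<tau> x) has_vector_derivative D 1 0 \<tau> x) (at \<tau> within I)" if "\<tau> \<in> I" for \<tau> x
  proof -
   have "((\<lambda>\<tau>. D 0 0 \<tau> x) has_vector_derivative D 1 0 \<tau> x) (at \<tau> within I)" using D_time[OF that, of 0 0 x] by simp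
   then show ?thesis by (rule has_vector_derivative_transform[OF that, rotated]) (simp add: D0)
  qed
  have qbd: "norm (q \<tau> x) <= 2 * B" if "\<tau> \<in> I" "\<tau> \<noteq> t" "\<bar>\<tau> - t\<bar> < e" for \<tau> x
   unfolding q_def by (rule difference_quotient_bound[OF interval t St B(2) B(1) that])
  have qev: "\<forall>\<^sub>F \<tau> in at t within I. \<forall>x. norm (q \<tau> x) <= 2 * B"
   unfolding eventually_at dist_real_def using B(1) qbd by blast
  have ql: "((\<lambda>\<tau>. q \<tau> x) \<longlongrightarrow> 0) (at t within I)" for x
   unfolding q_def by (rule has_vector_derivative_within_quotient[OF St[OF t]])
  have qt: "((\<lambda>\<tau>. l2_sq X (\<lambda>x. pauli (q \<tau> x) *v y x)) \<longlongrightarrow> 0) (at t within I)" if "L2 X y" for y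
   by (rule pauli_mult_tendsto_0[OF that qc qev B0 ql])
  \<comment> \<open>The quantifier over vectors stands inside, so that one null set serves for
    \<open>z x\<close> and for \<open>p x\<close>.\<close>
  have Dt: "AE x in lborel. \<forall>u. pauli (D 1 0 t x) *v u = (- (\<i> / 2)) *s (spin_matrix S t x *v (W x *v u)) + (\<i> / 2) *s (W x *v (spin_matrix S t x *v u))"
   using spin_field.abs_nabla_field[OF spin_field[OF t]]
  proof eventually_elim
   case (elim x)
   show ?case unfolding time_derivative[OF False t] elim pauli_cross W_def spin_matrix_def by (simp add: vec_eq_iff algebra_simps)
  qed
  have "\<forall>\<tau>\<in>I. \<exists>r. hv X (\<lambda>x. spin_matrix S \<tau> x *v z x) r"
  proof
   fix \<tau> assume \<tau>: "\<tau> \<in> I"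
   have "norm (S \<tau> x) <= 1" for x using S_unit[OF \<tau>] by simp
   from L2_pauli_mult[OF continuous_field[OF \<tau>] this S_base[OF \<tau>] zp(1)]
   obtain r where "hv X (\<lambda>x. pauli (S \<tau> x) *v z x) r" by (rule hv_exists)
   then show "\<exists>r. hv X (\<lambda>x. spin_matrix S \<tau> x *v z x) r" unfolding spin_matrix_def by blast
  qed
  then obtain r where "\<forall>\<tau>\<in>I. hv X (\<lambda>x. spin_matrix S \<tau> x *v z x) (r \<tau>)" by (rule bchoice[THEN exE])
  note r = bspec[OF this]
  have bound: "l2_sq X (\<lambda>x. (1 / (\<tau> - t)) *\<^sub>R (lax_L X (spin_matrix S \<tau>) z x - lax_L X (spin_matrix S t) z x) - v x)
   <= (ennreal ((hc X)^2) * (2 * ennreal (4 * pi))) * l2_sq X (\<lambda>x. pauli (q \<tau> x) *v z x) + (ennreal ((hc X)^2) * 2) * l2_sq X (\<lambda>x. pauli (q \<tau> x) *v p x)"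
   if \<tau>: "\<tau> \<in> I" "\<tau> \<noteq> t" "\<bar>\<tau> - t\<bar> < e" for \<tau>
  proof -
   define a where "a = complex_of_real (1 / (\<tau> - t))"
   have Q: "L2 X (\<lambda>x. pauli (q \<tau> x) *v y x)" if "L2 X y" for y
    by (rule L2_pauli_mult[OF qc[OF \<tau>(1)] qbd[OF \<tau>] qb[OF \<tau>(1)] that])
   have qp: "pauli (q \<tau> x) *v u = a *s (spin_matrix S \<tau> x *v u) + (- a) *s (spin_matrix S t x *v u) - pauli (D 1 0 t x) *v u" for x u
   proof -
    have s: "(b *\<^sub>R A) *v u = of_real b *s (A *v u)" for b and A :: "complex^2^2"
     by (simp add: matrix_vector_mult_def vec_eq_iff scaleR_conv_of_real[where 'a = complex] sum_distrib_left mult.assoc)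
    show ?thesis unfolding q_def spin_matrix_def linear_simps[OF bounded_linear_pauli] matrix_vector_mult_diff_rdistrib s a_def
     by (simp add: vec_eq_iff algebra_simps)
   qed
   \<comment> \<open>The image of \<open>Q z\<close> is assembled from the images \<open>r\<close>
     and \<open>G\<close> already in use, so that it matches the pointwise formulas for
     \<open>lax_L\<close>.\<close>
   define h where "h x = 1 *s (a *s r \<tau> x + (- a) *s r t x) + (- 1) *s G x" for x
   have h': "hv X (\<lambda>x. 1 *s (a *s (spin_matrix S \<tau> x *v z x) + (- a) *s (spin_matrix S t x *v z x))
    + (- 1) *s ((- (\<i> / 2)) *s (spin_matrix S t x *v (W x *v z x)) + (\<i> / 2) *s (W x *v (spin_matrix S t x *v z x)))) h"
    unfolding h_def G_def by (rule hv_lin[OF hv_lin[OF r[OF \<tau>(1)] r[OF t]] hv_lin[OF g k]])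
   have h: "hv X (\<lambda>x. pauli (q \<tau> x) *v z x) h"
   proof (rule hv_cong[OF h' _ AE_I2])
    show "AE x in lborel. 1 *s (a *s (spin_matrix S \<tau> x *v z x) + (- a) *s (spin_matrix S t x *v z x))
    + (- 1) *s ((- (\<i> / 2)) *s (spin_matrix S t x *v (W x *v z x)) + (\<i> / 2) *s (W x *v (spin_matrix S t x *v z x))) = pauli (q \<tau> x) *v z x"
     using Dt
    proof eventually_elim
     case (elim x)
     show ?case unfolding qp spec[OF elim] by (simp add: vec_eq_iff algebra_simps)
    qed
   qed (use L2_on_base[OF Q[OF zp(1)]] L2_on_base[OF hv_L2(2)[OF h']] in auto)
   have "AE x in lborel. (1 / (\<tau> - t)) *\<^sub>R (lax_L X (spin_matrix S \<tau>) z x - lax_L X (spin_matrix S t) z x) - v x = c *s (h x - pauli (q \<tau> x) *v p x)"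
    using lax_L_pauli[OF \<tau>(1) p r[OF \<tau>(1), unfolded spin_matrix_def]] lax_L_pauli[OF t p r[OF t, unfolded spin_matrix_def]] vGP Dt
   proof eventually_elim
    case (elim x)
    have s: "(1 / (\<tau> - t)) *\<^sub>R u = a *s u" for u :: "complex^2" by (simp add: a_def vec_eq_iff scaleR_conv_of_real[where 'a = complex])
    show ?case unfolding s elim(1-3) qp spec[OF elim(4)] unfolding h_def P_def c_def[symmetric] spin_matrix_def[symmetric]
     by (simp add: vec_eq_iff algebra_simps)
   qed
   then have ae: "AE x in lborel. norm ((1 / (\<tau> - t)) *\<^sub>R (lax_L X (spin_matrix S \<tau>) z x - lax_L X (spin_matrix S t) z x) - v x) <= hc X * norm (h x - pauli (q \<tau> x) *v p x)"
   proof eventually_elim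
    case (elim x)
    have "c *s u = hc X *\<^sub>R u" for u :: "complex^2" by (simp add: c_def vec_eq_iff scaleR_conv_of_real[where 'a = complex])
    then show ?case unfolding elim using hc_pos[of X] by (simp only: norm_scaleR)
   qed
   have mh: "h \<in> borel_measurable lebesgue" and mq: "(\<lambda>x. pauli (q \<tau> x) *v p x) \<in> borel_measurable lebesgue"
    using hv_L2(2)[OF h] Q[OF zp(2)] by (simp_all add: L2_def)
   have "l2_sq X (\<lambda>x. (1 / (\<tau> - t)) *\<^sub>R (lax_L X (spin_matrix S \<tau>) z x - lax_L X (spin_matrix S t) z x) - v x)
    <= ennreal ((hc X)^2) * l2_sq X (\<lambda>x. h x - pauli (q \<tau> x) *v p x)"
    using mh mq by (intro l2_sq_le[OF ae] borel_measurable_diff)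
   also have "... <= ennreal ((hc X)^2) * (2 * (ennreal (4 * pi) * l2_sq X (\<lambda>x. pauli (q \<tau> x) *v z x)) + 2 * l2_sq X (\<lambda>x. pauli (q \<tau> x) *v p x))"
    by (intro mult_left_mono order_trans[OF l2_sq_diff[OF mh mq]] add_mono hv_bound[OF h]) simp_all
   finally show ?thesis by (simp add: distrib_left mult.assoc)
  qed
  show ?thesis
  proof (rule tendsto_0_le_ennreal)
   show "((\<lambda>\<tau>. (ennreal ((hc X)^2) * (2 * ennreal (4 * pi))) * l2_sq X (\<lambda>x. pauli (q \<tau> x) *v z x) + (ennreal ((hc X)^2) * 2) * l2_sq X (\<lambda>x. pauli (q \<tau> x) *v p x)) \<longlongrightarrow> 0) (at t within I)"
    by (intro ennreal_cmult_add_tendsto_0 qt zp) (auto simp: ennreal_mult_less_top)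
   show "\<forall>\<^sub>F \<tau> in at t within I. l2_sq X (\<lambda>x. (1 / (\<tau> - t)) *\<^sub>R (lax_L X (spin_matrix S \<tau>) z x - lax_L X (spin_matrix S t) z x) - v x)
   <= (ennreal ((hc X)^2) * (2 * ennreal (4 * pi))) * l2_sq X (\<lambda>x. pauli (q \<tau> x) *v z x) + (ennreal ((hc X)^2) * 2) * l2_sq X (\<lambda>x. pauli (q \<tau> x) *v p x)"
    unfolding eventually_at dist_real_def using B(1) bound by blast
  qed
 qed
 then show ?thesis using H1L[OF t] L2L L2v unfolding has_L2_derivative_def v_def by blast
qed

end

theorem theorem1:
  fixes X :: base_space and I :: "real set" and S :: "real \<Rightarrow> real \<Rightarrow> real^3"
  assumes "is_interval I"
    and "regular_spin_field X I S"
    and "half_wave_maps X I S"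
  shows "\<forall>t\<in>I. \<forall>\<phi>. H1 X \<phi> \<longrightarrow>
           H1 X (lax_L X (spin_matrix S t) \<phi>) \<and>
           has_L2_derivative X (\<lambda>\<tau>. lax_L X (spin_matrix S \<tau>) \<phi>)
             (commutator (lax_B X (spin_matrix S t)) (lax_L X (spin_matrix S t)) \<phi>) t I"
proof -
  obtain D where "\<forall>t\<in>I. \<forall>x. D 0 0 t x = S t x" "\<forall>j k. continuous_on (I \<times> UNIV) (\<lambda>(t, x). D j k t x)"
    "\<forall>j k. \<forall>t\<in>I. \<forall>x. ((\<lambda>\<tau>. D j k \<tau> x) has_vector_derivative D (Suc j) k t x) (at t within I) \<and>
           ((\<lambda>y. D j k t y) has_vector_derivative D j (Suc k) t x) (at x)"
    using assms(2) unfolding regular_spin_field_def smooth_on_strip_def by blast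
  then have "spin_evolution X I S D"
    using assms unfolding regular_spin_field_def by unfold_locales auto
  then show ?thesis using spin_evolution.lax_equation by blast
qed

end
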